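(* Let $k$ be a field and let $G$ be a finite abelian group which splits over $k$. Let $\mathcal{C}$ be a skeletally small $k$-linear additive category which is idempotent complete and Hom-finite, with a $k$-linear $G$-action $\{F_g,\varepsilon_{g,h}\mid g,h\in G\}$, and consider the dual $\widehat{G}$-action on $\mathcal{C}^G$. Then there is a bijection $$\iota\colon{\rm Stab}^G(\mathcal{C})\longrightarrow{\rm Stab}^{\widehat{G}}(\mathcal{C}^G),\quad M\mapsto\iota(M),$$ where the (basic) object $\iota(M)$ is uniquely determined by ${\rm add}\,\iota(M)={\rm add}\,{\rm Ind}(M)$. Moreover, $\iota$ induces a bijection on orbit sets $${\rm Stab}^G(\mathcal{C})/{\rm Aut}(\mathcal{C};G)\longrightarrow{\rm Stab}^{\widehat{G}}(\mathcal{C}^G)/{\rm Aut}(\mathcal{C}^G;\widehat{G}).$$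
   Context: All functors are $k$-linear. $G$ splits over $k$ if $kG$ is a product of copies of $k$. $\widehat{G}={\rm Hom}(G,k^* )$. Hom-finite means all Hom spaces are finite dimensional over $k$; then $\mathcal{C}$ is Krull-Schmidt. ${\rm add}\,M$ is the full subcategory of direct summands of finite direct sums of copies of $M$. A $G$-action on $\mathcal{C}$ consists of autoequivalences $F_g$ and natural isomorphisms $\varepsilon_{g,h}\colon F_gF_h\to F_{gh}$ with $\varepsilon_{gh,l}\circ\varepsilon_{g,h}F_l=\varepsilon_{g,hl}\circ F_g\varepsilon_{h,l}$. $\mathcal{C}^G$ is the category of pairs $(X,\alpha)$ with isomorphisms $\alpha_g\colon X\to F_g(X)$ satisfying $\alpha_{gh}=(\varepsilon_{g,h})_X\circ F_g(\alpha_h)\circ\alpha_g$, and morphisms $f\colon(X,\alpha)\to(Y,\beta)$ with $\beta_gf=F_g(f)\alpha_g$. The induction functor ${\rm Ind}\colon\mathcal{C}\to\mathcal{C}^G$ is ${\rm Ind}(X)=(\bigoplus_{h\in G}F_h(X),\varepsilon(X))$, where $\varepsilon(X)_g$ is diagonally induced by $(\varepsilon_{g,g^{-1}h})_X^{-1}\colon F_h(X)\to F_gF_{g^{-1}h}(X)$. The dual action is the strict $\widehat{G}$-action on $\mathcal{C}^G$ with $F_\chi(X,\alpha)=(X,(\chi(g^{-1})\alpha_g)_g)$, identity on morphisms. ${\rm Aut}(\mathcal{C};G)$ is the group of isoclasses $[F,\delta]$ of $k$-linear $G$-equivariant autoequivalences: $F$ is an autoequivalence and $\delta_g\colon FF_g\to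 F_gF$ are natural isomorphisms with $\delta_{gh}\circ F\varepsilon_{g,h}=\varepsilon_{g,h}F\circ F_g\delta_h\circ\delta_gF_h$; isomorphisms $(F,\delta)\to(F',\delta')$ are natural isomorphisms $\phi\colon F\to F'$ with $F_g\phi\circ\delta_g=\delta'_g\circ\phi F_g$. An object is basic if each indecomposable summand has multiplicity one; $M$ is $G$-stable if $F_g(M)\simeq M$ for all $g\in G$. ${\rm Stab}^G(\mathcal{C})$ is the set of isoclasses of basic $G$-stable objects, on which ${\rm Aut}(\mathcal{C};G)$ acts by $[F,\delta].M=F(M)$. Likewise for $\mathcal{C}^G$ with the dual $\widehat{G}$-action. *)

theory Defs
  imports
    "HOL-Algebra.Group_Action"
    "HOL-Algebra.QuotRing"
    "Jordan_Normal_Form.Missing_VectorSpace"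
begin

section \<open>Linear categories\<close>

text \<open>
  Each Hom space is a \<open>module\<close> record over the ground field (its multiplicative fields are
  unused). Hom sets need not be disjoint: a morphism does not determine its source and target,
  so functors below take them as explicit arguments. Object and morphism sets are HOL sets,
  so every category is small; a skeletally small category is represented by an equivalent small one.
\<close>

record ('o, 'm, 'k) category =
  Obj :: "'o set"
  Hom :: "'o \<Rightarrow> 'o \<Rightarrow> ('k, 'm) module"
  Ident :: "'o \<Rightarrow> 'm"
  Comp :: "'m \<Rightarrow> 'm \<Rightarrow> 'm" (infixl \<open>\<cdot>\<index>\<close> 70)

abbreviation mor :: "('o, 'm, 'k) category \<Rightarrow> 'o \<Rightarrow> 'o \<Rightarrow> 'm set"
  where "mor C X Y \<equiv> carrier (Hom C X Y)"

locale linear_category =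
  fixes K :: "'k ring" and C :: "('o, 'm, 'k) category" (structure)
  assumes Hom_vectorspace:
      "\<lbrakk>X \<in> Obj C; Y \<in> Obj C\<rbrakk> \<Longrightarrow> vectorspace K (Hom C X Y)"
    and Ident_closed:
      "X \<in> Obj C \<Longrightarrow> Ident C X \<in> mor C X X"
    and Comp_closed:
      "\<lbrakk>X \<in> Obj C; Y \<in> Obj C; Z \<in> Obj C; f \<in> mor C X Y; g \<in> mor C Y Z\<rbrakk> \<Longrightarrow> g \<cdot> f \<in> mor C X Z"
    and Comp_Ident_left:
      "\<lbrakk>X \<in> Obj C; Y \<in> Obj C; f \<in> mor C X Y\<rbrakk> \<Longrightarrow> Ident C Y \<cdot> f = f"
    and Comp_Ident_right:
      "\<lbrakk>X \<in> Obj C; Y \<in> Obj C; f \<in> mor C X Y\<rbrakk> \<Longrightarrow> f \<cdot> Ident C X = f"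
    and Comp_assoc:
      "\<lbrakk>W \<in> Obj C; X \<in> Obj C; Y \<in> Obj C; Z \<in> Obj C;
        f \<in> mor C W X; g \<in> mor C X Y; h \<in> mor C Y Z\<rbrakk> \<Longrightarrow> (h \<cdot> g) \<cdot> f = h \<cdot> (g \<cdot> f)"
    and Comp_add_left:
      "\<lbrakk>X \<in> Obj C; Y \<in> Obj C; Z \<in> Obj C; f \<in> mor C X Y; g \<in> mor C Y Z; g' \<in> mor C Y Z\<rbrakk>
        \<Longrightarrow> (g \<oplus>\<^bsub>Hom C Y Z\<^esub> g') \<cdot> f = (g \<cdot> f) \<oplus>\<^bsub>Hom C X Z\<^esub> (g' \<cdot> f)"
    and Comp_add_right:
      "\<lbrakk>X \<in> Obj C; Y \<in> Obj C; Z \<in> Obj C; f \<in> mor C X Y; f' \<in> mor C X Y; g \<in> mor C Y Z\<rbrakk>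
        \<Longrightarrow> g \<cdot> (f \<oplus>\<^bsub>Hom C X Y\<^esub> f') = (g \<cdot> f) \<oplus>\<^bsub>Hom C X Z\<^esub> (g \<cdot> f')"
    and Comp_smult_left:
      "\<lbrakk>X \<in> Obj C; Y \<in> Obj C; Z \<in> Obj C; a \<in> carrier K; f \<in> mor C X Y; g \<in> mor C Y Z\<rbrakk>
        \<Longrightarrow> (a \<odot>\<^bsub>Hom C Y Z\<^esub> g) \<cdot> f = a \<odot>\<^bsub>Hom C X Z\<^esub> (g \<cdot> f)"
    and Comp_smult_right:
      "\<lbrakk>X \<in> Obj C; Y \<in> Obj C; Z \<in> Obj C; a \<in> carrier K; f \<in> mor C X Y; g \<in> mor C Y Z\<rbrakk>
        \<Longrightarrow> g \<cdot> (a \<odot>\<^bsub>Hom C X Y\<^esub> f) = a \<odot>\<^bsub>Hom C X Z\<^esub> (g \<cdot> f)"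

definition hom_finite :: "'k ring \<Rightarrow> ('o, 'm, 'k) category \<Rightarrow> bool"
  where "hom_finite K C \<longleftrightarrow> (\<forall>X\<in>Obj C. \<forall>Y\<in>Obj C. vectorspace.fin_dim K (Hom C X Y))"

definition inverse_morphisms ::
    "('o, 'm, 'k) category \<Rightarrow> 'o \<Rightarrow> 'o \<Rightarrow> 'm \<Rightarrow> 'm \<Rightarrow> bool"
  where "inverse_morphisms C X Y f g \<longleftrightarrow> f \<in> mor C X Y \<and> g \<in> mor C Y X \<and>
    g \<cdot>\<^bsub>C\<^esub> f = Ident C X \<and> f \<cdot>\<^bsub>C\<^esub> g = Ident C Y"

definition isos :: "('o, 'm, 'k) category \<Rightarrow> 'o \<Rightarrow> 'o \<Rightarrow> 'm set"
  where "isos C X Y = {f. \<exists>g. inverse_morphisms C X Y f g}"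

definition inv_mor :: "('o, 'm, 'k) category \<Rightarrow> 'o \<Rightarrow> 'o \<Rightarrow> 'm \<Rightarrow> 'm"
  where "inv_mor C X Y f = (THE g. inverse_morphisms C X Y f g)"

definition iso_rel :: "('o, 'm, 'k) category \<Rightarrow> ('o \<times> 'o) set"
  where "iso_rel C = {(X, Y). X \<in> Obj C \<and> Y \<in> Obj C \<and> isos C X Y \<noteq> {}}"

definition idempotent_complete :: "('o, 'm, 'k) category \<Rightarrow> bool"
  where "idempotent_complete C \<longleftrightarrow>
    (\<forall>X\<in>Obj C. \<forall>e\<in>mor C X X. e \<cdot>\<^bsub>C\<^esub> e = e \<longrightarrow>
      (\<exists>Y\<in>Obj C. \<exists>r\<in>mor C X Y. \<exists>s\<in>mor C Y X. s \<cdot>\<^bsub>C\<^esub> r = e \<and> r \<cdot>\<^bsub>C\<^esub> s = Ident C Y))"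


subsection \<open>Direct sums and summands\<close>

definition is_biproduct ::
    "('o, 'm, 'k) category \<Rightarrow> 'i set \<Rightarrow> ('i \<Rightarrow> 'o) \<Rightarrow> 'o \<Rightarrow> ('i \<Rightarrow> 'm) \<Rightarrow> ('i \<Rightarrow> 'm) \<Rightarrow> bool"
  where "is_biproduct C I Xs S inc prj \<longleftrightarrow>
    finite I \<and> S \<in> Obj C \<and>
    (\<forall>i\<in>I. Xs i \<in> Obj C \<and> inc i \<in> mor C (Xs i) S \<and> prj i \<in> mor C S (Xs i)) \<and>
    (\<forall>i\<in>I. \<forall>j\<in>I. prj j \<cdot>\<^bsub>C\<^esub> inc i =
      (if i = j then Ident C (Xs i) else \<zero>\<^bsub>Hom C (Xs i) (Xs j)\<^esub>)) \<and>
    (\<Oplus>\<^bsub>Hom C S S\<^esub>i\<in>I. inc i \<cdot>\<^bsub>C\<^esub> prj i) = Ident C S"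

definition is_direct_sum ::
    "('o, 'm, 'k) category \<Rightarrow> 'i set \<Rightarrow> ('i \<Rightarrow> 'o) \<Rightarrow> 'o \<Rightarrow> bool"
  where "is_direct_sum C I Xs S \<longleftrightarrow> (\<exists>inc prj. is_biproduct C I Xs S inc prj)"

definition is_direct_sum2 :: "('o, 'm, 'k) category \<Rightarrow> 'o \<Rightarrow> 'o \<Rightarrow> 'o \<Rightarrow> bool"
  where "is_direct_sum2 C X Y S \<longleftrightarrow> is_direct_sum C (UNIV :: bool set) (\<lambda>b. if b then X else Y) S"

text \<open>The case \<open>n = 0\<close> provides a zero object.\<close>

definition additive_category :: "('o, 'm, 'k) category \<Rightarrow> bool"
  where "additive_category C \<longleftrightarrow>
    (\<forall>(n::nat) Xs. (\<forall>i<n. Xs i \<in> Obj C) \<longrightarrow> (\<exists>S. is_direct_sum C {..<n} Xs S))"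

definition zero_object :: "('o, 'm, 'k) category \<Rightarrow> 'o \<Rightarrow> bool"
  where "zero_object C Z \<longleftrightarrow> Z \<in> Obj C \<and>
    (\<forall>X\<in>Obj C. (\<exists>!f. f \<in> mor C Z X) \<and> (\<exists>!f. f \<in> mor C X Z))"

definition indecomposable :: "('o, 'm, 'k) category \<Rightarrow> 'o \<Rightarrow> bool"
  where "indecomposable C X \<longleftrightarrow> X \<in> Obj C \<and> \<not> zero_object C X \<and>
    (\<forall>A B. is_direct_sum2 C A B X \<longrightarrow> zero_object C A \<or> zero_object C B)"

text \<open>
  In the Krull--Schmidt setting: the decomposition into indecomposables has all multiplicities
  equal to one. The zero object (empty decomposition) is basic.
\<close>

definition basic_object :: "('o, 'm, 'k) category \<Rightarrow> 'o \<Rightarrow> bool"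
  where "basic_object C M \<longleftrightarrow>
    (\<exists>(n::nat) Xs. is_direct_sum C {..<n} Xs M \<and> (\<forall>i<n. indecomposable C (Xs i)) \<and>
      (\<forall>i<n. \<forall>j<n. i \<noteq> j \<longrightarrow> (Xs i, Xs j) \<notin> iso_rel C))"

definition add_closure :: "('o, 'm, 'k) category \<Rightarrow> 'o \<Rightarrow> 'o set"
  where "add_closure C M =
    {X. \<exists>(n::nat) S Y. is_direct_sum C {..<n} (\<lambda>_. M) S \<and> is_direct_sum2 C X Y S}"


section \<open>Functors and natural transformations\<close>

record ('o, 'm, 'p, 'n) functr =
  ob :: "'o \<Rightarrow> 'p"
  ar :: "'o \<Rightarrow> 'o \<Rightarrow> 'm \<Rightarrow> 'n"

definition linear_functor ::
    "'k ring \<Rightarrow> ('o, 'm, 'k) category \<Rightarrow> ('p, 'n, 'k) category \<Rightarrow> ('o, 'm, 'p, 'n) functr \<Rightarrow> bool"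
  where "linear_functor K C D F \<longleftrightarrow>
    (\<forall>X\<in>Obj C. ob F X \<in> Obj D \<and> ar F X X (Ident C X) = Ident D (ob F X)) \<and>
    (\<forall>X\<in>Obj C. \<forall>Y\<in>Obj C. \<forall>f\<in>mor C X Y. ar F X Y f \<in> mor D (ob F X) (ob F Y)) \<and>
    (\<forall>X\<in>Obj C. \<forall>Y\<in>Obj C. \<forall>Z\<in>Obj C. \<forall>f\<in>mor C X Y. \<forall>g\<in>mor C Y Z.
      ar F X Z (g \<cdot>\<^bsub>C\<^esub> f) = ar F Y Z g \<cdot>\<^bsub>D\<^esub> ar F X Y f) \<and>
    (\<forall>X\<in>Obj C. \<forall>Y\<in>Obj C. \<forall>f\<in>mor C X Y. \<forall>g\<in>mor C X Y.
      ar F X Y (f \<oplus>\<^bsub>Hom C X Y\<^esub> g) = ar F X Y f \<oplus>\<^bsub>Hom D (ob F X) (ob F Y)\<^esub> ar F X Y g) \<and>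
    (\<forall>X\<in>Obj C. \<forall>Y\<in>Obj C. \<forall>a\<in>carrier K. \<forall>f\<in>mor C X Y.
      ar F X Y (a \<odot>\<^bsub>Hom C X Y\<^esub> f) = a \<odot>\<^bsub>Hom D (ob F X) (ob F Y)\<^esub> ar F X Y f)"

definition id_functor :: "('o, 'm, 'o, 'm) functr"
  where "id_functor = \<lparr>ob = (\<lambda>X. X), ar = (\<lambda>X Y f. f)\<rparr>"

definition comp_functor ::
    "('p, 'n, 'q, 'l) functr \<Rightarrow> ('o, 'm, 'p, 'n) functr \<Rightarrow> ('o, 'm, 'q, 'l) functr"
    (infixr \<open>\<circ>\<^sub>F\<close> 55)
  where "F \<circ>\<^sub>F H =
    \<lparr>ob = (\<lambda>X. ob F (ob H X)), ar = (\<lambda>X Y f. ar F (ob H X) (ob H Y) (ar H X Y f))\<rparr>"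

definition natural_iso ::
    "('o, 'm, 'k) category \<Rightarrow> ('p, 'n, 'k) category \<Rightarrow>
     ('o, 'm, 'p, 'n) functr \<Rightarrow> ('o, 'm, 'p, 'n) functr \<Rightarrow> ('o \<Rightarrow> 'n) \<Rightarrow> bool"
  where "natural_iso C D F F' \<phi> \<longleftrightarrow>
    (\<forall>X\<in>Obj C. \<phi> X \<in> isos D (ob F X) (ob F' X)) \<and>
    (\<forall>X\<in>Obj C. \<forall>Y\<in>Obj C. \<forall>f\<in>mor C X Y. \<phi> Y \<cdot>\<^bsub>D\<^esub> ar F X Y f = ar F' X Y f \<cdot>\<^bsub>D\<^esub> \<phi> X)"

definition autoequivalence ::
    "'k ring \<Rightarrow> ('o, 'm, 'k) category \<Rightarrow> ('o, 'm, 'o, 'm) functr \<Rightarrow> bool"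
  where "autoequivalence K C F \<longleftrightarrow> linear_functor K C C F \<and>
    (\<exists>H \<eta> \<theta>. linear_functor K C C H \<and>
      natural_iso C C (H \<circ>\<^sub>F F) id_functor \<eta> \<and> natural_iso C C (F \<circ>\<^sub>F H) id_functor \<theta>)"


section \<open>Group actions on categories and equivariant objects\<close>

definition category_action ::
    "'k ring \<Rightarrow> ('o, 'm, 'k) category \<Rightarrow> 'g monoid \<Rightarrow>
     ('g \<Rightarrow> ('o, 'm, 'o, 'm) functr) \<Rightarrow> ('g \<Rightarrow> 'g \<Rightarrow> 'o \<Rightarrow> 'm) \<Rightarrow> bool"
  where "category_action K C G F \<epsilon> \<longleftrightarrow>
    (\<forall>g\<in>carrier G. autoequivalence K C (F g)) \<and>
    (\<forall>g\<in>carrier G. \<forall>h\<in>carrier G.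
      natural_iso C C (F g \<circ>\<^sub>F F h) (F (g \<otimes>\<^bsub>G\<^esub> h)) (\<epsilon> g h)) \<and>
    (\<forall>g\<in>carrier G. \<forall>h\<in>carrier G. \<forall>l\<in>carrier G. \<forall>X\<in>Obj C.
      \<epsilon> (g \<otimes>\<^bsub>G\<^esub> h) l X \<cdot>\<^bsub>C\<^esub> \<epsilon> g h (ob (F l) X) =
      \<epsilon> g (h \<otimes>\<^bsub>G\<^esub> l) X \<cdot>\<^bsub>C\<^esub>
        ar (F g) (ob (F h) (ob (F l) X)) (ob (F (h \<otimes>\<^bsub>G\<^esub> l)) X) (\<epsilon> h l X))"

text \<open>
  The category of equivariant objects; \<open>\<alpha>\<close> is taken extensional on \<open>carrier G\<close>, so that it is
  determined by its values on the group.
\<close>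

definition equivariant_objects ::
    "('o, 'm, 'k) category \<Rightarrow> 'g monoid \<Rightarrow>
     ('g \<Rightarrow> ('o, 'm, 'o, 'm) functr) \<Rightarrow> ('g \<Rightarrow> 'g \<Rightarrow> 'o \<Rightarrow> 'm) \<Rightarrow> ('o \<times> ('g \<Rightarrow> 'm)) set"
  where "equivariant_objects C G F \<epsilon> =
    {(X, \<alpha>). X \<in> Obj C \<and> \<alpha> \<in> (\<Pi>\<^sub>E g\<in>carrier G. isos C X (ob (F g) X)) \<and>
      (\<forall>g\<in>carrier G. \<forall>h\<in>carrier G.
        \<alpha> (g \<otimes>\<^bsub>G\<^esub> h) = \<epsilon> g h X \<cdot>\<^bsub>C\<^esub> (ar (F g) X (ob (F h) X) (\<alpha> h) \<cdot>\<^bsub>C\<^esub> \<alpha> g))}"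

definition equivariantization ::
    "('o, 'm, 'k) category \<Rightarrow> 'g monoid \<Rightarrow>
     ('g \<Rightarrow> ('o, 'm, 'o, 'm) functr) \<Rightarrow> ('g \<Rightarrow> 'g \<Rightarrow> 'o \<Rightarrow> 'm) \<Rightarrow>
     ('o \<times> ('g \<Rightarrow> 'm), 'm, 'k) category"
  where "equivariantization C G F \<epsilon> =
    \<lparr>Obj = equivariant_objects C G F \<epsilon>,
     Hom = (\<lambda>(X, \<alpha>) (Y, \<beta>). (Hom C X Y)
       \<lparr>carrier := {f \<in> mor C X Y. \<forall>g\<in>carrier G. \<beta> g \<cdot>\<^bsub>C\<^esub> f = ar (F g) X Y f \<cdot>\<^bsub>C\<^esub> \<alpha> g}\<rparr>),
     Ident = (\<lambda>(X, \<alpha>). Ident C X),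
     Comp = Comp C\<rparr>"

text \<open>
  A chosen direct sum, with its injections and projections. It exists for finite families of
  objects in an additive category; \<open>Ind(X)\<close> is independent of the choice up to
  isomorphism.
\<close>

definition chosen_biproduct ::
    "('o, 'm, 'k) category \<Rightarrow> 'i set \<Rightarrow> ('i \<Rightarrow> 'o) \<Rightarrow> 'o \<times> ('i \<Rightarrow> 'm) \<times> ('i \<Rightarrow> 'm)"
  where "chosen_biproduct C I Xs = (SOME (S, inc, prj). is_biproduct C I Xs S inc prj)"

definition Ind_ob ::
    "('o, 'm, 'k) category \<Rightarrow> 'g monoid \<Rightarrow>
     ('g \<Rightarrow> ('o, 'm, 'o, 'm) functr) \<Rightarrow> ('g \<Rightarrow> 'g \<Rightarrow> 'o \<Rightarrow> 'm) \<Rightarrow> 'o \<Rightarrow> 'o \<times> ('g \<Rightarrow> 'm)"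
  where "Ind_ob C G F \<epsilon> X =
    (case chosen_biproduct C (carrier G) (\<lambda>h. ob (F h) X) of (S, inc, prj) \<Rightarrow>
      (S, \<lambda>g\<in>carrier G. \<Oplus>\<^bsub>Hom C S (ob (F g) S)\<^esub>h\<in>carrier G.
        (let h' = inv\<^bsub>G\<^esub> g \<otimes>\<^bsub>G\<^esub> h in
          ar (F g) (ob (F h') X) S (inc h') \<cdot>\<^bsub>C\<^esub>
          (inv_mor C (ob (F g) (ob (F h') X)) (ob (F h) X) (\<epsilon> g h' X) \<cdot>\<^bsub>C\<^esub> prj h))))"

definition Ind_ar ::
    "('o, 'm, 'k) category \<Rightarrow> 'g monoid \<Rightarrow> ('g \<Rightarrow> ('o, 'm, 'o, 'm) functr) \<Rightarrow>
     'o \<Rightarrow> 'o \<Rightarrow> 'm \<Rightarrow> 'm"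
  where "Ind_ar C G F X Y f =
    (case chosen_biproduct C (carrier G) (\<lambda>h. ob (F h) X) of (S, _, prj) \<Rightarrow>
     case chosen_biproduct C (carrier G) (\<lambda>h. ob (F h) Y) of (T, inc, _) \<Rightarrow>
       \<Oplus>\<^bsub>Hom C S T\<^esub>h\<in>carrier G. inc h \<cdot>\<^bsub>C\<^esub> (ar (F h) X Y f \<cdot>\<^bsub>C\<^esub> prj h))"

definition Ind ::
    "('o, 'm, 'k) category \<Rightarrow> 'g monoid \<Rightarrow>
     ('g \<Rightarrow> ('o, 'm, 'o, 'm) functr) \<Rightarrow> ('g \<Rightarrow> 'g \<Rightarrow> 'o \<Rightarrow> 'm) \<Rightarrow>
     ('o, 'm, 'o \<times> ('g \<Rightarrow> 'm), 'm) functr"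
  where "Ind C G F \<epsilon> = \<lparr>ob = Ind_ob C G F \<epsilon>, ar = Ind_ar C G F\<rparr>"


section \<open>Split groups, characters and the dual action\<close>

definition group_algebra :: "'k ring \<Rightarrow> 'g monoid \<Rightarrow> ('k, 'g \<Rightarrow> 'k) module"
  where "group_algebra K G =
    \<lparr>carrier = carrier G \<rightarrow>\<^sub>E carrier K,
     monoid.mult = (\<lambda>a b. \<lambda>g\<in>carrier G. \<Oplus>\<^bsub>K\<^esub>h\<in>carrier G. a h \<otimes>\<^bsub>K\<^esub> b (inv\<^bsub>G\<^esub> h \<otimes>\<^bsub>G\<^esub> g)),
     one = (\<lambda>g\<in>carrier G. if g = \<one>\<^bsub>G\<^esub> then \<one>\<^bsub>K\<^esub> else \<zero>\<^bsub>K\<^esub>),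
     zero = (\<lambda>g\<in>carrier G. \<zero>\<^bsub>K\<^esub>),
     add = (\<lambda>a b. \<lambda>g\<in>carrier G. a g \<oplus>\<^bsub>K\<^esub> b g),
     smult = (\<lambda>c a. \<lambda>g\<in>carrier G. c \<otimes>\<^bsub>K\<^esub> a g)\<rparr>"

definition power_algebra :: "'k ring \<Rightarrow> nat \<Rightarrow> ('k, nat \<Rightarrow> 'k) module"
  where "power_algebra K n =
    \<lparr>carrier = {..<n} \<rightarrow>\<^sub>E carrier K,
     monoid.mult = (\<lambda>a b. \<lambda>i\<in>{..<n}. a i \<otimes>\<^bsub>K\<^esub> b i),
     one = (\<lambda>i\<in>{..<n}. \<one>\<^bsub>K\<^esub>),
     zero = (\<lambda>i\<in>{..<n}. \<zero>\<^bsub>K\<^esub>),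
     add = (\<lambda>a b. \<lambda>i\<in>{..<n}. a i \<oplus>\<^bsub>K\<^esub> b i),
     smult = (\<lambda>c a. \<lambda>i\<in>{..<n}. c \<otimes>\<^bsub>K\<^esub> a i)\<rparr>"

definition splits_over :: "'g monoid \<Rightarrow> 'k ring \<Rightarrow> bool"
  where "splits_over G K \<longleftrightarrow>
    (\<exists>n. \<exists>\<phi> \<in> ring_iso (group_algebra K G) (power_algebra K n).
      \<forall>c\<in>carrier K. \<forall>a\<in>carrier (group_algebra K G).
        \<phi> (c \<odot>\<^bsub>group_algebra K G\<^esub> a) = c \<odot>\<^bsub>power_algebra K n\<^esub> \<phi> a)"

definition character_group :: "'k ring \<Rightarrow> 'g monoid \<Rightarrow> ('g \<Rightarrow> 'k) monoid"
  where "character_group K G =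
    \<lparr>carrier = hom G (units_of K) \<inter> extensional (carrier G),
     monoid.mult = (\<lambda>\<chi> \<psi>. \<lambda>g\<in>carrier G. \<chi> g \<otimes>\<^bsub>K\<^esub> \<psi> g),
     one = (\<lambda>g\<in>carrier G. \<one>\<^bsub>K\<^esub>)\<rparr>"

definition dual_functor ::
    "('o, 'm, 'k) category \<Rightarrow> 'g monoid \<Rightarrow> ('g \<Rightarrow> ('o, 'm, 'o, 'm) functr) \<Rightarrow> ('g \<Rightarrow> 'k) \<Rightarrow>
     ('o \<times> ('g \<Rightarrow> 'm), 'm, 'o \<times> ('g \<Rightarrow> 'm), 'm) functr"
  where "dual_functor C G F \<chi> =
    \<lparr>ob = (\<lambda>(X, \<alpha>). (X, \<lambda>g\<in>carrier G. \<chi> (inv\<^bsub>G\<^esub> g) \<odot>\<^bsub>Hom C X (ob (F g) X)\<^esub> \<alpha> g)),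
     ar = (\<lambda>_ _ f. f)\<rparr>"

text \<open>The dual action is strict: its structure isomorphisms are identities.\<close>

definition dual_eps ::
    "('o, 'm, 'k) category \<Rightarrow> ('g \<Rightarrow> 'k) \<Rightarrow> ('g \<Rightarrow> 'k) \<Rightarrow> 'o \<times> ('g \<Rightarrow> 'm) \<Rightarrow> 'm"
  where "dual_eps C \<chi> \<psi> = (\<lambda>(X, \<alpha>). Ident C X)"


section \<open>Equivariant autoequivalences and stable objects\<close>

definition equivariant_autoequivalences ::
    "'k ring \<Rightarrow> ('o, 'm, 'k) category \<Rightarrow> 'g monoid \<Rightarrow>
     ('g \<Rightarrow> ('o, 'm, 'o, 'm) functr) \<Rightarrow> ('g \<Rightarrow> 'g \<Rightarrow> 'o \<Rightarrow> 'm) \<Rightarrow>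
     (('o, 'm, 'o, 'm) functr \<times> ('g \<Rightarrow> 'o \<Rightarrow> 'm)) set"
  where "equivariant_autoequivalences K C G F \<epsilon> =
    {(H, \<delta>). autoequivalence K C H \<and>
      (\<forall>g\<in>carrier G. natural_iso C C (H \<circ>\<^sub>F F g) (F g \<circ>\<^sub>F H) (\<delta> g)) \<and>
      (\<forall>g\<in>carrier G. \<forall>h\<in>carrier G. \<forall>X\<in>Obj C.
        \<delta> (g \<otimes>\<^bsub>G\<^esub> h) X \<cdot>\<^bsub>C\<^esub>
          ar H (ob (F g) (ob (F h) X)) (ob (F (g \<otimes>\<^bsub>G\<^esub> h)) X) (\<epsilon> g h X) =
        \<epsilon> g h (ob H X) \<cdot>\<^bsub>C\<^esub>
          (ar (F g) (ob H (ob (F h) X)) (ob (F h) (ob H X)) (\<delta> h X) \<cdot>\<^bsub>C\<^esub> \<delta> g (ob (F h) X)))}"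

definition equivariant_iso_rel ::
    "'k ring \<Rightarrow> ('o, 'm, 'k) category \<Rightarrow> 'g monoid \<Rightarrow>
     ('g \<Rightarrow> ('o, 'm, 'o, 'm) functr) \<Rightarrow> ('g \<Rightarrow> 'g \<Rightarrow> 'o \<Rightarrow> 'm) \<Rightarrow>
     (('o, 'm, 'o, 'm) functr \<times> ('g \<Rightarrow> 'o \<Rightarrow> 'm)) rel"
  where "equivariant_iso_rel K C G F \<epsilon> =
    {((H, \<delta>), (H', \<delta>')).
      (H, \<delta>) \<in> equivariant_autoequivalences K C G F \<epsilon> \<and>
      (H', \<delta>') \<in> equivariant_autoequivalences K C G F \<epsilon> \<and>
      (\<exists>\<phi>. natural_iso C C H H' \<phi> \<and>
        (\<forall>g\<in>carrier G. \<forall>X\<in>Obj C.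
          ar (F g) (ob H X) (ob H' X) (\<phi> X) \<cdot>\<^bsub>C\<^esub> \<delta> g X = \<delta>' g X \<cdot>\<^bsub>C\<^esub> \<phi> (ob (F g) X)))}"

definition equivariant_comp ::
    "('o, 'm, 'k) category \<Rightarrow> ('g \<Rightarrow> ('o, 'm, 'o, 'm) functr) \<Rightarrow>
     ('o, 'm, 'o, 'm) functr \<times> ('g \<Rightarrow> 'o \<Rightarrow> 'm) \<Rightarrow>
     ('o, 'm, 'o, 'm) functr \<times> ('g \<Rightarrow> 'o \<Rightarrow> 'm) \<Rightarrow>
     ('o, 'm, 'o, 'm) functr \<times> ('g \<Rightarrow> 'o \<Rightarrow> 'm)"
  where "equivariant_comp C F = (\<lambda>(H, \<delta>) (H', \<delta>').
    (H \<circ>\<^sub>F H', \<lambda>g X. \<delta> g (ob H' X) \<cdot>\<^bsub>C\<^esub> ar H (ob H' (ob (F g) X)) (ob (F g) (ob H' X)) (\<delta>' g X)))"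

definition equivariant_Aut ::
    "'k ring \<Rightarrow> ('o, 'm, 'k) category \<Rightarrow> 'g monoid \<Rightarrow>
     ('g \<Rightarrow> ('o, 'm, 'o, 'm) functr) \<Rightarrow> ('g \<Rightarrow> 'g \<Rightarrow> 'o \<Rightarrow> 'm) \<Rightarrow>
     (('o, 'm, 'o, 'm) functr \<times> ('g \<Rightarrow> 'o \<Rightarrow> 'm)) set monoid"
  where "equivariant_Aut K C G F \<epsilon> =
    \<lparr>carrier = equivariant_autoequivalences K C G F \<epsilon> // equivariant_iso_rel K C G F \<epsilon>,
     monoid.mult = (\<lambda>A B. \<Union>a\<in>A. \<Union>b\<in>B. equivariant_iso_rel K C G F \<epsilon> `` {equivariant_comp C F a b}),
     one = equivariant_iso_rel K C G F \<epsilon> `` {(id_functor, \<lambda>g X. Ident C (ob (F g) X))}\<rparr>"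

definition stable_object ::
    "('o, 'm, 'k) category \<Rightarrow> 'g monoid \<Rightarrow> ('g \<Rightarrow> ('o, 'm, 'o, 'm) functr) \<Rightarrow> 'o \<Rightarrow> bool"
  where "stable_object C G F M \<longleftrightarrow> M \<in> Obj C \<and> (\<forall>g\<in>carrier G. (ob (F g) M, M) \<in> iso_rel C)"

definition Stab ::
    "('o, 'm, 'k) category \<Rightarrow> 'g monoid \<Rightarrow> ('g \<Rightarrow> ('o, 'm, 'o, 'm) functr) \<Rightarrow> 'o set set"
  where "Stab C G F = {M \<in> Obj C. basic_object C M \<and> stable_object C G F M} // iso_rel C"

text \<open>
  \<open>[H, \<delta>].[M] = [H(M)]\<close>; the union over all representatives is over a constant family.
\<close>

definition Aut_act ::
    "('o, 'm, 'k) category \<Rightarrow>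
     (('o, 'm, 'o, 'm) functr \<times> ('g \<Rightarrow> 'o \<Rightarrow> 'm)) set \<Rightarrow> 'o set \<Rightarrow> 'o set"
  where "Aut_act C A m = (\<Union>(H, \<delta>)\<in>A. \<Union>M\<in>m. iso_rel C `` {ob H M})"

end

theory Submission
  imports Defs
begin

text \<open>
  Write \<open>X \<preceq> M\<close> for \<open>X \<in> add M\<close>. In a Krull--Schmidt category a basic object is determined up to
  isomorphism by its additive closure (\<open>basic_iso_of_generated\<close>), and every object has the additive
  closure of some basic object (\<open>basic_generator_exists\<close>). Both \<open>C\<close> and \<open>C\<^sup>G\<close> are of this kind, so
  the theorem is about the preorder \<open>\<preceq>\<close>.

  After forgetting the equivariant structure, \<open>Ind M\<close> becomes \<open>\<Oplus> F\<^sub>h M\<close>. Hence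
  \<open>M \<preceq> U (Ind M) \<preceq> M\<close> for a stable \<open>M\<close>, so that \<open>add (Ind M)\<close> determines \<open>add M\<close>: the map is
  injective. Conversely let \<open>N\<close> be an equivariant object. The structure isomorphisms of \<open>N\<close> are the
  components of a morphism \<open>N \<rightarrow> Ind (U N)\<close>, and averaging over the group retracts it
  (\<open>retract_of_induced\<close>); the order of \<open>G\<close> is invertible in \<open>k\<close> because \<open>kG\<close> is a product of copies
  of \<open>k\<close>. By the orthogonality of the characters \<open>Ind (U N)\<close> is built from the twists \<open>F\<^sub>\<chi> N\<close>
  (\<open>induced_generated_by_stable\<close>). For a stable \<open>N\<close> therefore \<open>N \<preceq> Ind (U N) \<preceq> N\<close>, and the basic object
  of \<open>add (U N)\<close>, which is stable since \<open>U N \<cong> F\<^sub>g (U N)\<close>, is a preimage of \<open>N\<close>.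

  For the orbits, an equivariant autoequivalence \<open>(H, \<delta>)\<close> of \<open>C\<close> acts on equivariant objects, and
  the resulting \<open>H\<^sup>G\<close> satisfies \<open>H\<^sup>G (Ind M) \<cong> Ind (H M)\<close>
  (\<open>equivariantization_of_autoequivalence\<close>). The converse direction recovers \<open>C\<close> from \<open>C\<^sup>G\<close> and the
  dual action. A \<^emph>\<open>grading\<close> of an equivariant object \<open>N\<close> is a multiplicative family of morphisms
  \<open>t\<^sub>\<chi> : N \<rightarrow> F\<^sub>\<chi> N\<close>. The underlying arrows commute, and their common eigenspaces decompose \<open>U N\<close> as
  \<open>\<Oplus> F\<^sub>h X\<close>, where \<open>X\<close> is the eigenspace of degree one; thus \<open>N \<cong> Ind X\<close>, and \<open>C\<close> is equivalent to
  the category of graded objects and morphisms of degree one. This description is preserved by every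
  equivariant autoequivalence \<open>H'\<close> of \<open>C\<^sup>G\<close>. So \<open>H'\<close> induces an autoequivalence \<open>H\<close> of \<open>C\<close> with
  \<open>H' (Ind X) \<cong> Ind (H X)\<close> (\<open>descent_Ind\<close>), and the morphisms \<open>Ind (F\<^sub>g X) \<rightarrow> Ind X\<close> of degree \<open>g\<close>
  make \<open>H\<close> equivariant (\<open>descent_equivariant\<close>). Since \<open>\<iota>\<close> is injective, the two directions together
  say that it carries orbits bijectively to orbits.
\<close>

section \<open>Arrows with source and target\<close>

text \<open>A morphism that is tagged with its source and target can be composed, added and mapped by a functor
  without further arguments, and its typing becomes two equations between objects, which rewriting
  decides. The operations below are those of the category on tagged morphisms.\<close>

datatype ('o, 'm) arr = Arr (src: 'o) (mph: 'm) (trg: 'o)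

definition is_arr :: "('o, 'm, 'k) category \<Rightarrow> ('o, 'm) arr \<Rightarrow> bool"
  where "is_arr C f \<longleftrightarrow> src f \<in> Obj C \<and> trg f \<in> Obj C \<and> mph f \<in> mor C (src f) (trg f)"

definition arrows :: "('o, 'm, 'k) category \<Rightarrow> 'o \<Rightarrow> 'o \<Rightarrow> ('o, 'm) arr set"
  where "arrows C X Y = {f. is_arr C f \<and> src f = X \<and> trg f = Y}"

definition cmp :: "('o, 'm, 'k) category \<Rightarrow> ('o, 'm) arr \<Rightarrow> ('o, 'm) arr \<Rightarrow> ('o, 'm) arr" (infixr \<open>**\<index>\<close> 75)
  where "g **\<^bsub>C\<^esub> f = Arr (src f) (mph g \<cdot>\<^bsub>C\<^esub> mph f) (trg g)"

definition idn :: "('o, 'm, 'k) category \<Rightarrow> 'o \<Rightarrow> ('o, 'm) arr"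
  where "idn C X = Arr X (Ident C X) X"

definition zr :: "('o, 'm, 'k) category \<Rightarrow> 'o \<Rightarrow> 'o \<Rightarrow> ('o, 'm) arr"
  where "zr C X Y = Arr X \<zero>\<^bsub>Hom C X Y\<^esub> Y"

definition pl :: "('o, 'm, 'k) category \<Rightarrow> ('o, 'm) arr \<Rightarrow> ('o, 'm) arr \<Rightarrow> ('o, 'm) arr"
  where "pl C f g = Arr (src f) (mph f \<oplus>\<^bsub>Hom C (src f) (trg f)\<^esub> mph g) (trg f)"

definition scl :: "('o, 'm, 'k) category \<Rightarrow> 'k \<Rightarrow> ('o, 'm) arr \<Rightarrow> ('o, 'm) arr"
  where "scl C a f = Arr (src f) (a \<odot>\<^bsub>Hom C (src f) (trg f)\<^esub> mph f) (trg f)"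

definition sm :: "('o, 'm, 'k) category \<Rightarrow> 'o \<Rightarrow> 'o \<Rightarrow> 'i set \<Rightarrow> ('i \<Rightarrow> ('o, 'm) arr) \<Rightarrow> ('o, 'm) arr"
  where "sm C X Y I t = Arr X (\<Oplus>\<^bsub>Hom C X Y\<^esub>i\<in>I. mph (t i)) Y"

lemma arrows_iff [simp]: "f \<in> arrows C X Y \<longleftrightarrow> is_arr C f \<and> src f = X \<and> trg f = Y"
  by (simp add: arrows_def)

lemma is_arr_Arr: "is_arr C (Arr X f Y) \<longleftrightarrow> X \<in> Obj C \<and> Y \<in> Obj C \<and> f \<in> mor C X Y"
  by (simp add: is_arr_def)

lemma src_trg_simps [simp]:
  "src (g **\<^bsub>C\<^esub> f) = src f" "trg (g **\<^bsub>C\<^esub> f) = trg g"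
  "src (idn C X) = X" "trg (idn C X) = X"
  "src (zr C X Y) = X" "trg (zr C X Y) = Y"
  "src (pl C f g) = src f" "trg (pl C f g) = trg f"
  "src (scl C a f) = src f" "trg (scl C a f) = trg f"
  "src (sm C X Y I t) = X" "trg (sm C X Y I t) = Y"
  by (simp_all add: cmp_def idn_def zr_def pl_def scl_def sm_def)

lemma is_arr_Obj: "is_arr C f \<Longrightarrow> src f \<in> Obj C" "is_arr C f \<Longrightarrow> trg f \<in> Obj C"
  by (simp_all add: is_arr_def)

lemma arr_eqI: "src f = src g \<Longrightarrow> trg f = trg g \<Longrightarrow> mph f = mph g \<Longrightarrow> f = g"
  by (cases f; cases g) simp

context linear_category
begin

lemma Hom_module: "X \<in> Obj C \<Longrightarrow> Y \<in> Obj C \<Longrightarrow> module K (Hom C X Y)"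
  by (rule vectorspace.axioms(1)[OF Hom_vectorspace])

lemma Hom_abelian_group: "X \<in> Obj C \<Longrightarrow> Y \<in> Obj C \<Longrightarrow> abelian_group (Hom C X Y)"
  by (rule module.axioms(2)[OF Hom_module])

lemma is_arr_cmp [simp]: "is_arr C g \<Longrightarrow> is_arr C f \<Longrightarrow> trg f = src g \<Longrightarrow> is_arr C (g ** f)"
  using Comp_closed[of "src f" "src g" "trg g" "mph f" "mph g"] by (auto simp: is_arr_def cmp_def)

lemma cmp_assoc [simp]:
  "is_arr C h \<Longrightarrow> is_arr C g \<Longrightarrow> is_arr C f \<Longrightarrow> trg f = src g \<Longrightarrow> trg g = src h \<Longrightarrow>
    (h ** g) ** f = h ** (g ** f)"
  using Comp_assoc[of "src f" "src g" "src h" "trg h" "mph f" "mph g" "mph h"]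
  by (auto simp: is_arr_def cmp_def)

text \<open>Rewriting modulo associativity: an equation between composites of two arrows is also usable
  inside a longer composite that is bracketed to the right.\<close>

lemma cmp_assoc_subst:
  "g ** f = k \<Longrightarrow> is_arr C g \<Longrightarrow> is_arr C f \<Longrightarrow> is_arr C x \<Longrightarrow> trg x = src f \<Longrightarrow> trg f = src g \<Longrightarrow>
    g ** (f ** x) = k ** x"
  using cmp_assoc by metis

lemma is_arr_idn [simp]: "X \<in> Obj C \<Longrightarrow> is_arr C (idn C X)"
  using Ident_closed by (auto simp: is_arr_def idn_def)

lemma cmp_idn_left [simp]: "is_arr C f \<Longrightarrow> trg f = Y \<Longrightarrow> idn C Y ** f = f"
  using Comp_Ident_left[of "src f" "trg f" "mph f"] by (auto simp: is_arr_def cmp_def idn_def intro!: arr_eqI)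

lemma cmp_idn_right [simp]: "is_arr C f \<Longrightarrow> src f = X \<Longrightarrow> f ** idn C X = f"
  using Comp_Ident_right[of "src f" "trg f" "mph f"] by (auto simp: is_arr_def cmp_def idn_def intro!: arr_eqI)

lemma is_arr_zr [simp]: "X \<in> Obj C \<Longrightarrow> Y \<in> Obj C \<Longrightarrow> is_arr C (zr C X Y)"
  using abelian_monoid.zero_closed[OF abelian_group.axioms(1)[OF Hom_abelian_group], of X Y]
  by (auto simp: is_arr_def zr_def)

lemma is_arr_pl [simp]:
  "is_arr C f \<Longrightarrow> is_arr C g \<Longrightarrow> src f = src g \<Longrightarrow> trg f = trg g \<Longrightarrow> is_arr C (pl C f g)"
  using abelian_monoid.a_closed[OF abelian_group.axioms(1)[OF Hom_abelian_group],
      of "src f" "trg f" "mph f" "mph g"]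
  by (auto simp: is_arr_def pl_def)

lemma is_arr_scl [simp]: "is_arr C f \<Longrightarrow> a \<in> carrier K \<Longrightarrow> is_arr C (scl C a f)"
  using module.smult_closed[OF Hom_module, of "src f" "trg f" a "mph f"] by (auto simp: is_arr_def scl_def)

lemma is_arr_sm [simp]:
  assumes "X \<in> Obj C" "Y \<in> Obj C" "\<And>i. i \<in> I \<Longrightarrow> t i \<in> arrows C X Y"
  shows "is_arr C (sm C X Y I t)"
proof -
  interpret M: module K "Hom C X Y" using assms Hom_module by blast
  have "mph (t i) \<in> mor C X Y" if "i \<in> I" for i using assms(3)[OF that] by (auto simp: is_arr_def)
  then show ?thesis using assms(1,2) M.finsum_closed[of "\<lambda>i. mph (t i)" I]
    by (simp add: is_arr_Arr sm_def Pi_def)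
qed

lemma cmp_pl:
  assumes "is_arr C f" "is_arr C g" "is_arr C h" "src f = src g" "trg f = trg g" "trg f = src h"
  shows "h ** pl C f g = pl C (h ** f) (h ** g)"
  using assms Comp_add_right[of "src f" "src h" "trg h" "mph f" "mph g" "mph h"] by (auto simp: is_arr_def cmp_def pl_def)

lemma pl_cmp:
  assumes "is_arr C f" "is_arr C g" "is_arr C h" "src f = src g" "trg f = trg g" "trg h = src f"
  shows "pl C f g ** h = pl C (f ** h) (g ** h)"
  using assms Comp_add_left[of "src h" "src f" "trg f" "mph h" "mph f" "mph g"] by (auto simp: is_arr_def cmp_def pl_def)

lemma cmp_scl [simp]:
  assumes "is_arr C f" "is_arr C h" "trg f = src h" "a \<in> carrier K"
  shows "h ** scl C a f = scl C a (h ** f)"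
  using assms Comp_smult_right[of "src f" "src h" "trg h" a "mph f" "mph h"] by (auto simp: is_arr_def cmp_def scl_def)

lemma scl_cmp [simp]:
  assumes "is_arr C f" "is_arr C h" "trg h = src f" "a \<in> carrier K"
  shows "scl C a f ** h = scl C a (f ** h)"
  using assms Comp_smult_left[of "src h" "src f" "trg f" a "mph h" "mph f"] by (auto simp: is_arr_def cmp_def scl_def)

lemma scl_one [simp]: "is_arr C f \<Longrightarrow> scl C \<one>\<^bsub>K\<^esub> f = f"
  using module.smult_one[OF Hom_module, of "src f" "trg f" "mph f"] by (auto simp: is_arr_def scl_def intro!: arr_eqI)

lemma scl_zero [simp]: "is_arr C f \<Longrightarrow> scl C \<zero>\<^bsub>K\<^esub> f = zr C (src f) (trg f)"
  using module.smult_l_null[OF Hom_module, of "src f" "trg f" "mph f"] by (auto simp: is_arr_def scl_def zr_def intro!: arr_eqI)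

lemma scl_zr [simp]: "X \<in> Obj C \<Longrightarrow> Y \<in> Obj C \<Longrightarrow> a \<in> carrier K \<Longrightarrow> scl C a (zr C X Y) = zr C X Y"
  using module.smult_r_null[OF Hom_module, of X Y a] by (auto simp: is_arr_def scl_def zr_def intro!: arr_eqI)

lemma scl_scl [simp]:
  "is_arr C f \<Longrightarrow> a \<in> carrier K \<Longrightarrow> b \<in> carrier K \<Longrightarrow> scl C a (scl C b f) = scl C (a \<otimes>\<^bsub>K\<^esub> b) f"
  using module.smult_assoc1[OF Hom_module, of "src f" "trg f" a b "mph f"] by (auto simp: is_arr_def scl_def)

lemma pl_zr [simp]:
  "is_arr C f \<Longrightarrow> X = src f \<Longrightarrow> Y = trg f \<Longrightarrow> pl C f (zr C X Y) = f"
  "is_arr C f \<Longrightarrow> X = src f \<Longrightarrow> Y = trg f \<Longrightarrow> pl C (zr C X Y) f = f"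
  using abelian_monoid.r_zero[OF abelian_group.axioms(1)[OF Hom_abelian_group], of "src f" "trg f" "mph f"]
    abelian_monoid.l_zero[OF abelian_group.axioms(1)[OF Hom_abelian_group], of "src f" "trg f" "mph f"]
  by (auto simp: is_arr_def pl_def zr_def intro!: arr_eqI)

lemma pl_commute:
  "is_arr C f \<Longrightarrow> is_arr C g \<Longrightarrow> src f = src g \<Longrightarrow> trg f = trg g \<Longrightarrow> pl C f g = pl C g f"
  using abelian_monoid.a_comm[OF abelian_group.axioms(1)[OF Hom_abelian_group],
      of "src f" "trg f" "mph f" "mph g"]
  by (auto simp: is_arr_def pl_def)

lemma pl_assoc:
  "is_arr C f \<Longrightarrow> is_arr C g \<Longrightarrow> is_arr C h \<Longrightarrow> src f = src g \<Longrightarrow> trg f = trg g \<Longrightarrow>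
    src h = src g \<Longrightarrow> trg h = trg g \<Longrightarrow> pl C (pl C f g) h = pl C f (pl C g h)"
  using abelian_monoid.a_assoc[OF abelian_group.axioms(1)[OF Hom_abelian_group],
      of "src f" "trg f" "mph f" "mph g" "mph h"]
  by (auto simp: is_arr_def pl_def)

lemma scl_pl: "is_arr C f \<Longrightarrow> is_arr C g \<Longrightarrow> src f = src g \<Longrightarrow> trg f = trg g \<Longrightarrow> a \<in> carrier K \<Longrightarrow>
    scl C a (pl C f g) = pl C (scl C a f) (scl C a g)"
  using module.smult_r_distr[OF Hom_module, of "src f" "trg f" a "mph f" "mph g"] by (auto simp: is_arr_def scl_def pl_def)

end

declare is_arr_Obj [simp]

context linear_category
begin

lemma field_K: "X \<in> Obj C \<Longrightarrow> field K"
  by (rule vectorspace.axioms(2)[OF Hom_vectorspace])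

lemma K_zero: "X \<in> Obj C \<Longrightarrow> \<zero>\<^bsub>K\<^esub> \<in> carrier K"
  by (rule cring.cring_simprules(2)[OF fieldE(1)[OF field_K]])

lemma cmp_zr [simp]: "is_arr C h \<Longrightarrow> src h = Y \<Longrightarrow> X \<in> Obj C \<Longrightarrow> h ** zr C X Y = zr C X (trg h)"
  using cmp_scl[of "zr C X Y" h "\<zero>\<^bsub>K\<^esub>"] K_zero[of X] scl_zr[of X Y "\<zero>\<^bsub>K\<^esub>"]
    scl_zero[of "h ** zr C X Y"] by auto

lemma zr_cmp [simp]: "is_arr C h \<Longrightarrow> trg h = X \<Longrightarrow> Y \<in> Obj C \<Longrightarrow> zr C X Y ** h = zr C (src h) Y"
  using scl_cmp[of "zr C X Y" h "\<zero>\<^bsub>K\<^esub>"] K_zero[of X] scl_zr[of X Y "\<zero>\<^bsub>K\<^esub>"]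
    scl_zero[of "zr C X Y ** h"] by auto

subsection \<open>Finite sums\<close>

lemma sm_empty [simp]: "X \<in> Obj C \<Longrightarrow> Y \<in> Obj C \<Longrightarrow> sm C X Y {} t = zr C X Y"
  using abelian_monoid.finsum_empty[OF abelian_group.axioms(1)[OF Hom_abelian_group], of X Y]
  by (simp add: sm_def zr_def)

lemma sm_insert:
  assumes "finite I" "j \<notin> I" "X \<in> Obj C" "Y \<in> Obj C" "\<And>i. i \<in> insert j I \<Longrightarrow> t i \<in> arrows C X Y"
  shows "sm C X Y (insert j I) t = pl C (t j) (sm C X Y I t)"
proof -
  interpret M: module K "Hom C X Y" using assms Hom_module by blast
  have "mph (t i) \<in> mor C X Y" if "i \<in> insert j I" for i using assms(5)[OF that] by (auto simp del: is_arr_Obj simp: is_arr_def)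
  then show ?thesis using assms M.finsum_insert[of I j "\<lambda>i. mph (t i)"]
    by (auto simp: sm_def pl_def)
qed

lemma sm_cong:
  assumes "I = J" "X \<in> Obj C" "Y \<in> Obj C" "\<And>i. i \<in> J \<Longrightarrow> t i = u i" "\<And>i. i \<in> J \<Longrightarrow> u i \<in> arrows C X Y"
  shows "sm C X Y I t = sm C X Y J u"
proof -
  interpret M: module K "Hom C X Y" using assms Hom_module by blast
  have "mph (u i) \<in> mor C X Y" if "i \<in> J" for i using assms(5)[OF that] by (auto simp del: is_arr_Obj simp: is_arr_def)
  then show ?thesis using assms by (auto simp: sm_def intro!: M.finsum_cong')
qed

lemma cmp_sm:
  assumes "finite I" "is_arr C h" "src h = Y" "X \<in> Obj C" "\<And>i. i \<in> I \<Longrightarrow> t i \<in> arrows C X Y"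
  shows "h ** sm C X Y I t = sm C X (trg h) I (\<lambda>i. h ** t i)"
  using assms(1,5)
proof (induction I rule: finite_induct)
  case empty
  then show ?case using assms by auto
next
  case (insert j J)
  have "Y \<in> Obj C" using assms by auto
  moreover have "h ** t i \<in> arrows C X (trg h)" if "i \<in> insert j J" for i
    using insert.prems[OF that] assms(2,3) by auto
  ultimately show ?case
    using insert.prems insert.hyps insert.IH assms(2-4) sm_insert[of J j X Y t]
      sm_insert[of J j X "trg h" "\<lambda>i. h ** t i"] by (simp add: cmp_pl)
qed

lemma sm_cmp:
  assumes "finite I" "is_arr C h" "trg h = X" "Y \<in> Obj C" "\<And>i. i \<in> I \<Longrightarrow> t i \<in> arrows C X Y"
  shows "sm C X Y I t ** h = sm C (src h) Y I (\<lambda>i. t i ** h)"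
  using assms(1,5)
proof (induction I rule: finite_induct)
  case empty
  then show ?case using assms by auto
next
  case (insert j J)
  have "X \<in> Obj C" using assms by auto
  moreover have "t i ** h \<in> arrows C (src h) Y" if "i \<in> insert j J" for i
    using insert.prems[OF that] assms(2,3) by auto
  ultimately show ?case
    using insert.prems insert.hyps insert.IH assms(2-4) sm_insert[of J j X Y t]
      sm_insert[of J j "src h" Y "\<lambda>i. t i ** h"] by (simp add: pl_cmp)
qed

lemma scl_sm:
  assumes "finite I" "a \<in> carrier K" "X \<in> Obj C" "Y \<in> Obj C" "\<And>i. i \<in> I \<Longrightarrow> t i \<in> arrows C X Y"
  shows "scl C a (sm C X Y I t) = sm C X Y I (\<lambda>i. scl C a (t i))"
  using assms(1,5)
proof (induction I rule: finite_induct)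
  case empty
  then show ?case using assms by auto
next
  case (insert j J)
  then show ?case using assms(2-4) sm_insert[of J j X Y t]
      sm_insert[of J j X Y "\<lambda>i. scl C a (t i)"] by (simp add: scl_pl)
qed

lemma sm_const_scl:
  assumes "finite I" "is_arr C f" "src f = X" "trg f = Y" "\<And>i. i \<in> I \<Longrightarrow> c i \<in> carrier K"
  shows "sm C X Y I (\<lambda>i. scl C (c i) f) = scl C (\<Oplus>\<^bsub>K\<^esub>i\<in>I. c i) f"
  using assms(1,5)
proof (induction I rule: finite_induct)
  case empty
  interpret M: module K "Hom C X Y" using assms Hom_module by auto
  show ?case using assms by auto
next
  case (insert j J)
  have XY: "X \<in> Obj C" "Y \<in> Obj C" using assms by auto
  interpret M: module K "Hom C X Y" using XY Hom_module by auto
  have "mph f \<in> mor C X Y" "finsum K c J \<in> carrier K" "c j \<in> carrier K"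
    using assms(2-4) insert.prems by (auto simp del: is_arr_Obj simp: is_arr_def)
  then have *: "scl C (\<Oplus>\<^bsub>K\<^esub>i\<in>insert j J. c i) f = pl C (scl C (c j) f) (scl C (\<Oplus>\<^bsub>K\<^esub>i\<in>J. c i) f)"
    using insert assms(2-4) XY by (simp add: pl_def scl_def M.smult_l_distr)
  show ?case
    unfolding * using insert assms(2-4) XY sm_insert[of J j X Y "\<lambda>i. scl C (c i) f"] by simp
qed

lemma sm_reindex:
  assumes "bij_betw \<sigma> J I" "X \<in> Obj C" "Y \<in> Obj C" "\<And>i. i \<in> I \<Longrightarrow> t i \<in> arrows C X Y"
  shows "sm C X Y I t = sm C X Y J (\<lambda>j. t (\<sigma> j))"
proof -
  interpret M: module K "Hom C X Y" using assms Hom_module by blast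
  have I: "I = \<sigma> ` J" using assms(1) by (auto simp: bij_betw_def)
  have "mph (t i) \<in> mor C X Y" if "i \<in> I" for i using assms(4)[OF that] by (auto simp del: is_arr_Obj simp: is_arr_def)
  then show ?thesis using assms(1) unfolding I
    by (auto simp: sm_def bij_betw_def intro!: M.finsum_reindex)
qed

lemma sm_mono_neutral:
  assumes "finite J" "I \<subseteq> J" "X \<in> Obj C" "Y \<in> Obj C" "\<And>i. i \<in> I \<Longrightarrow> t i \<in> arrows C X Y"
    and "\<And>i. i \<in> J - I \<Longrightarrow> t i = zr C X Y"
  shows "sm C X Y J t = sm C X Y I t"
proof -
  interpret M: module K "Hom C X Y" using assms Hom_module by blast
  have "mph (t i) \<in> mor C X Y" if "i \<in> I" for i using assms(5)[OF that] by (auto simp del: is_arr_Obj simp: is_arr_def)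
  moreover have "mph (t i) = \<zero>\<^bsub>Hom C X Y\<^esub>" if "i \<in> J - I" for i using assms(6)[OF that] by (simp add: zr_def)
  ultimately have "(\<lambda>i. mph (t i)) \<in> J \<rightarrow> mor C X Y" by fastforce
  then have "(\<Oplus>\<^bsub>Hom C X Y\<^esub>i\<in>I. mph (t i)) = (\<Oplus>\<^bsub>Hom C X Y\<^esub>i\<in>J. mph (t i))"
    using assms(1,2) \<open>\<And>i. i \<in> J - I \<Longrightarrow> mph (t i) = \<zero>\<^bsub>Hom C X Y\<^esub>\<close>
    by (intro M.add.finprod_mono_neutral_cong_left) auto
  then show ?thesis by (simp add: sm_def)
qed

lemma sm_single:
  assumes "finite I" "j \<in> I" "X \<in> Obj C" "Y \<in> Obj C" "t j \<in> arrows C X Y"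
    and "\<And>i. i \<in> I \<Longrightarrow> i \<noteq> j \<Longrightarrow> t i = zr C X Y"
  shows "sm C X Y I t = t j"
  using assms sm_mono_neutral[of I "{j}" X Y t] sm_insert[of "{}" j X Y t] by simp

lemma sm_swap:
  assumes "finite I" "finite J" "X \<in> Obj C" "Y \<in> Obj C" "\<And>i j. i \<in> I \<Longrightarrow> j \<in> J \<Longrightarrow> t i j \<in> arrows C X Y"
  shows "sm C X Y I (\<lambda>i. sm C X Y J (t i)) = sm C X Y J (\<lambda>j. sm C X Y I (\<lambda>i. t i j))"
proof -
  interpret M: module K "Hom C X Y" using assms Hom_module by blast
  have "mph (t i j) \<in> mor C X Y" if "i \<in> I" "j \<in> J" for i j using assms(5)[OF that] by (auto simp del: is_arr_Obj simp: is_arr_def)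
  then show ?thesis using assms(1-4) M.add.finprod_finprod_swap[of I J "\<lambda>i j. mph (t i j)"]
    by (auto simp: sm_def Pi_def)
qed

end

subsection \<open>Isomorphisms\<close>

definition inverses :: "('o, 'm, 'k) category \<Rightarrow> ('o, 'm) arr \<Rightarrow> ('o, 'm) arr \<Rightarrow> bool"
  where "inverses C f g \<longleftrightarrow> is_arr C f \<and> is_arr C g \<and> src g = trg f \<and> trg g = src f \<and>
    g **\<^bsub>C\<^esub> f = idn C (src f) \<and> f **\<^bsub>C\<^esub> g = idn C (trg f)"

definition iso_arr :: "('o, 'm, 'k) category \<Rightarrow> ('o, 'm) arr \<Rightarrow> bool"
  where "iso_arr C f \<longleftrightarrow> (\<exists>g. inverses C f g)"

definition ainv :: "('o, 'm, 'k) category \<Rightarrow> ('o, 'm) arr \<Rightarrow> ('o, 'm) arr"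
  where "ainv C f = (SOME g. inverses C f g)"

lemma iso_arr_arr: "iso_arr C f \<Longrightarrow> is_arr C f"
  by (auto simp: iso_arr_def inverses_def)

lemma inverses_ainv: "iso_arr C f \<Longrightarrow> inverses C f (ainv C f)"
  unfolding iso_arr_def ainv_def by (rule someI_ex)

lemma ainv_simps [simp]:
  assumes "iso_arr C f"
  shows "is_arr C (ainv C f)" "src (ainv C f) = trg f" "trg (ainv C f) = src f"
    "ainv C f **\<^bsub>C\<^esub> f = idn C (src f)" "f **\<^bsub>C\<^esub> ainv C f = idn C (trg f)"
  using inverses_ainv[OF assms] by (auto simp: inverses_def)

lemma inverses_sym: "inverses C f g \<Longrightarrow> inverses C g f"
  by (auto simp: inverses_def)

lemma iso_arr_ainv [simp]: "iso_arr C f \<Longrightarrow> iso_arr C (ainv C f)"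
  using inverses_ainv inverses_sym iso_arr_def by blast

lemma inverse_morphisms_iff:
  "X \<in> Obj C \<Longrightarrow> Y \<in> Obj C \<Longrightarrow> inverse_morphisms C X Y f g \<longleftrightarrow> inverses C (Arr X f Y) (Arr Y g X)"
  by (auto simp: inverse_morphisms_def inverses_def is_arr_Arr cmp_def idn_def)

lemma isos_iff:
  assumes "X \<in> Obj C" "Y \<in> Obj C"
  shows "f \<in> isos C X Y \<longleftrightarrow> iso_arr C (Arr X f Y)"
proof -
  have "\<exists>h. inverses C (Arr X f Y) (Arr Y h X)" if "inverses C (Arr X f Y) g" for g
    using that by (cases g) (auto simp: inverses_def)
  then show ?thesis using assms by (auto simp: isos_def iso_arr_def inverse_morphisms_iff)
qed

lemma iso_rel_iff: "(X, Y) \<in> iso_rel C \<longleftrightarrow> X \<in> Obj C \<and> Y \<in> Obj C \<and> (\<exists>f\<in>arrows C X Y. iso_arr C f)"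
proof -
  have "(\<exists>f. iso_arr C (Arr X f Y)) \<longleftrightarrow> (\<exists>f\<in>arrows C X Y. iso_arr C f)"
    by (metis arr.collapse arr.sel(1) arr.sel(3) arrows_iff iso_arr_arr)
  then show ?thesis by (auto simp: iso_rel_def isos_iff)
qed

lemma iso_relI: "iso_arr C f \<Longrightarrow> src f = X \<Longrightarrow> trg f = Y \<Longrightarrow> (X, Y) \<in> iso_rel C"
  using iso_arr_arr[of C f] by (auto simp: iso_rel_iff)

context linear_category
begin

lemma inverses_unique:
  assumes "inverses C f g" "inverses C f h"
  shows "g = h"
proof -
  have "g = g ** (f ** h)" using assms by (auto simp: inverses_def)
  also have "\<dots> = (g ** f) ** h" using assms by (intro cmp_assoc[symmetric]) (auto simp: inverses_def)
  also have "\<dots> = h" using assms by (auto simp: inverses_def)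
  finally show ?thesis .
qed

lemma ainv_eqI: "inverses C f g \<Longrightarrow> ainv C f = g"
  using inverses_unique inverses_ainv iso_arr_def by blast

lemma inv_mor_ainv:
  assumes "X \<in> Obj C" "Y \<in> Obj C" "iso_arr C (Arr X f Y)"
  shows "Arr Y (inv_mor C X Y f) X = ainv C (Arr X f Y)"
proof -
  let ?g = "ainv C (Arr X f Y)"
  have g: "?g = Arr Y (mph ?g) X" using assms(3) by (intro arr_eqI) auto
  have "inverses C (Arr X f Y) (Arr Y (mph ?g) X)" using inverses_ainv[OF assms(3)] g by simp
  then have "inv_mor C X Y f = mph ?g"
    unfolding inv_mor_def using assms(1,2)
    by (intro the_equality) (auto simp: inverse_morphisms_iff dest: ainv_eqI)
  then show ?thesis using g by simp
qed

lemma inverses_idn: "X \<in> Obj C \<Longrightarrow> inverses C (idn C X) (idn C X)"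
  by (simp add: inverses_def)

lemma iso_arr_idn [simp]: "X \<in> Obj C \<Longrightarrow> iso_arr C (idn C X)"
  using inverses_idn iso_arr_def by blast

lemma ainv_cancel:
  assumes "iso_arr C f" "is_arr C x"
  shows "trg x = src f \<Longrightarrow> ainv C f ** (f ** x) = x" "trg x = trg f \<Longrightarrow> f ** (ainv C f ** x) = x"
  using assms iso_arr_arr[OF assms(1)] by (simp_all add: cmp_assoc[symmetric] del: cmp_assoc)

lemma cancel_ainv:
  assumes "iso_arr C f" "is_arr C x"
  shows "src x = src f \<Longrightarrow> (x ** ainv C f) ** f = x" "src x = trg f \<Longrightarrow> (x ** f) ** ainv C f = x"
  using assms iso_arr_arr[OF assms(1)] by simp_all

lemma inverses_cmp:
  assumes "inverses C f f'" "inverses C g g'" "trg f = src g"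
  shows "inverses C (g ** f) (f' ** g')"
  using assms
  by (auto simp: inverses_def cmp_assoc_subst)

lemma iso_arr_cmp [simp]: "iso_arr C f \<Longrightarrow> iso_arr C g \<Longrightarrow> trg f = src g \<Longrightarrow> iso_arr C (g ** f)"
  using inverses_cmp iso_arr_def by metis

lemma iso_cancel_left:
  assumes "iso_arr C f" "is_arr C x" "is_arr C y" "trg x = src f" "trg y = src f" "f ** x = f ** y"
  shows "x = y"
  by (metis ainv_cancel(1)[OF assms(1,2,4)] ainv_cancel(1)[OF assms(1,3,5)] assms(6))

lemma iso_cancel_right:
  assumes "iso_arr C f" "is_arr C x" "is_arr C y" "src x = trg f" "src y = trg f" "x ** f = y ** f"
  shows "x = y"
  by (metis cancel_ainv(2)[OF assms(1,2)] cancel_ainv(2)[OF assms(1,3)] assms(4-6))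

lemma iso_rel_refl: "X \<in> Obj C \<Longrightarrow> (X, X) \<in> iso_rel C"
  by (rule iso_relI[of C "idn C X"]) auto

lemma iso_rel_sym: "(X, Y) \<in> iso_rel C \<Longrightarrow> (Y, X) \<in> iso_rel C"
  unfolding iso_rel_iff by (metis arrows_iff ainv_simps(1-3) iso_arr_ainv)

lemma iso_rel_trans: "(X, Y) \<in> iso_rel C \<Longrightarrow> (Y, Z) \<in> iso_rel C \<Longrightarrow> (X, Z) \<in> iso_rel C"
  unfolding iso_rel_iff by (metis arrows_iff is_arr_cmp iso_arr_cmp src_trg_simps(1,2))

end

subsection \<open>Functors\<close>

definition fmap :: "('o, 'm, 'p, 'n) functr \<Rightarrow> ('o, 'm) arr \<Rightarrow> ('p, 'n) arr"
  where "fmap F t = Arr (ob F (src t)) (ar F (src t) (trg t) (mph t)) (ob F (trg t))"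

lemma src_fmap [simp]: "src (fmap F t) = ob F (src t)" and trg_fmap [simp]: "trg (fmap F t) = ob F (trg t)"
  by (simp_all add: fmap_def)

lemma fmap_id_functor [simp]: "fmap id_functor t = t"
  by (simp add: fmap_def id_functor_def)

lemma fmap_comp_functor [simp]: "fmap (F \<circ>\<^sub>F H) t = fmap F (fmap H t)"
  by (simp add: fmap_def comp_functor_def)

lemma ob_comp_functor [simp]: "ob (F \<circ>\<^sub>F H) X = ob F (ob H X)"
  by (simp add: comp_functor_def)

lemma ob_id_functor [simp]: "ob id_functor X = X"
  by (simp add: id_functor_def)

definition mk_functor :: "('o \<Rightarrow> 'p) \<Rightarrow> (('o, 'm) arr \<Rightarrow> ('p, 'n) arr) \<Rightarrow> ('o, 'm, 'p, 'n) functr"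
  where "mk_functor obm \<phi> = \<lparr>ob = obm, ar = (\<lambda>X Y f. mph (\<phi> (Arr X f Y)))\<rparr>"

lemma ob_mk_functor [simp]: "ob (mk_functor obm \<phi>) X = obm X"
  by (simp add: mk_functor_def)

locale lin_functor = C: linear_category K C + D: linear_category K D
  for K :: "'k ring" and C :: "('o, 'm, 'k) category" and D :: "('p, 'n, 'k) category" +
  fixes F :: "('o, 'm, 'p, 'n) functr"
  assumes F: "linear_functor K C D F"
begin

lemma ob_Obj [simp]: "X \<in> Obj C \<Longrightarrow> ob F X \<in> Obj D"
  using F by (auto simp: linear_functor_def)

lemma is_arr_fmap [simp]: "is_arr C f \<Longrightarrow> is_arr D (fmap F f)"
  using F by (auto simp del: is_arr_Obj simp: linear_functor_def fmap_def is_arr_def)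

lemma fmap_idn [simp]: "X \<in> Obj C \<Longrightarrow> fmap F (idn C X) = idn D (ob F X)"
  using F by (auto simp: linear_functor_def fmap_def idn_def)

lemma fmap_cmp:
  "is_arr C f \<Longrightarrow> is_arr C g \<Longrightarrow> trg f = src g \<Longrightarrow> fmap F (g **\<^bsub>C\<^esub> f) = fmap F g **\<^bsub>D\<^esub> fmap F f"
  using F by (auto simp del: is_arr_Obj simp: linear_functor_def fmap_def is_arr_def cmp_def)

lemma fmap_pl:
  "is_arr C f \<Longrightarrow> is_arr C g \<Longrightarrow> src f = src g \<Longrightarrow> trg f = trg g \<Longrightarrow>
    fmap F (pl C f g) = pl D (fmap F f) (fmap F g)"
  using F by (auto simp del: is_arr_Obj simp: linear_functor_def fmap_def is_arr_def pl_def)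

lemma fmap_scl:
  "is_arr C f \<Longrightarrow> a \<in> carrier K \<Longrightarrow> fmap F (scl C a f) = scl D a (fmap F f)"
  using F by (auto simp del: is_arr_Obj simp: linear_functor_def fmap_def is_arr_def scl_def)

lemma fmap_zr [simp]:
  assumes "X \<in> Obj C" "Y \<in> Obj C"
  shows "fmap F (zr C X Y) = zr D (ob F X) (ob F Y)"
proof -
  have "fmap F (scl C \<zero>\<^bsub>K\<^esub> (zr C X Y)) = scl D \<zero>\<^bsub>K\<^esub> (fmap F (zr C X Y))"
    using assms C.K_zero by (intro fmap_scl) auto
  then show ?thesis using assms C.K_zero by auto
qed

lemma fmap_sm:
  assumes "finite I" "X \<in> Obj C" "Y \<in> Obj C" "\<And>i. i \<in> I \<Longrightarrow> t i \<in> arrows C X Y"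
  shows "fmap F (sm C X Y I t) = sm D (ob F X) (ob F Y) I (\<lambda>i. fmap F (t i))"
  using assms(1,4)
proof (induction I rule: finite_induct)
  case empty
  then show ?case using assms by simp
next
  case (insert j J)
  then show ?case
    using assms(2,3) C.sm_insert[of J j X Y t] D.sm_insert[of J j "ob F X" "ob F Y" "\<lambda>i. fmap F (t i)"]
    by (simp add: fmap_pl)
qed

lemma fmap_inverses: "inverses C f g \<Longrightarrow> inverses D (fmap F f) (fmap F g)"
  by (auto simp: inverses_def fmap_cmp[symmetric])

lemma fmap_iso_arr: "iso_arr C f \<Longrightarrow> iso_arr D (fmap F f)"
  using fmap_inverses by (auto simp: iso_arr_def)

lemma fmap_ainv: "iso_arr C f \<Longrightarrow> fmap F (ainv C f) = ainv D (fmap F f)"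
  by (rule D.ainv_eqI[symmetric]) (intro fmap_inverses inverses_ainv)

lemma ob_iso_rel: "(X, Y) \<in> iso_rel C \<Longrightarrow> (ob F X, ob F Y) \<in> iso_rel D"
  unfolding iso_rel_iff by (metis arrows_iff is_arr_fmap ob_Obj fmap_iso_arr src_fmap trg_fmap)

end

text \<open>A functor may be specified by its values on tagged arrows. All functors constructed below arise in
  this way.\<close>

lemma linear_functor_mk_functor:
  assumes "\<And>X. X \<in> Obj C \<Longrightarrow> obm X \<in> Obj D"
    and "\<And>f. is_arr C f \<Longrightarrow> \<phi> f \<in> arrows D (obm (src f)) (obm (trg f))"
    and "\<And>X. X \<in> Obj C \<Longrightarrow> \<phi> (idn C X) = idn D (obm X)"
    and "\<And>f g. is_arr C f \<Longrightarrow> is_arr C g \<Longrightarrow> trg f = src g \<Longrightarrow> \<phi> (g **\<^bsub>C\<^esub> f) = \<phi> g **\<^bsub>D\<^esub> \<phi> f"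
    and "\<And>f g. is_arr C f \<Longrightarrow> is_arr C g \<Longrightarrow> src f = src g \<Longrightarrow> trg f = trg g \<Longrightarrow>
      \<phi> (pl C f g) = pl D (\<phi> f) (\<phi> g)"
    and "\<And>a f. is_arr C f \<Longrightarrow> a \<in> carrier K \<Longrightarrow> \<phi> (scl C a f) = scl D a (\<phi> f)"
  shows "linear_functor K C D (mk_functor obm \<phi>) \<and> (\<forall>f. is_arr C f \<longrightarrow> fmap (mk_functor obm \<phi>) f = \<phi> f)"
proof (intro conjI allI impI)
  have arr: "mph (\<phi> (Arr X f Y)) \<in> mor D (obm X) (obm Y)"
      "src (\<phi> (Arr X f Y)) = obm X" "trg (\<phi> (Arr X f Y)) = obm Y"
    if "X \<in> Obj C" "Y \<in> Obj C" "f \<in> mor C X Y" for X Y f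
    using assms(2)[of "Arr X f Y"] that by (auto simp del: is_arr_Obj simp: is_arr_def)
  have id: "mph (\<phi> (Arr X (Ident C X) X)) = Ident D (obm X)" if "X \<in> Obj C" for X
    using assms(3)[OF that] by (simp add: idn_def)
  have cmp: "mph (\<phi> (Arr X (g \<cdot>\<^bsub>C\<^esub> f) Z)) = mph (\<phi> (Arr Y g Z)) \<cdot>\<^bsub>D\<^esub> mph (\<phi> (Arr X f Y))"
    if "X \<in> Obj C" "Y \<in> Obj C" "Z \<in> Obj C" "f \<in> mor C X Y" "g \<in> mor C Y Z" for X Y Z f g
    using assms(4)[of "Arr X f Y" "Arr Y g Z"] that by (simp add: is_arr_Arr cmp_def)
  have pl: "mph (\<phi> (Arr X (f \<oplus>\<^bsub>Hom C X Y\<^esub> g) Y)) =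
      mph (\<phi> (Arr X f Y)) \<oplus>\<^bsub>Hom D (obm X) (obm Y)\<^esub> mph (\<phi> (Arr X g Y))"
    if "X \<in> Obj C" "Y \<in> Obj C" "f \<in> mor C X Y" "g \<in> mor C X Y" for X Y f g
    using assms(5)[of "Arr X f Y" "Arr X g Y"] arr that by (simp add: is_arr_Arr pl_def)
  have scl: "mph (\<phi> (Arr X (a \<odot>\<^bsub>Hom C X Y\<^esub> f) Y)) = a \<odot>\<^bsub>Hom D (obm X) (obm Y)\<^esub> mph (\<phi> (Arr X f Y))"
    if "X \<in> Obj C" "Y \<in> Obj C" "f \<in> mor C X Y" "a \<in> carrier K" for X Y f a
    using assms(6)[of "Arr X f Y" a] arr that by (simp add: is_arr_Arr scl_def)
  show "linear_functor K C D (mk_functor obm \<phi>)"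
    unfolding linear_functor_def mk_functor_def using assms(1) arr id cmp pl scl by simp
  show "fmap (mk_functor obm \<phi>) f = \<phi> f" if "is_arr C f" for f
    using assms(2)[OF that] by (intro arr_eqI) (auto simp: fmap_def mk_functor_def)
qed

lemma natural_iso_iff:
  assumes "linear_functor K C D F" "linear_functor K C D F'"
  shows "natural_iso C D F F' \<phi> \<longleftrightarrow>
    (\<forall>X\<in>Obj C. iso_arr D (Arr (ob F X) (\<phi> X) (ob F' X))) \<and>
    (\<forall>f. is_arr C f \<longrightarrow> Arr (ob F (trg f)) (\<phi> (trg f)) (ob F' (trg f)) **\<^bsub>D\<^esub> fmap F f =
      fmap F' f **\<^bsub>D\<^esub> Arr (ob F (src f)) (\<phi> (src f)) (ob F' (src f)))"
proof -
  have ob: "ob F X \<in> Obj D" "ob F' X \<in> Obj D" if "X \<in> Obj C" for X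
    using assms that by (auto simp: linear_functor_def)
  have "(\<forall>X\<in>Obj C. \<forall>Y\<in>Obj C. \<forall>f\<in>mor C X Y. \<phi> Y \<cdot>\<^bsub>D\<^esub> ar F X Y f = ar F' X Y f \<cdot>\<^bsub>D\<^esub> \<phi> X) \<longleftrightarrow>
    (\<forall>f. is_arr C f \<longrightarrow> Arr (ob F (trg f)) (\<phi> (trg f)) (ob F' (trg f)) **\<^bsub>D\<^esub> fmap F f =
      fmap F' f **\<^bsub>D\<^esub> Arr (ob F (src f)) (\<phi> (src f)) (ob F' (src f)))" (is "?l = ?r")
  proof
    assume ?l then show ?r by (simp del: is_arr_Obj add: is_arr_def cmp_def fmap_def)
  next
    assume r: ?r
    show ?l
    proof (intro ballI)
      fix X Y f assume "X \<in> Obj C" "Y \<in> Obj C" "f \<in> mor C X Y"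
      then show "\<phi> Y \<cdot>\<^bsub>D\<^esub> ar F X Y f = ar F' X Y f \<cdot>\<^bsub>D\<^esub> \<phi> X"
        using r[rule_format, of "Arr X f Y"] by (simp add: is_arr_Arr cmp_def fmap_def)
    qed
  qed
  then show ?thesis using ob by (simp add: natural_iso_def isos_iff)
qed

lemma linear_functor_id: "linear_functor K C C id_functor"
  by (auto simp: linear_functor_def id_functor_def)

lemma linear_functor_comp:
  assumes "linear_functor K C D F" "linear_functor K D E H"
  shows "linear_functor K C E (H \<circ>\<^sub>F F)"
  using assms unfolding linear_functor_def comp_functor_def by simp

subsection \<open>Equivalences are the fully faithful, essentially surjective functors\<close>

definition faithful_functor :: "('o, 'm, 'k) category \<Rightarrow> ('o, 'm, 'p, 'n) functr \<Rightarrow> bool"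
  where "faithful_functor C F \<longleftrightarrow> (\<forall>f g. is_arr C f \<longrightarrow> is_arr C g \<longrightarrow> src f = src g \<longrightarrow> trg f = trg g \<longrightarrow>
    fmap F f = fmap F g \<longrightarrow> f = g)"

definition full_functor ::
    "('o, 'm, 'k) category \<Rightarrow> ('p, 'n, 'k) category \<Rightarrow> ('o, 'm, 'p, 'n) functr \<Rightarrow> bool"
  where "full_functor C D F \<longleftrightarrow> (\<forall>X\<in>Obj C. \<forall>Y\<in>Obj C. \<forall>g\<in>arrows D (ob F X) (ob F Y).
    \<exists>f\<in>arrows C X Y. fmap F f = g)"

lemma faithfulD:
  "faithful_functor C F \<Longrightarrow> fmap F f = fmap F g \<Longrightarrow> is_arr C f \<Longrightarrow> is_arr C g \<Longrightarrow>
    src f = src g \<Longrightarrow> trg f = trg g \<Longrightarrow> f = g"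
  by (simp add: faithful_functor_def)

lemma fullE:
  assumes "full_functor C D F" "X \<in> Obj C" "Y \<in> Obj C" "is_arr D g" "src g = ob F X" "trg g = ob F Y"
  obtains f where "is_arr C f" "src f = X" "trg f = Y" "fmap F f = g"
  using assms by (force simp: full_functor_def)

context linear_category
begin

text \<open>With a quasi-inverse \<open>H\<close> and \<open>\<eta> : H F \<cong> id\<close>, naturality expresses \<open>f\<close> as a conjugate of
  \<open>H (F f)\<close>, so \<open>F\<close> is faithful, and likewise \<open>H\<close>. The conjugate of \<open>H g\<close> by \<open>\<eta>\<close> is a preimage of
  \<open>g\<close>, because \<open>H\<close> is faithful.\<close>

lemma autoequivalence_faithful_full:
  assumes "autoequivalence K C F"
  shows "faithful_functor C F" "full_functor C C F" "\<And>Y. Y \<in> Obj C \<Longrightarrow> \<exists>X\<in>Obj C. (ob F X, Y) \<in> iso_rel C"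
proof -
  obtain H \<eta> \<theta> where F: "linear_functor K C C F" and H: "linear_functor K C C H"
    and \<eta>: "natural_iso C C (H \<circ>\<^sub>F F) id_functor \<eta>" and \<theta>: "natural_iso C C (F \<circ>\<^sub>F H) id_functor \<theta>"
    using assms by (auto simp: autoequivalence_def)
  interpret F: lin_functor K C C F using F by unfold_locales
  interpret H: lin_functor K C C H using H by unfold_locales
  have reflects: "faithful_functor C E"
    if E: "linear_functor K C C E" and E': "linear_functor K C C E'" and
      nat: "natural_iso C C (E' \<circ>\<^sub>F E) id_functor \<phi>" for E E' \<phi>
    unfolding faithful_functor_def
  proof (intro allI impI)
    interpret E: lin_functor K C C E using E by unfold_locales
    interpret E': lin_functor K C C E' using E' by unfold_locales
    let ?n = "\<lambda>X. Arr (ob E' (ob E X)) (\<phi> X) X"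
    have iso: "iso_arr C (?n X)" if "X \<in> Obj C" for X
      using nat that by (simp add: natural_iso_iff[OF linear_functor_comp[OF E E'] linear_functor_id])
    have n: "?n (trg f) ** fmap E' (fmap E f) = f ** ?n (src f)" if "is_arr C f" for f
      using nat that by (simp add: natural_iso_iff[OF linear_functor_comp[OF E E'] linear_functor_id])
    fix f g assume f: "is_arr C f" "is_arr C g" "src f = src g" "trg f = trg g" "fmap E f = fmap E g"
    then have "f ** ?n (src f) = g ** ?n (src f)" using n[of f] n[of g] by simp
    then show "f = g" using iso[of "src f"] f by - (rule iso_cancel_right[of "?n (src f)"], auto+)
  qed
  show "faithful_functor C F" using reflects F H \<eta> by blast
  have Hf: "faithful_functor C H" using reflects F H \<theta> by blast
  let ?n = "\<lambda>X. Arr (ob H (ob F X)) (\<eta> X) X"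
  have iso: "iso_arr C (?n X)" if "X \<in> Obj C" for X
    using \<eta> that by (simp add: natural_iso_iff[OF linear_functor_comp[OF F H] linear_functor_id])
  have n: "?n (trg f) ** fmap H (fmap F f) = f ** ?n (src f)" if "is_arr C f" for f
    using \<eta> that by (simp add: natural_iso_iff[OF linear_functor_comp[OF F H] linear_functor_id])
  show "full_functor C C F"
    unfolding full_functor_def
  proof (intro ballI)
    fix X Y g assume X: "X \<in> Obj C" and Y: "Y \<in> Obj C" and g: "g \<in> arrows C (ob F X) (ob F Y)"
    note iX = iso[OF X] and iY = iso[OF Y]
    note aX = iso_arr_arr[OF iX] and aY = iso_arr_arr[OF iY]
    define f where "f = ?n Y ** (fmap H g ** ainv C (?n X))"
    have f: "is_arr C f" "src f = X" "trg f = Y" using g aX aY iX unfolding f_def by simp_all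
    have "?n Y ** fmap H (fmap F f) = f ** ?n X" using n[of f] f by simp
    also have "\<dots> = ?n Y ** fmap H g" using g aX aY iX unfolding f_def by simp
    finally have "fmap H (fmap F f) = fmap H g" using iY aY f g by (elim iso_cancel_left[rotated -1]) auto
    then have "fmap F f = g" using f g by - (rule faithfulD[OF Hf], auto+)
    then show "\<exists>f\<in>arrows C X Y. fmap F f = g" using f by auto
  qed
  show "\<exists>X\<in>Obj C. (ob F X, Y) \<in> iso_rel C" if "Y \<in> Obj C" for Y
    using \<theta> that H.ob_Obj[OF that]
    by (intro bexI[of _ "ob H Y"] iso_relI[of C "Arr (ob F (ob H Y)) (\<theta> Y) Y"])
      (simp_all add: natural_iso_iff[OF linear_functor_comp[OF H F] linear_functor_id])
qed

text \<open>The quasi-inverse sends \<open>Y\<close> to a chosen \<open>P Y\<close> with \<open>u : F (P Y) \<cong> Y\<close>, and an arrow to the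
  preimage of its conjugate by \<open>u\<close>. One of the two natural isomorphisms is \<open>u\<close> itself, the other
  consists of the preimages of \<open>u\<close> at the objects \<open>F X\<close>.\<close>

lemma autoequivalenceI:
  assumes F: "linear_functor K C C F" and faithful: "faithful_functor C F" and full: "full_functor C C F"
    and es: "\<And>Y. Y \<in> Obj C \<Longrightarrow> \<exists>X\<in>Obj C. (ob F X, Y) \<in> iso_rel C"
  shows "autoequivalence K C F"
proof -
  interpret F: lin_functor K C C F using F by unfold_locales
  obtain P where P: "\<And>Y. Y \<in> Obj C \<Longrightarrow> P Y \<in> Obj C \<and> (ob F (P Y), Y) \<in> iso_rel C" using es by metis
  then obtain u where u: "\<And>Y. Y \<in> Obj C \<Longrightarrow> u Y \<in> arrows C (ob F (P Y)) Y \<and> iso_arr C (u Y)"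
    unfolding iso_rel_iff by metis
  define h where "h f = ainv C (u (trg f)) ** (f ** u (src f))" for f
  have h: "is_arr C (h f)" "src (h f) = ob F (P (src f))" "trg (h f) = ob F (P (trg f))" if "is_arr C f" for f
    using u[of "src f"] u[of "trg f"] that by (auto simp: h_def)
  have "\<exists>g. g \<in> arrows C (P (src f)) (P (trg f)) \<and> fmap F g = h f" if "is_arr C f" for f
    using fullE[OF full, of "P (src f)" "P (trg f)" "h f"] h[OF that] P that by (metis arrows_iff is_arr_Obj)
  then obtain \<phi> where \<phi>: "\<And>f. is_arr C f \<Longrightarrow> \<phi> f \<in> arrows C (P (src f)) (P (trg f)) \<and> fmap F (\<phi> f) = h f"
    by metis
  have \<phi>_eqI: "\<phi> f = g" if "is_arr C f" "g \<in> arrows C (P (src f)) (P (trg f))" "fmap F g = h f" for f g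
    using that \<phi>[of f] by - (rule faithfulD[OF faithful], auto+)
  let ?H = "mk_functor P \<phi>"
  have mk: "linear_functor K C C ?H \<and> (\<forall>f. is_arr C f \<longrightarrow> fmap ?H f = \<phi> f)"
  proof (rule linear_functor_mk_functor, goal_cases)
    case (1 X) then show ?case using P by blast
  next
    case (2 f) then show ?case using \<phi> by blast
  next
    case (3 X) then show ?case using P[of X] u[of X] by - (rule \<phi>_eqI, (auto simp: h_def)+)
  next
    case (4 f g)
    then show ?case using \<phi>[of f] \<phi>[of g] u[of "src f"] u[of "trg f"] u[of "trg g"]
      by - (rule \<phi>_eqI, (auto simp: h_def F.fmap_cmp ainv_cancel)+)
  next
    case (5 f g)
    then show ?case using \<phi>[of f] \<phi>[of g] u[of "src f"] u[of "trg f"]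
      by - (rule \<phi>_eqI, (auto simp: h_def F.fmap_pl pl_cmp cmp_pl)+)
  next
    case (6 a f)
    then show ?case using \<phi>[of f] u[of "src f"] u[of "trg f"]
      by - (rule \<phi>_eqI, (auto simp: h_def F.fmap_scl)+)
  qed
  then have H: "linear_functor K C C ?H" "\<And>f. is_arr C f \<Longrightarrow> fmap ?H f = \<phi> f" by blast+
  interpret H: lin_functor K C C ?H using H(1) by unfold_locales
  have uu: "Arr (ob (F \<circ>\<^sub>F ?H) Y) (mph (u Y)) (ob id_functor Y) = u Y" if "Y \<in> Obj C" for Y
    using u[OF that] by (intro arr_eqI) auto
  have \<theta>: "natural_iso C C (F \<circ>\<^sub>F ?H) id_functor (\<lambda>Y. mph (u Y))"
  proof (subst natural_iso_iff[OF linear_functor_comp[OF H(1) F] linear_functor_id], intro conjI ballI allI impI)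
    fix Y assume "Y \<in> Obj C" then show "iso_arr C (Arr (ob (F \<circ>\<^sub>F ?H) Y) (mph (u Y)) (ob id_functor Y))"
      using u[of Y] uu by simp
  next
    fix f assume f: "is_arr C f"
    then show "Arr (ob (F \<circ>\<^sub>F ?H) (trg f)) (mph (u (trg f))) (ob id_functor (trg f)) ** fmap (F \<circ>\<^sub>F ?H) f =
      fmap id_functor f ** Arr (ob (F \<circ>\<^sub>F ?H) (src f)) (mph (u (src f))) (ob id_functor (src f))"
      using uu[of "trg f"] uu[of "src f"] H(2)[OF f] \<phi>[OF f] u[of "src f"] u[of "trg f"]
      by (auto simp: h_def ainv_cancel)
  qed
  have "\<exists>v. v \<in> arrows C (P (ob F X)) X \<and> fmap F v = u (ob F X)" if "X \<in> Obj C" for X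
    using fullE[OF full, of "P (ob F X)" X "u (ob F X)"] P[of "ob F X"] u[of "ob F X"] that
    by (metis F.ob_Obj arrows_iff)
  then obtain v where v: "\<And>X. X \<in> Obj C \<Longrightarrow> v X \<in> arrows C (P (ob F X)) X \<and> fmap F (v X) = u (ob F X)"
    by metis
  have iso_v: "iso_arr C (v X)" if X: "X \<in> Obj C" for X
  proof -
    obtain w where w: "is_arr C w" "src w = X" "trg w = P (ob F X)" "fmap F w = ainv C (u (ob F X))"
      using fullE[OF full, of X "P (ob F X)" "ainv C (u (ob F X))"] X P[of "ob F X"] u[of "ob F X"]
      by (auto simp del: F.fmap_cmp)
    have "w ** v X = idn C (P (ob F X))" using w v[OF X] u[of "ob F X"] X P[of "ob F X"]
      by - (rule faithfulD[OF faithful], (auto simp: F.fmap_cmp)+)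
    moreover have "v X ** w = idn C X" using w v[OF X] u[of "ob F X"] X P[of "ob F X"]
      by - (rule faithfulD[OF faithful], (auto simp: F.fmap_cmp)+)
    ultimately show ?thesis using w v[OF X] by (auto simp: iso_arr_def inverses_def intro!: exI[of _ w])
  qed
  have vv: "Arr (ob (?H \<circ>\<^sub>F F) Y) (mph (v Y)) (ob id_functor Y) = v Y" if "Y \<in> Obj C" for Y
    using v[OF that] by (intro arr_eqI) auto
  have \<eta>: "natural_iso C C (?H \<circ>\<^sub>F F) id_functor (\<lambda>X. mph (v X))"
  proof (subst natural_iso_iff[OF linear_functor_comp[OF F H(1)] linear_functor_id], intro conjI ballI allI impI)
    fix Y assume "Y \<in> Obj C" then show "iso_arr C (Arr (ob (?H \<circ>\<^sub>F F) Y) (mph (v Y)) (ob id_functor Y))"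
      using iso_v[of Y] vv by simp
  next
    fix f assume f: "is_arr C f"
    then have "v (trg f) ** \<phi> (fmap F f) = f ** v (src f)"
      using \<phi>[of "fmap F f"] u[of "ob F (src f)"] u[of "ob F (trg f)"] v[of "src f"] v[of "trg f"]
      by - (rule faithfulD[OF faithful], (auto simp: F.fmap_cmp h_def ainv_cancel)+)
    then show "Arr (ob (?H \<circ>\<^sub>F F) (trg f)) (mph (v (trg f))) (ob id_functor (trg f)) ** fmap (?H \<circ>\<^sub>F F) f =
      fmap id_functor f ** Arr (ob (?H \<circ>\<^sub>F F) (src f)) (mph (v (src f))) (ob id_functor (src f))"
      using vv[of "trg f"] vv[of "src f"] f H(2)[of "fmap F f"] by simp
  qed
  show ?thesis unfolding autoequivalence_def using F H(1) \<eta> \<theta> by blast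
qed

end

section \<open>Direct sums and generation\<close>

definition biprod ::
    "('o, 'm, 'k) category \<Rightarrow> 'i set \<Rightarrow> ('i \<Rightarrow> 'o) \<Rightarrow> 'o \<Rightarrow> ('i \<Rightarrow> ('o, 'm) arr) \<Rightarrow> ('i \<Rightarrow> ('o, 'm) arr) \<Rightarrow> bool"
  where "biprod C I Xs S j p \<longleftrightarrow> finite I \<and> S \<in> Obj C \<and>
    (\<forall>i\<in>I. j i \<in> arrows C (Xs i) S \<and> p i \<in> arrows C S (Xs i)) \<and>
    (\<forall>i\<in>I. \<forall>k\<in>I. p k **\<^bsub>C\<^esub> j i = (if i = k then idn C (Xs i) else zr C (Xs i) (Xs k))) \<and>
    sm C S S I (\<lambda>i. j i **\<^bsub>C\<^esub> p i) = idn C S"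

lemma is_biproduct_iff_biprod:
  "is_biproduct C I Xs S inc prj \<longleftrightarrow> biprod C I Xs S (\<lambda>i. Arr (Xs i) (inc i) S) (\<lambda>i. Arr S (prj i) (Xs i))"
  by (auto simp: is_biproduct_def biprod_def is_arr_Arr cmp_def idn_def zr_def sm_def)

lemma biprodD:
  assumes "biprod C I Xs S j p"
  shows "finite I" "S \<in> Obj C"
    and "\<And>i. i \<in> I \<Longrightarrow> is_arr C (j i)" "\<And>i. i \<in> I \<Longrightarrow> src (j i) = Xs i" "\<And>i. i \<in> I \<Longrightarrow> trg (j i) = S"
    and "\<And>i. i \<in> I \<Longrightarrow> is_arr C (p i)" "\<And>i. i \<in> I \<Longrightarrow> src (p i) = S" "\<And>i. i \<in> I \<Longrightarrow> trg (p i) = Xs i"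
    and "\<And>i. i \<in> I \<Longrightarrow> Xs i \<in> Obj C"
    and "\<And>i. i \<in> I \<Longrightarrow> p i **\<^bsub>C\<^esub> j i = idn C (Xs i)"
    and "\<And>i k. i \<in> I \<Longrightarrow> k \<in> I \<Longrightarrow> i \<noteq> k \<Longrightarrow> p k **\<^bsub>C\<^esub> j i = zr C (Xs i) (Xs k)"
    and "sm C S S I (\<lambda>i. j i **\<^bsub>C\<^esub> p i) = idn C S"
  using assms by (auto simp: biprod_def) (metis is_arr_Obj(1))

lemma is_direct_sum_iff: "is_direct_sum C I Xs S \<longleftrightarrow> (\<exists>j p. biprod C I Xs S j p)"
proof
  assume "is_direct_sum C I Xs S" then show "\<exists>j p. biprod C I Xs S j p"
    by (auto simp: is_direct_sum_def is_biproduct_iff_biprod)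
next
  assume "\<exists>j p. biprod C I Xs S j p"
  then obtain j p where jp: "biprod C I Xs S j p" by blast
  have "Arr (Xs i) (mph (j i)) S = j i" "Arr S (mph (p i)) (Xs i) = p i" if "i \<in> I" for i
    using biprodD(3-8)[OF jp that] by (auto intro: arr_eqI)
  then have "biprod C I Xs S (\<lambda>i. Arr (Xs i) (mph (j i)) S) (\<lambda>i. Arr S (mph (p i)) (Xs i))"
    using jp unfolding biprod_def by (simp add: sm_def cong: if_cong) (simp add: cmp_def)
  then show "is_direct_sum C I Xs S"
    unfolding is_direct_sum_def is_biproduct_iff_biprod
    by (intro exI[of _ "\<lambda>i. mph (j i)"] exI[of _ "\<lambda>i. mph (p i)"])
qed

lemma biprod_mono_Xs: "biprod C I Xs S j p \<Longrightarrow> (\<And>i. i \<in> I \<Longrightarrow> Xs i = Ys i) \<Longrightarrow> biprod C I Ys S j p"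
  by (auto simp: biprod_def)

context linear_category
begin

lemma biprod_expand_left:
  assumes "biprod C I Xs S j p" "is_arr C f" "trg f = S"
  shows "f = sm C (src f) S I (\<lambda>i. j i ** (p i ** f))"
proof -
  note b = biprodD[OF assms(1)]
  have "f = sm C S S I (\<lambda>i. j i ** p i) ** f" using assms b(12) by simp
  also have "\<dots> = sm C (src f) S I (\<lambda>i. (j i ** p i) ** f)" using assms b by (intro sm_cmp) auto
  also have "\<dots> = sm C (src f) S I (\<lambda>i. j i ** (p i ** f))" using assms b by (intro sm_cong) auto
  finally show ?thesis .
qed

lemma biprod_expand_right:
  assumes "biprod C I Xs S j p" "is_arr C f" "src f = S"
  shows "f = sm C S (trg f) I (\<lambda>i. (f ** j i) ** p i)"
proof -
  note b = biprodD[OF assms(1)]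
  have "f = f ** sm C S S I (\<lambda>i. j i ** p i)" using assms b(12) by simp
  also have "\<dots> = sm C S (trg f) I (\<lambda>i. f ** (j i ** p i))" using assms b by (intro cmp_sm) auto
  also have "\<dots> = sm C S (trg f) I (\<lambda>i. (f ** j i) ** p i)" using assms b by (intro sm_cong) auto
  finally show ?thesis .
qed

lemma biprod_eqI_right:
  assumes "biprod C I Xs S j p" "f \<in> arrows C S Y" "g \<in> arrows C S Y" "\<And>i. i \<in> I \<Longrightarrow> f ** j i = g ** j i"
  shows "f = g"
proof -
  note b = biprodD[OF assms(1)]
  have "Y \<in> Obj C" using assms(2) by auto
  then have "sm C S Y I (\<lambda>i. (f ** j i) ** p i) = sm C S Y I (\<lambda>i. (g ** j i) ** p i)"
    using assms b by (intro sm_cong) auto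
  then show ?thesis using biprod_expand_right[OF assms(1), of f] biprod_expand_right[OF assms(1), of g] assms(2,3)
    by auto
qed

lemma biprod_eqI_left:
  assumes "biprod C I Xs S j p" "f \<in> arrows C Y S" "g \<in> arrows C Y S" "\<And>i. i \<in> I \<Longrightarrow> p i ** f = p i ** g"
  shows "f = g"
proof -
  note b = biprodD[OF assms(1)]
  have "Y \<in> Obj C" using assms(2) by auto
  then have "sm C Y S I (\<lambda>i. j i ** (p i ** f)) = sm C Y S I (\<lambda>i. j i ** (p i ** g))"
    using assms b by (intro sm_cong) auto
  then show ?thesis using biprod_expand_left[OF assms(1), of f] biprod_expand_left[OF assms(1), of g] assms(2,3)
    by auto
qed

lemma biprod_sm_inc:
  assumes "biprod C I Xs S j p" "k \<in> I" "Y \<in> Obj C" "\<And>i. i \<in> I \<Longrightarrow> t i \<in> arrows C (Xs i) Y"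
  shows "sm C S Y I (\<lambda>i. t i ** p i) ** j k = t k"
proof -
  note b = biprodD[OF assms(1)]
  have "sm C S Y I (\<lambda>i. t i ** p i) ** j k = sm C (Xs k) Y I (\<lambda>i. (t i ** p i) ** j k)"
    using assms b by (subst sm_cmp) auto
  also have "\<dots> = sm C (Xs k) Y I (\<lambda>i. if i = k then t k else zr C (Xs k) Y)"
    using assms b by (intro sm_cong) auto
  also have "\<dots> = t k"
    using sm_single[of I k "Xs k" Y "\<lambda>i. if i = k then t k else zr C (Xs k) Y"] assms b by auto
  finally show ?thesis .
qed

lemma biprod_prj_sm:
  assumes "biprod C I Xs S j p" "k \<in> I" "Y \<in> Obj C" "\<And>i. i \<in> I \<Longrightarrow> t i \<in> arrows C Y (Xs i)"
  shows "p k ** sm C Y S I (\<lambda>i. j i ** t i) = t k"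
proof -
  note b = biprodD[OF assms(1)]
  have "p k ** sm C Y S I (\<lambda>i. j i ** t i) = sm C Y (Xs k) I (\<lambda>i. p k ** (j i ** t i))"
    using assms b by (subst cmp_sm) auto
  also have "\<dots> = sm C Y (Xs k) I (\<lambda>i. if i = k then t k else zr C Y (Xs k))"
  proof (intro sm_cong)
    fix i assume i: "i \<in> I"
    have "p k ** (j i ** t i) = (if i = k then idn C (Xs i) else zr C (Xs i) (Xs k)) ** t i"
      using i assms(2-4) b by (intro cmp_assoc_subst) auto
    then show "p k ** (j i ** t i) = (if i = k then t k else zr C Y (Xs k))"
      using i assms(2-4) b by auto
  qed (use assms b in auto)
  also have "\<dots> = t k"
    using sm_single[of I k Y "Xs k" "\<lambda>i. if i = k then t k else zr C Y (Xs k)"] assms b by auto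
  finally show ?thesis .
qed

lemma biprod_reindex:
  assumes b: "biprod C I Xs S j p" and \<sigma>: "bij_betw \<sigma> J I"
  shows "biprod C J (\<lambda>k. Xs (\<sigma> k)) S (\<lambda>k. j (\<sigma> k)) (\<lambda>k. p (\<sigma> k))"
proof -
  note bb = biprodD[OF b]
  have \<sigma>I: "\<sigma> k \<in> I" if "k \<in> J" for k using \<sigma> that by (auto simp: bij_betw_def)
  have inj: "\<sigma> k = \<sigma> l \<longleftrightarrow> k = l" if "k \<in> J" "l \<in> J" for k l
    using \<sigma> that by (auto simp: bij_betw_def inj_on_def)
  have "sm C S S I (\<lambda>i. j i ** p i) = sm C S S J (\<lambda>k. j (\<sigma> k) ** p (\<sigma> k))"
    using bb by (intro sm_reindex[OF \<sigma>]) auto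
  moreover have "finite J" using bb(1) \<sigma> bij_betw_finite by blast
  ultimately show ?thesis unfolding biprod_def using bb \<sigma>I inj by auto
qed

text \<open>The inverse is assembled from the inverses on the summands. Both the equivariant structure of a
  direct sum and the isomorphisms of graded objects are obtained in this way.\<close>

lemma biprod_iso_arr:
  assumes "biprod C I Xs S j p" "biprod C J Ys T j' p'" "bij_betw \<sigma> I J"
    and u: "\<And>i. i \<in> I \<Longrightarrow> u i \<in> arrows C (Xs i) (Ys (\<sigma> i))" "\<And>i. i \<in> I \<Longrightarrow> iso_arr C (u i)"
    and f: "f \<in> arrows C S T" and fj: "\<And>k. k \<in> I \<Longrightarrow> f ** j k = j' (\<sigma> k) ** u k"
  shows "iso_arr C f"
proof -
  note b = biprodD[OF assms(1)]
  define g where "g = sm C T S I (\<lambda>i. (j i ** ainv C (u i)) ** p' (\<sigma> i))"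
  have bJ: "biprod C I (\<lambda>i. Ys (\<sigma> i)) T (\<lambda>i. j' (\<sigma> i)) (\<lambda>i. p' (\<sigma> i))"
    by (rule biprod_reindex[OF assms(2,3)])
  note bb = biprodD[OF bJ]
  have g: "g \<in> arrows C T S" using b bb u unfolding g_def by auto
  have gj: "g ** j' (\<sigma> k) = j k ** ainv C (u k)" if "k \<in> I" for k
    unfolding g_def using that u bb b biprod_sm_inc[OF bJ, of k S "\<lambda>i. j i ** ainv C (u i)"] by auto
  have "g ** f = idn C S"
  proof (rule biprod_eqI_right[OF assms(1)])
    fix k assume k: "k \<in> I"
    have "(g ** f) ** j k = (g ** j' (\<sigma> k)) ** u k" using k f g fj[OF k] b bb u(1)[OF k] by auto
    then show "(g ** f) ** j k = idn C S ** j k" using k gj[OF k] b u(1)[OF k] u(2)[OF k] by auto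
  qed (use f g b in auto)
  moreover have "f ** g = idn C T"
  proof (rule biprod_eqI_right[OF bJ])
    fix k assume k: "k \<in> I"
    have "(f ** g) ** j' (\<sigma> k) = (f ** j k) ** ainv C (u k)"
      using k f g gj[OF k] b bb u(1)[OF k] u(2)[OF k] by auto
    then show "(f ** g) ** j' (\<sigma> k) = idn C T ** j' (\<sigma> k)" using k fj[OF k] bb u(1)[OF k] u(2)[OF k] by auto
  qed (use f g bb in auto)
  ultimately have "inverses C f g" using f g by (auto simp: inverses_def)
  then show ?thesis by (auto simp: iso_arr_def)
qed

lemma biprod_iso:
  assumes "biprod C I Xs S j p" "biprod C J Ys T j' p'" "bij_betw \<sigma> I J"
    and "\<And>i. i \<in> I \<Longrightarrow> (Xs i, Ys (\<sigma> i)) \<in> iso_rel C"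
  shows "(S, T) \<in> iso_rel C"
proof -
  note b = biprodD[OF assms(1)] and b' = biprodD[OF assms(2)]
  have \<sigma>: "\<sigma> i \<in> J" if "i \<in> I" for i using assms(3) that by (auto simp: bij_betw_def)
  obtain u where u: "\<And>i. i \<in> I \<Longrightarrow> u i \<in> arrows C (Xs i) (Ys (\<sigma> i)) \<and> iso_arr C (u i)"
    using assms(4) unfolding iso_rel_iff by metis
  define f where "f = sm C S T I (\<lambda>i. (j' (\<sigma> i) ** u i) ** p i)"
  have f: "f \<in> arrows C S T" using b b' u \<sigma> unfolding f_def by auto
  have fj: "f ** j k = j' (\<sigma> k) ** u k" if "k \<in> I" for k
    unfolding f_def using that u b' b \<sigma> by (subst biprod_sm_inc[OF assms(1)]) auto
  have "iso_arr C f" using u by (intro biprod_iso_arr[OF assms(1-3) _ _ f fj]) auto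
  then show ?thesis using f by (intro iso_relI[of C f]) auto
qed

subsection \<open>Arrows through an object\<close>

text \<open>The ideal of arrows that are sums of composites through \<open>M\<close>. An object lies in the additive
  closure of \<open>M\<close> iff this ideal contains its identity, and in this form the additive closure is
  visibly transitive and preserved by linear functors.\<close>

inductive_set thru :: "'o \<Rightarrow> 'o \<Rightarrow> 'o \<Rightarrow> ('o, 'm) arr set" for M X Y where
  thru_zr: "zr C X Y \<in> thru M X Y"
| thru_pl: "t \<in> thru M X Y \<Longrightarrow> a \<in> arrows C X M \<Longrightarrow> b \<in> arrows C M Y \<Longrightarrow> pl C t (b ** a) \<in> thru M X Y"

definition generated :: "'o \<Rightarrow> 'o \<Rightarrow> bool" (infix \<open>\<preceq>\<close> 50)
  where "X \<preceq> M \<longleftrightarrow> X \<in> Obj C \<and> M \<in> Obj C \<and> idn C X \<in> thru M X X"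

lemma thru_arrows: "t \<in> thru M X Y \<Longrightarrow> X \<in> Obj C \<Longrightarrow> Y \<in> Obj C \<Longrightarrow> t \<in> arrows C X Y"
  by (induction rule: thru.induct) auto

lemma thru_cmp: "a \<in> arrows C X M \<Longrightarrow> b \<in> arrows C M Y \<Longrightarrow> b ** a \<in> thru M X Y"
  using thru_pl[OF thru_zr, of a X M b Y] by auto

lemma thru_add:
  assumes "u \<in> thru M X Y" "t \<in> thru M X Y" "X \<in> Obj C" "Y \<in> Obj C"
  shows "pl C t u \<in> thru M X Y"
  using assms(1)
proof (induction rule: thru.induct)
  case thru_zr
  then show ?case using thru_arrows[OF assms(2-4)] assms(2) by auto
next
  case (thru_pl u a b)
  have "pl C t (pl C u (b ** a)) = pl C (pl C t u) (b ** a)"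
    using thru_arrows[OF assms(2-4)] thru_arrows[OF thru_pl(1) assms(3,4)] thru_pl(2,3)
    by (subst pl_assoc) auto
  then show ?case using thru.thru_pl[OF thru_pl(4,2,3)] by simp
qed

lemma thru_sm:
  assumes "finite I" "X \<in> Obj C" "Y \<in> Obj C" "\<And>i. i \<in> I \<Longrightarrow> t i \<in> thru M X Y"
  shows "sm C X Y I t \<in> thru M X Y"
  using assms(1,4)
proof (induction I rule: finite_induct)
  case empty
  then show ?case using assms thru_zr by simp
next
  case (insert j J)
  then show ?case
    using assms(2,3) thru_arrows[of "t _" M X Y]
    by (subst sm_insert) (auto intro!: thru_add)
qed

lemma thru_cmp_closed:
  assumes "t \<in> thru M X Y" "c \<in> arrows C W X" "d \<in> arrows C Y Z"
  shows "d ** (t ** c) \<in> thru M W Z"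
  using assms(1)
proof (induction rule: thru.induct)
  case thru_zr
  have "X \<in> Obj C" "Y \<in> Obj C" "Z \<in> Obj C" using assms by auto
  then show ?case using assms(2,3) thru.thru_zr by auto
next
  case (thru_pl t a b)
  have "t \<in> arrows C X Y" using thru_arrows[OF thru_pl(1)] assms(2,3) by auto
  then have "d ** (pl C t (b ** a) ** c) = pl C (d ** (t ** c)) ((d ** b) ** (a ** c))"
    using thru_pl(2,3) assms(2,3) by (auto simp: pl_cmp cmp_pl)
  then show ?case
    using thru.thru_pl[OF thru_pl(4), of "a ** c" "d ** b"] thru_pl(2,3) assms(2,3) by auto
qed

lemma thru_trans:
  assumes "t \<in> thru M X Y" "M \<preceq> N" "X \<in> Obj C" "Y \<in> Obj C"
  shows "t \<in> thru N X Y"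
  using assms(1)
proof (induction rule: thru.induct)
  case thru_zr
  then show ?case by (rule thru.thru_zr)
next
  case (thru_pl t a b)
  have "b ** (idn C M ** a) \<in> thru N X Y"
    using assms(2) thru_pl(2,3) by (intro thru_cmp_closed[of "idn C M"]) (auto simp: generated_def)
  then show ?case using thru_pl assms by (intro thru_add) auto
qed

lemma generated_Obj: "X \<preceq> M \<Longrightarrow> X \<in> Obj C" "X \<preceq> M \<Longrightarrow> M \<in> Obj C"
  by (auto simp: generated_def)

lemma generated_refl: "X \<in> Obj C \<Longrightarrow> X \<preceq> X"
  using thru_cmp[of "idn C X" X X "idn C X" X] by (simp add: generated_def)

lemma generated_trans: "X \<preceq> M \<Longrightarrow> M \<preceq> N \<Longrightarrow> X \<preceq> N"
  using thru_trans by (auto simp: generated_def)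

lemma generated_retract:
  "a \<in> arrows C X M \<Longrightarrow> b \<in> arrows C M X \<Longrightarrow> b ** a = idn C X \<Longrightarrow> X \<preceq> M"
  using thru_cmp[of a X M b X] by (auto simp: generated_def)

lemma iso_generated: "(X, Y) \<in> iso_rel C \<Longrightarrow> X \<preceq> Y"
  unfolding iso_rel_iff
proof (elim conjE bexE)
  fix f assume "f \<in> arrows C X Y" "iso_arr C f"
  then show "X \<preceq> Y" by (intro generated_retract[of f _ _ "ainv C f"]) auto
qed

lemma generated_sm:
  assumes "finite I" "X \<in> Obj C" "M \<in> Obj C" "\<And>i. i \<in> I \<Longrightarrow> t i \<in> thru M X X"
    "sm C X X I t = idn C X"
  shows "X \<preceq> M"
  unfolding generated_def using thru_sm[of I X X t M] assms by simp

lemma biprod_generated: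
  assumes "biprod C I Xs S j p" "M \<in> Obj C" "\<And>i. i \<in> I \<Longrightarrow> Xs i \<preceq> M"
  shows "S \<preceq> M"
proof (rule generated_sm)
  note b = biprodD[OF assms(1)]
  show "sm C S S I (\<lambda>i. j i ** p i) = idn C S" "finite I" "S \<in> Obj C" using b by auto
  show "j i ** p i \<in> thru M S S" if "i \<in> I" for i
    using thru_cmp_closed[of "idn C (Xs i)" M "Xs i" "Xs i" "p i" S "j i" S] assms(3)[OF that] b that
    by (auto simp: generated_def)
qed (rule assms)

lemma generated_biprod:
  assumes "biprod C I Xs S j p" "i \<in> I"
  shows "Xs i \<preceq> S"
  using biprodD[OF assms(1)] assms(2) by (intro generated_retract[of "j i" _ _ "p i"]) auto

lemma scl_add:
  "is_arr C f \<Longrightarrow> a \<in> carrier K \<Longrightarrow> b \<in> carrier K \<Longrightarrow> scl C (a \<oplus>\<^bsub>K\<^esub> b) f = pl C (scl C a f) (scl C b f)"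
  using module.smult_l_distr[OF Hom_module, of "src f" "trg f" a b "mph f"]
  by (auto simp del: is_arr_Obj simp: is_arr_def scl_def pl_def)

lemma biprod2I:
  assumes "j1 \<in> arrows C X S" "p1 \<in> arrows C S X" "j2 \<in> arrows C Y S" "p2 \<in> arrows C S Y"
    "p1 ** j1 = idn C X" "p2 ** j2 = idn C Y" "p1 ** j2 = zr C Y X" "p2 ** j1 = zr C X Y"
    "pl C (j1 ** p1) (j2 ** p2) = idn C S"
  shows "is_direct_sum2 C X Y S"
proof -
  let ?j = "\<lambda>b. if b then j1 else j2" and ?p = "\<lambda>b. if b then p1 else p2"
  have S: "S \<in> Obj C" using assms by auto
  have "sm C S S (UNIV :: bool set) (\<lambda>b. ?j b ** ?p b) = pl C (j1 ** p1) (j2 ** p2)"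
    using assms S sm_insert[of "{False}" True S S "\<lambda>b. ?j b ** ?p b"] sm_insert[of "{}" False S S "\<lambda>b. ?j b ** ?p b"]
    by (simp add: UNIV_bool insert_commute)
  then have "biprod C (UNIV :: bool set) (\<lambda>b. if b then X else Y) S ?j ?p"
    unfolding biprod_def using assms S by auto
  then show ?thesis unfolding is_direct_sum2_def is_direct_sum_iff by blast
qed

lemma direct_sum2D:
  assumes "is_direct_sum2 C X Y S"
  obtains j1 p1 j2 p2 where "j1 \<in> arrows C X S" "p1 \<in> arrows C S X" "j2 \<in> arrows C Y S" "p2 \<in> arrows C S Y"
    "p1 ** j1 = idn C X" "p2 ** j2 = idn C Y" "p1 ** j2 = zr C Y X" "p2 ** j1 = zr C X Y"
    "pl C (j1 ** p1) (j2 ** p2) = idn C S"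
proof -
  obtain j p where jp: "biprod C (UNIV :: bool set) (\<lambda>b. if b then X else Y) S j p"
    using assms by (auto simp: is_direct_sum2_def is_direct_sum_iff)
  note b = biprodD[OF jp]
  have "sm C S S (UNIV :: bool set) (\<lambda>b. j b ** p b) = pl C (j True ** p True) (j False ** p False)"
    using b sm_insert[of "{False}" True S S "\<lambda>b. j b ** p b"] sm_insert[of "{}" False S S "\<lambda>b. j b ** p b"]
    by (simp add: UNIV_bool insert_commute)
  then show ?thesis using b(3-10)[of True] b(3-10)[of False] b(11)[of True False] b(11)[of False True] b(12)
    by (intro that[of "j True" "p True" "j False" "p False"]) auto
qed

text \<open>The complementary idempotent \<open>1 - e\<close>.\<close>

definition compl :: "('o, 'm) arr \<Rightarrow> ('o, 'm) arr"
  where "compl e = pl C (idn C (src e)) (scl C (\<ominus>\<^bsub>K\<^esub> \<one>\<^bsub>K\<^esub>) e)"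

lemma K_facts:
  assumes "X \<in> Obj C"
  shows "\<one>\<^bsub>K\<^esub> \<in> carrier K" "\<ominus>\<^bsub>K\<^esub> \<one>\<^bsub>K\<^esub> \<in> carrier K" "\<one>\<^bsub>K\<^esub> \<oplus>\<^bsub>K\<^esub> \<ominus>\<^bsub>K\<^esub> \<one>\<^bsub>K\<^esub> = \<zero>\<^bsub>K\<^esub>"
    "\<ominus>\<^bsub>K\<^esub> \<one>\<^bsub>K\<^esub> \<oplus>\<^bsub>K\<^esub> \<one>\<^bsub>K\<^esub> = \<zero>\<^bsub>K\<^esub>"
proof -
  interpret K: field K by (rule field_K[OF assms])
  show "\<one>\<^bsub>K\<^esub> \<in> carrier K" "\<ominus>\<^bsub>K\<^esub> \<one>\<^bsub>K\<^esub> \<in> carrier K" "\<one>\<^bsub>K\<^esub> \<oplus>\<^bsub>K\<^esub> \<ominus>\<^bsub>K\<^esub> \<one>\<^bsub>K\<^esub> = \<zero>\<^bsub>K\<^esub>"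
    "\<ominus>\<^bsub>K\<^esub> \<one>\<^bsub>K\<^esub> \<oplus>\<^bsub>K\<^esub> \<one>\<^bsub>K\<^esub> = \<zero>\<^bsub>K\<^esub>"
    by (simp_all add: K.r_neg K.l_neg)
qed

lemma pl_neg:
  assumes "is_arr C f"
  shows "pl C f (scl C (\<ominus>\<^bsub>K\<^esub> \<one>\<^bsub>K\<^esub>) f) = zr C (src f) (trg f)"
    "pl C (scl C (\<ominus>\<^bsub>K\<^esub> \<one>\<^bsub>K\<^esub>) f) f = zr C (src f) (trg f)"
  using scl_add[OF assms K_facts(1,2)[of "src f"]] scl_add[OF assms K_facts(2,1)[of "src f"]]
    K_facts(3,4)[of "src f"] assms
  by (auto simp del: is_arr_Obj simp: is_arr_Obj[OF assms])

lemma compl_idempotent: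
  assumes "e \<in> arrows C X X" "e ** e = e"
  shows "compl e \<in> arrows C X X" "e ** compl e = zr C X X" "compl e ** e = zr C X X" "compl e ** compl e = compl e"
    "pl C e (compl e) = idn C X"
proof -
  have X: "X \<in> Obj C" using assms by auto
  note k = K_facts[OF X]
  show c: "compl e \<in> arrows C X X" using assms X k by (auto simp: compl_def)
  show 1: "e ** compl e = zr C X X" using assms X k pl_neg[of e] by (auto simp: compl_def cmp_pl)
  show 2: "compl e ** e = zr C X X" using assms X k pl_neg[of e] by (auto simp: compl_def pl_cmp)
  have "compl e ** compl e = pl C (compl e) (scl C (\<ominus>\<^bsub>K\<^esub> \<one>\<^bsub>K\<^esub>) (e ** compl e))"
    using assms c X k by (subst (1) compl_def) (auto simp: pl_cmp)
  then show "compl e ** compl e = compl e" using c X k 1 by auto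
  have "pl C (compl e) e = idn C X"
    using assms X k pl_neg[of e] by (auto simp: compl_def pl_assoc)
  then show "pl C e (compl e) = idn C X" using c assms pl_commute[of e "compl e"] by auto
qed

end

locale karoubi_category = linear_category +
  assumes idempotent_complete: "idempotent_complete C"
begin

lemma split_idempotent:
  assumes "e \<in> arrows C X X" "e ** e = e"
  obtains Y r s where "Y \<in> Obj C" "r \<in> arrows C X Y" "s \<in> arrows C Y X" "s ** r = e" "r ** s = idn C Y"
proof -
  have X: "X \<in> Obj C" and e: "e = Arr X (mph e) X" "mph e \<in> mor C X X"
    using assms(1) by (auto simp del: is_arr_Obj simp: is_arr_def intro: arr_eqI)
  have "mph e \<cdot> mph e = mph e" using assms(2) e(1) by (metis arr.inject cmp_def)
  then obtain Y r s where "Y \<in> Obj C" "r \<in> mor C X Y" "s \<in> mor C Y X" "s \<cdot> r = mph e" "r \<cdot> s = Ident C Y"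
    using idempotent_complete e(2) X unfolding idempotent_complete_def by blast
  then show ?thesis using X e(1)
    by (intro that[of Y "Arr X r Y" "Arr Y s X"]) (auto simp: is_arr_Arr cmp_def idn_def)
qed

text \<open>The complementary idempotent \<open>1 - s r\<close> splits as well, and its splitting is the complement of
  \<open>X\<close> in \<open>S\<close>.\<close>

lemma retract_direct_summand:
  assumes "s \<in> arrows C X S" "r \<in> arrows C S X" "r ** s = idn C X"
  obtains Y where "is_direct_sum2 C X Y S"
    and "pl C (s ** r) (compl (s ** r)) = idn C S"
    and "\<exists>r' s'. r' \<in> arrows C S Y \<and> s' \<in> arrows C Y S \<and> s' ** r' = compl (s ** r) \<and> r' ** s' = idn C Y"
proof -
  let ?e = "s ** r"
  have e: "?e \<in> arrows C S S" using assms by auto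
  have ee: "?e ** ?e = ?e" using assms cmp_assoc_subst[OF assms(3), of r] by auto
  note c = compl_idempotent[OF e ee]
  obtain Y r' s' where Y: "Y \<in> Obj C" "r' \<in> arrows C S Y" "s' \<in> arrows C Y S"
    "s' ** r' = compl ?e" "r' ** s' = idn C Y"
    using split_idempotent[OF c(1,4)] by blast
  have X: "X \<in> Obj C" using assms by auto
  have "r ** s' = r ** ((?e ** compl ?e) ** s')"
  proof -
    have "(?e ** compl ?e) ** s' = ?e ** (s' ** (r' ** s'))" using Y assms by (auto simp flip: Y(4))
    then have "r ** ((?e ** compl ?e) ** s') = (r ** s) ** (r ** s')"
      using Y assms cmp_assoc_subst[OF assms(3), of "r ** s'"] by auto
    then show ?thesis using Y assms by auto
  qed
  then have 1: "r ** s' = zr C Y X" using c(2) Y assms X by auto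
  have "r' ** s = r' ** ((compl ?e ** ?e) ** s)"
  proof -
    have "(compl ?e ** ?e) ** s = s' ** (r' ** (s ** (r ** s)))" using Y assms by (auto simp flip: Y(4))
    then have "r' ** ((compl ?e ** ?e) ** s) = (r' ** s') ** (r' ** s)"
      using Y assms cmp_assoc_subst[OF Y(5), of "r' ** s"] by auto
    then show ?thesis using Y assms by auto
  qed
  then have 2: "r' ** s = zr C X Y" using c(3) Y assms X by auto
  have "is_direct_sum2 C X Y S"
    using assms Y 1 2 c(5) by (intro biprod2I[of s X S r s' Y r']) auto
  then show ?thesis using that c(5) Y by blast
qed

end

locale additive_karoubi_category = karoubi_category +
  assumes additive: "additive_category C"
begin

text \<open>A sum of \<open>n\<close> composites \<open>X \<rightarrow> M \<rightarrow> X\<close> is one composite through \<open>M\<^sup>n\<close>. If it equals the identity,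
  \<open>X\<close> is a retract of \<open>M\<^sup>n\<close> and hence a direct summand.\<close>

lemma add_closure_iff:
  assumes M: "M \<in> Obj C"
  shows "X \<in> add_closure C M \<longleftrightarrow> X \<preceq> M"
proof
  assume "X \<in> add_closure C M"
  then obtain n S Y where S: "is_direct_sum C {..<n::nat} (\<lambda>_. M) S" and XY: "is_direct_sum2 C X Y S"
    by (auto simp: add_closure_def)
  obtain j p where jp: "biprod C {..<n} (\<lambda>_. M) S j p" using S by (auto simp: is_direct_sum_iff)
  have "S \<preceq> M" using generated_refl M by (intro biprod_generated[OF jp]) auto
  moreover have "X \<preceq> S" using XY by (auto elim!: direct_sum2D intro: generated_retract)
  ultimately show "X \<preceq> M" using generated_trans by blast
next
  assume g: "X \<preceq> M"
  then have X: "X \<in> Obj C" by (simp add: generated_def)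
  have "\<exists>n a b. (\<forall>i<n::nat. a i \<in> arrows C X M \<and> b i \<in> arrows C M X) \<and> t = sm C X X {..<n} (\<lambda>i. b i ** a i)"
    if "t \<in> thru M X X" for t
    using that
  proof (induction rule: thru.induct)
    case thru_zr
    then show ?case using X by (intro exI[of _ 0]) auto
  next
    case (thru_pl t a b)
    then obtain n as bs where h: "\<forall>i<n::nat. as i \<in> arrows C X M \<and> bs i \<in> arrows C M X"
      "t = sm C X X {..<n} (\<lambda>i. bs i ** as i)" by blast
    let ?as = "as(n := a)" and ?bs = "bs(n := b)"
    have "sm C X X {..<Suc n} (\<lambda>i. ?bs i ** ?as i) = pl C (b ** a) (sm C X X {..<n} (\<lambda>i. ?bs i ** ?as i))"
      unfolding lessThan_Suc using h thru_pl X by (subst sm_insert) auto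
    also have "sm C X X {..<n} (\<lambda>i. ?bs i ** ?as i) = t" unfolding h(2) using X h(1) by (intro sm_cong) auto
    also have "pl C (b ** a) t = pl C t (b ** a)" using thru_arrows[OF thru_pl(1)] X thru_pl(2,3) by (intro pl_commute) auto
    finally show ?case using h thru_pl(2,3)
      by (intro exI[of _ "Suc n"] exI[of _ ?as] exI[of _ ?bs]) (auto simp: less_Suc_eq)
  qed
  then obtain n a b where ab: "\<And>i. i < n \<Longrightarrow> a i \<in> arrows C X M \<and> b i \<in> arrows C M X"
    "idn C X = sm C X X {..<n::nat} (\<lambda>i. b i ** a i)"
    using g unfolding generated_def by meson
  obtain S where S: "is_direct_sum C {..<n} (\<lambda>_. M) S"
    using additive[unfolded additive_category_def, rule_format, of n "\<lambda>_. M"] M by auto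
  then obtain j p where jp: "biprod C {..<n} (\<lambda>_. M) S j p" by (auto simp: is_direct_sum_iff)
  note bb = biprodD[OF jp]
  define s where "s = sm C X S {..<n} (\<lambda>i. j i ** a i)"
  define r where "r = sm C S X {..<n} (\<lambda>i. b i ** p i)"
  have s: "s \<in> arrows C X S" unfolding s_def using ab(1) bb(2-8) X by (auto intro!: is_arr_sm)
  have r: "r \<in> arrows C S X" unfolding r_def using ab(1) bb(2-8) X by (auto intro!: is_arr_sm)
  have "r ** s = sm C X X {..<n} (\<lambda>i. r ** (j i ** a i))"
    unfolding s_def using ab bb X r by (subst cmp_sm) auto
  also have "\<dots> = sm C X X {..<n} (\<lambda>i. b i ** a i)"
  proof (intro sm_cong)
    fix i assume i: "i \<in> {..<n}"
    have "r ** j i = b i" unfolding r_def using i ab X by (intro biprod_sm_inc[OF jp]) auto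
    then show "r ** (j i ** a i) = b i ** a i" using i ab bb r by (intro cmp_assoc_subst) auto
  qed (use ab X in auto)
  finally have "r ** s = idn C X" using ab by simp
  then obtain Y where "is_direct_sum2 C X Y S" using retract_direct_summand[OF s r] by blast
  then show "X \<in> add_closure C M" using S by (auto simp: add_closure_def)
qed

lemma add_closure_eq_iff:
  assumes "M \<in> Obj C" "N \<in> Obj C"
  shows "add_closure C M = add_closure C N \<longleftrightarrow> M \<preceq> N \<and> N \<preceq> M"
  using assms add_closure_iff generated_refl generated_trans by blast

end

context lin_functor
begin

lemma thru_fmap:
  assumes "t \<in> C.thru M X Y" "X \<in> Obj C" "Y \<in> Obj C" "M \<in> Obj C"
  shows "fmap F t \<in> D.thru (ob F M) (ob F X) (ob F Y)"
  using assms(1)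
proof (induction rule: C.thru.induct)
  case thru_zr
  then show ?case using assms D.thru_zr by simp
next
  case (thru_pl t a b)
  then show ?case
    using C.thru_arrows[OF thru_pl(1) assms(2,3)] D.thru_pl[OF thru_pl(4), of "fmap F a" "fmap F b"]
    by (auto simp: fmap_pl fmap_cmp)
qed

lemma generated_ob: "C.generated X M \<Longrightarrow> D.generated (ob F X) (ob F M)"
  using thru_fmap[of "idn C X" M X X] by (auto simp: C.generated_def D.generated_def)

lemma biprod_fmap:
  assumes "biprod C I Xs S j p"
  shows "biprod D I (\<lambda>i. ob F (Xs i)) (ob F S) (\<lambda>i. fmap F (j i)) (\<lambda>i. fmap F (p i))"
proof -
  note b = biprodD[OF assms]
  have "sm D (ob F S) (ob F S) I (\<lambda>i. fmap F (j i) **\<^bsub>D\<^esub> fmap F (p i)) =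
      sm D (ob F S) (ob F S) I (\<lambda>i. fmap F (j i **\<^bsub>C\<^esub> p i))"
    using b by (intro D.sm_cong) (auto simp: fmap_cmp)
  also have "\<dots> = fmap F (sm C S S I (\<lambda>i. j i **\<^bsub>C\<^esub> p i))" using b by (subst fmap_sm) auto
  finally show ?thesis using b unfolding biprod_def by (auto simp flip: fmap_cmp)
qed

end

section \<open>Krull--Schmidt theory\<close>

context linear_category
begin

text \<open>Characterizations by identities and idempotents, as opposed to universal properties, are what
  fully faithful functors visibly respect.\<close>

lemma zero_object_iff: "zero_object C Z \<longleftrightarrow> Z \<in> Obj C \<and> idn C Z = zr C Z Z"
proof
  assume z: "zero_object C Z"
  then have Z: "Z \<in> Obj C" and u: "\<exists>!f. f \<in> mor C Z Z" by (auto simp: zero_object_def)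
  have "Ident C Z \<in> mor C Z Z" "\<zero>\<^bsub>Hom C Z Z\<^esub> \<in> mor C Z Z"
    using is_arr_idn[OF Z] is_arr_zr[OF Z Z] by (simp_all add: idn_def zr_def is_arr_Arr)
  then have "Ident C Z = \<zero>\<^bsub>Hom C Z Z\<^esub>" using u by blast
  then show "Z \<in> Obj C \<and> idn C Z = zr C Z Z" using Z by (simp add: idn_def zr_def)
next
  assume z: "Z \<in> Obj C \<and> idn C Z = zr C Z Z"
  then have Z: "Z \<in> Obj C" by simp
  have out: "f = zr C Z (trg f)" if "is_arr C f" "src f = Z" for f
    using cmp_idn_right[OF that] z that by simp
  have into: "f = zr C (src f) Z" if "is_arr C f" "trg f = Z" for f
    using cmp_idn_left[OF that] z that by simp
  have "\<exists>!f. f \<in> mor C Z X" "\<exists>!f. f \<in> mor C X Z" if X: "X \<in> Obj C" for X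
  proof -
    have "f = \<zero>\<^bsub>Hom C Z X\<^esub>" if "f \<in> mor C Z X" for f
      using out[of "Arr Z f X"] X Z that by (simp add: is_arr_Arr zr_def)
    moreover have "f = \<zero>\<^bsub>Hom C X Z\<^esub>" if "f \<in> mor C X Z" for f
      using into[of "Arr X f Z"] X Z that by (simp add: is_arr_Arr zr_def)
    moreover have "\<zero>\<^bsub>Hom C Z X\<^esub> \<in> mor C Z X" "\<zero>\<^bsub>Hom C X Z\<^esub> \<in> mor C X Z"
      using is_arr_zr[OF Z X] is_arr_zr[OF X Z] by (simp_all add: zr_def is_arr_Arr)
    ultimately show "\<exists>!f. f \<in> mor C Z X" "\<exists>!f. f \<in> mor C X Z" by blast+
  qed
  then show "zero_object C Z" using Z by (simp add: zero_object_def)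
qed

lemma zero_arrow_cancel:
  assumes "r \<in> arrows C Y X" "s \<in> arrows C X Y" "r ** s = idn C X" "s ** r = zr C Y Y"
  shows "idn C X = zr C X X"
proof -
  have XY: "X \<in> Obj C" "Y \<in> Obj C" using assms by auto
  have "idn C X = (r ** s) ** (r ** s)" using assms(3) XY by simp
  also have "\<dots> = r ** ((s ** r) ** s)" using assms(1,2) by simp
  also have "\<dots> = zr C X X" unfolding assms(4) using assms(1,2) XY by auto
  finally show ?thesis .
qed

primrec pw :: "('o, 'm) arr \<Rightarrow> nat \<Rightarrow> ('o, 'm) arr"
  where "pw f 0 = idn C (src f)"
  | "pw f (Suc n) = f ** pw f n"

lemma pw_arrows [simp]:
  assumes "is_arr C f" "trg f = src f"
  shows "is_arr C (pw f n)" "src (pw f n) = src f" "trg (pw f n) = src f"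
  using assms by (induction n) auto

lemma pw_add: "is_arr C f \<Longrightarrow> trg f = src f \<Longrightarrow> pw f (m + n) = pw f m ** pw f n"
  by (induction m) auto

lemma pw_commute:
  assumes "is_arr C f" "is_arr C q" "trg f = src f" "src q = src f" "trg q = src f" "f ** q = q ** f"
  shows "pw f n ** q = q ** pw f n"
proof (induction n)
  case (Suc n)
  have "pw f (Suc n) ** q = f ** (q ** pw f n)" using assms(1-5) Suc by simp
  also have "\<dots> = (q ** f) ** pw f n" using assms by (intro cmp_assoc_subst) auto
  also have "\<dots> = q ** pw f (Suc n)" using assms(1-5) by simp
  finally show ?case .
qed (use assms in simp)

lemma scl_nonzero:
  assumes "is_arr C f" "c \<in> carrier K" "c \<noteq> \<zero>\<^bsub>K\<^esub>" "scl C c f = zr C (src f) (trg f)"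
  shows "f = zr C (src f) (trg f)"
proof -
  interpret K: field K by (rule field_K[of "src f"]) (use assms in simp)
  have c: "inv\<^bsub>K\<^esub> c \<in> carrier K" "inv\<^bsub>K\<^esub> c \<otimes>\<^bsub>K\<^esub> c = \<one>\<^bsub>K\<^esub>"
    using assms(2,3) K.field_Units by (auto simp: K.Units_l_inv)
  have "f = scl C (inv\<^bsub>K\<^esub> c) (scl C c f)" using assms(1,2) c by simp
  then show ?thesis using assms c by simp
qed

end

text \<open>The endomorphism algebra of \<open>X\<close> has dimension at most \<open>d\<close>. In this form the bound passes at
  once to equivariant objects, whose endomorphisms are among those of the underlying object.\<close>

definition end_dim_le :: "'k ring \<Rightarrow> ('o, 'm, 'k) category \<Rightarrow> 'o \<Rightarrow> nat \<Rightarrow> bool"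
  where "end_dim_le K C X d \<longleftrightarrow> (\<forall>v. (\<forall>i\<le>d. v i \<in> arrows C X X) \<longrightarrow>
    (\<exists>c. (\<forall>i\<le>d. c i \<in> carrier K) \<and> (\<exists>i\<le>d. c i \<noteq> \<zero>\<^bsub>K\<^esub>) \<and>
      sm C X X {..d} (\<lambda>i. scl C (c i) (v i)) = zr C X X))"

text \<open>An injective family of \<open>dim + 1\<close> vectors is a linearly dependent set; if \<open>v p = v q\<close>, then
  \<open>v p - v q = 0\<close> is a relation.\<close>

lemma (in vectorspace) family_dependent:
  assumes "fin_dim" and v: "\<And>i::nat. i \<le> dim \<Longrightarrow> v i \<in> carrier V"
  shows "\<exists>c. (\<forall>i\<le>dim. c i \<in> carrier K) \<and> (\<exists>i\<le>dim. c i \<noteq> \<zero>\<^bsub>K\<^esub>) \<and>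
    (\<Oplus>\<^bsub>V\<^esub>i\<in>{..dim}. c i \<odot>\<^bsub>V\<^esub> v i) = \<zero>\<^bsub>V\<^esub>"
proof (cases "inj_on v {..dim}")
  case True
  have S: "v ` {..dim} \<subseteq> carrier V" using v by auto
  have "lin_dep (v ` {..dim})"
    using li_le_dim(2)[OF assms(1) S] card_image[OF True] by fastforce
  then obtain a w where a: "a \<in> v ` {..dim} \<rightarrow> carrier K" "lincomb a (v ` {..dim}) = \<zero>\<^bsub>V\<^esub>"
    "w \<in> v ` {..dim}" "a w \<noteq> \<zero>\<^bsub>K\<^esub>"
    using finite_lin_dep[OF _ _ S] by auto
  have "(\<Oplus>\<^bsub>V\<^esub>x\<in>v ` {..dim}. a x \<odot>\<^bsub>V\<^esub> x) = (\<Oplus>\<^bsub>V\<^esub>i\<in>{..dim}. a (v i) \<odot>\<^bsub>V\<^esub> v i)"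
    using True v a(1) by (intro finsum_reindex) auto
  then show ?thesis using a by (intro exI[of _ "a \<circ> v"]) (auto simp: lincomb_def)
next
  case False
  then obtain p q where pq: "p \<le> dim" "q \<le> dim" "p \<noteq> q" "v p = v q" by (auto simp: inj_on_def)
  define c where "c i = (if i = p then \<one>\<^bsub>K\<^esub> else if i = q then \<ominus>\<^bsub>K\<^esub> \<one>\<^bsub>K\<^esub> else \<zero>\<^bsub>K\<^esub>)" for i
  have c: "c i \<in> carrier K" for i by (simp add: c_def)
  define R where "R = {..dim} - {p, q}"
  have split: "{..dim} = insert p (insert q R)" and R: "finite R" "p \<notin> R" "q \<notin> R" "\<And>i. i \<in> R \<Longrightarrow> i \<le> dim"
    using pq by (auto simp: R_def)
  have "(\<Oplus>\<^bsub>V\<^esub>i\<in>R. c i \<odot>\<^bsub>V\<^esub> v i) = (\<Oplus>\<^bsub>V\<^esub>i\<in>R. \<zero>\<^bsub>V\<^esub>)"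
    using v by (intro finsum_cong') (auto simp: c_def R_def)
  then have "(\<Oplus>\<^bsub>V\<^esub>i\<in>{..dim}. c i \<odot>\<^bsub>V\<^esub> v i) = v p \<oplus>\<^bsub>V\<^esub> (\<ominus>\<^bsub>V\<^esub> v p)"
    unfolding split using pq v c R
    by (subst finsum_insert; (subst finsum_insert)?) (auto simp: c_def smult_l_minus)
  also have "\<dots> = \<zero>\<^bsub>V\<^esub>" using v pq by (simp add: M.r_neg)
  finally show ?thesis using c pq by (intro exI[of _ c]) (auto simp: c_def)
qed

lemma (in linear_category) hom_finite_end_dim:
  assumes "hom_finite K C" "X \<in> Obj C"
  shows "\<exists>d. end_dim_le K C X d"
proof -
  interpret V: vectorspace K "Hom C X X" using Hom_vectorspace assms(2) by blast
  have fd: "V.fin_dim" using assms by (auto simp: hom_finite_def)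
  have "end_dim_le K C X V.dim"
    unfolding end_dim_le_def
  proof (intro allI impI)
    fix v assume v: "\<forall>i\<le>V.dim. v i \<in> arrows C X X"
    have m: "mph (v i) \<in> mor C X X" if "i \<le> V.dim" for i
      using v[rule_format, OF that] by (auto simp del: is_arr_Obj simp: is_arr_def)
    obtain c where c: "\<forall>i\<le>V.dim. c i \<in> carrier K" "\<exists>i\<le>V.dim. c i \<noteq> \<zero>\<^bsub>K\<^esub>"
      "(\<Oplus>\<^bsub>Hom C X X\<^esub>i\<in>{..V.dim}. c i \<odot>\<^bsub>Hom C X X\<^esub> mph (v i)) = \<zero>\<^bsub>Hom C X X\<^esub>"
      using V.family_dependent[OF fd, of "\<lambda>i. mph (v i)"] m by blast
    have "(\<Oplus>\<^bsub>Hom C X X\<^esub>i\<in>{..V.dim}. mph (scl C (c i) (v i))) =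
        (\<Oplus>\<^bsub>Hom C X X\<^esub>i\<in>{..V.dim}. c i \<odot>\<^bsub>Hom C X X\<^esub> mph (v i))"
      using v c(1) m by (intro V.finsum_cong') (auto simp: scl_def)
    then have "sm C X X {..V.dim} (\<lambda>i. scl C (c i) (v i)) = zr C X X"
      using c(3) by (simp add: sm_def zr_def)
    then show "\<exists>c. (\<forall>i\<le>V.dim. c i \<in> carrier K) \<and> (\<exists>i\<le>V.dim. c i \<noteq> \<zero>\<^bsub>K\<^esub>) \<and>
      sm C X X {..V.dim} (\<lambda>i. scl C (c i) (v i)) = zr C X X" using c by blast
  qed
  then show ?thesis by blast
qed

context karoubi_category
begin

text \<open>A splitting of an idempotent is one half of a decomposition of \<open>X\<close>, and a decomposition provides
  the idempotent that projects to its first summand.\<close>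

lemma indecomposable_iff:
  "indecomposable C X \<longleftrightarrow> X \<in> Obj C \<and> idn C X \<noteq> zr C X X \<and>
    (\<forall>e\<in>arrows C X X. e ** e = e \<longrightarrow> e = zr C X X \<or> e = idn C X)"
proof (intro iffI conjI ballI impI)
  assume i: "indecomposable C X"
  then show X: "X \<in> Obj C" "idn C X \<noteq> zr C X X" by (auto simp: indecomposable_def zero_object_iff)
  fix e assume e: "e \<in> arrows C X X" "e ** e = e"
  obtain Y r s where Y: "Y \<in> Obj C" "r \<in> arrows C X Y" "s \<in> arrows C Y X" "s ** r = e" "r ** s = idn C Y"
    using split_idempotent[OF e] by blast
  obtain Z r' s' where Z: "is_direct_sum2 C Y Z X" "pl C e (compl e) = idn C X"
    "r' \<in> arrows C X Z" "s' \<in> arrows C Z X" "s' ** r' = compl e" "r' ** s' = idn C Z"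
    using retract_direct_summand[OF Y(3,2,5)] Y(4) by metis
  have "zero_object C Y \<or> zero_object C Z" using i Z(1) by (auto simp: indecomposable_def)
  then show "e = zr C X X \<or> e = idn C X"
  proof
    assume "zero_object C Y"
    then have "s ** (idn C Y ** r) = zr C X X" using Y X by (auto simp: zero_object_iff)
    then show ?thesis using Y by auto
  next
    assume "zero_object C Z"
    then have "s' ** (idn C Z ** r') = zr C X X" using Z X by (auto simp: zero_object_iff)
    then have "compl e = zr C X X" using Z by auto
    then show ?thesis using Z(2) e by auto
  qed
next
  assume i: "X \<in> Obj C \<and> idn C X \<noteq> zr C X X \<and> (\<forall>e\<in>arrows C X X. e ** e = e \<longrightarrow> e = zr C X X \<or> e = idn C X)"
  have "zero_object C A \<or> zero_object C B" if ds: "is_direct_sum2 C A B X" for A B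
  proof -
    obtain j1 p1 j2 p2 where jp: "j1 \<in> arrows C A X" "p1 \<in> arrows C X A" "j2 \<in> arrows C B X" "p2 \<in> arrows C X B"
      "p1 ** j1 = idn C A" "p2 ** j2 = idn C B" "p1 ** j2 = zr C B A" "p2 ** j1 = zr C A B"
      using direct_sum2D[OF ds] by metis
    have AB: "A \<in> Obj C" "B \<in> Obj C" using jp by auto
    have "(j1 ** p1) ** (j1 ** p1) = j1 ** p1" using jp cmp_assoc_subst[OF jp(5), of p1] by auto
    then have "j1 ** p1 = zr C X X \<or> j1 ** p1 = idn C X" using i jp by auto
    then show ?thesis
    proof
      assume "j1 ** p1 = zr C X X"
      then have "idn C A = zr C A A" using zero_arrow_cancel[OF jp(2,1,5)] by simp
      then show ?thesis using AB by (simp add: zero_object_iff)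
    next
      assume 1: "j1 ** p1 = idn C X"
      have "p2 = p2 ** (j1 ** p1)" using 1 jp by simp
      also have "\<dots> = zr C X B" using cmp_assoc_subst[OF jp(8), of p1] jp AB by auto
      finally have "p2 = zr C X B" .
      then have "idn C B = zr C B B" using jp(3,6) AB by auto
      then show ?thesis using AB by (simp add: zero_object_iff)
    qed
  qed
  then show "indecomposable C X" using i by (auto simp: indecomposable_def zero_object_iff)
qed

end

locale krull_schmidt_category = additive_karoubi_category +
  assumes end_finite: "X \<in> Obj C \<Longrightarrow> \<exists>d. end_dim_le K C X d"
begin

text \<open>The powers of \<open>f\<close> are linearly dependent. If \<open>f^m\<close> is the lowest power that occurs in a
  relation, solving for it gives \<open>q\<close> as a polynomial in \<open>f\<close>.\<close>

lemma power_relation: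
  assumes f: "f \<in> arrows C X X"
  obtains m q where "q \<in> arrows C X X" "f ** q = q ** f" "pw f m = pw f (Suc m) ** q"
proof -
  have X: "X \<in> Obj C" using f by auto
  interpret K: field K by (rule field_K[OF X])
  obtain d where "end_dim_le K C X d" using end_finite X by blast
  then obtain c where c: "\<And>i. i \<le> d \<Longrightarrow> c i \<in> carrier K" "\<exists>i\<le>d. c i \<noteq> \<zero>\<^bsub>K\<^esub>"
    "sm C X X {..d} (\<lambda>i. scl C (c i) (pw f i)) = zr C X X"
    using f unfolding end_dim_le_def by (elim allE[of _ "pw f"]) (auto simp: Ball_def)
  define m where "m = (LEAST i. i \<le> d \<and> c i \<noteq> \<zero>\<^bsub>K\<^esub>)"
  have m: "m \<le> d" "c m \<noteq> \<zero>\<^bsub>K\<^esub>" using LeastI_ex[OF c(2)] by (auto simp: m_def)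
  have below: "c i = \<zero>\<^bsub>K\<^esub>" if "i < m" for i using not_less_Least[of i] that m unfolding m_def by fastforce
  \<comment> \<open>Multiplied by \<open>b\<close>, the relation is solved for \<open>f^m\<close>.\<close>
  define b where "b = \<ominus>\<^bsub>K\<^esub> (inv\<^bsub>K\<^esub> (c m))"
  have cm: "c m \<in> Units K" using c(1) m K.field_Units by auto
  then have b: "b \<in> carrier K" "b \<otimes>\<^bsub>K\<^esub> c m = \<ominus>\<^bsub>K\<^esub> \<one>\<^bsub>K\<^esub>"
    using c(1)[OF m(1)] by (auto simp: b_def K.l_minus)
  define J where "J = {Suc m..d}"
  define t where "t i = scl C (c i) (pw f i)" for i
  have t: "t i \<in> arrows C X X" if "i \<le> d" for i using c(1)[OF that] f by (auto simp: t_def)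
  have tz: "t i = zr C X X" if "i < m" for i using below[OF that] f X by (simp add: t_def)
  have "zr C X X = sm C X X {..d} t" using c(3) by (simp add: t_def[abs_def])
  also have "\<dots> = sm C X X (insert m J) t"
    using t X m tz by (intro sm_mono_neutral) (auto simp: J_def)
  also have "\<dots> = pl C (t m) (sm C X X J t)"
    using t X m by (intro sm_insert) (auto simp: J_def)
  finally have rel: "pl C (t m) (sm C X X J t) = zr C X X" ..
  define s where "s = sm C X X J t"
  have "is_arr C s" unfolding s_def by (rule is_arr_sm[OF X X t]) (simp add: J_def)
  then have s: "s \<in> arrows C X X" by (simp add: s_def)
  have "zr C X X = scl C b (pl C (t m) s)" using rel b X by (simp add: s_def)
  also have "\<dots> = pl C (scl C (\<ominus>\<^bsub>K\<^esub> \<one>\<^bsub>K\<^esub>) (pw f m)) (scl C b s)"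
    using t[OF m(1)] s b f c(1)[OF m(1)] by (subst scl_pl) (auto simp: t_def)
  finally have z: "zr C X X = pl C (scl C (\<ominus>\<^bsub>K\<^esub> \<one>\<^bsub>K\<^esub>) (pw f m)) (scl C b s)" .
  have "pl C (pw f m) (pl C (scl C (\<ominus>\<^bsub>K\<^esub> \<one>\<^bsub>K\<^esub>) (pw f m)) (scl C b s)) = pw f m"
    unfolding z[symmetric] using f X by auto
  moreover have "pl C (pw f m) (pl C (scl C (\<ominus>\<^bsub>K\<^esub> \<one>\<^bsub>K\<^esub>) (pw f m)) (scl C b s)) =
      pl C (pl C (pw f m) (scl C (\<ominus>\<^bsub>K\<^esub> \<one>\<^bsub>K\<^esub>) (pw f m))) (scl C b s)"
    using f X s b by (subst pl_assoc) auto
  moreover have "\<dots> = scl C b s" using pl_neg[of "pw f m"] f s b by auto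
  ultimately have fm: "pw f m = scl C b s" by simp
  define q0 where "q0 = sm C X X J (\<lambda>i. scl C (c i) (pw f (i - Suc m)))"
  have ar: "scl C (c i) (pw f (i - Suc m)) \<in> arrows C X X" if "i \<in> J" for i
    using that c(1) f by (auto simp: J_def)
  have q0: "q0 \<in> arrows C X X" using ar X unfolding q0_def by (auto intro!: is_arr_sm)
  have "pw f (Suc m) ** q0 = sm C X X J (\<lambda>i. pw f (Suc m) ** scl C (c i) (pw f (i - Suc m)))"
    unfolding q0_def using ar X f cmp_sm[of J "pw f (Suc m)" X X] by (auto simp: J_def simp del: pw.simps)
  also have "\<dots> = s"
    unfolding s_def
  proof (intro sm_cong)
    fix i assume i: "i \<in> J"
    then have "pw f (Suc m) ** pw f (i - Suc m) = pw f i"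
      using f by (subst pw_add[symmetric]) (auto simp: J_def)
    then show "pw f (Suc m) ** scl C (c i) (pw f (i - Suc m)) = t i"
      using i c(1)[of i] f by (auto simp: t_def J_def simp del: pw.simps)
  qed (use X t in \<open>auto simp: J_def\<close>)
  finally have s_eq: "pw f (Suc m) ** q0 = s" .
  have "f ** q0 = sm C X X J (\<lambda>i. f ** scl C (c i) (pw f (i - Suc m)))"
    unfolding q0_def using ar X f cmp_sm[of J f X X] by (auto simp: J_def)
  also have "\<dots> = sm C X X J (\<lambda>i. scl C (c i) (pw f (i - Suc m)) ** f)"
    using f X c(1) pw_commute[of f f] by (intro sm_cong) (auto simp: J_def)
  also have "\<dots> = q0 ** f"
    unfolding q0_def using ar X f sm_cmp[of J f X X] by (auto simp: J_def)
  finally have comm: "f ** q0 = q0 ** f" .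
  show ?thesis
  proof (rule that[of "scl C b q0" m])
    show "scl C b q0 \<in> arrows C X X" using q0 b by auto
    show "f ** scl C b q0 = scl C b q0 ** f" using comm f q0 b by auto
    show "pw f m = pw f (Suc m) ** scl C b q0" using fm s_eq q0 b f by (auto simp del: pw.simps)
  qed
qed

text \<open>From \<open>f^m = f^(m+1) q\<close> one obtains \<open>f^m = f^(2m) q^m\<close>, so that \<open>e = f^m q^m\<close> is an idempotent with
  \<open>f^m e = f^m\<close>. Over an indecomposable object either \<open>e = 0\<close>, and \<open>f\<close> is nilpotent, or \<open>e = 1\<close>, and \<open>f\<close>
  is invertible.\<close>

lemma fitting:
  assumes X: "indecomposable C X" and f: "f \<in> arrows C X X"
  shows "iso_arr C f \<or> (\<exists>m. pw f m = zr C X X)"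
proof -
  obtain m q where q: "q \<in> arrows C X X" "f ** q = q ** f" "pw f m = pw f (Suc m) ** q"
    using power_relation[OF f] by blast
  have XO: "X \<in> Obj C" using f by auto
  note comm = pw_commute[of f q for n] and qc = pw_commute[of q f]
  have pf: "pw f n \<in> arrows C X X" "pw q n \<in> arrows C X X" for n using f q by auto
  have "q ** pw f n = pw f n ** q" for n using pw_commute[of f q n] f q by auto
  then have qf: "pw q k ** pw f n = pw f n ** pw q k" for n k
    using pw_commute[of q "pw f n" k] pf q by auto
  have iter: "pw f m = pw f (m + k) ** pw q k" for k
  proof (induction k)
    case 0
    then show ?case using f q by auto
  next
    case (Suc k)
    have "pw f (m + k) = pw f k ** pw f m" using pw_add[of f k m] f by (auto simp: add.commute)
    also have "\<dots> = (pw f k ** pw f (Suc m)) ** q" using q(1) pf by (subst q(3)) (auto simp del: pw.simps)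
    also have "pw f k ** pw f (Suc m) = pw f (m + Suc k)"
      using pw_add[of f k "Suc m"] f by (auto simp: add.commute simp del: pw.simps)
    finally have "pw f m = (pw f (m + Suc k) ** q) ** pw q k" using Suc by simp
    then show ?case using q f pf by (simp del: pw.simps(2) add: pw.simps(2)[of q])
  qed
  define e where "e = pw f m ** pw q m"
  have e: "e \<in> arrows C X X" using pf by (auto simp: e_def)
  have fe: "pw f m ** e = pw f m"
  proof -
    have "pw f m ** e = pw f (m + m) ** pw q m" using pw_add[of f m m] f pf unfolding e_def by simp
    then show ?thesis using iter[of m] by simp
  qed
  have "e ** e = pw f m ** ((pw q m ** pw f m) ** pw q m)" unfolding e_def using pf by auto
  also have "\<dots> = (pw f m ** e) ** pw q m" unfolding qf using pf by (auto simp: e_def)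
  also have "\<dots> = e" unfolding fe by (simp add: e_def)
  finally have "e = zr C X X \<or> e = idn C X" using X e by (auto simp: indecomposable_iff)
  then show ?thesis
  proof
    assume "e = zr C X X"
    then have "pw f m = zr C X X" using fe pf[of m] XO by auto
    then show ?thesis by blast
  next
    assume e1: "e = idn C X"
    show ?thesis
    proof (cases m)
      case 0
      then have "f ** q = idn C X" using q(3) f q(1) by auto
      then show ?thesis using q f by (auto simp: iso_arr_def inverses_def intro!: exI[of _ q])
    next
      case (Suc n)
      have 1: "f ** (pw f n ** pw q m) = idn C X" using e1 pf f q(1) unfolding e_def by (simp add: Suc)
      have "(pw f n ** pw q m) ** f = pw f n ** (f ** pw q m)"
        using qf[of m 1] pf f by auto
      also have "\<dots> = f ** (pw f n ** pw q m)" using pw_commute[of f f n] pf f cmp_assoc_subst[of "pw f n" f _ "pw q m"] by auto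
      finally have 2: "(pw f n ** pw q m) ** f = idn C X" using 1 by simp
      show ?thesis using 1 2 pf f
        by (auto simp: iso_arr_def inverses_def intro!: exI[of _ "pw f n ** pw q m"])
    qed
  qed
qed

text \<open>Otherwise both are nilpotent. If \<open>n\<close> is maximal with \<open>f^n \<noteq> 0\<close>, then \<open>f^n = f^n (f + g) = f^n g\<close>,
  and iterating this, \<open>f^n = f^n g^i = 0\<close> for large \<open>i\<close>.\<close>

lemma local_pl:
  assumes X: "indecomposable C X" and f: "f \<in> arrows C X X" and g: "g \<in> arrows C X X"
    and fg: "pl C f g = idn C X"
  shows "iso_arr C f \<or> iso_arr C g"
proof (rule ccontr)
  assume not: "\<not> (iso_arr C f \<or> iso_arr C g)"
  have XO: "X \<in> Obj C" "idn C X \<noteq> zr C X X" using X by (auto simp: indecomposable_iff)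
  obtain k where k: "pw g k = zr C X X" using fitting[OF X g] not by blast
  have "\<exists>m. pw f m = zr C X X" using fitting[OF X f] not by blast
  then obtain m where m: "pw f m = zr C X X" "\<And>n. n < m \<Longrightarrow> pw f n \<noteq> zr C X X"
    unfolding exists_least_iff[of "\<lambda>m. pw f m = zr C X X"] by blast
  obtain n where n: "m = Suc n" using m(1) XO f by (cases m) auto
  have "pw f n = pw f n ** pl C f g" using fg f by simp
  also have "\<dots> = pl C (pw f n ** f) (pw f n ** g)" using f g by (intro cmp_pl) auto
  also have "pw f n ** f = zr C X X" using pw_commute[of f f n] f m(1) n by auto
  also have "pl C (zr C X X) (pw f n ** g) = pw f n ** g" using f g by auto
  finally have step: "pw f n = pw f n ** g" .
  have "pw f n = pw f n ** pw g i" for i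
  proof (induction i)
    case 0
    then show ?case using f g by auto
  next
    case (Suc i)
    have "pw f n ** pw g (Suc i) = (pw f n ** g) ** pw g i" using f g by auto
    then show ?case using step Suc by simp
  qed
  then have "pw f n = zr C X X" using k f XO by (metis arrows_iff cmp_zr pw_arrows)
  then show False using m(2) n by simp
qed

lemma local_pl_iso:
  assumes X: "indecomposable C X" and f: "f \<in> arrows C X X" and g: "g \<in> arrows C X X"
    and fg: "iso_arr C (pl C f g)"
  shows "iso_arr C f \<or> iso_arr C g"
proof -
  let ?u = "ainv C (pl C f g)"
  have u: "?u \<in> arrows C X X" "iso_arr C ?u" "?u ** pl C f g = idn C X" using fg f by auto
  have "pl C (?u ** f) (?u ** g) = idn C X" using u f g by (subst cmp_pl[symmetric]) auto
  then have "iso_arr C (?u ** f) \<or> iso_arr C (?u ** g)" using local_pl[OF X] u(1) f g by auto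
  moreover have "iso_arr C h" if "iso_arr C (?u ** h)" "h \<in> arrows C X X" for h
  proof -
    have "iso_arr C (ainv C ?u ** (?u ** h))"
      using that(2) u(1,2) by (intro iso_arr_cmp[OF that(1) iso_arr_ainv[OF u(2)]]) auto
    moreover have "ainv C ?u ** (?u ** h) = h" using that(2) u(1) by (intro ainv_cancel(1)[OF u(2)]) auto
    ultimately show ?thesis by simp
  qed
  ultimately show ?thesis using f g by blast
qed

lemma zr_not_iso: "idn C X \<noteq> zr C X X \<Longrightarrow> X \<in> Obj C \<Longrightarrow> \<not> iso_arr C (zr C X X)"
proof
  assume X: "idn C X \<noteq> zr C X X" "X \<in> Obj C" and i: "iso_arr C (zr C X X)"
  have "zr C X X ** ainv C (zr C X X) = idn C X" using ainv_simps(5)[OF i] by simp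
  moreover have "zr C X X ** ainv C (zr C X X) = zr C X X" using X(2) ainv_simps(1-3)[OF i] by simp
  ultimately show False using X(1) by simp
qed

lemma local_sm:
  assumes "indecomposable C X" "finite I" "\<And>i. i \<in> I \<Longrightarrow> t i \<in> arrows C X X" "iso_arr C (sm C X X I t)"
  shows "\<exists>i\<in>I. iso_arr C (t i)"
  using assms(2-4)
proof (induction I rule: finite_induct)
  case empty
  then show ?case using zr_not_iso assms(1) by (auto simp: indecomposable_iff)
next
  case (insert j J)
  have XO: "X \<in> Obj C" using assms(1) by (auto simp: indecomposable_iff)
  have ar: "t j \<in> arrows C X X" "sm C X X J t \<in> arrows C X X"
    using insert.prems(1) XO by (auto intro!: is_arr_sm)
  have "iso_arr C (pl C (t j) (sm C X X J t))"
    using insert.prems insert.hyps XO sm_insert[of J j X X t] by simp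
  then show ?case using local_pl_iso[OF assms(1) ar] insert by blast
qed

lemma local_thru:
  assumes X: "indecomposable C X" and t: "t \<in> thru M X X" "iso_arr C t"
  shows "\<exists>a\<in>arrows C X M. \<exists>b\<in>arrows C M X. iso_arr C (b ** a)"
  using t
proof (induction rule: thru.induct)
  case thru_zr
  then show ?case using X zr_not_iso by (auto simp: indecomposable_iff)
next
  case (thru_pl t a b)
  have XO: "X \<in> Obj C" using X by (auto simp: indecomposable_iff)
  have "iso_arr C t \<or> iso_arr C (b ** a)"
    using thru_pl thru_arrows[OF thru_pl(1) XO XO] by (intro local_pl_iso[OF X]) auto
  then show ?case using thru_pl by blast
qed

text \<open>Normalizing \<open>b\<close> so that \<open>b a = 1\<close> makes \<open>a b\<close> an idempotent of \<open>Y\<close>. It is nonzero since \<open>X\<close>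
  is, hence it is the identity.\<close>

lemma indecomposable_retract_iso:
  assumes X: "indecomposable C X" and Y: "indecomposable C Y"
    and a: "a \<in> arrows C X Y" and b: "b \<in> arrows C Y X" and ba: "iso_arr C (b ** a)"
  shows "(X, Y) \<in> iso_rel C"
proof -
  define r where "r = ainv C (b ** a) ** b"
  have r: "r \<in> arrows C Y X" using a b ba by (auto simp: r_def)
  have ra: "r ** a = idn C X" using ainv_simps(4)[OF ba] ba a b unfolding r_def by auto
  have "(a ** r) ** (a ** r) = a ** r" using a r cmp_assoc_subst[OF ra, of r] by auto
  then have "a ** r = zr C Y Y \<or> a ** r = idn C Y" using Y a r by (auto simp: indecomposable_iff)
  moreover have "a ** r \<noteq> zr C Y Y" using zero_arrow_cancel[OF r a ra] X by (auto simp: indecomposable_iff)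
  ultimately have "inverses C a r" using a r ra by (auto simp: inverses_def)
  then show ?thesis using a by (intro iso_relI[of C a]) (auto simp: iso_arr_def)
qed

text \<open>The identity of \<open>X\<close> is a sum of arrows that factor through the summands of \<open>S\<close>; as the
  endomorphism ring of \<open>X\<close> is local, one of them is invertible.\<close>

lemma indecomposable_generated:
  assumes X: "indecomposable C X" and S: "biprod C I Xs S j p" "\<And>i. i \<in> I \<Longrightarrow> indecomposable C (Xs i)"
    and g: "X \<preceq> S"
  shows "\<exists>i\<in>I. (X, Xs i) \<in> iso_rel C"
proof -
  note bb = biprodD[OF S(1)]
  have XO: "X \<in> Obj C" using X by (auto simp: indecomposable_iff)
  obtain a b where ab: "a \<in> arrows C X S" "b \<in> arrows C S X" "iso_arr C (b ** a)"
    using local_thru[OF X, of "idn C X" S] g XO by (auto simp: generated_def)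
  have "a = sm C X S I (\<lambda>i. j i ** (p i ** a))" using biprod_expand_left[OF S(1), of a] ab by auto
  then have "b ** a = b ** sm C X S I (\<lambda>i. j i ** (p i ** a))" by simp
  also have "\<dots> = sm C X X I (\<lambda>i. b ** (j i ** (p i ** a)))" using ab bb XO by (subst cmp_sm) auto
  finally have eq: "b ** a = sm C X X I (\<lambda>i. b ** (j i ** (p i ** a)))" .
  have "\<exists>i\<in>I. iso_arr C (b ** (j i ** (p i ** a)))"
    using ab bb by (intro local_sm[OF X]) (auto simp flip: eq)
  then obtain i where i: "i \<in> I" "iso_arr C (b ** (j i ** (p i ** a)))" by blast
  have "b ** (j i ** (p i ** a)) = (b ** j i) ** (p i ** a)" using i ab bb by auto
  then show ?thesis using i ab bb X S(2)[OF i(1)]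
    by (intro bexI[of _ i] indecomposable_retract_iso[of X "Xs i" "p i ** a" "b ** j i"]) auto
qed

lemma basic_object_iff_biprod:
  "basic_object C M \<longleftrightarrow> (\<exists>(n::nat) Xs j p. biprod C {..<n} Xs M j p \<and> (\<forall>i<n. indecomposable C (Xs i)) \<and>
    (\<forall>i<n. \<forall>k<n. i \<noteq> k \<longrightarrow> (Xs i, Xs k) \<notin> iso_rel C))"
  unfolding basic_object_def is_direct_sum_iff by blast

text \<open>Every indecomposable summand of one object is isomorphic to a summand of the other. As the
  summands of either are pairwise not isomorphic, this is a bijection between them.\<close>

theorem basic_iso_of_generated:
  assumes "basic_object C X" "basic_object C Y" "X \<preceq> Y" "Y \<preceq> X"
  shows "(X, Y) \<in> iso_rel C"
proof -
  obtain n :: nat and Xs j p where X: "biprod C {..<n} Xs X j p" "\<And>i. i < n \<Longrightarrow> indecomposable C (Xs i)"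
    "\<And>i k. i < n \<Longrightarrow> k < n \<Longrightarrow> (Xs i, Xs k) \<in> iso_rel C \<Longrightarrow> i = k"
    using assms(1) unfolding basic_object_iff_biprod by blast
  obtain m :: nat and Ys j' p' where Y: "biprod C {..<m} Ys Y j' p'" "\<And>i. i < m \<Longrightarrow> indecomposable C (Ys i)"
    "\<And>i k. i < m \<Longrightarrow> k < m \<Longrightarrow> (Ys i, Ys k) \<in> iso_rel C \<Longrightarrow> i = k"
    using assms(2) unfolding basic_object_iff_biprod by blast
  have "\<exists>k<m. (Xs i, Ys k) \<in> iso_rel C" if i: "i < n" for i
    using indecomposable_generated[OF X(2)[OF i] Y(1)] Y(2) generated_biprod[OF X(1), of i] i assms(3)
      generated_trans by blast
  then obtain \<sigma> where \<sigma>: "\<And>i. i < n \<Longrightarrow> \<sigma> i < m \<and> (Xs i, Ys (\<sigma> i)) \<in> iso_rel C" by metis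
  have "\<exists>i<n. (Ys k, Xs i) \<in> iso_rel C" if k: "k < m" for k
    using indecomposable_generated[OF Y(2)[OF k] X(1)] X(2) generated_biprod[OF Y(1), of k] k assms(4)
      generated_trans by blast
  then have "\<exists>i<n. k = \<sigma> i" if "k < m" for k
    using that \<sigma> Y(3) iso_rel_trans by meson
  moreover have "i = k" if "i < n" "k < n" "\<sigma> i = \<sigma> k" for i k
    using \<sigma>[OF that(1)] \<sigma>[OF that(2)] that X(3) iso_rel_trans iso_rel_sym by metis
  ultimately have "bij_betw \<sigma> {..<n} {..<m}" using \<sigma> by (auto simp: bij_betw_def inj_on_def image_iff)
  then show ?thesis using biprod_iso[OF X(1) Y(1)] \<sigma> by blast
qed

text \<open>Endomorphisms of \<open>A\<close> together with the projection to \<open>B\<close> satisfy a relation as endomorphisms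
  of \<open>X\<close>. Its component on \<open>B\<close> shows that the projection does not occur, and its component on \<open>A\<close>
  is the relation sought.\<close>

lemma end_dim_summand:
  assumes "is_direct_sum2 C A B X" "idn C B \<noteq> zr C B B" "end_dim_le K C X (Suc d)"
  shows "end_dim_le K C A d"
  unfolding end_dim_le_def
proof (intro allI impI)
  fix v assume v: "\<forall>i\<le>d. v i \<in> arrows C A A"
  obtain j1 p1 j2 p2 where jp: "j1 \<in> arrows C A X" "p1 \<in> arrows C X A" "j2 \<in> arrows C B X" "p2 \<in> arrows C X B"
    "p1 ** j1 = idn C A" "p2 ** j2 = idn C B" "p1 ** j2 = zr C B A" "p2 ** j1 = zr C A B"
    using direct_sum2D[OF assms(1)] by metis
  have O: "A \<in> Obj C" "B \<in> Obj C" "X \<in> Obj C" using jp by auto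
  define w where "w i = (if i = Suc d then j2 ** p2 else j1 ** (v i ** p1))" for i
  have w: "w i \<in> arrows C X X" if "i \<le> Suc d" for i using v jp that by (auto simp: w_def le_Suc_eq)
  obtain c where c: "\<And>i. i \<le> Suc d \<Longrightarrow> c i \<in> carrier K" "\<exists>i\<le>Suc d. c i \<noteq> \<zero>\<^bsub>K\<^esub>"
    "sm C X X {..Suc d} (\<lambda>i. scl C (c i) (w i)) = zr C X X"
    using assms(3) w unfolding end_dim_le_def by (elim allE[of _ w]) auto
  have cw: "scl C (c i) (w i) \<in> arrows C X X" if "i \<le> Suc d" for i using w[OF that] c(1)[OF that] by auto
  have p1w: "p1 ** (w i ** j1) = (if i = Suc d then zr C A A else v i)" if "i \<le> Suc d" for i
  proof (cases "i = Suc d")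
    case True
    have "p1 ** ((j2 ** p2) ** j1) = (p1 ** j2) ** (p2 ** j1)" using jp by auto
    then show ?thesis using True jp(7,8) O by (simp add: w_def)
  next
    case False
    then have vi: "v i \<in> arrows C A A" using that v by auto
    have "p1 ** ((j1 ** (v i ** p1)) ** j1) = (p1 ** j1) ** (v i ** (p1 ** j1))" using jp(1-4) vi by auto
    then show ?thesis using False jp(5) vi by (simp add: w_def)
  qed
  have p2w: "p2 ** (w i ** j2) = (if i = Suc d then idn C B else zr C B B)" if "i \<le> Suc d" for i
  proof (cases "i = Suc d")
    case True
    have "p2 ** ((j2 ** p2) ** j2) = (p2 ** j2) ** (p2 ** j2)" using jp(1-4) by auto
    then show ?thesis using True jp(6) O by (simp add: w_def)
  next
    case False
    then have vi: "v i \<in> arrows C A A" using that v by auto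
    have "p2 ** ((j1 ** (v i ** p1)) ** j2) = (p2 ** j1) ** (v i ** (p1 ** j2))" using jp(1-4) vi by auto
    then show ?thesis using False jp(7,8) vi O by (simp add: w_def)
  qed
  have sandwich: "p ** (sm C X X {..Suc d} (\<lambda>i. scl C (c i) (w i)) ** j) =
      sm C Y Y {..Suc d} (\<lambda>i. scl C (c i) (p ** (w i ** j)))"
    if "p \<in> arrows C X Y" "j \<in> arrows C Y X" for p j Y
  proof -
    have Y: "Y \<in> Obj C" using that by auto
    have "sm C X X {..Suc d} (\<lambda>i. scl C (c i) (w i)) ** j = sm C Y X {..Suc d} (\<lambda>i. scl C (c i) (w i) ** j)"
      using that O cw by (subst sm_cmp) auto
    also have "p ** \<dots> = sm C Y Y {..Suc d} (\<lambda>i. p ** (scl C (c i) (w i) ** j))"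
      using that O Y cw by (subst cmp_sm) auto
    also have "\<dots> = sm C Y Y {..Suc d} (\<lambda>i. scl C (c i) (p ** (w i ** j)))"
      using that Y w c(1) by (intro sm_cong) auto
    finally show ?thesis .
  qed
  have "zr C B B = sm C B B {..Suc d} (\<lambda>i. scl C (c i) (p2 ** (w i ** j2)))"
    using sandwich[of p2 B j2] c(3) jp O by auto
  also have "\<dots> = sm C B B {..Suc d} (\<lambda>i. if i = Suc d then scl C (c (Suc d)) (idn C B) else zr C B B)"
    using O c(1) p2w by (intro sm_cong) auto
  also have "\<dots> = scl C (c (Suc d)) (idn C B)"
    using sm_single[of "{..Suc d}" "Suc d" B B "\<lambda>i. if i = Suc d then scl C (c (Suc d)) (idn C B) else zr C B B"] O c(1)
    by auto
  finally have cd: "c (Suc d) = \<zero>\<^bsub>K\<^esub>" using scl_nonzero[of "idn C B" "c (Suc d)"] O c(1) assms(2) by auto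
  have "zr C A A = sm C A A {..Suc d} (\<lambda>i. scl C (c i) (p1 ** (w i ** j1)))"
    using sandwich[of p1 A j1] c(3) jp O by auto
  also have "\<dots> = pl C (scl C (c (Suc d)) (p1 ** (w (Suc d) ** j1))) (sm C A A {..d} (\<lambda>i. scl C (c i) (p1 ** (w i ** j1))))"
    unfolding atMost_Suc using O jp w c(1) by (intro sm_insert) auto
  also have "sm C A A {..d} (\<lambda>i. scl C (c i) (p1 ** (w i ** j1))) = sm C A A {..d} (\<lambda>i. scl C (c i) (v i))"
    using O v c(1) p1w by (intro sm_cong) auto
  also have "scl C (c (Suc d)) (p1 ** (w (Suc d) ** j1)) = zr C A A" using p1w[of "Suc d"] O c(1) by auto
  also have "pl C (zr C A A) (sm C A A {..d} (\<lambda>i. scl C (c i) (v i))) = sm C A A {..d} (\<lambda>i. scl C (c i) (v i))"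
    using O v c(1) by (intro pl_zr(2)) (auto intro!: is_arr_sm)
  finally have z: "sm C A A {..d} (\<lambda>i. scl C (c i) (v i)) = zr C A A" ..
  have "\<exists>i\<le>d. c i \<noteq> \<zero>\<^bsub>K\<^esub>" using c(2) cd by (metis le_Suc_eq)
  then show "\<exists>c. (\<forall>i\<le>d. c i \<in> carrier K) \<and> (\<exists>i\<le>d. c i \<noteq> \<zero>\<^bsub>K\<^esub>) \<and>
      sm C A A {..d} (\<lambda>i. scl C (c i) (v i)) = zr C A A" using z c(1) by (intro exI[of _ c]) auto
qed

lemma direct_sum2_swap: "is_direct_sum2 C A B X \<Longrightarrow> is_direct_sum2 C B A X"
proof (elim direct_sum2D)
  fix j1 p1 j2 p2
  assume jp: "j1 \<in> arrows C A X" "p1 \<in> arrows C X A" "j2 \<in> arrows C B X" "p2 \<in> arrows C X B"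
    "p1 ** j1 = idn C A" "p2 ** j2 = idn C B" "p1 ** j2 = zr C B A" "p2 ** j1 = zr C A B"
    "pl C (j1 ** p1) (j2 ** p2) = idn C X"
  then show ?thesis using pl_commute[of "j1 ** p1" "j2 ** p2"]
    by (intro biprod2I[of j2 B X p2 j1 A p1]) auto
qed

lemma direct_sum2_generated:
  assumes "is_direct_sum2 C A B X"
  shows "A \<preceq> X" "B \<preceq> X" "\<And>M. A \<preceq> M \<Longrightarrow> B \<preceq> M \<Longrightarrow> X \<preceq> M"
proof -
  obtain j p where jp: "biprod C (UNIV :: bool set) (\<lambda>b. if b then A else B) X j p"
    using assms by (auto simp: is_direct_sum2_def is_direct_sum_iff)
  show "A \<preceq> X" "B \<preceq> X" using generated_biprod[OF jp, of True] generated_biprod[OF jp, of False] by auto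
  show "X \<preceq> M" if "A \<preceq> M" "B \<preceq> M" for M using that generated_Obj by (intro biprod_generated[OF jp]) auto
qed

text \<open>Decompose \<open>X\<close> repeatedly; each decomposition lowers the bound on the dimension of the
  endomorphism algebra. Recording only which indecomposables occur avoids all bookkeeping of
  multiplicities.\<close>

lemma finite_indecomposable_generators:
  assumes "X \<in> Obj C" "end_dim_le K C X d"
  shows "\<exists>T. finite T \<and> (\<forall>Z\<in>T. indecomposable C Z \<and> Z \<preceq> X) \<and>
    (\<forall>M\<in>Obj C. (\<forall>Z\<in>T. Z \<preceq> M) \<longrightarrow> X \<preceq> M)"
  using assms
proof (induction d arbitrary: X)
  have zero: "\<exists>T. finite T \<and> (\<forall>Z\<in>T. indecomposable C Z \<and> Z \<preceq> X) \<and>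
    (\<forall>M\<in>Obj C. (\<forall>Z\<in>T. Z \<preceq> M) \<longrightarrow> X \<preceq> M)" if "idn C X = zr C X X" "X \<in> Obj C" for X
    using that thru_zr by (intro exI[of _ "{}"]) (auto simp: generated_def)
  {
    case 0
    have "idn C X = zr C X X"
    proof -
      obtain c where c: "c 0 \<in> carrier K" "c 0 \<noteq> \<zero>\<^bsub>K\<^esub>" "sm C X X {..0::nat} (\<lambda>i. scl C (c i) (idn C X)) = zr C X X"
        using 0(2) 0(1) unfolding end_dim_le_def by (elim allE[of _ "\<lambda>i. idn C X"]) auto
      have "sm C X X {..0::nat} (\<lambda>i. scl C (c i) (idn C X)) = scl C (c 0) (idn C X)"
        using sm_single[of "{..0::nat}" 0 X X "\<lambda>i. scl C (c i) (idn C X)"] 0(1) c(1) by auto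
      then show ?thesis using scl_nonzero[of "idn C X" "c 0"] c 0(1) by auto
    qed
    then show ?case using zero 0(1) by blast
  next
    case (Suc d)
    consider "idn C X = zr C X X" | "indecomposable C X" | "idn C X \<noteq> zr C X X" "\<not> indecomposable C X" by blast
    then show ?case
    proof cases
      case 1
      then show ?thesis using zero Suc.prems by blast
    next
      case 2
      then show ?thesis using generated_refl Suc.prems by (intro exI[of _ "{X}"]) auto
    next
      case 3
      then obtain A B where AB: "is_direct_sum2 C A B X" "\<not> zero_object C A" "\<not> zero_object C B"
        using Suc.prems(1) by (auto simp: indecomposable_def zero_object_iff)
      have O: "A \<in> Obj C" "B \<in> Obj C" using direct_sum2_generated(1,2)[OF AB(1)] generated_Obj by blast+
      have nz: "idn C A \<noteq> zr C A A" "idn C B \<noteq> zr C B B" using AB O by (auto simp: zero_object_iff)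
      obtain TA where TA: "finite TA" "\<forall>Z\<in>TA. indecomposable C Z \<and> Z \<preceq> A"
        "\<forall>M\<in>Obj C. (\<forall>Z\<in>TA. Z \<preceq> M) \<longrightarrow> A \<preceq> M"
        using Suc.IH[OF O(1) end_dim_summand[OF AB(1) nz(2) Suc.prems(2)]] by blast
      obtain TB where TB: "finite TB" "\<forall>Z\<in>TB. indecomposable C Z \<and> Z \<preceq> B"
        "\<forall>M\<in>Obj C. (\<forall>Z\<in>TB. Z \<preceq> M) \<longrightarrow> B \<preceq> M"
        using Suc.IH[OF O(2) end_dim_summand[OF direct_sum2_swap[OF AB(1)] nz(1) Suc.prems(2)]] by blast
      show ?thesis
      proof (intro exI[of _ "TA \<union> TB"] conjI ballI impI)
        show "finite (TA \<union> TB)" using TA TB by simp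
        show "indecomposable C Z" "Z \<preceq> X" if "Z \<in> TA \<union> TB" for Z
          using that TA(2) TB(2) direct_sum2_generated(1,2)[OF AB(1)] generated_trans by blast+
        show "X \<preceq> M" if "M \<in> Obj C" "\<forall>Z\<in>TA \<union> TB. Z \<preceq> M" for M
          using that TA(3) TB(3) direct_sum2_generated(3)[OF AB(1)] by blast
      qed
    qed
  }
qed

text \<open>The direct sum of one object from each isomorphism class of indecomposables that occur.\<close>

theorem basic_generator_exists:
  assumes X: "X \<in> Obj C"
  obtains Y where "basic_object C Y" "Y \<in> Obj C" "X \<preceq> Y" "Y \<preceq> X"
proof -
  obtain T where T: "finite T" "\<And>Z. Z \<in> T \<Longrightarrow> indecomposable C Z \<and> Z \<preceq> X"
    "\<And>M. M \<in> Obj C \<Longrightarrow> (\<forall>Z\<in>T. Z \<preceq> M) \<Longrightarrow> X \<preceq> M"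
    using end_finite[OF X] finite_indecomposable_generators[OF X] by metis
  define rep where "rep Z = (SOME W. W \<in> T \<and> (Z, W) \<in> iso_rel C)" for Z
  have rep: "rep Z \<in> T \<and> (Z, rep Z) \<in> iso_rel C" if "Z \<in> T" for Z
    unfolding rep_def by (rule someI[of _ Z]) (use that T(2)[OF that] iso_rel_refl in \<open>auto simp: indecomposable_def\<close>)
  have rep_eq: "rep Z = rep W" if "(Z, W) \<in> iso_rel C" for Z W
    unfolding rep_def using that iso_rel_sym iso_rel_trans by (metis (no_types, lifting))
  have rep_rep: "rep (rep Z) = rep Z" if "Z \<in> T" for Z
    using rep_eq[OF iso_rel_sym] rep[OF that] by blast
  obtain n :: nat and f where f: "bij_betw f {..<n} (rep ` T)"
    using T(1) ex_bij_betw_nat_finite[of "rep ` T"] by (auto simp: atLeast0LessThan)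
  have fT: "f i \<in> rep ` T" if "i < n" for i using f that by (auto simp: bij_betw_def)
  then have fi: "indecomposable C (f i)" "f i \<preceq> X" "f i \<in> Obj C" "rep (f i) = f i" if "i < n" for i
    using that rep T(2) rep_rep by (fastforce simp: indecomposable_def)+
  obtain Y where "is_direct_sum C {..<n} f Y"
    using additive fi(3) unfolding additive_category_def by blast
  then obtain j p where Y: "biprod C {..<n} f Y j p" by (auto simp: is_direct_sum_iff)
  have YO: "Y \<in> Obj C" using biprodD(2)[OF Y] .
  have "(f i, f k) \<notin> iso_rel C" if "i < n" "k < n" "i \<noteq> k" for i k
    using rep_eq[of "f i" "f k"] fi(4) that f by (auto simp: bij_betw_def inj_on_def)
  then have "basic_object C Y" unfolding basic_object_iff_biprod using Y fi(1) by blast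
  moreover have "Y \<preceq> X" using biprod_generated[OF Y X] fi(2) by auto
  moreover have "Z \<preceq> Y" if "Z \<in> T" for Z
  proof -
    have "rep Z \<in> f ` {..<n}" using f that by (auto simp: bij_betw_def)
    then have "rep Z \<preceq> Y" using generated_biprod[OF Y] by auto
    moreover have "Z \<preceq> rep Z" using rep[OF that] iso_generated by blast
    ultimately show ?thesis using generated_trans by blast
  qed
  ultimately show ?thesis using that YO T(3)[OF YO] by blast
qed

lemma basic_object_iso:
  assumes "basic_object C X" "(X, Y) \<in> iso_rel C"
  shows "basic_object C Y"
proof -
  obtain n :: nat and Xs j p where X: "biprod C {..<n} Xs X j p" "\<forall>i<n. indecomposable C (Xs i)"
    "\<forall>i<n. \<forall>k<n. i \<noteq> k \<longrightarrow> (Xs i, Xs k) \<notin> iso_rel C"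
    using assms(1) unfolding basic_object_iff_biprod by blast
  obtain u where u: "u \<in> arrows C X Y" "iso_arr C u" using assms(2) by (auto simp: iso_rel_iff)
  note b = biprodD[OF X(1)]
  have Y: "Y \<in> Obj C" using u by auto
  have "biprod C {..<n} Xs Y (\<lambda>i. u ** j i) (\<lambda>i. p i ** ainv C u)"
    unfolding biprod_def
  proof (intro conjI ballI)
    show "(p k ** ainv C u) ** (u ** j i) = (if i = k then idn C (Xs i) else zr C (Xs i) (Xs k))"
      if "i \<in> {..<n}" "k \<in> {..<n}" for i k
      using that u b ainv_cancel(1)[OF u(2), of "j i"] by auto
    have "sm C Y Y {..<n} (\<lambda>i. (u ** j i) ** (p i ** ainv C u)) = sm C Y Y {..<n} (\<lambda>i. u ** ((j i ** p i) ** ainv C u))"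
      using u b Y by (intro sm_cong) auto
    also have "\<dots> = u ** (sm C X X {..<n} (\<lambda>i. j i ** p i) ** ainv C u)"
      using u b Y by (subst sm_cmp; (subst cmp_sm)?) auto
    also have "\<dots> = idn C Y" unfolding b(12) using u by auto
    finally show "sm C Y Y {..<n} (\<lambda>i. (u ** j i) ** (p i ** ainv C u)) = idn C Y" .
  qed (use u b in auto)
  then show ?thesis using X(2,3) unfolding basic_object_iff_biprod by blast
qed

end

locale ff_functor = lin_functor K C D F + C: krull_schmidt_category K C + D: krull_schmidt_category K D
  for K :: "'k ring" and C :: "('o, 'm, 'k) category" and D :: "('p, 'n, 'k) category"
    and F :: "('o, 'm, 'p, 'n) functr" +
  assumes faithful: "faithful_functor C F" and full: "full_functor C D F"
begin

lemma indecomposable_ob: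
  assumes "indecomposable C X"
  shows "indecomposable D (ob F X)"
  unfolding D.indecomposable_iff
proof (intro conjI ballI impI)
  have X: "X \<in> Obj C" "idn C X \<noteq> zr C X X" using assms by (auto simp: C.indecomposable_iff)
  show "ob F X \<in> Obj D" using X by simp
  show "idn D (ob F X) \<noteq> zr D (ob F X) (ob F X)"
    using X faithfulD[OF faithful, of "idn C X" "zr C X X"] by auto
  fix e assume e: "e \<in> arrows D (ob F X) (ob F X)" "e **\<^bsub>D\<^esub> e = e"
  obtain f where f: "is_arr C f" "src f = X" "trg f = X" "fmap F f = e"
    using fullE[OF full, of X X e] X e by auto
  have "f **\<^bsub>C\<^esub> f = f" using f e by - (rule faithfulD[OF faithful], auto simp: fmap_cmp)
  then have "f = zr C X X \<or> f = idn C X" using assms f by (auto simp: C.indecomposable_iff)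
  then show "e = zr D (ob F X) (ob F X) \<or> e = idn D (ob F X)"
    using f(4) fmap_zr[OF X(1,1)] fmap_idn[OF X(1)] by metis
qed

lemma iso_rel_reflect:
  assumes "X \<in> Obj C" "Y \<in> Obj C" "(ob F X, ob F Y) \<in> iso_rel D"
  shows "(X, Y) \<in> iso_rel C"
proof -
  obtain u where u: "is_arr D u" "src u = ob F X" "trg u = ob F Y" "iso_arr D u"
    using assms(3) by (auto simp: iso_rel_iff)
  obtain f where f: "is_arr C f" "src f = X" "trg f = Y" "fmap F f = u"
    using fullE[OF full assms(1,2) u(1-3)] by metis
  obtain g where g: "is_arr C g" "src g = Y" "trg g = X" "fmap F g = ainv D u"
    using fullE[OF full assms(2,1), of "ainv D u"] u by auto
  have "g **\<^bsub>C\<^esub> f = idn C X" using f g u assms by - (rule faithfulD[OF faithful], auto simp: fmap_cmp)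
  moreover have "f **\<^bsub>C\<^esub> g = idn C Y" using f g u assms by - (rule faithfulD[OF faithful], auto simp: fmap_cmp)
  ultimately have "inverses C f g" using f g by (auto simp: inverses_def)
  then show ?thesis using f by (intro iso_relI[of C f]) (auto simp: iso_arr_def)
qed

lemma basic_object_ob:
  assumes "basic_object C X"
  shows "basic_object D (ob F X)"
proof -
  obtain n :: nat and Xs j p where X: "biprod C {..<n} Xs X j p" "\<forall>i<n. indecomposable C (Xs i)"
    "\<forall>i<n. \<forall>k<n. i \<noteq> k \<longrightarrow> (Xs i, Xs k) \<notin> iso_rel C"
    using assms unfolding C.basic_object_iff_biprod by blast
  have O: "Xs i \<in> Obj C" if "i < n" for i using biprodD(9)[OF X(1)] that by simp
  show ?thesis unfolding D.basic_object_iff_biprod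
    using biprod_fmap[OF X(1)] X(2,3) indecomposable_ob iso_rel_reflect O by meson
qed

end

section \<open>Characters of a split abelian group\<close>

locale split_abelian_group = K: field K + G: comm_group G
  for K :: "'k ring" and G :: "'g monoid" (structure) +
  assumes finite_G: "finite (carrier G)" and splits: "splits_over G K"
begin

abbreviation "Gd \<equiv> character_group K G"

lemma char_iff:
  "\<chi> \<in> carrier Gd \<longleftrightarrow> \<chi> \<in> extensional (carrier G) \<and> (\<forall>g\<in>carrier G. \<chi> g \<in> Units K) \<and>
    (\<forall>g\<in>carrier G. \<forall>h\<in>carrier G. \<chi> (g \<otimes> h) = \<chi> g \<otimes>\<^bsub>K\<^esub> \<chi> h)"
  by (auto simp: character_group_def hom_def units_of_def)

lemma char_closed [simp]: "\<chi> \<in> carrier Gd \<Longrightarrow> g \<in> carrier G \<Longrightarrow> \<chi> g \<in> carrier K"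
  by (auto simp: char_iff)

lemma char_Units: "\<chi> \<in> carrier Gd \<Longrightarrow> g \<in> carrier G \<Longrightarrow> \<chi> g \<in> Units K"
  by (auto simp: char_iff)

lemma char_mult: "\<chi> \<in> carrier Gd \<Longrightarrow> g \<in> carrier G \<Longrightarrow> h \<in> carrier G \<Longrightarrow> \<chi> (g \<otimes> h) = \<chi> g \<otimes>\<^bsub>K\<^esub> \<chi> h"
  by (auto simp: char_iff)

lemma char_one [simp]: "\<chi> \<in> carrier Gd \<Longrightarrow> \<chi> \<one> = \<one>\<^bsub>K\<^esub>"
  using char_mult[of \<chi> \<one> \<one>] char_Units[of \<chi> \<one>]
  by (metis G.l_one G.one_closed K.Units_closed K.Units_l_cancel K.one_closed K.r_one)

lemma char_inv [simp]:
  assumes "\<chi> \<in> carrier Gd" "g \<in> carrier G"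
  shows "\<chi> g \<otimes>\<^bsub>K\<^esub> \<chi> (inv g) = \<one>\<^bsub>K\<^esub>" "\<chi> (inv g) \<otimes>\<^bsub>K\<^esub> \<chi> g = \<one>\<^bsub>K\<^esub>"
  using char_mult[OF assms G.inv_closed[OF assms(2)]] char_mult[OF assms(1) G.inv_closed[OF assms(2)] assms(2)] assms
  by simp_all

lemma char_mult_apply: "g \<in> carrier G \<Longrightarrow> (\<chi> \<otimes>\<^bsub>Gd\<^esub> \<psi>) g = \<chi> g \<otimes>\<^bsub>K\<^esub> \<psi> g"
  by (simp add: character_group_def)

lemma char_one_apply: "g \<in> carrier G \<Longrightarrow> \<one>\<^bsub>Gd\<^esub> g = \<one>\<^bsub>K\<^esub>"
  by (simp add: character_group_def)

lemma char_eqI: "\<chi> \<in> carrier Gd \<Longrightarrow> \<psi> \<in> carrier Gd \<Longrightarrow> (\<And>g. g \<in> carrier G \<Longrightarrow> \<chi> g = \<psi> g) \<Longrightarrow> \<chi> = \<psi>"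
  by (rule extensionalityI[of _ "carrier G"]) (auto simp: char_iff)

lemma character_group: "comm_group Gd"
proof (rule comm_groupI)
  fix \<chi> \<psi> assume *: "\<chi> \<in> carrier Gd" "\<psi> \<in> carrier Gd"
  show "\<chi> \<otimes>\<^bsub>Gd\<^esub> \<psi> \<in> carrier Gd"
    using * unfolding char_iff
    by (auto simp: char_mult_apply K.m_ac K.Units_closed) (simp add: character_group_def)
  show "\<chi> \<otimes>\<^bsub>Gd\<^esub> \<psi> = \<psi> \<otimes>\<^bsub>Gd\<^esub> \<chi>"
    unfolding character_group_def using * by (auto intro!: restrict_ext K.m_comm)
next
  fix \<chi> \<psi> \<omega> assume *: "\<chi> \<in> carrier Gd" "\<psi> \<in> carrier Gd" "\<omega> \<in> carrier Gd"
  then have "\<chi> g \<in> carrier K" "\<psi> g \<in> carrier K" "\<omega> g \<in> carrier K" if "g \<in> carrier G" for g using that by simp_all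
  then show "\<chi> \<otimes>\<^bsub>Gd\<^esub> \<psi> \<otimes>\<^bsub>Gd\<^esub> \<omega> = \<chi> \<otimes>\<^bsub>Gd\<^esub> (\<psi> \<otimes>\<^bsub>Gd\<^esub> \<omega>)"
    unfolding character_group_def by (auto intro!: restrict_ext K.m_assoc)
next
  show one: "\<one>\<^bsub>Gd\<^esub> \<in> carrier Gd" unfolding char_iff by (auto simp: char_one_apply) (simp add: character_group_def)
  fix \<chi> assume c: "\<chi> \<in> carrier Gd"
  show "\<one>\<^bsub>Gd\<^esub> \<otimes>\<^bsub>Gd\<^esub> \<chi> = \<chi>"
    using c by (intro extensionalityI[of _ "carrier G"])
      (auto simp: char_mult_apply char_one_apply char_iff, simp add: character_group_def)
  define \<psi> where "\<psi> = (\<lambda>g\<in>carrier G. \<chi> (inv g))"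
  have "\<psi> \<in> carrier Gd"
    using c unfolding char_iff by (auto simp: \<psi>_def G.inv_mult)
  moreover have "\<psi> \<otimes>\<^bsub>Gd\<^esub> \<chi> = \<one>\<^bsub>Gd\<^esub>"
    unfolding character_group_def \<psi>_def using c by (auto intro!: restrict_ext)
  ultimately show "\<exists>\<psi>\<in>carrier Gd. \<psi> \<otimes>\<^bsub>Gd\<^esub> \<chi> = \<one>\<^bsub>Gd\<^esub>" by blast
qed

sublocale Gd: comm_group Gd by (rule character_group)

lemma char_inv_apply: "\<chi> \<in> carrier Gd \<Longrightarrow> g \<in> carrier G \<Longrightarrow> (inv\<^bsub>Gd\<^esub> \<chi>) g = \<chi> (inv g)"
proof -
  assume *: "\<chi> \<in> carrier Gd" "g \<in> carrier G"
  have "(inv\<^bsub>Gd\<^esub> \<chi>) g \<otimes>\<^bsub>K\<^esub> \<chi> g = \<one>\<^bsub>K\<^esub>"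
    using * char_mult_apply[of g "inv\<^bsub>Gd\<^esub> \<chi>" \<chi>] char_one_apply by simp
  then show ?thesis using * K.inv_unique'[of "\<chi> g" "\<chi> (inv g)"] K.inv_unique'[of "\<chi> g" "(inv\<^bsub>Gd\<^esub> \<chi>) g"]
    by (simp add: K.m_comm)
qed

text \<open>The order of \<open>G\<close> as an element of the field.\<close>

definition ordK :: 'k where "ordK = (\<Oplus>\<^bsub>K\<^esub>g\<in>carrier G. \<one>\<^bsub>K\<^esub>)"

lemma ordK_closed [simp]: "ordK \<in> carrier K"
  by (simp add: ordK_def)

lemma translate_bij: "g \<in> carrier G \<Longrightarrow> bij_betw (\<lambda>h. g \<otimes> h) (carrier G) (carrier G)"
  unfolding bij_betw_def by (simp add: G.inj_on_cmult G.surj_const_mult)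

lemma finsum_translate:
  assumes "g \<in> carrier G" "\<And>h. h \<in> carrier G \<Longrightarrow> f h \<in> carrier K"
  shows "(\<Oplus>\<^bsub>K\<^esub>h\<in>carrier G. f h) = (\<Oplus>\<^bsub>K\<^esub>h\<in>carrier G. f (g \<otimes> h))"
  using K.finsum_reindex[of f "\<lambda>h. g \<otimes> h" "carrier G"] translate_bij[OF assms(1)] assms
  by (auto simp: bij_betw_def)

text \<open>Translating the sum by \<open>g\<close> multiplies it by \<open>\<chi> g\<close>, so it vanishes when \<open>\<chi> g \<noteq> 1\<close>.\<close>

lemma sum_char:
  assumes "\<chi> \<in> carrier Gd"
  shows "(\<Oplus>\<^bsub>K\<^esub>g\<in>carrier G. \<chi> g) = (if \<chi> = \<one>\<^bsub>Gd\<^esub> then ordK else \<zero>\<^bsub>K\<^esub>)"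
proof (cases "\<chi> = \<one>\<^bsub>Gd\<^esub>")
  case True
  have "(\<Oplus>\<^bsub>K\<^esub>g\<in>carrier G. \<chi> g) = ordK"
    unfolding ordK_def using True by (intro K.finsum_cong') (auto simp: char_one_apply)
  then show ?thesis using True by simp
next
  case False
  then obtain g where g: "g \<in> carrier G" "\<chi> g \<noteq> \<one>\<^bsub>K\<^esub>"
    using char_eqI[OF assms Gd.one_closed] char_one_apply by metis
  let ?S = "\<Oplus>\<^bsub>K\<^esub>g\<in>carrier G. \<chi> g"
  have S: "?S \<in> carrier K" using assms by auto
  have "?S = (\<Oplus>\<^bsub>K\<^esub>h\<in>carrier G. \<chi> (g \<otimes> h))" using g assms by (intro finsum_translate) auto
  also have "\<dots> = (\<Oplus>\<^bsub>K\<^esub>h\<in>carrier G. \<chi> g \<otimes>\<^bsub>K\<^esub> \<chi> h)" using g assms by (intro K.finsum_cong') (auto simp: char_mult)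
  also have "\<dots> = \<chi> g \<otimes>\<^bsub>K\<^esub> ?S" using g assms finite_G by (subst K.finsum_rdistr) auto
  finally have "?S = \<chi> g \<otimes>\<^bsub>K\<^esub> ?S" .
  then have "(\<one>\<^bsub>K\<^esub> \<ominus>\<^bsub>K\<^esub> \<chi> g) \<otimes>\<^bsub>K\<^esub> ?S = \<zero>\<^bsub>K\<^esub>"
    using S g assms by (simp add: K.l_distr K.l_minus a_minus_def K.r_neg)
  moreover have "\<one>\<^bsub>K\<^esub> \<ominus>\<^bsub>K\<^esub> \<chi> g \<noteq> \<zero>\<^bsub>K\<^esub>"
  proof
    assume "\<one>\<^bsub>K\<^esub> \<ominus>\<^bsub>K\<^esub> \<chi> g = \<zero>\<^bsub>K\<^esub>"
    moreover have "\<one>\<^bsub>K\<^esub> \<ominus>\<^bsub>K\<^esub> \<chi> g \<oplus>\<^bsub>K\<^esub> \<chi> g = \<one>\<^bsub>K\<^esub>" using g assms by (simp add: a_minus_def K.a_assoc K.l_neg)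
    ultimately show False using g assms by simp
  qed
  ultimately have "?S = \<zero>\<^bsub>K\<^esub>" using S g assms K.integral_iff by auto
  then show ?thesis using False by simp
qed

text \<open>The coordinates of \<open>kG \<cong> k^n\<close> are \<open>n\<close> characters \<open>\<chi>\<^sub>i\<close>, and the preimage \<open>e\<^sub>i\<close> of the
  \<open>i\<close>-th unit vector satisfies \<open>g e\<^sub>i = \<chi>\<^sub>i(g) e\<^sub>i\<close>, hence \<open>e\<^sub>i = c\<^sub>i \<Sum> \<chi>\<^sub>i(g\<inverse>) g\<close>. Comparing
  coefficients in \<open>e\<^sub>i e\<^sub>i = e\<^sub>i\<close> gives \<open>c\<^sub>i |G| = 1\<close>, and in \<open>\<Sum> e\<^sub>i = 1\<close> column orthogonality.\<close>

lemma characters_enumerated: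
  obtains n :: nat and x where "ordK \<noteq> \<zero>\<^bsub>K\<^esub>" "\<And>i. i < n \<Longrightarrow> x i \<in> carrier Gd" "inj_on x {..<n}"
    "\<And>g. g \<in> carrier G \<Longrightarrow> (\<Oplus>\<^bsub>K\<^esub>i\<in>{..<n}. x i g) = (if g = \<one> then ordK else \<zero>\<^bsub>K\<^esub>)"
proof -
  let ?A = "group_algebra K G"
  obtain n \<phi> where phi: "\<phi> \<in> ring_iso ?A (power_algebra K n)" and
    lin: "\<And>c a. c \<in> carrier K \<Longrightarrow> a \<in> carrier ?A \<Longrightarrow> \<phi> (c \<odot>\<^bsub>?A\<^esub> a) = c \<odot>\<^bsub>power_algebra K n\<^esub> \<phi> a"
    using splits unfolding splits_over_def by blast
  let ?P = "power_algebra K n"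
  have bij: "bij_betw \<phi> (carrier ?A) (carrier ?P)" and hom: "\<phi> \<in> ring_hom ?A ?P"
    using phi by (auto simp: ring_iso_def)
  have P: "\<phi> a \<in> carrier ?P" if "a \<in> carrier ?A" for a using bij that by (auto simp: bij_betw_def)
  have Pi: "\<phi> a i \<in> carrier K" if "a \<in> carrier ?A" "i < n" for a i
    using P[OF that(1)] that(2) by (auto simp: power_algebra_def)
  have inj: "a = b" if "a \<in> carrier ?A" "b \<in> carrier ?A" "\<And>i. i < n \<Longrightarrow> \<phi> a i = \<phi> b i" for a b
  proof -
    have "\<phi> a = \<phi> b" using P[OF that(1)] P[OF that(2)] that(3)
      by (auto simp: power_algebra_def intro: PiE_ext)
    then show ?thesis using bij that by (auto simp: bij_betw_def inj_on_def)
  qed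
  have pm: "\<phi> (a \<otimes>\<^bsub>?A\<^esub> b) i = \<phi> a i \<otimes>\<^bsub>K\<^esub> \<phi> b i" if "a \<in> carrier ?A" "b \<in> carrier ?A" "i < n" for a b i
    using ring_hom_mult[OF hom that(1,2)] that(3) by (simp add: power_algebra_def)
  have pa: "\<phi> (a \<oplus>\<^bsub>?A\<^esub> b) i = \<phi> a i \<oplus>\<^bsub>K\<^esub> \<phi> b i" if "a \<in> carrier ?A" "b \<in> carrier ?A" "i < n" for a b i
    using ring_hom_add[OF hom that(1,2)] that(3) by (simp add: power_algebra_def)
  have p1: "\<phi> \<one>\<^bsub>?A\<^esub> i = \<one>\<^bsub>K\<^esub>" if "i < n" for i
    using ring_hom_one[OF hom] that by (simp add: power_algebra_def)
  have ps: "\<phi> (c \<odot>\<^bsub>?A\<^esub> a) i = c \<otimes>\<^bsub>K\<^esub> \<phi> a i" if "c \<in> carrier K" "a \<in> carrier ?A" "i < n" for c a i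
    using lin[OF that(1,2)] that(3) by (simp add: power_algebra_def)
  have A: "a \<in> carrier ?A \<longleftrightarrow> a \<in> carrier G \<rightarrow>\<^sub>E carrier K" for a by (simp add: group_algebra_def)
  have Am: "a \<otimes>\<^bsub>?A\<^esub> b \<in> carrier ?A" if "a \<in> carrier ?A" "b \<in> carrier ?A" for a b
    using that unfolding A by (auto simp: group_algebra_def intro!: K.finsum_closed)
  have As: "c \<odot>\<^bsub>?A\<^esub> b \<in> carrier ?A" if "c \<in> carrier K" "b \<in> carrier ?A" for c b
    using that unfolding A by (auto simp: group_algebra_def)
  have Aa: "a \<oplus>\<^bsub>?A\<^esub> b \<in> carrier ?A" if "a \<in> carrier ?A" "b \<in> carrier ?A" for a b
    using that unfolding A by (auto simp: group_algebra_def)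
  have A1: "\<one>\<^bsub>?A\<^esub> \<in> carrier ?A" unfolding A by (auto simp: group_algebra_def)
  \<comment> \<open>The element \<open>g\<close> of the group algebra.\<close>
  define d where "d g = (\<lambda>h\<in>carrier G. if h = g then \<one>\<^bsub>K\<^esub> else \<zero>\<^bsub>K\<^esub>)" for g
  have dA: "d g \<in> carrier ?A" for g unfolding A by (auto simp: d_def)
  have d_mult: "(d g \<otimes>\<^bsub>?A\<^esub> b) h = b (inv g \<otimes> h)" if "g \<in> carrier G" "h \<in> carrier G" "b \<in> carrier ?A" for g h b
  proof -
    have "(d g \<otimes>\<^bsub>?A\<^esub> b) h = (\<Oplus>\<^bsub>K\<^esub>l\<in>carrier G. d g l \<otimes>\<^bsub>K\<^esub> b (inv l \<otimes> h))"
      using that(2) by (simp add: group_algebra_def)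
    also have "\<dots> = (\<Oplus>\<^bsub>K\<^esub>l\<in>carrier G. if g = l then b (inv l \<otimes> h) else \<zero>\<^bsub>K\<^esub>)"
      using that(2) PiE_mem[OF that(3)[unfolded A]] by (intro K.finsum_cong') (auto simp: d_def)
    also have "\<dots> = b (inv g \<otimes> h)"
      using that finite_G unfolding A by (intro K.finsum_singleton) auto
    finally show ?thesis .
  qed
  have dd: "d g \<otimes>\<^bsub>?A\<^esub> d h = d (g \<otimes> h)" if g: "g \<in> carrier G" and h: "h \<in> carrier G" for g h
  proof (rule extensionalityI[of _ "carrier G"])
    fix l assume l: "l \<in> carrier G"
    have "inv g \<otimes> l = h \<longleftrightarrow> l = g \<otimes> h" using g h l by (metis G.inv_closed G.inv_solve_left)
    then show "(d g \<otimes>\<^bsub>?A\<^esub> d h) l = d (g \<otimes> h) l" using d_mult[OF g l dA] g h l by (simp add: d_def)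
  qed (auto simp: group_algebra_def d_def)
  have d1: "d \<one> = \<one>\<^bsub>?A\<^esub>" by (simp add: d_def group_algebra_def)
  define x where "x i = (\<lambda>g\<in>carrier G. \<phi> (d g) i)" for i
  have xm: "x i (g \<otimes> h) = x i g \<otimes>\<^bsub>K\<^esub> x i h" if "i < n" "g \<in> carrier G" "h \<in> carrier G" for i g h
    using pm[OF dA dA that(1), of g h] dd that by (simp add: x_def)
  have x1: "x i \<one> = \<one>\<^bsub>K\<^esub>" if "i < n" for i using p1[OF that] d1 by (simp add: x_def)
  have xK: "x i g \<in> carrier K" if "i < n" "g \<in> carrier G" for i g using Pi[OF dA that(1)] that(2) by (simp add: x_def)
  have x: "x i \<in> carrier Gd" if i: "i < n" for i
    unfolding char_iff
  proof (intro conjI ballI)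
    fix g assume g: "g \<in> carrier G"
    have "x i g \<otimes>\<^bsub>K\<^esub> x i (inv g) = \<one>\<^bsub>K\<^esub>" using xm[OF i g, of "inv g"] x1[OF i] g by simp
    then show "x i g \<in> Units K" using xK[OF i] g
      by (auto simp: Units_def K.m_comm intro!: bexI[of _ "x i (inv g)"])
  qed (use xm[OF i] in \<open>auto simp: x_def\<close>)
  \<comment> \<open>The idempotents of the coordinates, and below their preimages.\<close>
  define un where "un i = (\<lambda>j\<in>{..<n}. if j = i then \<one>\<^bsub>K\<^esub> else \<zero>\<^bsub>K\<^esub>)" for i
  have "\<exists>e. e \<in> carrier ?A \<and> \<phi> e = un i" for i
  proof -
    have "un i \<in> carrier ?P" by (auto simp: un_def power_algebra_def)
    then have "un i \<in> \<phi> ` carrier ?A" using bij by (simp add: bij_betw_def)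
    then show ?thesis by auto
  qed
  then obtain e where e: "\<And>i. e i \<in> carrier ?A" "\<And>i. \<phi> (e i) = un i" by metis
  have eK: "e i g \<in> carrier K" if "g \<in> carrier G" for i g using e(1)[of i] that unfolding A by auto
  have de: "d g \<otimes>\<^bsub>?A\<^esub> e i = x i g \<odot>\<^bsub>?A\<^esub> e i" if "i < n" "g \<in> carrier G" for i g
  proof (rule inj)
    fix j assume j: "j < n"
    show "\<phi> (d g \<otimes>\<^bsub>?A\<^esub> e i) j = \<phi> (x i g \<odot>\<^bsub>?A\<^esub> e i) j"
      using pm[OF dA e(1) j] ps[OF xK[OF that] e(1) j] e(2) j that Pi[OF dA that(1)] Pi[OF dA j]
      by (auto simp: un_def x_def)
  qed (use dA e Am As xK that in auto)
  define c where "c i = e i \<one>" for i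
  have cK: "c i \<in> carrier K" for i using eK by (simp add: c_def)
  have ec: "e i g = x i (inv g) \<otimes>\<^bsub>K\<^esub> c i" if i: "i < n" and g: "g \<in> carrier G" for i g
  proof -
    have "(d (inv g) \<otimes>\<^bsub>?A\<^esub> e i) \<one> = e i g" using d_mult[of "inv g" \<one> "e i"] e(1) g by simp
    then have "e i g = (x i (inv g) \<odot>\<^bsub>?A\<^esub> e i) \<one>" using de[OF i, of "inv g"] g by simp
    then show ?thesis by (simp add: group_algebra_def c_def)
  qed
  have cN: "c i \<otimes>\<^bsub>K\<^esub> ordK = \<one>\<^bsub>K\<^esub>" if i: "i < n" for i
  proof -
    note xi = x[OF i]
    have ee: "e i \<otimes>\<^bsub>?A\<^esub> e i = e i"
      using pm[OF e(1) e(1)] e(2) by (intro inj) (auto simp: un_def intro!: Am e)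
    have "e i \<one> = (\<Oplus>\<^bsub>K\<^esub>l\<in>carrier G. e i l \<otimes>\<^bsub>K\<^esub> e i (inv l \<otimes> \<one>))"
      by (subst ee[symmetric]) (simp add: group_algebra_def)
    also have "\<dots> = (\<Oplus>\<^bsub>K\<^esub>l\<in>carrier G. (c i \<otimes>\<^bsub>K\<^esub> c i) \<otimes>\<^bsub>K\<^esub> \<one>\<^bsub>K\<^esub>)"
    proof (intro K.finsum_cong')
      fix l assume l: "l \<in> carrier G"
      have "e i l \<otimes>\<^bsub>K\<^esub> e i (inv l \<otimes> \<one>) = (x i (inv l) \<otimes>\<^bsub>K\<^esub> c i) \<otimes>\<^bsub>K\<^esub> (x i l \<otimes>\<^bsub>K\<^esub> c i)"
        using ec[OF i l] ec[OF i, of "inv l"] l by simp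
      also have "\<dots> = (x i (inv l) \<otimes>\<^bsub>K\<^esub> x i l) \<otimes>\<^bsub>K\<^esub> (c i \<otimes>\<^bsub>K\<^esub> c i)"
        using xi l cK[of i] by (simp add: K.m_ac)
      finally show "e i l \<otimes>\<^bsub>K\<^esub> e i (inv l \<otimes> \<one>) = (c i \<otimes>\<^bsub>K\<^esub> c i) \<otimes>\<^bsub>K\<^esub> \<one>\<^bsub>K\<^esub>" using xi l cK[of i] by simp
    qed (use cK in auto)
    also have "\<dots> = (c i \<otimes>\<^bsub>K\<^esub> c i) \<otimes>\<^bsub>K\<^esub> ordK"
      unfolding ordK_def using finite_G cK by (subst K.finsum_rdistr) auto
    finally have "c i = c i \<otimes>\<^bsub>K\<^esub> (c i \<otimes>\<^bsub>K\<^esub> ordK)" using cK[of i] by (simp add: c_def[symmetric] K.m_assoc)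
    moreover have "c i \<noteq> \<zero>\<^bsub>K\<^esub>"
    proof
      assume "c i = \<zero>\<^bsub>K\<^esub>"
      then have ez: "e i g = \<zero>\<^bsub>K\<^esub>" if "g \<in> carrier G" for g using ec[OF i that] xi that by simp
      have "e i = \<zero>\<^bsub>K\<^esub> \<odot>\<^bsub>?A\<^esub> e i"
        using e(1)[of i] ez unfolding A
        by (intro extensionalityI[of _ "carrier G"]) (auto simp: group_algebra_def PiE_def)
      then have "\<phi> (e i) i = \<zero>\<^bsub>K\<^esub>" using ps[of "\<zero>\<^bsub>K\<^esub>" "e i" i] e(1) i Pi[OF e(1) i] by simp
      then show False using e(2) i by (simp add: un_def)
    qed
    ultimately have "c i \<otimes>\<^bsub>K\<^esub> (c i \<otimes>\<^bsub>K\<^esub> ordK) = c i \<otimes>\<^bsub>K\<^esub> \<one>\<^bsub>K\<^esub>" using cK[of i] by simp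
    then show ?thesis using cK[of i] \<open>c i \<noteq> \<zero>\<^bsub>K\<^esub>\<close> K.m_lcancel[of "c i" "c i \<otimes>\<^bsub>K\<^esub> ordK" "\<one>\<^bsub>K\<^esub>"] by simp
  qed
  \<comment> \<open>Initial segments of \<open>\<Sum> e\<^sub>i\<close>, as \<open>\<phi>\<close> is known to be additive for two summands.\<close>
  have partial: "\<phi> (\<lambda>g\<in>carrier G. \<Oplus>\<^bsub>K\<^esub>i\<in>{..<m}. e i g) j = (if j < m then \<one>\<^bsub>K\<^esub> else \<zero>\<^bsub>K\<^esub>)"
    if "m \<le> n" "j < n" for m j
    using that
  proof (induction m)
    case 0
    have "(\<lambda>g\<in>carrier G. \<Oplus>\<^bsub>K\<^esub>i\<in>{..<0::nat}. e i g) = \<zero>\<^bsub>K\<^esub> \<odot>\<^bsub>?A\<^esub> \<one>\<^bsub>?A\<^esub>"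
      by (auto simp: group_algebra_def)
    then show ?case using ps[of "\<zero>\<^bsub>K\<^esub>" "\<one>\<^bsub>?A\<^esub>" j] A1 Pi[OF A1] 0 by simp
  next
    case (Suc m)
    let ?a = "\<lambda>g\<in>carrier G. \<Oplus>\<^bsub>K\<^esub>i\<in>{..<m}. e i g"
    have aA: "?a \<in> carrier ?A" unfolding A using eK by auto
    have "(\<lambda>g\<in>carrier G. \<Oplus>\<^bsub>K\<^esub>i\<in>{..<Suc m}. e i g) = e m \<oplus>\<^bsub>?A\<^esub> ?a"
      using eK unfolding lessThan_Suc by (auto simp: group_algebra_def intro!: restrict_ext)
    then show ?case using pa[OF e(1)[of m] aA Suc.prems(2)] Suc e(2)[of m]
      by (auto simp: un_def)
  qed
  have "(\<lambda>g\<in>carrier G. \<Oplus>\<^bsub>K\<^esub>i\<in>{..<n}. e i g) = \<one>\<^bsub>?A\<^esub>"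
    using partial[of n] p1 A1 eK by (intro inj) (auto simp: A)
  then have sum_e: "(\<Oplus>\<^bsub>K\<^esub>i\<in>{..<n}. e i g) = (if g = \<one> then \<one>\<^bsub>K\<^esub> else \<zero>\<^bsub>K\<^esub>)" if "g \<in> carrier G" for g
    using that by (auto simp: group_algebra_def fun_eq_iff restrict_def split: if_splits)
  \<comment> \<open>As \<open>1 \<noteq> 0\<close> in \<open>k\<close>, there is at least one coordinate.\<close>
  have "n \<noteq> 0" using sum_e[of \<one>] by (cases n) auto
  then have N0: "ordK \<noteq> \<zero>\<^bsub>K\<^esub>" using cN[of 0] cK[of 0] by auto
  have col: "(\<Oplus>\<^bsub>K\<^esub>i\<in>{..<n}. x i g) = (if g = \<one> then ordK else \<zero>\<^bsub>K\<^esub>)" if g: "g \<in> carrier G" for g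
  proof -
    have "(\<Oplus>\<^bsub>K\<^esub>i\<in>{..<n}. x i g) = (\<Oplus>\<^bsub>K\<^esub>i\<in>{..<n}. ordK \<otimes>\<^bsub>K\<^esub> e i (inv g))"
    proof (intro K.finsum_cong')
      fix i assume "i \<in> {..<n}"
      then have i: "i < n" by simp
      have "ordK \<otimes>\<^bsub>K\<^esub> e i (inv g) = x i g \<otimes>\<^bsub>K\<^esub> (c i \<otimes>\<^bsub>K\<^esub> ordK)"
        using ec[OF i, of "inv g"] g xK[OF i g] cK[of i] by (simp add: K.m_ac)
      then show "x i g = ordK \<otimes>\<^bsub>K\<^esub> e i (inv g)" using cN[OF i] xK[OF i g] by simp
    qed (use eK g in auto)
    also have "\<dots> = ordK \<otimes>\<^bsub>K\<^esub> (\<Oplus>\<^bsub>K\<^esub>i\<in>{..<n}. e i (inv g))"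
      using eK g by (subst K.finsum_rdistr) auto
    also have "\<dots> = (if g = \<one> then ordK else \<zero>\<^bsub>K\<^esub>)" using sum_e[of "inv g"] g by (auto simp: G.inv_eq_1_iff)
    finally show ?thesis .
  qed
  have "inj_on x {..<n}"
  proof (rule inj_onI)
    fix i j assume ij: "i \<in> {..<n}" "j \<in> {..<n}" "x i = x j"
    have "c i \<otimes>\<^bsub>K\<^esub> ordK = c j \<otimes>\<^bsub>K\<^esub> ordK" using cN ij by simp
    then have "c i = c j" using K.m_rcancel[OF N0, of "c i" "c j"] cK by simp
    then have "e i g = e j g" if "g \<in> carrier G" for g using ec[of i g] ec[of j g] ij that by simp
    then have "e i = e j" using e(1)[of i] e(1)[of j] unfolding A
      by (intro extensionalityI[of _ "carrier G"]) (auto simp: PiE_def)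
    then have "un i i = un j i" using e(2) by metis
    then show "i = j" using ij by (auto simp: un_def split: if_splits)
  qed
  then show ?thesis using that[OF N0 x _ col] by blast
qed

lemma ordK_nonzero: "ordK \<noteq> \<zero>\<^bsub>K\<^esub>"
  using characters_enumerated by metis

text \<open>A character \<open>\<psi>\<close> different from all \<open>\<chi>\<^sub>i\<close> would be orthogonal to each of them. Then
  \<open>\<Sum>\<^sub>g \<psi>(g\<inverse>) \<Sum>\<^sub>i \<chi>\<^sub>i(g)\<close> would vanish, but by column orthogonality it equals \<open>|G|\<close>.\<close>

lemma sum_char_eval: "g \<in> carrier G \<Longrightarrow> (\<Oplus>\<^bsub>K\<^esub>\<chi>\<in>carrier Gd. \<chi> g) = (if g = \<one> then ordK else \<zero>\<^bsub>K\<^esub>)"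
  and finite_chars: "finite (carrier Gd)"
proof -
  obtain n :: nat and x where x: "\<And>i. i < n \<Longrightarrow> x i \<in> carrier Gd" "inj_on x {..<n}"
    "\<And>g. g \<in> carrier G \<Longrightarrow> (\<Oplus>\<^bsub>K\<^esub>i\<in>{..<n}. x i g) = (if g = \<one> then ordK else \<zero>\<^bsub>K\<^esub>)"
    using characters_enumerated by metis
  have "\<psi> \<in> x ` {..<n}" if \<psi>: "\<psi> \<in> carrier Gd" for \<psi>
  proof (rule ccontr)
    assume not: "\<psi> \<notin> x ` {..<n}"
    have "ordK = (\<Oplus>\<^bsub>K\<^esub>g\<in>carrier G. if \<one> = g then ordK else \<zero>\<^bsub>K\<^esub>)"
      using K.add.finprod_singleton[of \<one> "carrier G" "\<lambda>_. ordK"] finite_G by simp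
    also have "\<dots> = (\<Oplus>\<^bsub>K\<^esub>g\<in>carrier G. \<psi> (inv g) \<otimes>\<^bsub>K\<^esub> (\<Oplus>\<^bsub>K\<^esub>i\<in>{..<n}. x i g))"
      using x \<psi> by (intro K.finsum_cong') auto
    also have "\<dots> = (\<Oplus>\<^bsub>K\<^esub>g\<in>carrier G. \<Oplus>\<^bsub>K\<^esub>i\<in>{..<n}. \<psi> (inv g) \<otimes>\<^bsub>K\<^esub> x i g)"
      using x \<psi> by (intro K.finsum_cong' K.finsum_rdistr) auto
    also have "\<dots> = (\<Oplus>\<^bsub>K\<^esub>i\<in>{..<n}. \<Oplus>\<^bsub>K\<^esub>g\<in>carrier G. \<psi> (inv g) \<otimes>\<^bsub>K\<^esub> x i g)"
      using x \<psi> finite_G by (intro K.finsum_finsum_swap) auto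
    also have "\<dots> = (\<Oplus>\<^bsub>K\<^esub>i\<in>{..<n}. \<zero>\<^bsub>K\<^esub>)"
    proof (intro K.finsum_cong')
      fix i assume "i \<in> {..<n}"
      then have i: "i < n" by simp
      have "(\<Oplus>\<^bsub>K\<^esub>g\<in>carrier G. \<psi> (inv g) \<otimes>\<^bsub>K\<^esub> x i g) = (\<Oplus>\<^bsub>K\<^esub>g\<in>carrier G. (inv\<^bsub>Gd\<^esub> \<psi> \<otimes>\<^bsub>Gd\<^esub> x i) g)"
        using x(1)[OF i] \<psi> by (intro K.finsum_cong') (auto simp: char_mult_apply char_inv_apply)
      also have "\<dots> = (if inv\<^bsub>Gd\<^esub> \<psi> \<otimes>\<^bsub>Gd\<^esub> x i = \<one>\<^bsub>Gd\<^esub> then ordK else \<zero>\<^bsub>K\<^esub>)"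
        using x(1)[OF i] \<psi> by (intro sum_char) auto
      also have "inv\<^bsub>Gd\<^esub> \<psi> \<otimes>\<^bsub>Gd\<^esub> x i \<noteq> \<one>\<^bsub>Gd\<^esub>"
        using x(1)[OF i] \<psi> not i by (metis Gd.inv_closed Gd.inv_equality Gd.inv_inv Gd.m_comm imageI lessThan_iff)
      then have "(if inv\<^bsub>Gd\<^esub> \<psi> \<otimes>\<^bsub>Gd\<^esub> x i = \<one>\<^bsub>Gd\<^esub> then ordK else \<zero>\<^bsub>K\<^esub>) = \<zero>\<^bsub>K\<^esub>" by simp
      finally show "(\<Oplus>\<^bsub>K\<^esub>g\<in>carrier G. \<psi> (inv g) \<otimes>\<^bsub>K\<^esub> x i g) = \<zero>\<^bsub>K\<^esub>" .
    qed auto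
    also have "\<dots> = \<zero>\<^bsub>K\<^esub>" by simp
    finally show False using ordK_nonzero by simp
  qed
  then have img: "carrier Gd = x ` {..<n}" using x(1) by auto
  show "finite (carrier Gd)" using img by simp
  show "(\<Oplus>\<^bsub>K\<^esub>\<chi>\<in>carrier Gd. \<chi> g) = (if g = \<one> then ordK else \<zero>\<^bsub>K\<^esub>)" if "g \<in> carrier G" for g
  proof -
    have "(\<Oplus>\<^bsub>K\<^esub>\<chi>\<in>x ` {..<n}. \<chi> g) = (\<Oplus>\<^bsub>K\<^esub>i\<in>{..<n}. x i g)"
      using x(1,2) that by (intro K.finsum_reindex) auto
    then show ?thesis using x(3)[OF that] img by simp
  qed
qed

definition ordK_inv :: 'k where "ordK_inv = inv\<^bsub>K\<^esub> ordK"

lemma ordK_inv [simp]: "ordK_inv \<in> carrier K" "ordK_inv \<otimes>\<^bsub>K\<^esub> ordK = \<one>\<^bsub>K\<^esub>" "ordK \<otimes>\<^bsub>K\<^esub> ordK_inv = \<one>\<^bsub>K\<^esub>"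
  using ordK_nonzero K.field_Units by (auto simp: ordK_inv_def)

end

section \<open>The category of equivariant objects\<close>

locale G_category = krull_schmidt_category K C + G: group G
  for K :: "'k ring" and C :: "('o, 'm, 'k) category" (structure) and G :: "'g monoid" +
  fixes F :: "'g \<Rightarrow> ('o, 'm, 'o, 'm) functr" and \<epsilon> :: "'g \<Rightarrow> 'g \<Rightarrow> 'o \<Rightarrow> 'm"
  assumes finite_G: "finite (carrier G)" and action: "category_action K C G F \<epsilon>"
begin

abbreviation mult_G (infixl \<open>\<star>\<close> 70) where "g \<star> h \<equiv> g \<otimes>\<^bsub>G\<^esub> h"

lemma F_autoequivalence: "g \<in> carrier G \<Longrightarrow> autoequivalence K C (F g)"
  using action by (simp add: category_action_def)

lemma F_functor: "g \<in> carrier G \<Longrightarrow> lin_functor K C C (F g)"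
  using F_autoequivalence by unfold_locales (simp add: autoequivalence_def)

lemmas F_linear = lin_functor.F[OF F_functor]
lemmas F_Obj [simp] = lin_functor.ob_Obj[OF F_functor]
lemmas F_arr [simp] = lin_functor.is_arr_fmap[OF F_functor]
lemmas F_idn [simp] = lin_functor.fmap_idn[OF F_functor]
lemmas F_zr [simp] = lin_functor.fmap_zr[OF F_functor]
lemmas F_cmp = lin_functor.fmap_cmp[OF F_functor]
lemmas F_pl = lin_functor.fmap_pl[OF F_functor]
lemmas F_scl = lin_functor.fmap_scl[OF F_functor]
lemmas F_sm = lin_functor.fmap_sm[OF F_functor]
lemmas F_iso [simp] = lin_functor.fmap_iso_arr[OF F_functor]
lemmas F_ainv = lin_functor.fmap_ainv[OF F_functor]
lemmas F_faithful = autoequivalence_faithful_full(1)[OF F_autoequivalence]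

definition E :: "'g \<Rightarrow> 'g \<Rightarrow> 'o \<Rightarrow> ('o, 'm) arr"
  where "E g h X = Arr (ob (F g) (ob (F h) X)) (\<epsilon> g h X) (ob (F (g \<star> h)) X)"

lemma src_trg_E [simp]: "src (E g h X) = ob (F g) (ob (F h) X)" "trg (E g h X) = ob (F (g \<star> h)) X"
  by (simp_all add: E_def)

lemma E_iso [simp]:
  assumes "g \<in> carrier G" "h \<in> carrier G" "X \<in> Obj C"
  shows "iso_arr C (E g h X)"
  using action assms unfolding category_action_def E_def
  by (simp add: natural_iso_iff[OF linear_functor_comp[OF F_linear F_linear] F_linear])

lemma E_arr [simp]: "g \<in> carrier G \<Longrightarrow> h \<in> carrier G \<Longrightarrow> X \<in> Obj C \<Longrightarrow> is_arr C (E g h X)"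
  by (rule iso_arr_arr) simp

lemma E_natural:
  assumes "g \<in> carrier G" "h \<in> carrier G" "is_arr C f"
  shows "E g h (trg f) ** fmap (F g) (fmap (F h) f) = fmap (F (g \<star> h)) f ** E g h (src f)"
  using action assms unfolding category_action_def E_def
  by (simp add: natural_iso_iff[OF linear_functor_comp[OF F_linear F_linear] F_linear])

lemma E_assoc:
  assumes "g \<in> carrier G" "h \<in> carrier G" "l \<in> carrier G" "X \<in> Obj C"
  shows "E (g \<star> h) l X ** E g h (ob (F l) X) = E g (h \<star> l) X ** fmap (F g) (E h l X)"
proof -
  have "\<epsilon> (g \<star> h) l X \<cdot> \<epsilon> g h (ob (F l) X) = \<epsilon> g (h \<star> l) X \<cdot>
        ar (F g) (ob (F h) (ob (F l) X)) (ob (F (h \<star> l)) X) (\<epsilon> h l X)"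
    using action assms unfolding category_action_def by blast
  then show ?thesis using assms by (simp add: E_def cmp_def fmap_def G.m_assoc)
qed

abbreviation "CG \<equiv> equivariantization C G F \<epsilon>"

text \<open>An equivariant object is handled through its structure isomorphisms \<open>\<alpha>\<^sub>g\<close> as tagged arrows, and
  conversely built from such arrows.\<close>

definition st :: "'o \<times> ('g \<Rightarrow> 'm) \<Rightarrow> 'g \<Rightarrow> ('o, 'm) arr"
  where "st N g = Arr (fst N) (snd N g) (ob (F g) (fst N))"

definition mk_eq :: "'o \<Rightarrow> ('g \<Rightarrow> ('o, 'm) arr) \<Rightarrow> 'o \<times> ('g \<Rightarrow> 'm)"
  where "mk_eq X a = (X, \<lambda>g\<in>carrier G. mph (a g))"

lemma src_trg_st [simp]: "src (st N g) = fst N" "trg (st N g) = ob (F g) (fst N)"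
  by (simp_all add: st_def)

lemma fst_mk_eq [simp]: "fst (mk_eq X a) = X"
  by (simp add: mk_eq_def)

lemma st_mk_eq [simp]:
  "g \<in> carrier G \<Longrightarrow> src (a g) = X \<Longrightarrow> trg (a g) = ob (F g) X \<Longrightarrow> st (mk_eq X a) g = a g"
  by (simp add: st_def mk_eq_def arr_eqI)

lemma CG_Obj_iff:
  "N \<in> Obj CG \<longleftrightarrow> fst N \<in> Obj C \<and> snd N \<in> extensional (carrier G) \<and>
    (\<forall>g\<in>carrier G. iso_arr C (st N g)) \<and>
    (\<forall>g\<in>carrier G. \<forall>h\<in>carrier G. st N (g \<star> h) = E g h (fst N) ** (fmap (F g) (st N h) ** st N g))"
  by (cases N) (auto simp: equivariantization_def equivariant_objects_def st_def E_def cmp_def fmap_def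
      PiE_iff isos_iff)

lemma CG_ObjD:
  assumes "N \<in> Obj CG"
  shows "fst N \<in> Obj C" "\<And>g. g \<in> carrier G \<Longrightarrow> iso_arr C (st N g)" "\<And>g. g \<in> carrier G \<Longrightarrow> is_arr C (st N g)"
    "\<And>g h. g \<in> carrier G \<Longrightarrow> h \<in> carrier G \<Longrightarrow>
      st N (g \<star> h) = E g h (fst N) ** (fmap (F g) (st N h) ** st N g)"
  using assms by (auto simp: CG_Obj_iff iso_arr_arr)

lemma mk_eq_Obj:
  assumes "X \<in> Obj C" "\<And>g. g \<in> carrier G \<Longrightarrow> iso_arr C (a g)"
    "\<And>g. g \<in> carrier G \<Longrightarrow> src (a g) = X" "\<And>g. g \<in> carrier G \<Longrightarrow> trg (a g) = ob (F g) X"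
    "\<And>g h. g \<in> carrier G \<Longrightarrow> h \<in> carrier G \<Longrightarrow> a (g \<star> h) = E g h X ** (fmap (F g) (a h) ** a g)"
  shows "mk_eq X a \<in> Obj CG"
proof -
  have "snd (mk_eq X a) \<in> extensional (carrier G)" by (simp add: mk_eq_def)
  then show ?thesis unfolding CG_Obj_iff using assms by simp
qed

lemma CG_Obj_eqI:
  assumes "M \<in> Obj CG" "N \<in> Obj CG" "fst M = fst N" "\<And>g. g \<in> carrier G \<Longrightarrow> st M g = st N g"
  shows "M = N"
proof -
  have "snd M = snd N"
    using assms by (intro extensionalityI[of _ "carrier G"]) (auto simp: CG_Obj_iff st_def)
  then show ?thesis using assms(3) by (simp add: prod_eq_iff)
qed

text \<open>Parallel equivariant arrows are equal as soon as their underlying arrows are, so \<open>U\<close> reduces all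
  equations to \<open>C\<close>, and \<open>lift\<close> leads back.\<close>

definition U :: "('o \<times> ('g \<Rightarrow> 'm), 'm) arr \<Rightarrow> ('o, 'm) arr"
  where "U t = Arr (fst (src t)) (mph t) (fst (trg t))"

definition lift :: "'o \<times> ('g \<Rightarrow> 'm) \<Rightarrow> 'o \<times> ('g \<Rightarrow> 'm) \<Rightarrow> ('o, 'm) arr \<Rightarrow> ('o \<times> ('g \<Rightarrow> 'm), 'm) arr"
  where "lift M N f = Arr M (mph f) N"

lemma src_trg_U [simp]: "src (U t) = fst (src t)" "trg (U t) = fst (trg t)"
  by (simp_all add: U_def)

lemma src_trg_lift [simp]: "src (lift M N f) = M" "trg (lift M N f) = N"
  by (simp_all add: lift_def)

lemma U_lift [simp]: "src f = fst M \<Longrightarrow> trg f = fst N \<Longrightarrow> U (lift M N f) = f"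
  by (simp add: U_def lift_def arr_eqI)

lemma U_eqI: "U f = U g \<Longrightarrow> src f = src g \<Longrightarrow> trg f = trg g \<Longrightarrow> f = g"
  by (cases f; cases g) (simp add: U_def)

lemma U_eq_iff: "src f = src g \<Longrightarrow> trg f = trg g \<Longrightarrow> f = g \<longleftrightarrow> U f = U g"
  by (cases f; cases g) (simp add: U_def)

lemma lift_U [simp]: "lift (src f) (trg f) (U f) = f"
  by (simp add: lift_def U_def)

lemma U_cmp [simp]: "U (g **\<^bsub>CG\<^esub> f) = U g ** U f"
  by (simp add: U_def cmp_def equivariantization_def)

lemma U_idn [simp]: "U (idn CG N) = idn C (fst N)"
  by (simp add: U_def idn_def equivariantization_def split_beta)

lemma Hom_CG: "Hom CG M N = Hom C (fst M) (fst N)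
    \<lparr>carrier := {f \<in> mor C (fst M) (fst N). \<forall>g\<in>carrier G.
      snd N g \<cdot> f = ar (F g) (fst M) (fst N) f \<cdot> snd M g}\<rparr>"
  by (simp add: equivariantization_def split_beta)

lemma U_pl [simp]: "U (pl CG f g) = pl C (U f) (U g)"
  by (simp add: U_def pl_def Hom_CG)

lemma U_scl [simp]: "U (scl CG a f) = scl C a (U f)"
  by (simp add: U_def scl_def Hom_CG)

lemma U_zr [simp]: "U (zr CG M N) = zr C (fst M) (fst N)"
  by (simp add: U_def zr_def Hom_CG)

lemma is_arr_CG_iff:
  "is_arr CG t \<longleftrightarrow> src t \<in> Obj CG \<and> trg t \<in> Obj CG \<and> is_arr C (U t) \<and>
    (\<forall>g\<in>carrier G. st (trg t) g ** U t = fmap (F g) (U t) ** st (src t) g)"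
proof -
  have eq: "st (trg t) g ** U t = fmap (F g) (U t) ** st (src t) g \<longleftrightarrow>
      snd (trg t) g \<cdot> mph t = ar (F g) (fst (src t)) (fst (trg t)) (mph t) \<cdot> snd (src t) g" for g
    by (simp add: st_def U_def cmp_def fmap_def)
  have U: "is_arr C (U t) \<longleftrightarrow> fst (src t) \<in> Obj C \<and> fst (trg t) \<in> Obj C \<and> mph t \<in> mor C (fst (src t)) (fst (trg t))"
    by (simp add: U_def is_arr_Arr)
  have "is_arr CG t \<longleftrightarrow> src t \<in> Obj CG \<and> trg t \<in> Obj CG \<and> mph t \<in> mor CG (src t) (trg t)"
    by (rule is_arr_def)
  then show ?thesis unfolding eq U Hom_CG using CG_ObjD(1)[of "src t"] CG_ObjD(1)[of "trg t"] by (auto simp del: is_arr_Obj)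
qed

lemma is_arr_CGI:
  assumes "src t \<in> Obj CG" "trg t \<in> Obj CG" "is_arr C (U t)"
    "\<And>g. g \<in> carrier G \<Longrightarrow> st (trg t) g ** U t = fmap (F g) (U t) ** st (src t) g"
  shows "is_arr CG t"
  using assms unfolding is_arr_CG_iff by blast

lemma CG_arrD:
  assumes "is_arr CG t"
  shows "src t \<in> Obj CG" "trg t \<in> Obj CG" "is_arr C (U t)"
    "\<And>g. g \<in> carrier G \<Longrightarrow> st (trg t) g ** U t = fmap (F g) (U t) ** st (src t) g"
  using assms unfolding is_arr_CG_iff by blast+

lemma lift_arr:
  assumes "M \<in> Obj CG" "N \<in> Obj CG" "f \<in> arrows C (fst M) (fst N)"
    "\<And>g. g \<in> carrier G \<Longrightarrow> st N g ** f = fmap (F g) f ** st M g"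
  shows "is_arr CG (lift M N f)"
  using assms by (intro is_arr_CGI) auto

lemma CG_arr_Arr: "X \<in> Obj CG \<Longrightarrow> Y \<in> Obj CG \<Longrightarrow> f \<in> mor CG X Y \<longleftrightarrow> is_arr CG (Arr X f Y)"
  by (simp add: is_arr_Arr)

lemma equivariant_cmp:
  assumes "L \<in> Obj CG" "M \<in> Obj CG" "N \<in> Obj CG" "g \<in> carrier G"
    "f \<in> arrows C (fst L) (fst M)" "f' \<in> arrows C (fst M) (fst N)"
    "st M g ** f = fmap (F g) f ** st L g" "st N g ** f' = fmap (F g) f' ** st M g"
  shows "st N g ** (f' ** f) = fmap (F g) (f' ** f) ** st L g"
proof -
  note s = CG_ObjD(3)[OF assms(1) assms(4)] CG_ObjD(3)[OF assms(2) assms(4)] CG_ObjD(3)[OF assms(3) assms(4)]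
  have "st N g ** (f' ** f) = (fmap (F g) f' ** st M g) ** f"
    using s assms(4-6) by (intro cmp_assoc_subst[OF assms(8)]) auto
  also have "\<dots> = fmap (F g) f' ** (st M g ** f)" using s assms(4-6) by auto
  also have "\<dots> = fmap (F g) f' ** (fmap (F g) f ** st L g)" unfolding assms(7) ..
  also have "\<dots> = fmap (F g) (f' ** f) ** st L g" using s assms(4-6) by (auto simp: F_cmp)
  finally show ?thesis .
qed

lemma CG_cmp_arr:
  assumes "is_arr CG g" "is_arr CG f" "trg f = src g"
  shows "is_arr CG (g **\<^bsub>CG\<^esub> f)"
proof (rule is_arr_CGI)
  note f = CG_arrD[OF assms(2)] and g = CG_arrD[OF assms(1)]
  show "st (trg (g **\<^bsub>CG\<^esub> f)) h ** U (g **\<^bsub>CG\<^esub> f) = fmap (F h) (U (g **\<^bsub>CG\<^esub> f)) ** st (src (g **\<^bsub>CG\<^esub> f)) h"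
    if "h \<in> carrier G" for h
    using equivariant_cmp[of "src f" "src g" "trg g" h "U f" "U g"] f g that assms(3) by auto
qed (use CG_arrD[OF assms(1)] CG_arrD[OF assms(2)] assms(3) in auto)

lemma CG_Hom_vectorspace:
  assumes M: "M \<in> Obj CG" and N: "N \<in> Obj CG"
  shows "vectorspace K (Hom CG M N)"
proof -
  let ?H = "Hom C (fst M) (fst N)"
  let ?W = "{f \<in> mor C (fst M) (fst N). \<forall>g\<in>carrier G. snd N g \<cdot> f = ar (F g) (fst M) (fst N) f \<cdot> snd M g}"
  note MO = CG_ObjD(1)[OF M] and NO = CG_ObjD(1)[OF N]
  interpret V: vectorspace K ?H using Hom_vectorspace MO NO by blast
  have W: "f \<in> ?W \<longleftrightarrow> is_arr CG (Arr M f N)" for f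
    using M N by (simp add: is_arr_Arr Hom_CG)
  have pl: "is_arr CG (pl CG s t)" if "is_arr CG s" "is_arr CG t" "src s = M" "src t = M" "trg s = N" "trg t = N" for s t
  proof (rule is_arr_CGI)
    show "st (trg (pl CG s t)) g ** U (pl CG s t) = fmap (F g) (U (pl CG s t)) ** st (src (pl CG s t)) g"
      if g: "g \<in> carrier G" for g
      using CG_arrD[OF \<open>is_arr CG s\<close>] CG_arrD[OF \<open>is_arr CG t\<close>] that \<open>src s = M\<close> \<open>src t = M\<close> \<open>trg s = N\<close> \<open>trg t = N\<close>
        CG_ObjD[OF M] CG_ObjD[OF N]
      by (simp add: cmp_pl F_pl pl_cmp)
  qed (use that CG_arrD(3) M N in auto)
  have scl: "is_arr CG (scl CG a s)" if "is_arr CG s" "a \<in> carrier K" "src s = M" "trg s = N" for s a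
  proof (rule is_arr_CGI)
    show "st (trg (scl CG a s)) g ** U (scl CG a s) = fmap (F g) (U (scl CG a s)) ** st (src (scl CG a s)) g"
      if g: "g \<in> carrier G" for g
      using CG_arrD[OF \<open>is_arr CG s\<close>] that \<open>src s = M\<close> \<open>trg s = N\<close> \<open>a \<in> carrier K\<close>
        CG_ObjD[OF M] CG_ObjD[OF N]
      by (simp add: F_scl)
  qed (use that CG_arrD(3) M N in auto)
  have zr: "is_arr CG (zr CG M N)"
    using M N CG_ObjD[OF M] CG_ObjD[OF N] by (intro is_arr_CGI) auto
  have "LinearCombinations.submodule K ?W ?H"
  proof
    show "?W \<subseteq> carrier ?H" by auto
    show "v \<oplus>\<^bsub>?H\<^esub> w \<in> ?W" if "v \<in> ?W" "w \<in> ?W" for v w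
      using pl[of "Arr M v N" "Arr M w N"] that unfolding W by (simp add: pl_def Hom_CG)
    show "\<zero>\<^bsub>?H\<^esub> \<in> ?W" unfolding W using zr by (simp add: zr_def Hom_CG)
    show "c \<odot>\<^bsub>?H\<^esub> v \<in> ?W" if "c \<in> carrier K" "v \<in> ?W" for c v
      using scl[of "Arr M v N" c] that unfolding W by (simp add: scl_def Hom_CG)
  qed
  then have "subspace K ?W ?H" using V.vectorspace_axioms by (simp add: subspace_def)
  then show ?thesis using V.subspace_is_vs unfolding Hom_CG by blast
qed

lemma CG_linear: "linear_category K CG"
proof (rule linear_category.intro)
  have arr: "is_arr CG (Arr X f Y)" if "X \<in> Obj CG" "Y \<in> Obj CG" "f \<in> mor CG X Y" for X Y f
    using that by (simp add: is_arr_Arr)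
  note d = CG_arrD(3)[OF arr]
  have eqI: "f = g" if "U (Arr X f Y) = U (Arr X g Y)" for X f Y g using that by (simp add: U_def)
  have cmpA: "Arr X (g \<cdot>\<^bsub>CG\<^esub> f) Z = Arr Y g Z **\<^bsub>CG\<^esub> Arr X f Y" for X Y Z f g by (simp add: cmp_def)
  have plA: "Arr X (f \<oplus>\<^bsub>Hom CG X Y\<^esub> g) Y = pl CG (Arr X f Y) (Arr X g Y)" for X Y f g by (simp add: pl_def)
  have sclA: "Arr X (a \<odot>\<^bsub>Hom CG X Y\<^esub> f) Y = scl CG a (Arr X f Y)" for X Y f a by (simp add: scl_def)
  have idA: "Arr X (Ident CG X) X = idn CG X" for X by (simp add: idn_def)
  show "vectorspace K (Hom CG X Y)" if "X \<in> Obj CG" "Y \<in> Obj CG" for X Y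
    by (rule CG_Hom_vectorspace[OF that])
  show "Ident CG X \<in> mor CG X X" if X: "X \<in> Obj CG" for X
    using X CG_ObjD[OF X] unfolding CG_arr_Arr[OF X X] idA by (intro is_arr_CGI) auto
  show "g \<cdot>\<^bsub>CG\<^esub> f \<in> mor CG X Z" if "X \<in> Obj CG" "Y \<in> Obj CG" "Z \<in> Obj CG" "f \<in> mor CG X Y" "g \<in> mor CG Y Z" for X Y Z f g
    unfolding CG_arr_Arr[OF that(1,3)] cmpA[of X g f Z Y]
    by (rule CG_cmp_arr[OF arr[OF that(2,3,5)] arr[OF that(1,2,4)]]) simp
  show "Ident CG Y \<cdot>\<^bsub>CG\<^esub> f = f" if "X \<in> Obj CG" "Y \<in> Obj CG" "f \<in> mor CG X Y" for X Y f
    using d[OF that] that by (intro eqI[of X _ Y]) (simp add: cmpA[of X _ _ Y Y] idA)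
  show "f \<cdot>\<^bsub>CG\<^esub> Ident CG X = f" if "X \<in> Obj CG" "Y \<in> Obj CG" "f \<in> mor CG X Y" for X Y f
    using d[OF that] that by (intro eqI[of X _ Y]) (simp add: cmpA[of X _ _ Y X] idA)
  show "h \<cdot>\<^bsub>CG\<^esub> g \<cdot>\<^bsub>CG\<^esub> f = h \<cdot>\<^bsub>CG\<^esub> (g \<cdot>\<^bsub>CG\<^esub> f)"
    if "W \<in> Obj CG" "X \<in> Obj CG" "Y \<in> Obj CG" "Z \<in> Obj CG" "f \<in> mor CG W X" "g \<in> mor CG X Y" "h \<in> mor CG Y Z"
    for W X Y Z f g h
    using d[OF that(1,2,5)] d[OF that(2,3,6)] d[OF that(3,4,7)]
    by (intro eqI[of W _ Z]) (simp add: cmpA[of W "h \<cdot>\<^bsub>CG\<^esub> g" f Z X] cmpA[of X h g Z Y]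
      cmpA[of W h "g \<cdot>\<^bsub>CG\<^esub> f" Z Y] cmpA[of W g f Y X])
  show "(g \<oplus>\<^bsub>Hom CG Y Z\<^esub> g') \<cdot>\<^bsub>CG\<^esub> f = g \<cdot>\<^bsub>CG\<^esub> f \<oplus>\<^bsub>Hom CG X Z\<^esub> g' \<cdot>\<^bsub>CG\<^esub> f"
    if "X \<in> Obj CG" "Y \<in> Obj CG" "Z \<in> Obj CG" "f \<in> mor CG X Y" "g \<in> mor CG Y Z" "g' \<in> mor CG Y Z" for X Y Z f g g'
    using d[OF that(1,2,4)] d[OF that(2,3,5)] d[OF that(2,3,6)]
    by (intro eqI[of X _ Z]) (simp add: cmpA[of X _ _ Z Y] plA pl_cmp)
  show "g \<cdot>\<^bsub>CG\<^esub> (f \<oplus>\<^bsub>Hom CG X Y\<^esub> f') = g \<cdot>\<^bsub>CG\<^esub> f \<oplus>\<^bsub>Hom CG X Z\<^esub> g \<cdot>\<^bsub>CG\<^esub> f'"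
    if "X \<in> Obj CG" "Y \<in> Obj CG" "Z \<in> Obj CG" "f \<in> mor CG X Y" "f' \<in> mor CG X Y" "g \<in> mor CG Y Z" for X Y Z f f' g
    using d[OF that(1,2,4)] d[OF that(1,2,5)] d[OF that(2,3,6)]
    by (intro eqI[of X _ Z]) (simp add: cmpA[of X _ _ Z Y] plA cmp_pl)
  show "(a \<odot>\<^bsub>Hom CG Y Z\<^esub> g) \<cdot>\<^bsub>CG\<^esub> f = a \<odot>\<^bsub>Hom CG X Z\<^esub> (g \<cdot>\<^bsub>CG\<^esub> f)"
    if "X \<in> Obj CG" "Y \<in> Obj CG" "Z \<in> Obj CG" "a \<in> carrier K" "f \<in> mor CG X Y" "g \<in> mor CG Y Z" for X Y Z a f g
    using d[OF that(1,2,5)] d[OF that(2,3,6)] that(4)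
    by (intro eqI[of X _ Z]) (simp add: cmpA[of X _ _ Z Y] sclA)
  show "g \<cdot>\<^bsub>CG\<^esub> (a \<odot>\<^bsub>Hom CG X Y\<^esub> f) = a \<odot>\<^bsub>Hom CG X Z\<^esub> (g \<cdot>\<^bsub>CG\<^esub> f)"
    if "X \<in> Obj CG" "Y \<in> Obj CG" "Z \<in> Obj CG" "a \<in> carrier K" "f \<in> mor CG X Y" "g \<in> mor CG Y Z" for X Y Z a f g
    using d[OF that(1,2,5)] d[OF that(2,3,6)] that(4)
    by (intro eqI[of X _ Z]) (simp add: cmpA[of X _ _ Z Y] sclA)
qed

definition forget :: "('o \<times> ('g \<Rightarrow> 'm), 'm, 'o, 'm) functr"
  where "forget = \<lparr>ob = fst, ar = (\<lambda>_ _ f. f)\<rparr>"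

lemma ob_forget [simp]: "ob forget N = fst N" and fmap_forget [simp]: "fmap forget t = U t"
  by (simp_all add: forget_def fmap_def U_def)

lemma forget_functor: "lin_functor K CG C forget"
proof -
  interpret CG: linear_category K CG by (rule CG_linear)
  have *: "forget = mk_functor fst U"
    by (simp add: forget_def mk_functor_def U_def)
  have "linear_functor K CG C (mk_functor fst U) \<and> (\<forall>f. is_arr CG f \<longrightarrow> fmap (mk_functor fst U) f = U f)"
    by (rule linear_functor_mk_functor) (simp_all add: CG_ObjD(1) CG_arrD(3))
  then show ?thesis by unfold_locales (simp add: *)
qed

lemma U_sm:
  "finite I \<Longrightarrow> M \<in> Obj CG \<Longrightarrow> N \<in> Obj CG \<Longrightarrow> (\<And>i. i \<in> I \<Longrightarrow> t i \<in> arrows CG M N) \<Longrightarrow>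
    U (sm CG M N I t) = sm C (fst M) (fst N) I (\<lambda>i. U (t i))"
  using lin_functor.fmap_sm[OF forget_functor, of I M N t] by simp

text \<open>Cancelling \<open>F\<^sub>g f\<close> on the left reduces the claim to the equivariance of \<open>f\<close>.\<close>

lemma equivariant_inverse:
  assumes M: "M \<in> Obj CG" and N: "N \<in> Obj CG" and g: "g \<in> carrier G" and f: "iso_arr C f" "src f = fst M" "trg f = fst N"
    and e: "st N g ** f = fmap (F g) f ** st M g"
  shows "st M g ** ainv C f = fmap (F g) (ainv C f) ** st N g"
proof -
  note M' = CG_ObjD(3)[OF M g] and N' = CG_ObjD(3)[OF N g] and fa = iso_arr_arr[OF f(1)]
  have "fmap (F g) f ** (st M g ** ainv C f) = (st N g ** f) ** ainv C f"
    unfolding e using M' N' f fa g by simp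
  also have "\<dots> = st N g" using N' f fa by simp
  also have "\<dots> = fmap (F g) f ** (fmap (F g) (ainv C f) ** st N g)"
    unfolding F_ainv[OF g f(1)] using ainv_cancel(2)[OF F_iso[OF g f(1)] N'] f N' by simp
  finally show ?thesis using M' N' f fa g by - (rule iso_cancel_left[OF F_iso[OF g f(1)]], auto)
qed

lemma CG_iso:
  assumes "is_arr CG t" "iso_arr C (U t)"
  shows "iso_arr CG t"
proof -
  note t = CG_arrD[OF assms(1)]
  let ?s = "lift (trg t) (src t) (ainv C (U t))"
  have "is_arr CG ?s"
    using t assms(2) equivariant_inverse[OF t(1,2) _ assms(2)] by (intro lift_arr) auto
  moreover have "?s **\<^bsub>CG\<^esub> t = idn CG (src t)" using assms(2) by (intro U_eqI) simp_all
  moreover have "t **\<^bsub>CG\<^esub> ?s = idn CG (trg t)" using assms(2) by (intro U_eqI) simp_all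
  ultimately have "inverses CG t ?s" using assms(1) by (simp add: inverses_def)
  then show ?thesis by (auto simp: iso_arr_def)
qed

lemma CG_end_dim:
  assumes N: "N \<in> Obj CG" and d: "end_dim_le K C (fst N) d"
  shows "end_dim_le K CG N d"
  unfolding end_dim_le_def
proof (intro allI impI)
  interpret CG: linear_category K CG by (rule CG_linear)
  fix v assume v: "\<forall>i\<le>d. v i \<in> arrows CG N N"
  then have Uv: "U (v i) \<in> arrows C (fst N) (fst N)" if "i \<le> d" for i using that CG_arrD(3) by auto
  obtain c where c: "\<forall>i\<le>d. c i \<in> carrier K" "\<exists>i\<le>d. c i \<noteq> \<zero>\<^bsub>K\<^esub>"
    "sm C (fst N) (fst N) {..d} (\<lambda>i. scl C (c i) (U (v i))) = zr C (fst N) (fst N)"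
    using d Uv unfolding end_dim_le_def by (elim allE[of _ "\<lambda>i. U (v i)"]) auto
  have "U (sm CG N N {..d} (\<lambda>i. scl CG (c i) (v i))) = zr C (fst N) (fst N)"
    using U_sm[of "{..d}" N N "\<lambda>i. scl CG (c i) (v i)"] N v c by simp
  then have "sm CG N N {..d} (\<lambda>i. scl CG (c i) (v i)) = zr CG N N" by (intro U_eqI) simp_all
  then show "\<exists>c. (\<forall>i\<le>d. c i \<in> carrier K) \<and> (\<exists>i\<le>d. c i \<noteq> \<zero>\<^bsub>K\<^esub>) \<and>
      sm CG N N {..d} (\<lambda>i. scl CG (c i) (v i)) = zr CG N N" using c by blast
qed

text \<open>The splitting \<open>Y\<close> of the underlying idempotent in \<open>C\<close> carries the structure \<open>F\<^sub>g(r) \<alpha>\<^sub>g s\<close>.\<close>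

lemma CG_idempotent_complete: "idempotent_complete CG"
  unfolding idempotent_complete_def
proof (intro ballI impI)
  fix N e assume N: "N \<in> Obj CG" and e: "e \<in> mor CG N N" "e \<cdot>\<^bsub>CG\<^esub> e = e"
  define t where "t = Arr N e N"
  have t: "is_arr CG t" "src t = N" "trg t = N" using N e(1) by (simp_all add: t_def is_arr_Arr)
  have tt: "U t ** U t = U t" using e(2) by (simp flip: U_cmp) (simp add: t_def cmp_def)
  note n = CG_ObjD[OF N] and ut = CG_arrD[OF t(1)]
  obtain Y r s where Y: "Y \<in> Obj C" "r \<in> arrows C (fst N) Y" "s \<in> arrows C Y (fst N)" "s ** r = U t" "r ** s = idn C Y"
    using split_idempotent[OF _ tt, of "fst N"] ut t by auto
  define a where "a g = fmap (F g) r ** (st N g ** s)" for g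
  have comm: "st N g ** (s ** r) = (fmap (F g) s ** fmap (F g) r) ** st N g" if "g \<in> carrier G" for g
    using ut(4)[OF that] t Y that by (simp add: F_cmp[symmetric])
  have rs: "fmap (F g) r ** fmap (F g) s = idn C (ob (F g) Y)" if "g \<in> carrier G" for g
    using Y that by (simp add: F_cmp[symmetric])
  have a_s: "fmap (F g) s ** a g = st N g ** s" if g: "g \<in> carrier G" for g
  proof -
    have "fmap (F g) s ** a g = ((fmap (F g) s ** fmap (F g) r) ** st N g) ** s"
      using Y n g by (simp add: a_def)
    also have "\<dots> = (st N g ** (s ** r)) ** s" using comm[OF g] by simp
    also have "\<dots> = st N g ** (s ** (r ** s))" using Y(2,3) n g by simp
    finally show ?thesis using Y(3,5) by simp
  qed
  have r_a: "a g ** r = fmap (F g) r ** st N g" if g: "g \<in> carrier G" for g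
  proof -
    have "a g ** r = fmap (F g) r ** (st N g ** (s ** r))" using Y n g by (simp add: a_def)
    also have "\<dots> = (fmap (F g) r ** fmap (F g) s) ** (fmap (F g) r ** st N g)"
      unfolding comm[OF g] using Y(2,3) n g by simp
    finally show ?thesis unfolding rs[OF g] using Y(2,3) n g by simp
  qed
  have a: "a g \<in> arrows C Y (ob (F g) Y)" if "g \<in> carrier G" for g using Y n that by (simp add: a_def)
  have iso: "iso_arr C (a g)" if g: "g \<in> carrier G" for g
  proof -
    let ?b = "r ** (ainv C (st N g) ** fmap (F g) s)"
    have b: "?b \<in> arrows C (ob (F g) Y) Y" using Y n g by simp
    have "?b ** a g = r ** (ainv C (st N g) ** (fmap (F g) s ** a g))" using Y(2,3) n g a[OF g] by simp
    also have "\<dots> = r ** s" unfolding a_s[OF g] using ainv_cancel(1)[OF n(2)[OF g], of s] Y(2,3) by simp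
    finally have 1: "?b ** a g = idn C Y" using Y(5) by simp
    have "a g ** ?b = (a g ** r) ** (ainv C (st N g) ** fmap (F g) s)" using Y(2,3) n g a[OF g] by simp
    also have "\<dots> = fmap (F g) r ** fmap (F g) s"
      unfolding r_a[OF g] using ainv_cancel(2)[OF n(2)[OF g], of "fmap (F g) s"] Y(2,3) n g by simp
    finally have 2: "a g ** ?b = idn C (ob (F g) Y)" using rs[OF g] by simp
    have "inverses C (a g) ?b" using a[OF g] b 1 2 by (simp add: inverses_def)
    then show ?thesis by (auto simp: iso_arr_def)
  qed
  have YN: "mk_eq Y a \<in> Obj CG"
  proof (rule mk_eq_Obj)
    fix g h assume g: "g \<in> carrier G" and h: "h \<in> carrier G"
    have "E g h Y ** (fmap (F g) (a h) ** a g) = E g h Y ** (fmap (F g) (fmap (F h) r) ** (fmap (F g) (st N h) ** (fmap (F g) s ** a g)))"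
      unfolding a_def[of h] using Y n g h a by (simp add: F_cmp)
    also have "\<dots> = E g h Y ** (fmap (F g) (fmap (F h) r) ** (fmap (F g) (st N h) ** (st N g ** s)))"
      unfolding a_s[OF g] ..
    also have "\<dots> = (fmap (F (g \<star> h)) r ** E g h (fst N)) ** (fmap (F g) (st N h) ** (st N g ** s))"
      using E_natural[OF g h, of r] Y n g h by (intro cmp_assoc_subst) auto
    also have "\<dots> = a (g \<star> h)"
      unfolding a_def n(4)[OF g h] using Y n g h by simp
    finally show "a (g \<star> h) = E g h Y ** (fmap (F g) (a h) ** a g)" ..
  qed (use Y a iso in auto)
  have st: "st (mk_eq Y a) g = a g" if "g \<in> carrier G" for g using that a[OF that] by simp
  have R: "is_arr CG (lift N (mk_eq Y a) r)" using N YN Y st r_a by (intro lift_arr) auto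
  have S: "is_arr CG (lift (mk_eq Y a) N s)" using N YN Y st a_s by (intro lift_arr) auto
  have SR: "lift (mk_eq Y a) N s **\<^bsub>CG\<^esub> lift N (mk_eq Y a) r = t" using Y t by (intro U_eqI) simp_all
  have RS: "lift N (mk_eq Y a) r **\<^bsub>CG\<^esub> lift (mk_eq Y a) N s = idn CG (mk_eq Y a)"
    using Y by (intro U_eqI) simp_all
  show "\<exists>Y\<in>Obj CG. \<exists>r\<in>mor CG N Y. \<exists>s\<in>mor CG Y N. s \<cdot>\<^bsub>CG\<^esub> r = e \<and> r \<cdot>\<^bsub>CG\<^esub> s = Ident CG Y"
    using YN R S SR RS by (intro bexI[of _ "mk_eq Y a"] bexI[of _ "mph r"] bexI[of _ "mph s"])
      (simp_all add: cmp_def lift_def idn_def t_def is_arr_Arr)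
qed

text \<open>The sum of the structure isomorphisms is the structure of the sum. The compatibility with the
  products of \<open>G\<close> may be checked on each summand.\<close>

lemma CG_direct_sum:
  assumes N: "\<And>i. i \<in> I \<Longrightarrow> Ns i \<in> Obj CG" and jp: "biprod C I (\<lambda>i. fst (Ns i)) S j p"
  shows "\<exists>SN. is_direct_sum CG I Ns SN"
proof -
  interpret CG: linear_category K CG by (rule CG_linear)
  note nn = CG_ObjD[OF N]
  note b = biprodD[OF jp]
  have Fjp: "biprod C I (\<lambda>i. ob (F g) (fst (Ns i))) (ob (F g) S) (\<lambda>i. fmap (F g) (j i)) (\<lambda>i. fmap (F g) (p i))"
    if "g \<in> carrier G" for g
    using lin_functor.biprod_fmap[OF F_functor[OF that] jp] .
  define a where "a g = sm C S (ob (F g) S) I (\<lambda>i. (fmap (F g) (j i) ** st (Ns i) g) ** p i)" for g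
  have a: "a g \<in> arrows C S (ob (F g) S)" if "g \<in> carrier G" for g
    unfolding a_def using b nn that by simp
  have aj: "a g ** j i = fmap (F g) (j i) ** st (Ns i) g" if "g \<in> carrier G" "i \<in> I" for g i
    unfolding a_def using that b nn biprod_sm_inc[OF jp, of i "ob (F g) S" "\<lambda>i. fmap (F g) (j i) ** st (Ns i) g"]
    by simp
  have iso: "iso_arr C (a g)" if g: "g \<in> carrier G" for g
    by (rule biprod_iso_arr[OF jp Fjp[OF g] bij_betw_id[unfolded id_def], of "\<lambda>i. st (Ns i) g"])
      (use nn g a[OF g] aj[OF g] in auto)
  have SN: "mk_eq S a \<in> Obj CG"
  proof (rule mk_eq_Obj)
    fix g h assume g: "g \<in> carrier G" and h: "h \<in> carrier G"
    have gh: "g \<star> h \<in> carrier G" using g h by simp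
    show "a (g \<star> h) = E g h S ** (fmap (F g) (a h) ** a g)"
    proof (rule biprod_eqI_right[OF jp])
      fix i assume i: "i \<in> I"
      have "(E g h S ** (fmap (F g) (a h) ** a g)) ** j i = E g h S ** (fmap (F g) (a h) ** (fmap (F g) (j i) ** st (Ns i) g))"
        using a[OF g] a[OF h] b g h i aj[OF g, of i] by simp
      also have "fmap (F g) (a h) ** (fmap (F g) (j i) ** st (Ns i) g) = fmap (F g) (a h ** j i) ** st (Ns i) g"
        using a[OF h] b g h i nn by (simp add: F_cmp)
      also have "\<dots> = fmap (F g) (fmap (F h) (j i)) ** (fmap (F g) (st (Ns i) h) ** st (Ns i) g)"
        using aj[OF h, of i] b g h i nn by (simp add: F_cmp)
      also have "E g h S ** \<dots> = (fmap (F (g \<star> h)) (j i) ** E g h (fst (Ns i))) ** (fmap (F g) (st (Ns i) h) ** st (Ns i) g)"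
        using E_natural[OF g h, of "j i"] b g h i nn by (intro cmp_assoc_subst) auto
      also have "\<dots> = fmap (F (g \<star> h)) (j i) ** st (Ns i) (g \<star> h)"
        using nn(4)[OF i g h] nn i g h b by simp
      finally show "a (g \<star> h) ** j i = (E g h S ** (fmap (F g) (a h) ** a g)) ** j i"
        using aj[OF gh, of i] i by simp
    qed (use a[OF g] a[OF h] a[OF gh] b g h in auto)
  qed (use b a iso in auto)
  have st: "st (mk_eq S a) g = a g" if "g \<in> carrier G" for g using that a[OF that] by simp
  have p_st: "st (Ns i) g ** p i = fmap (F g) (p i) ** a g" if g: "g \<in> carrier G" and i: "i \<in> I" for g i
  proof (rule biprod_eqI_right[OF jp])
    fix k assume k: "k \<in> I"
    have "(fmap (F g) (p i) ** a g) ** j k = fmap (F g) (p i) ** (fmap (F g) (j k) ** st (Ns k) g)"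
      using a[OF g] b g i k aj[OF g, of k] by simp
    also have "\<dots> = fmap (F g) (p i ** j k) ** st (Ns k) g" using b g i k nn by (simp add: F_cmp)
    also have "\<dots> = (st (Ns i) g ** p i) ** j k" using b g i k nn by (cases "i = k") simp_all
    finally show "(st (Ns i) g ** p i) ** j k = (fmap (F g) (p i) ** a g) ** j k" ..
  qed (use a[OF g] b g i nn in auto)
  let ?J = "\<lambda>i. lift (Ns i) (mk_eq S a) (j i)" and ?P = "\<lambda>i. lift (mk_eq S a) (Ns i) (p i)"
  have J: "is_arr CG (?J i)" if "i \<in> I" for i using that N SN b st aj by (intro lift_arr) auto
  have P: "is_arr CG (?P i)" if "i \<in> I" for i using that N SN b st p_st by (intro lift_arr) auto
  have "biprod CG I Ns (mk_eq S a) ?J ?P"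
    unfolding biprod_def
  proof (intro conjI ballI)
    fix i k assume i: "i \<in> I" and k: "k \<in> I"
    show "?P k **\<^bsub>CG\<^esub> ?J i = (if i = k then idn CG (Ns i) else zr CG (Ns i) (Ns k))"
      using i k b by (intro U_eqI) simp_all
  next
    have "U (sm CG (mk_eq S a) (mk_eq S a) I (\<lambda>i. ?J i **\<^bsub>CG\<^esub> ?P i)) =
      sm C S S I (\<lambda>i. U (?J i **\<^bsub>CG\<^esub> ?P i))"
      using J P SN b(1) by (subst U_sm) auto
    also have "\<dots> = sm C S S I (\<lambda>i. j i ** p i)" using b by (intro sm_cong) auto
    finally show "sm CG (mk_eq S a) (mk_eq S a) I (\<lambda>i. ?J i **\<^bsub>CG\<^esub> ?P i) = idn CG (mk_eq S a)"
      using b by (intro U_eqI) simp_all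
  qed (use J P SN b(1) in auto)
  then show ?thesis unfolding is_direct_sum_iff by blast
qed

lemma CG_additive: "additive_category CG"
  unfolding additive_category_def
proof (intro allI impI)
  fix n :: nat and Ns assume Ns: "\<forall>i<n. Ns i \<in> Obj CG"
  then have N: "Ns i \<in> Obj CG" if "i \<in> {..<n}" for i using that by simp
  obtain S where "is_direct_sum C {..<n} (\<lambda>i. fst (Ns i)) S"
    using additive CG_ObjD(1)[OF N] unfolding additive_category_def by (metis lessThan_iff)
  then obtain j p where "biprod C {..<n} (\<lambda>i. fst (Ns i)) S j p" by (auto simp: is_direct_sum_iff)
  then show "\<exists>S. is_direct_sum CG {..<n} Ns S" using CG_direct_sum[of "{..<n}" Ns] N by blast
qed

lemma CG_krull_schmidt: "krull_schmidt_category K CG"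
proof -
  interpret CG: linear_category K CG by (rule CG_linear)
  show ?thesis
    by unfold_locales (use CG_idempotent_complete CG_additive CG_end_dim end_finite CG_ObjD(1) in blast)+
qed

sublocale CG: krull_schmidt_category K CG by (rule CG_krull_schmidt)

sublocale forget: lin_functor K CG C forget by (rule forget_functor)

end

section \<open>The dual action and graded equivariant objects\<close>

locale dual_setting = G_category K C G F \<epsilon> + S: split_abelian_group K G
  for K :: "'k ring" and C :: "('o, 'm, 'k) category" (structure) and G :: "'g monoid"
    and F :: "'g \<Rightarrow> ('o, 'm, 'o, 'm) functr" and \<epsilon> :: "'g \<Rightarrow> 'g \<Rightarrow> 'o \<Rightarrow> 'm"
begin

abbreviation "Gd \<equiv> character_group K G"
abbreviation "Fd \<equiv> dual_functor C G F"

lemma fst_dual [simp]: "fst (ob (Fd \<chi>) N) = fst N"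
  by (simp add: dual_functor_def split_beta)

lemma st_dual [simp]: "g \<in> carrier G \<Longrightarrow> st (ob (Fd \<chi>) N) g = scl C (\<chi> (inv\<^bsub>G\<^esub> g)) (st N g)"
  by (simp add: dual_functor_def split_beta st_def scl_def)

lemma U_fmap_dual [simp]: "U (fmap (Fd \<chi>) t) = U t"
  by (simp add: U_def fmap_def) (simp add: dual_functor_def split_beta)

lemma iso_scl:
  assumes "iso_arr C f" "c \<in> carrier K" "d \<in> carrier K" "c \<otimes>\<^bsub>K\<^esub> d = \<one>\<^bsub>K\<^esub>"
  shows "iso_arr C (scl C c f)"
proof -
  have "d \<otimes>\<^bsub>K\<^esub> c = \<one>\<^bsub>K\<^esub>" using assms S.K.m_comm by simp
  then have "inverses C (scl C c f) (scl C d (ainv C f))"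
    using assms iso_arr_arr[OF assms(1)] by (simp add: inverses_def)
  then show ?thesis by (auto simp: iso_arr_def)
qed

lemma scl_cancel:
  assumes "is_arr C f" "is_arr C f'" "c \<in> carrier K" "d \<in> carrier K" "d \<otimes>\<^bsub>K\<^esub> c = \<one>\<^bsub>K\<^esub>" "scl C c f = scl C c f'"
  shows "f = f'"
proof -
  have "scl C d (scl C c f) = scl C d (scl C c f')" using assms(6) by simp
  then show ?thesis using assms(1-5) by simp
qed

lemma dual_Obj [simp]:
  assumes \<chi>: "\<chi> \<in> carrier Gd" and N: "N \<in> Obj CG"
  shows "ob (Fd \<chi>) N \<in> Obj CG"
  unfolding CG_Obj_iff
proof (intro conjI ballI)
  note n = CG_ObjD[OF N]
  show "fst (ob (Fd \<chi>) N) \<in> Obj C" using n by simp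
  show "snd (ob (Fd \<chi>) N) \<in> extensional (carrier G)" by (simp add: dual_functor_def split_beta)
  fix g assume g: "g \<in> carrier G"
  show "iso_arr C (st (ob (Fd \<chi>) N) g)"
    using n g \<chi> by (auto intro: iso_scl[where d = "\<chi> g"])
  fix h assume h: "h \<in> carrier G"
  have "\<chi> (inv\<^bsub>G\<^esub> (g \<star> h)) = \<chi> (inv\<^bsub>G\<^esub> g) \<otimes>\<^bsub>K\<^esub> \<chi> (inv\<^bsub>G\<^esub> h)"
    using g h \<chi> by (simp add: G.inv_mult_group S.char_mult S.K.m_comm)
  then show "st (ob (Fd \<chi>) N) (g \<star> h) =
    E g h (fst (ob (Fd \<chi>) N)) ** (fmap (F g) (st (ob (Fd \<chi>) N) h) ** st (ob (Fd \<chi>) N) g)"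
    using n g h \<chi> by (simp add: F_scl)
qed

lemma dual_arr [simp]:
  assumes \<chi>: "\<chi> \<in> carrier Gd" and t: "is_arr CG t"
  shows "is_arr CG (fmap (Fd \<chi>) t)"
proof (rule is_arr_CGI)
  note d = CG_arrD[OF t]
  show "src (fmap (Fd \<chi>) t) \<in> Obj CG" "trg (fmap (Fd \<chi>) t) \<in> Obj CG" using d(1,2) \<chi> by simp_all
  show "is_arr C (U (fmap (Fd \<chi>) t))" using d by simp
  show "st (trg (fmap (Fd \<chi>) t)) g ** U (fmap (Fd \<chi>) t) =
    fmap (F g) (U (fmap (Fd \<chi>) t)) ** st (src (fmap (Fd \<chi>) t)) g" if g: "g \<in> carrier G" for g
    using d(3) d(4)[OF g] CG_ObjD(3)[OF d(1) g] CG_ObjD(3)[OF d(2) g] \<chi> g by simp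
qed

lemma Fd_mk_functor: "Fd \<chi> = mk_functor (ob (Fd \<chi>)) (fmap (Fd \<chi>))"
  by (simp add: mk_functor_def fmap_def dual_functor_def)

lemma dual_lin_functor:
  assumes \<chi>: "\<chi> \<in> carrier Gd"
  shows "lin_functor K CG CG (Fd \<chi>)"
proof -
  have "linear_functor K CG CG (mk_functor (ob (Fd \<chi>)) (fmap (Fd \<chi>))) \<and>
    (\<forall>f. is_arr CG f \<longrightarrow> fmap (mk_functor (ob (Fd \<chi>)) (fmap (Fd \<chi>))) f = fmap (Fd \<chi>) f)"
    using \<chi> by (intro linear_functor_mk_functor) (auto intro!: U_eqI)
  then show ?thesis using Fd_mk_functor[of \<chi>] by unfold_locales simp
qed

lemma dual_ff_functor:
  assumes \<chi>: "\<chi> \<in> carrier Gd"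
  shows "ff_functor K CG CG (Fd \<chi>)"
proof -
  interpret L: lin_functor K CG CG "Fd \<chi>" by (rule dual_lin_functor[OF \<chi>])
  have "faithful_functor CG (Fd \<chi>)"
    unfolding faithful_functor_def by (metis U_eqI U_fmap_dual)
  moreover have "full_functor CG CG (Fd \<chi>)"
    unfolding full_functor_def
  proof (intro ballI)
    fix M N t assume M: "M \<in> Obj CG" and N: "N \<in> Obj CG" and t: "t \<in> arrows CG (ob (Fd \<chi>) M) (ob (Fd \<chi>) N)"
    have tt: "is_arr CG t" "src t = ob (Fd \<chi>) M" "trg t = ob (Fd \<chi>) N" using t by auto
    note d = CG_arrD[OF tt(1)]
    have ut: "is_arr C (U t)" "src (U t) = fst M" "trg (U t) = fst N" using d(3) tt by simp_all
    have "is_arr CG (lift M N (U t))"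
    proof (rule lift_arr[OF M N])
      fix g assume g: "g \<in> carrier G"
      have "scl C (\<chi> (inv\<^bsub>G\<^esub> g)) (st N g ** U t) = scl C (\<chi> (inv\<^bsub>G\<^esub> g)) (fmap (F g) (U t) ** st M g)"
        using d(4)[OF g] tt ut g \<chi> CG_ObjD(3)[OF M g] CG_ObjD(3)[OF N g] by simp
      then show "st N g ** U t = fmap (F g) (U t) ** st M g"
        using ut g \<chi> CG_ObjD(3)[OF M g] CG_ObjD(3)[OF N g]
        by - (rule scl_cancel[of _ _ "\<chi> (inv\<^bsub>G\<^esub> g)" "\<chi> g"], auto)
    qed (use ut in simp)
    moreover have "fmap (Fd \<chi>) (lift M N (U t)) = t" using tt ut by (intro U_eqI) simp_all
    ultimately show "\<exists>f\<in>arrows CG M N. fmap (Fd \<chi>) f = t" by auto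
  qed
  ultimately show ?thesis by unfold_locales
qed

lemma dual_dual:
  assumes "\<chi> \<in> carrier Gd" "\<psi> \<in> carrier Gd" "N \<in> Obj CG"
  shows "ob (Fd \<chi>) (ob (Fd \<psi>) N) = ob (Fd (\<chi> \<otimes>\<^bsub>Gd\<^esub> \<psi>)) N"
  using assms CG_ObjD[OF assms(3)] by (intro CG_Obj_eqI) (auto simp: S.char_mult_apply)

lemma dual_one: "N \<in> Obj CG \<Longrightarrow> ob (Fd \<one>\<^bsub>Gd\<^esub>) N = N"
  using CG_ObjD[of N] by (intro CG_Obj_eqI) (auto simp: S.char_one_apply)

text \<open>For an equivariant object the structure arrow at the unit is the unit constraint of the
  action, whence it commutes with all arrows, not only with the equivariant ones.\<close>

lemma unit_natural:
  assumes M: "M \<in> Obj CG" and N: "N \<in> Obj CG" and v: "v \<in> arrows C (fst M) (fst N)"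
  shows "st N \<one>\<^bsub>G\<^esub> ** v = fmap (F \<one>\<^bsub>G\<^esub>) v ** st M \<one>\<^bsub>G\<^esub>"
proof -
  let ?F = "fmap (F \<one>\<^bsub>G\<^esub>)" and ?E = "\<lambda>L. E \<one>\<^bsub>G\<^esub> \<one>\<^bsub>G\<^esub> (fst L)"
  have one: "\<one>\<^bsub>G\<^esub> \<in> carrier G" by simp
  have u: "?E L ** ?F (st L \<one>\<^bsub>G\<^esub>) = idn C (ob (F \<one>\<^bsub>G\<^esub>) (fst L))" if L: "L \<in> Obj CG" for L
  proof -
    note l = CG_ObjD(1)[OF L] CG_ObjD(2,3)[OF L one]
    have "st L \<one>\<^bsub>G\<^esub> = (?E L ** ?F (st L \<one>\<^bsub>G\<^esub>)) ** st L \<one>\<^bsub>G\<^esub>"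
      using CG_ObjD(4)[OF L one one] l by simp
    then have "idn C (ob (F \<one>\<^bsub>G\<^esub>) (fst L)) ** st L \<one>\<^bsub>G\<^esub> = (?E L ** ?F (st L \<one>\<^bsub>G\<^esub>)) ** st L \<one>\<^bsub>G\<^esub>"
      using l by simp
    then show ?thesis using l by - (rule iso_cancel_right[OF l(2), symmetric], auto)
  qed
  note m = CG_ObjD(1)[OF M] CG_ObjD(2,3)[OF M one] and n = CG_ObjD(1)[OF N] CG_ObjD(2,3)[OF N one]
  have "?E N ** ?F (?F v ** st M \<one>\<^bsub>G\<^esub>) = (?E N ** ?F (?F v)) ** ?F (st M \<one>\<^bsub>G\<^esub>)"
    using m n v by (simp add: F_cmp)
  also have "\<dots> = ?F v ** (?E M ** ?F (st M \<one>\<^bsub>G\<^esub>))"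
    using E_natural[OF one one, of v] m n v by simp
  also have "\<dots> = (?E N ** ?F (st N \<one>\<^bsub>G\<^esub>)) ** ?F v" unfolding u[OF M] u[OF N] using v m n by simp
  also have "\<dots> = ?E N ** ?F (st N \<one>\<^bsub>G\<^esub> ** v)" using m n v by (simp add: F_cmp)
  finally have "?F (?F v ** st M \<one>\<^bsub>G\<^esub>) = ?F (st N \<one>\<^bsub>G\<^esub> ** v)"
    using m n v by - (rule iso_cancel_left[OF E_iso[OF one one n(1)]], auto)
  then show ?thesis using m n v by - (rule faithfulD[OF F_faithful[OF one], symmetric], auto)
qed

subsection \<open>Gradings\<close>

text \<open>A grading of an equivariant object \<open>N\<close>: an action of the character group on the underlying
  object in \<open>C\<close> for which \<open>t \<chi>\<close> is a morphism \<open>N \<rightarrow> F\<^sub>\<chi> N\<close>. The homogeneous component of degree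
  \<open>h\<close> is the eigenspace on which \<open>t \<chi>\<close> is \<open>\<chi> h\<close>; the structure isomorphism \<open>\<alpha>\<^sub>g\<close> shifts degrees.\<close>

definition graded :: "'o \<times> ('g \<Rightarrow> 'm) \<Rightarrow> (('g \<Rightarrow> 'k) \<Rightarrow> ('o, 'm) arr) \<Rightarrow> bool"
  where "graded N t \<longleftrightarrow> N \<in> Obj CG \<and> (\<forall>\<chi>\<in>carrier Gd. t \<chi> \<in> arrows C (fst N) (fst N)) \<and>
    t \<one>\<^bsub>Gd\<^esub> = idn C (fst N) \<and> (\<forall>\<chi>\<in>carrier Gd. \<forall>\<psi>\<in>carrier Gd. t \<chi> ** t \<psi> = t (\<chi> \<otimes>\<^bsub>Gd\<^esub> \<psi>)) \<and>
    (\<forall>\<chi>\<in>carrier Gd. \<forall>g\<in>carrier G. st N g ** t \<chi> = scl C (\<chi> g) (fmap (F g) (t \<chi>) ** st N g))"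

text \<open>The projection \<open>|G|\<inverse> \<Sum>\<^sub>\<chi> \<chi>(h\<inverse>) t\<^sub>\<chi>\<close> to the eigenspace of degree \<open>h\<close>.\<close>

definition ee :: "'o \<times> ('g \<Rightarrow> 'm) \<Rightarrow> (('g \<Rightarrow> 'k) \<Rightarrow> ('o, 'm) arr) \<Rightarrow> 'g \<Rightarrow> ('o, 'm) arr"
  where "ee N t h = scl C S.ordK_inv
    (sm C (fst N) (fst N) (carrier Gd) (\<lambda>\<chi>. scl C (\<chi> (inv\<^bsub>G\<^esub> h)) (t \<chi>)))"

definition homogeneous ::
    "(('g \<Rightarrow> 'k) \<Rightarrow> ('o, 'm) arr) \<Rightarrow> (('g \<Rightarrow> 'k) \<Rightarrow> ('o, 'm) arr) \<Rightarrow> 'g \<Rightarrow> ('o, 'm) arr \<Rightarrow> bool"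
  where "homogeneous t t' a f \<longleftrightarrow> (\<forall>\<chi>\<in>carrier Gd. t' \<chi> ** f = scl C (\<chi> a) (f ** t \<chi>))"

lemma graded_lift_iff:
  assumes N: "N \<in> Obj CG" and \<chi>: "\<chi> \<in> carrier Gd" and f: "f \<in> arrows C (fst M) (fst N)" and M: "M \<in> Obj CG"
  shows "is_arr CG (lift M (ob (Fd \<chi>) N) f) \<longleftrightarrow>
    (\<forall>g\<in>carrier G. st N g ** f = scl C (\<chi> g) (fmap (F g) f ** st M g))"
proof -
  have "scl C (\<chi> (inv\<^bsub>G\<^esub> g)) (st N g ** f) = fmap (F g) f ** st M g \<longleftrightarrow>
      st N g ** f = scl C (\<chi> g) (fmap (F g) f ** st M g)" if g: "g \<in> carrier G" for g
  proof
    note a = CG_ObjD(3)[OF M g] CG_ObjD(3)[OF N g]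
    assume "scl C (\<chi> (inv\<^bsub>G\<^esub> g)) (st N g ** f) = fmap (F g) f ** st M g"
    then have "scl C (\<chi> g) (fmap (F g) f ** st M g) = scl C (\<chi> g) (scl C (\<chi> (inv\<^bsub>G\<^esub> g)) (st N g ** f))" by simp
    then show "st N g ** f = scl C (\<chi> g) (fmap (F g) f ** st M g)" using a f g \<chi> by simp
  next
    note a = CG_ObjD(3)[OF M g] CG_ObjD(3)[OF N g]
    assume e: "st N g ** f = scl C (\<chi> g) (fmap (F g) f ** st M g)"
    show "scl C (\<chi> (inv\<^bsub>G\<^esub> g)) (st N g ** f) = fmap (F g) f ** st M g" unfolding e using a f g \<chi> by simp
  qed
  moreover have "is_arr CG (lift M (ob (Fd \<chi>) N) f) \<longleftrightarrow>
      (\<forall>g\<in>carrier G. scl C (\<chi> (inv\<^bsub>G\<^esub> g)) (st N g) ** f = fmap (F g) f ** st M g)"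
    unfolding is_arr_CG_iff using f M N \<chi> by (simp del: is_arr_Obj)
  ultimately show ?thesis using f N \<chi> CG_ObjD(3)[OF N] by simp
qed

context
  fixes N t assumes gr: "graded N t"
begin

lemma gradedD:
  "N \<in> Obj CG" "fst N \<in> Obj C" "\<And>\<chi>. \<chi> \<in> carrier Gd \<Longrightarrow> is_arr C (t \<chi>)"
  "\<And>\<chi>. \<chi> \<in> carrier Gd \<Longrightarrow> src (t \<chi>) = fst N" "\<And>\<chi>. \<chi> \<in> carrier Gd \<Longrightarrow> trg (t \<chi>) = fst N"
  "t \<one>\<^bsub>Gd\<^esub> = idn C (fst N)" "\<And>\<chi> \<psi>. \<chi> \<in> carrier Gd \<Longrightarrow> \<psi> \<in> carrier Gd \<Longrightarrow> t \<chi> ** t \<psi> = t (\<chi> \<otimes>\<^bsub>Gd\<^esub> \<psi>)"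
  "\<And>\<chi> g. \<chi> \<in> carrier Gd \<Longrightarrow> g \<in> carrier G \<Longrightarrow> st N g ** t \<chi> = scl C (\<chi> g) (fmap (F g) (t \<chi>) ** st N g)"
  "\<And>g. g \<in> carrier G \<Longrightarrow> iso_arr C (st N g)" "\<And>g. g \<in> carrier G \<Longrightarrow> is_arr C (st N g)"
  using gr CG_ObjD[of N] unfolding graded_def by auto

lemma graded_lift: "\<chi> \<in> carrier Gd \<Longrightarrow> is_arr CG (lift N (ob (Fd \<chi>) N) (t \<chi>))"
  using gradedD by (subst graded_lift_iff) auto

lemma ee_arr: "h \<in> carrier G \<Longrightarrow> ee N t h \<in> arrows C (fst N) (fst N)"
  unfolding ee_def using gradedD by simp

end

text \<open>A homogeneous arrow of degree \<open>a\<close> intertwines the actions of the characters up to the scalars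
  \<open>\<chi>(a)\<close>, hence shifts the eigenspaces by \<open>a\<close>.\<close>

lemma homogeneous_ee:
  assumes A: "graded N t" and B: "graded N' t'" and f: "f \<in> arrows C (fst N) (fst N')"
    and a: "a \<in> carrier G" and k: "k \<in> carrier G" and deg: "homogeneous t t' a f"
  shows "ee N' t' (k \<star> a) ** f = f ** ee N t k"
proof -
  note tA = gradedD[OF A] and tB = gradedD[OF B]
  let ?Y = "fst N" and ?Y' = "fst N'" and ?c = "\<lambda>\<chi>. \<chi> (inv\<^bsub>G\<^esub> (k \<star> a))"
  have "sm C ?Y' ?Y' (carrier Gd) (\<lambda>\<chi>. scl C (?c \<chi>) (t' \<chi>)) ** f =
      sm C ?Y ?Y' (carrier Gd) (\<lambda>\<chi>. scl C (?c \<chi>) (t' \<chi>) ** f)"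
    using f tB a k S.finite_chars by (subst sm_cmp) auto
  also have "\<dots> = sm C ?Y ?Y' (carrier Gd) (\<lambda>\<chi>. f ** scl C (\<chi> (inv\<^bsub>G\<^esub> k)) (t \<chi>))"
  proof (intro sm_cong)
    fix \<chi> assume \<chi>: "\<chi> \<in> carrier Gd"
    have "?c \<chi> \<otimes>\<^bsub>K\<^esub> \<chi> a = \<chi> (inv\<^bsub>G\<^esub> k)"
      using \<chi> a k by (simp flip: S.char_mult add: S.G.inv_mult G.m_assoc)
    then show "scl C (?c \<chi>) (t' \<chi>) ** f = f ** scl C (\<chi> (inv\<^bsub>G\<^esub> k)) (t \<chi>)"
      using deg \<chi> a k f tA(1-6) tB(1-6) unfolding homogeneous_def by simp
  qed (use f tA tB(2) a k in auto)
  also have "\<dots> = f ** sm C ?Y ?Y (carrier Gd) (\<lambda>\<chi>. scl C (\<chi> (inv\<^bsub>G\<^esub> k)) (t \<chi>))"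
    using f tA k S.finite_chars by (subst cmp_sm) auto
  finally show ?thesis unfolding ee_def using f tA tB a k by simp
qed

context
  fixes N t assumes gr: "graded N t"
begin

text \<open>Multiplication by \<open>\<chi>\<close> permutes the characters, and substituting \<open>\<omega> = \<chi> \<psi>\<close> in the sum that defines
  the projection produces the scalar \<open>\<chi>(h)\<close>.\<close>

lemma t_ee:
  assumes \<chi>: "\<chi> \<in> carrier Gd" and h: "h \<in> carrier G"
  shows "t \<chi> ** ee N t h = scl C (\<chi> h) (ee N t h)"
proof -
  note d = gradedD[OF gr]
  let ?Y = "fst N"
  define f where "f \<omega> = scl C (\<chi> h \<otimes>\<^bsub>K\<^esub> \<omega> (inv\<^bsub>G\<^esub> h)) (t \<omega>)" for \<omega>
  have f: "f \<omega> \<in> arrows C ?Y ?Y" if "\<omega> \<in> carrier Gd" for \<omega> using d that \<chi> h by (simp add: f_def)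
  have "t \<chi> ** sm C ?Y ?Y (carrier Gd) (\<lambda>\<psi>. scl C (\<psi> (inv\<^bsub>G\<^esub> h)) (t \<psi>)) =
      sm C ?Y ?Y (carrier Gd) (\<lambda>\<psi>. t \<chi> ** scl C (\<psi> (inv\<^bsub>G\<^esub> h)) (t \<psi>))"
    using d \<chi> h S.finite_chars by (subst cmp_sm) auto
  also have "\<dots> = sm C ?Y ?Y (carrier Gd) (\<lambda>\<psi>. f (\<chi> \<otimes>\<^bsub>Gd\<^esub> \<psi>))"
  proof (intro sm_cong)
    fix \<psi> assume \<psi>: "\<psi> \<in> carrier Gd"
    have "\<chi> h \<otimes>\<^bsub>K\<^esub> (\<chi> \<otimes>\<^bsub>Gd\<^esub> \<psi>) (inv\<^bsub>G\<^esub> h) = (\<chi> h \<otimes>\<^bsub>K\<^esub> \<chi> (inv\<^bsub>G\<^esub> h)) \<otimes>\<^bsub>K\<^esub> \<psi> (inv\<^bsub>G\<^esub> h)"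
      using \<chi> \<psi> h by (simp add: S.char_mult_apply S.K.m_assoc del: S.char_inv)
    then show "t \<chi> ** scl C (\<psi> (inv\<^bsub>G\<^esub> h)) (t \<psi>) = f (\<chi> \<otimes>\<^bsub>Gd\<^esub> \<psi>)"
      using d \<chi> \<psi> h by (simp add: f_def)
  qed (use d f \<chi> in auto)
  also have "\<dots> = sm C ?Y ?Y (carrier Gd) f"
    using f d \<chi> S.Gd.inj_on_cmult[of \<chi>] S.Gd.surj_const_mult[of \<chi>]
    by (intro sm_reindex[symmetric]) (auto simp: bij_betw_def)
  also have "\<dots> = sm C ?Y ?Y (carrier Gd) (\<lambda>\<omega>. scl C (\<chi> h) (scl C (\<omega> (inv\<^bsub>G\<^esub> h)) (t \<omega>)))"
    using d \<chi> h by (intro sm_cong) (auto simp: f_def)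
  also have "\<dots> = scl C (\<chi> h) (sm C ?Y ?Y (carrier Gd) (\<lambda>\<omega>. scl C (\<omega> (inv\<^bsub>G\<^esub> h)) (t \<omega>)))"
    using d \<chi> h S.finite_chars by (subst scl_sm) auto
  finally show ?thesis
    unfolding ee_def using d \<chi> h by (simp add: S.K.m_comm)
qed

lemma t_commute: "\<chi> \<in> carrier Gd \<Longrightarrow> \<psi> \<in> carrier Gd \<Longrightarrow> t \<chi> ** t \<psi> = t \<psi> ** t \<chi>"
  using gradedD(7)[OF gr] S.Gd.m_comm by simp

lemma ee_t:
  assumes \<chi>: "\<chi> \<in> carrier Gd" and h: "h \<in> carrier G"
  shows "ee N t h ** t \<chi> = scl C (\<chi> h) (ee N t h)"
proof -
  have "homogeneous t t \<one>\<^bsub>G\<^esub> (t \<chi>)"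
    using t_commute[OF _ \<chi>] gradedD(3-5)[OF gr] \<chi> by (simp add: homogeneous_def)
  then have "ee N t h ** t \<chi> = t \<chi> ** ee N t h"
    using homogeneous_ee[OF gr gr _ G.one_closed h, of "t \<chi>"] gradedD(3-5)[OF gr \<chi>] h by simp
  then show ?thesis using t_ee[OF assms] by simp
qed

text \<open>On an eigenvector of degree \<open>k\<close> the projection acts as the scalar \<open>|G|\<inverse> \<Sum>\<^sub>\<chi> \<chi>(h\<inverse> k)\<close>, which
  column orthogonality evaluates.\<close>

lemma ee_eigen:
  assumes e: "e \<in> arrows C Z (fst N)" and h: "h \<in> carrier G" and k: "k \<in> carrier G"
    and te: "\<And>\<chi>. \<chi> \<in> carrier Gd \<Longrightarrow> t \<chi> ** e = scl C (\<chi> k) e"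
  shows "ee N t h ** e = (if h = k then e else zr C Z (fst N))"
proof -
  note d = gradedD[OF gr]
  let ?Y = "fst N"
  have "sm C ?Y ?Y (carrier Gd) (\<lambda>\<chi>. scl C (\<chi> (inv\<^bsub>G\<^esub> h)) (t \<chi>)) ** e =
      sm C Z ?Y (carrier Gd) (\<lambda>\<chi>. scl C (\<chi> (inv\<^bsub>G\<^esub> h)) (t \<chi>) ** e)"
    using d e h S.finite_chars by (subst sm_cmp) auto
  also have "\<dots> = sm C Z ?Y (carrier Gd) (\<lambda>\<chi>. scl C (\<chi> (inv\<^bsub>G\<^esub> h \<star> k)) e)"
    using d e h k te by (intro sm_cong) (auto simp: S.char_mult)
  also have "\<dots> = scl C (\<Oplus>\<^bsub>K\<^esub>\<chi>\<in>carrier Gd. \<chi> (inv\<^bsub>G\<^esub> h \<star> k)) e"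
    using d e h k S.finite_chars by (intro sm_const_scl) auto
  also have "(\<Oplus>\<^bsub>K\<^esub>\<chi>\<in>carrier Gd. \<chi> (inv\<^bsub>G\<^esub> h \<star> k)) = (if h = k then S.ordK else \<zero>\<^bsub>K\<^esub>)"
  proof -
    have "inv\<^bsub>G\<^esub> h \<star> k = \<one>\<^bsub>G\<^esub> \<longleftrightarrow> h = k"
      using h k by (metis G.inv_closed G.inv_inv G.inv_equality G.l_inv)
    then show ?thesis using S.sum_char_eval[of "inv\<^bsub>G\<^esub> h \<star> k"] h k by simp
  qed
  finally have *: "sm C ?Y ?Y (carrier Gd) (\<lambda>\<chi>. scl C (\<chi> (inv\<^bsub>G\<^esub> h)) (t \<chi>)) ** e =
    scl C (if h = k then S.ordK else \<zero>\<^bsub>K\<^esub>) e" .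
  have "ee N t h ** e = scl C S.ordK_inv (sm C ?Y ?Y (carrier Gd) (\<lambda>\<chi>. scl C (\<chi> (inv\<^bsub>G\<^esub> h)) (t \<chi>)) ** e)"
    using d e h by (simp add: ee_def[of N t h])
  then show ?thesis unfolding * using e d(2) by auto
qed

lemma ee_ee:
  "h \<in> carrier G \<Longrightarrow> k \<in> carrier G \<Longrightarrow>
    ee N t h ** ee N t k = (if h = k then ee N t k else zr C (fst N) (fst N))"
  by (rule ee_eigen[OF ee_arr[OF gr] _ _ t_ee])

text \<open>The dual orthogonality: summing the projections over the group leaves only the trivial
  character.\<close>

lemma sum_ee: "sm C (fst N) (fst N) (carrier G) (ee N t) = idn C (fst N)"
proof -
  note d = gradedD[OF gr]
  let ?Y = "fst N"
  have "sm C ?Y ?Y (carrier G) (\<lambda>h. sm C ?Y ?Y (carrier Gd) (\<lambda>\<chi>. scl C (\<chi> (inv\<^bsub>G\<^esub> h)) (t \<chi>))) =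
      sm C ?Y ?Y (carrier Gd) (\<lambda>\<chi>. sm C ?Y ?Y (carrier G) (\<lambda>h. scl C (\<chi> (inv\<^bsub>G\<^esub> h)) (t \<chi>)))"
    using d finite_G S.finite_chars by (intro sm_swap) auto
  also have "\<dots> = sm C ?Y ?Y (carrier Gd) (\<lambda>\<chi>. if \<chi> = \<one>\<^bsub>Gd\<^esub> then scl C S.ordK (idn C ?Y) else zr C ?Y ?Y)"
  proof (intro sm_cong)
    fix \<chi> assume \<chi>: "\<chi> \<in> carrier Gd"
    have "sm C ?Y ?Y (carrier G) (\<lambda>h. scl C (\<chi> (inv\<^bsub>G\<^esub> h)) (t \<chi>)) =
        scl C (\<Oplus>\<^bsub>K\<^esub>h\<in>carrier G. \<chi> (inv\<^bsub>G\<^esub> h)) (t \<chi>)"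
      using d \<chi> finite_G by (intro sm_const_scl) auto
    also have "(\<Oplus>\<^bsub>K\<^esub>h\<in>carrier G. \<chi> (inv\<^bsub>G\<^esub> h)) = (\<Oplus>\<^bsub>K\<^esub>h\<in>carrier G. (inv\<^bsub>Gd\<^esub> \<chi>) h)"
      using \<chi> by (intro S.K.finsum_cong') (auto simp: S.char_inv_apply)
    also have "\<dots> = (if \<chi> = \<one>\<^bsub>Gd\<^esub> then S.ordK else \<zero>\<^bsub>K\<^esub>)"
      using \<chi> by (simp add: S.sum_char S.Gd.inv_eq_1_iff)
    finally show "sm C ?Y ?Y (carrier G) (\<lambda>h. scl C (\<chi> (inv\<^bsub>G\<^esub> h)) (t \<chi>)) =
        (if \<chi> = \<one>\<^bsub>Gd\<^esub> then scl C S.ordK (idn C ?Y) else zr C ?Y ?Y)" using d \<chi> by auto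
  qed (use d in auto)
  also have "\<dots> = scl C S.ordK (idn C ?Y)"
    using sm_single[OF S.finite_chars S.Gd.one_closed d(2) d(2),
      of "\<lambda>\<chi>. if \<chi> = \<one>\<^bsub>Gd\<^esub> then scl C S.ordK (idn C ?Y) else zr C ?Y ?Y"] d(2) by simp
  finally have "scl C S.ordK_inv (sm C ?Y ?Y (carrier G) (\<lambda>h. sm C ?Y ?Y (carrier Gd)
      (\<lambda>\<chi>. scl C (\<chi> (inv\<^bsub>G\<^esub> h)) (t \<chi>)))) = idn C ?Y" using d(2) by simp
  then show ?thesis
    unfolding ee_def using d finite_G by (subst (asm) scl_sm) auto
qed

text \<open>The commutation rule for \<open>\<alpha>\<^sub>g\<close> and \<open>t\<^sub>\<chi>\<close> says that \<open>\<alpha>\<^sub>g\<close> maps the eigenspace of degree \<open>h\<close> to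
  \<open>F\<^sub>g\<close> of the eigenspace of degree \<open>g\<inverse> h\<close>. For \<open>g = h\<close> it identifies the former with \<open>F\<^sub>h X\<close>.\<close>

lemma st_ee:
  assumes g: "g \<in> carrier G" and h: "h \<in> carrier G"
  shows "st N g ** ee N t h = fmap (F g) (ee N t (inv\<^bsub>G\<^esub> g \<star> h)) ** st N g"
proof -
  note d = gradedD[OF gr]
  let ?Y = "fst N" and ?gh = "inv\<^bsub>G\<^esub> g \<star> h"
  have gh: "?gh \<in> carrier G" using g h by simp
  have inv: "inv\<^bsub>G\<^esub> ?gh = inv\<^bsub>G\<^esub> h \<star> g" using g h by (simp add: G.inv_mult_group)
  have ar: "scl C (\<chi> (inv\<^bsub>G\<^esub> k)) (t \<chi>) \<in> arrows C ?Y ?Y" if "\<chi> \<in> carrier Gd" "k \<in> carrier G" for \<chi> k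
    using that d by simp
  have "st N g ** sm C ?Y ?Y (carrier Gd) (\<lambda>\<chi>. scl C (\<chi> (inv\<^bsub>G\<^esub> h)) (t \<chi>)) =
      sm C ?Y (ob (F g) ?Y) (carrier Gd) (\<lambda>\<chi>. st N g ** scl C (\<chi> (inv\<^bsub>G\<^esub> h)) (t \<chi>))"
    using d g h S.finite_chars by (subst cmp_sm) auto
  also have "\<dots> = sm C ?Y (ob (F g) ?Y) (carrier Gd) (\<lambda>\<chi>. fmap (F g) (scl C (\<chi> (inv\<^bsub>G\<^esub> ?gh)) (t \<chi>)) ** st N g)"
    unfolding inv using d g h by (intro sm_cong) (auto simp: F_scl S.char_mult)
  also have "\<dots> = sm C (ob (F g) ?Y) (ob (F g) ?Y) (carrier Gd) (\<lambda>\<chi>. fmap (F g) (scl C (\<chi> (inv\<^bsub>G\<^esub> ?gh)) (t \<chi>))) ** st N g"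
    using d g gh S.finite_chars by (subst sm_cmp) auto
  also have "\<dots> = fmap (F g) (sm C ?Y ?Y (carrier Gd) (\<lambda>\<chi>. scl C (\<chi> (inv\<^bsub>G\<^esub> ?gh)) (t \<chi>))) ** st N g"
    using F_sm[OF g S.finite_chars d(2) d(2), of "\<lambda>\<chi>. scl C (\<chi> (inv\<^bsub>G\<^esub> ?gh)) (t \<chi>)"] ar[OF _ gh] by simp
  finally show ?thesis
    unfolding ee_def using d g h gh by (simp add: F_scl)
qed

end

text \<open>A graded object together with a splitting \<open>X\<close> of its component of degree \<open>1\<close>. The component
  of degree \<open>h\<close> is then a copy of \<open>F\<^sub>h X\<close>, with projection \<open>pr\<close> and inclusion \<open>ic\<close>.\<close>

definition graded_at ::
    "'o \<times> ('g \<Rightarrow> 'm) \<Rightarrow> (('g \<Rightarrow> 'k) \<Rightarrow> ('o, 'm) arr) \<Rightarrow> 'o \<Rightarrow> ('o, 'm) arr \<Rightarrow> ('o, 'm) arr \<Rightarrow> bool"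
  where "graded_at N t X r s \<longleftrightarrow> graded N t \<and> X \<in> Obj C \<and> r \<in> arrows C (fst N) X \<and>
    s \<in> arrows C X (fst N) \<and> s ** r = ee N t \<one>\<^bsub>G\<^esub> \<and> r ** s = idn C X"

definition pr :: "'o \<times> ('g \<Rightarrow> 'm) \<Rightarrow> ('o, 'm) arr \<Rightarrow> 'g \<Rightarrow> ('o, 'm) arr"
  where "pr N r h = fmap (F h) r ** st N h"

definition ic :: "'o \<times> ('g \<Rightarrow> 'm) \<Rightarrow> ('o, 'm) arr \<Rightarrow> 'g \<Rightarrow> ('o, 'm) arr"
  where "ic N s h = ainv C (st N h) ** fmap (F h) s"

lemma graded_split:
  assumes "graded N t"
  shows "\<exists>X r s. graded_at N t X r s"
proof -
  have e: "ee N t \<one>\<^bsub>G\<^esub> \<in> arrows C (fst N) (fst N)" "ee N t \<one>\<^bsub>G\<^esub> ** ee N t \<one>\<^bsub>G\<^esub> = ee N t \<one>\<^bsub>G\<^esub>"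
    using ee_arr[OF assms, of "\<one>\<^bsub>G\<^esub>"] ee_ee[OF assms, of "\<one>\<^bsub>G\<^esub>" "\<one>\<^bsub>G\<^esub>"] by simp_all
  show ?thesis by (rule split_idempotent[OF e]) (use assms in \<open>unfold graded_at_def, blast\<close>)
qed

context
  fixes N t X r s assumes gr: "graded_at N t X r s"
begin

lemma graded_atD:
  "graded N t" "N \<in> Obj CG" "fst N \<in> Obj C" "X \<in> Obj C" "is_arr C r" "src r = fst N" "trg r = X"
  "is_arr C s" "src s = X" "trg s = fst N" "s ** r = ee N t \<one>\<^bsub>G\<^esub>" "r ** s = idn C X"
  "\<And>g. g \<in> carrier G \<Longrightarrow> iso_arr C (st N g)" "\<And>g. g \<in> carrier G \<Longrightarrow> is_arr C (st N g)"
  using gr gradedD[of N t] unfolding graded_at_def by auto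

lemma pr_arr: "h \<in> carrier G \<Longrightarrow> is_arr C (pr N r h)" "src (pr N r h) = fst N" "trg (pr N r h) = ob (F h) X"
  unfolding pr_def using graded_atD by simp_all

lemma ic_arr:
  "h \<in> carrier G \<Longrightarrow> is_arr C (ic N s h)" "src (ic N s h) = ob (F h) X" "h \<in> carrier G \<Longrightarrow> trg (ic N s h) = fst N"
  unfolding ic_def using graded_atD by simp_all

lemma st_ic_self: "h \<in> carrier G \<Longrightarrow> st N h ** ic N s h = fmap (F h) s"
  unfolding ic_def using graded_atD by (intro ainv_cancel(2)) auto

lemma ic_pr: 
  assumes h: "h \<in> carrier G"
  shows "ic N s h ** pr N r h = ee N t h"
proof -
  note d = graded_atD
  have e: "ee N t h \<in> arrows C (fst N) (fst N)" using ee_arr[OF d(1) h] .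
  have "ic N s h ** pr N r h = ainv C (st N h) ** (fmap (F h) (s ** r) ** st N h)"
    unfolding ic_def pr_def using d(2-10) d(13,14)[OF h] h by (simp add: F_cmp)
  also have "fmap (F h) (s ** r) ** st N h = st N h ** ee N t h"
    unfolding d(11) using st_ee[OF d(1) h h] h by simp
  finally show ?thesis using ainv_cancel(1)[OF d(13)[OF h], of "ee N t h"] e by simp
qed

lemma pr_ic_same: "h \<in> carrier G \<Longrightarrow> pr N r h ** ic N s h = idn C (ob (F h) X)"
  unfolding pr_def using graded_atD st_ic_self[of h] ic_arr[of h] by (simp flip: F_cmp)

lemma pr_ee: "h \<in> carrier G \<Longrightarrow> pr N r h ** ee N t h = pr N r h"
  using pr_ic_same[of h] pr_arr[of h] ic_arr[of h] graded_atD(3,4)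
    cmp_assoc_subst[OF pr_ic_same[of h], of "pr N r h"] by (simp flip: ic_pr)

lemma ee_ic: "h \<in> carrier G \<Longrightarrow> ee N t h ** ic N s h = ic N s h"
  using pr_ic_same[of h] pr_arr[of h] ic_arr[of h] graded_atD(3,4) by (simp flip: ic_pr)

lemma pr_ic_other:
  assumes h: "h \<in> carrier G" and k: "k \<in> carrier G" and "h \<noteq> k"
  shows "pr N r k ** ic N s h = zr C (ob (F h) X) (ob (F k) X)"
proof -
  note d = graded_atD
  note e = ee_arr[OF d(1) h] ee_arr[OF d(1) k]
  have "pr N r k ** ic N s h = (pr N r k ** ee N t k) ** (ee N t h ** ic N s h)"
    using pr_ee[OF k] ee_ic[OF h] by simp
  also have "\<dots> = pr N r k ** ((ee N t k ** ee N t h) ** ic N s h)"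
    using e pr_arr[of k] ic_arr[of h] h k by simp
  also have "ee N t k ** ee N t h = zr C (fst N) (fst N)" using ee_ee[OF d(1) k h] assms(3) by simp
  finally show ?thesis using pr_arr[of k] ic_arr[of h] h k d(3,4) by simp
qed

lemma graded_biprod: "biprod C (carrier G) (\<lambda>h. ob (F h) X) (fst N) (ic N s) (pr N r)"
  unfolding biprod_def
proof (intro conjI ballI)
  have "sm C (fst N) (fst N) (carrier G) (\<lambda>i. ic N s i ** pr N r i) = sm C (fst N) (fst N) (carrier G) (ee N t)"
    using graded_atD ic_pr ee_arr[OF graded_atD(1)] by (intro sm_cong) auto
  then show "sm C (fst N) (fst N) (carrier G) (\<lambda>i. ic N s i ** pr N r i) = idn C (fst N)"
    using sum_ee[OF graded_atD(1)] by simp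
qed (use finite_G graded_atD(3) pr_arr ic_arr pr_ic_same pr_ic_other in auto)

lemma t_ic:
  assumes "\<chi> \<in> carrier Gd" "h \<in> carrier G"
  shows "t \<chi> ** ic N s h = scl C (\<chi> h) (ic N s h)"
proof -
  note d = graded_atD
  have "t \<chi> ** (ee N t h ** ic N s h) = scl C (\<chi> h) (ee N t h) ** ic N s h"
    using assms d gradedD[OF d(1)] ic_arr[of h] ee_arr[OF d(1) assms(2)]
    by (intro cmp_assoc_subst[OF t_ee[OF d(1) assms]]) auto
  then show ?thesis using ee_ic[OF assms(2)] assms ic_arr[of h] ee_arr[OF d(1) assms(2)] by simp
qed

lemma pr_t:
  assumes "\<chi> \<in> carrier Gd" "h \<in> carrier G"
  shows "pr N r h ** t \<chi> = scl C (\<chi> h) (pr N r h)"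
proof -
  note d = graded_atD
  have "pr N r h ** t \<chi> = pr N r h ** (ee N t h ** t \<chi>)"
    using assms gradedD[OF d(1)] pr_arr[of h] ee_arr[OF d(1) assms(2)]
      cmp_assoc_subst[OF pr_ee[OF assms(2)], of "t \<chi>"] by simp
  also have "\<dots> = scl C (\<chi> h) (pr N r h)"
    unfolding ee_t[OF d(1) assms] using assms pr_arr[of h] ee_arr[OF d(1) assms(2)] pr_ee[OF assms(2)] by simp
  finally show ?thesis .
qed

text \<open>In terms of the components, the equivariant structure is that of an induced object.\<close>

lemma pr_cocycle:
  assumes g: "g \<in> carrier G" and k: "k \<in> carrier G"
  shows "pr N r (g \<star> k) = E g k X ** (fmap (F g) (pr N r k) ** st N g)"
proof -
  note d = graded_atD
  have "pr N r (g \<star> k) = (fmap (F (g \<star> k)) r ** E g k (fst N)) ** (fmap (F g) (st N k) ** st N g)"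
    unfolding pr_def CG_ObjD(4)[OF d(2) g k] using d g k by simp
  also have "fmap (F (g \<star> k)) r ** E g k (fst N) = E g k X ** fmap (F g) (fmap (F k) r)"
    using E_natural[OF g k, of r] d by simp
  also have "(E g k X ** fmap (F g) (fmap (F k) r)) ** (fmap (F g) (st N k) ** st N g) =
      E g k X ** (fmap (F g) (pr N r k) ** st N g)"
    unfolding pr_def using d g k by (simp add: F_cmp)
  finally show ?thesis .
qed

lemma ic_cocycle:
  assumes g: "g \<in> carrier G" and k: "k \<in> carrier G"
  shows "st N g ** (ic N s (g \<star> k) ** E g k X) = fmap (F g) (ic N s k)"
proof -
  note d = graded_atD
  have gk: "g \<star> k \<in> carrier G" using g k by simp
  let ?u = "E g k (fst N) ** fmap (F g) (st N k)"
  have u: "iso_arr C ?u" using d g k by simp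
  have "?u ** (st N g ** (ic N s (g \<star> k) ** E g k X)) = (st N (g \<star> k) ** ic N s (g \<star> k)) ** E g k X"
    unfolding CG_ObjD(4)[OF d(2) g k] using d g k gk ic_arr(1,3)[OF gk] ic_arr(2)[of "g \<star> k"] by simp
  also have "\<dots> = E g k (fst N) ** fmap (F g) (fmap (F k) s)"
    unfolding st_ic_self[OF gk] using E_natural[OF g k, of s] d by simp
  also have "\<dots> = ?u ** fmap (F g) (ic N s k)"
    using st_ic_self[OF k, symmetric] d g k ic_arr(1,3)[OF k] ic_arr(2)[of k] by (simp flip: F_cmp)
  finally show ?thesis
    using u d g k gk ic_arr(1,3)[OF k] ic_arr(2)[of k] ic_arr(1,3)[OF gk] ic_arr(2)[of "g \<star> k"]
    by - (rule iso_cancel_left[OF u], auto)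
qed

end

subsection \<open>Homogeneous morphisms\<close>

context
  fixes N t X r s N' t' X' r' s' assumes A: "graded_at N t X r s" and B: "graded_at N' t' X' r' s'"
begin

lemma equivariant_ic:
  assumes f: "f \<in> arrows CG N N'" and h: "h \<in> carrier G"
  shows "U f ** ic N s h = ainv C (st N' h) ** fmap (F h) (U f ** s)"
proof -
  note a = graded_atD[OF A] and b = graded_atD[OF B]
  have f': "is_arr CG f" "src f = N" "trg f = N'" using f by auto
  note d = CG_arrD[OF f'(1)]
  note ia = ic_arr[OF A, of h]
  have "st N' h ** (U f ** ic N s h) = fmap (F h) (U f) ** (st N h ** ic N s h)"
    using cmp_assoc_subst[OF d(4)[OF h], of "ic N s h"] f'(2,3) d(3) a b ia h by simp
  also have "\<dots> = fmap (F h) (U f ** s)" unfolding st_ic_self[OF A h] using d(3) f' a h by (simp add: F_cmp)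
  finally have "ainv C (st N' h) ** (st N' h ** (U f ** ic N s h)) = ainv C (st N' h) ** fmap (F h) (U f ** s)" by simp
  then show ?thesis using ainv_cancel(1)[OF b(13)[OF h], of "U f ** ic N s h"] d(3) f' ia h by simp
qed

text \<open>The structure isomorphisms carry the component of degree one to all others, so an equivariant
  morphism is determined by its restriction to that component.\<close>

lemma equivariant_eqI:
  assumes f: "f \<in> arrows CG N N'" and f2: "f2 \<in> arrows CG N N'" and s: "U f ** s = U f2 ** s"
  shows "f = f2"
proof -
  have u: "is_arr C (U f)" "is_arr C (U f2)" using f f2 CG_arrD(3) by auto
  have "U f = U f2"
  proof (rule biprod_eqI_right[OF graded_biprod[OF A]])
    show "U f ** ic N s h = U f2 ** ic N s h" if "h \<in> carrier G" for h
      using equivariant_ic[OF f that] equivariant_ic[OF f2 that] s by simp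
  qed (use u f f2 in auto)
  then show ?thesis using f f2 by (intro U_eqI) auto
qed

lemma homogeneous_ee_s:
  assumes f: "is_arr C f" "src f = fst N" "trg f = fst N'" and deg: "homogeneous t t' a f" and a: "a \<in> carrier G"
  shows "ee N' t' a ** (f ** s) = f ** s"
proof -
  note dA = graded_atD[OF A] and dB = graded_atD[OF B]
  have "ee N' t' a ** f = f ** (s ** r)"
    using homogeneous_ee[OF dA(1) dB(1) _ a G.one_closed deg] f a by (simp add: dA(11))
  then have "ee N' t' a ** (f ** s) = (f ** (s ** r)) ** s"
    using f dA(8-10) ee_arr[OF dB(1) a] by (intro cmp_assoc_subst) auto
  then show ?thesis using f dA(1-10,12) by simp
qed

text \<open>An arrow of degree \<open>a\<close> maps the component \<open>X\<close> of degree one into the component \<open>F\<^sub>a X'\<close>. In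
  degree one there are two descriptions of that component, \<open>X'\<close> itself and \<open>F\<^sub>1 X'\<close>; the first
  avoids the unit constraint of the action.\<close>

lemma homogeneous_s:
  assumes f: "is_arr C f" "src f = fst N" "trg f = fst N'" and deg: "homogeneous t t' a f" and g: "a \<in> carrier G"
  shows "f ** s = ic N' s' a ** (pr N' r' a ** (f ** s))"
proof -
  have "ic N' s' a ** (pr N' r' a ** (f ** s)) = ee N' t' a ** (f ** s)"
    using f pr_arr[OF B, of a] ic_arr[OF B, of a] g graded_atD[OF A] graded_atD[OF B]
    by (intro cmp_assoc_subst[OF ic_pr[OF B g]]) auto
  then show ?thesis using homogeneous_ee_s[OF f deg] assms by simp
qed

lemma homogeneous_one_s:
  assumes f: "is_arr C f" "src f = fst N" "trg f = fst N'" and deg: "homogeneous t t' \<one>\<^bsub>G\<^esub> f"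
  shows "f ** s = s' ** (r' ** (f ** s))"
proof -
  have "s' ** (r' ** (f ** s)) = ee N' t' \<one>\<^bsub>G\<^esub> ** (f ** s)"
    using f graded_atD[OF A] graded_atD[OF B] by (intro cmp_assoc_subst[OF graded_atD(11)[OF B]]) auto
  then show ?thesis using homogeneous_ee_s[OF f deg] assms by simp
qed

text \<open>The arrow with components \<open>w\<^sub>h : F\<^sub>h X \<rightarrow> F\<^sub>h\<^sub>a X'\<close>. It suffices to check its equivariance on each
  component, where it is the compatibility of \<open>w\<close> with the constraints of the action.\<close>

definition assemble :: "'g \<Rightarrow> ('g \<Rightarrow> ('o, 'm) arr) \<Rightarrow> ('o \<times> ('g \<Rightarrow> 'm), 'm) arr"
  where "assemble a w = lift N N' (sm C (fst N) (fst N') (carrier G)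
    (\<lambda>h. (ic N' s' (h \<star> a) ** w h) ** pr N r h))"

lemma assemble:
  assumes a: "a \<in> carrier G"
    and w: "\<And>h. h \<in> carrier G \<Longrightarrow> w h \<in> arrows C (ob (F h) X) (ob (F (h \<star> a)) X')"
    and compat: "\<And>g k. g \<in> carrier G \<Longrightarrow> k \<in> carrier G \<Longrightarrow>
      E g (k \<star> a) X' ** fmap (F g) (w k) = w (g \<star> k) ** E g k X"
  shows "assemble a w \<in> arrows CG N N'"
    and "homogeneous t t' a (U (assemble a w))"
    and "\<And>h. h \<in> carrier G \<Longrightarrow> U (assemble a w) ** ic N s h = ic N' s' (h \<star> a) ** w h"
    and "(\<And>h. h \<in> carrier G \<Longrightarrow> iso_arr C (w h)) \<Longrightarrow> iso_arr CG (assemble a w)"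
proof -
  note dA = graded_atD[OF A] and dB = graded_atD[OF B] and bt = gradedD[OF graded_atD(1)[OF B]]
    and at = gradedD[OF graded_atD(1)[OF A]]
  note iA = ic_arr[OF A] and iB = ic_arr[OF B] and pA = pr_arr[OF A] and pB = pr_arr[OF B]
  note bA = graded_biprod[OF A] and bB = graded_biprod[OF B]
  define f where "f = U (assemble a w)"
  have f_sm: "f = sm C (fst N) (fst N') (carrier G) (\<lambda>h. (ic N' s' (h \<star> a) ** w h) ** pr N r h)"
    by (simp add: f_def assemble_def)
  have f: "f \<in> arrows C (fst N) (fst N')" unfolding f_sm using dA dB iB pA w a by simp
  have f_ic: "f ** ic N s h = ic N' s' (h \<star> a) ** w h" if "h \<in> carrier G" for h
    unfolding f_sm using that dB(3) iB w a
      biprod_sm_inc[OF bA, of h "fst N'" "\<lambda>h. ic N' s' (h \<star> a) ** w h"] by simp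
  have "is_arr CG (lift N N' f)"
  proof (rule lift_arr[OF dA(2) dB(2) f])
    fix g assume g: "g \<in> carrier G"
    show "st N' g ** f = fmap (F g) f ** st N g"
    proof (rule biprod_eqI_right[OF bA])
      fix h assume h: "h \<in> carrier G"
      define k where "k = inv\<^bsub>G\<^esub> g \<star> h"
      have k: "k \<in> carrier G" and hk: "h = g \<star> k" using g h by (simp_all add: k_def G.m_assoc[symmetric])
      have gka: "g \<star> (k \<star> a) \<in> carrier G" "k \<star> a \<in> carrier G" using g k a by simp_all
      note iBa = iB(1,3)[OF gka(1)] iB(2)[of "g \<star> (k \<star> a)"] iB(1,3)[OF gka(2)] iB(2)[of "k \<star> a"]
      have wgk: "w (g \<star> k) \<in> arrows C (ob (F (g \<star> k)) X) (ob (F (g \<star> (k \<star> a))) X')"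
        using w[of "g \<star> k"] g k a by (simp add: G.m_assoc)
      have "(st N' g ** f) ** (ic N s h ** E g k X) = st N' g ** ((f ** ic N s h) ** E g k X)"
        using f dA dB iA(1,3)[OF h] iA(2)[of h] g k hk by simp
      also have "\<dots> = st N' g ** ((ic N' s' (h \<star> a) ** w h) ** E g k X)" unfolding f_ic[OF h] ..
      also have "\<dots> = st N' g ** (ic N' s' (g \<star> (k \<star> a)) ** (w (g \<star> k) ** E g k X))"
        using iBa wgk dA dB g k a by (simp add: hk G.m_assoc)
      also have "w (g \<star> k) ** E g k X = E g (k \<star> a) X' ** fmap (F g) (w k)"
        using compat[OF g k] by simp
      also have "st N' g ** (ic N' s' (g \<star> (k \<star> a)) ** (E g (k \<star> a) X' ** fmap (F g) (w k))) =
          (st N' g ** (ic N' s' (g \<star> (k \<star> a)) ** E g (k \<star> a) X')) ** fmap (F g) (w k)"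
        using iBa w[OF k] dA dB g k gka by simp
      also have "\<dots> = fmap (F g) (ic N' s' (k \<star> a) ** w k)"
        unfolding ic_cocycle[OF B g gka(2)] using iBa w[OF k] g by (simp add: F_cmp)
      also have "\<dots> = fmap (F g) f ** fmap (F g) (ic N s k)"
        unfolding f_ic[OF k, symmetric] using f g iA(1,3)[OF k] by (simp add: F_cmp)
      also have "\<dots> = (fmap (F g) f ** st N g) ** (ic N s h ** E g k X)"
        unfolding ic_cocycle[OF A g k, symmetric] hk[symmetric]
        using f dA iA(1,3)[OF h] iA(2)[of h] g k hk by simp
      finally have "((st N' g ** f) ** ic N s h) ** E g k X = ((fmap (F g) f ** st N g) ** ic N s h) ** E g k X"
        using f dA dB iA(1,3)[OF h] iA(2)[of h] g k hk by simp
      then show "(st N' g ** f) ** ic N s h = (fmap (F g) f ** st N g) ** ic N s h"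
        using f dA dB iA(1,3)[OF h] iA(2)[of h] g k hk
        by - (rule iso_cancel_right[OF E_iso[OF g k dA(4)]], auto)
    qed (use f g dA dB in auto)
  qed
  moreover have lf: "lift N N' f = assemble a w" unfolding f_def by (simp add: assemble_def)
  ultimately show arr: "assemble a w \<in> arrows CG N N'" by (simp add: assemble_def)
  show "homogeneous t t' a (U (assemble a w))"
    unfolding homogeneous_def f_def[symmetric]
  proof
    fix \<chi> assume \<chi>: "\<chi> \<in> carrier Gd"
    show "t' \<chi> ** f = scl C (\<chi> a) (f ** t \<chi>)"
    proof (rule biprod_eqI_right[OF bA])
      fix h assume h: "h \<in> carrier G"
      have ha: "h \<star> a \<in> carrier G" using h a by simp
      note iBa = iB(1,3)[OF ha] iB(2)[of "h \<star> a"]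
      have "(t' \<chi> ** f) ** ic N s h = t' \<chi> ** (ic N' s' (h \<star> a) ** w h)"
        using f bt \<chi> iA(1,3)[OF h] f_ic[OF h] by simp
      also have "\<dots> = scl C (\<chi> (h \<star> a)) (ic N' s' (h \<star> a)) ** w h"
        using bt \<chi> iBa w[OF h] by (intro cmp_assoc_subst[OF t_ic[OF B \<chi> ha]]) auto
      also have "\<dots> = scl C (\<chi> a \<otimes>\<^bsub>K\<^esub> \<chi> h) (f ** ic N s h)"
        unfolding f_ic[OF h] using iBa w[OF h] \<chi> h a by (simp add: S.char_mult S.K.m_comm)
      also have "\<dots> = scl C (\<chi> a) (f ** t \<chi>) ** ic N s h"
        using f at \<chi> h a iA(1,3)[OF h] t_ic[OF A \<chi> h] by simp
      finally show "(t' \<chi> ** f) ** ic N s h = scl C (\<chi> a) (f ** t \<chi>) ** ic N s h" .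
    qed (use f at bt \<chi> a in auto)
  qed
  show "U (assemble a w) ** ic N s h = ic N' s' (h \<star> a) ** w h" if "h \<in> carrier G" for h
    using f_ic[OF that] by (simp add: f_def)
  show "iso_arr CG (assemble a w)" if wi: "\<And>h. h \<in> carrier G \<Longrightarrow> iso_arr C (w h)"
  proof (rule CG_iso)
    show "is_arr CG (assemble a w)" using arr by simp
    have bij: "bij_betw (\<lambda>h. h \<star> a) (carrier G) (carrier G)"
      by (rule bij_betw_byWitness[where f' = "\<lambda>h. h \<star> inv\<^bsub>G\<^esub> a"]) (use a in \<open>auto simp: G.m_assoc\<close>)
    show "iso_arr C (U (assemble a w))"
      unfolding f_def[symmetric] by (rule biprod_iso_arr[OF bA bB bij w wi f f_ic])
  qed
qed

text \<open>Fullness of the passage from \<open>X\<close> to graded objects: the components \<open>F\<^sub>h u\<close> are compatible by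
  naturality. The assembled morphism restricts to \<open>u\<close> itself, and not only to \<open>F\<^sub>1 u\<close>, because the
  structure isomorphism at the unit is natural in all arrows of \<open>C\<close>.\<close>

lemma extend_component:
  assumes u: "u \<in> arrows C X X'"
  obtains f where "f \<in> arrows CG N N'" "homogeneous t t' \<one>\<^bsub>G\<^esub> (U f)" "U f ** s = s' ** u" "r' ** U f = u ** r"
    "iso_arr C u \<Longrightarrow> iso_arr CG f"
proof -
  note dA = graded_atD[OF A] and dB = graded_atD[OF B] and at = gradedD[OF graded_atD(1)[OF A]]
  have one: "\<one>\<^bsub>G\<^esub> \<in> carrier G" by simp
  define w where "w h = fmap (F h) u" for h
  define f where "f = assemble \<one>\<^bsub>G\<^esub> w"
  have w: "w h \<in> arrows C (ob (F h) X) (ob (F (h \<star> \<one>\<^bsub>G\<^esub>)) X')" if "h \<in> carrier G" for h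
    using that u by (simp add: w_def)
  have compat: "E g (k \<star> \<one>\<^bsub>G\<^esub>) X' ** fmap (F g) (w k) = w (g \<star> k) ** E g k X"
    if "g \<in> carrier G" "k \<in> carrier G" for g k
    using E_natural[OF that, of u] u that by (simp add: w_def)
  have as: "f \<in> arrows CG N N'" "homogeneous t t' \<one>\<^bsub>G\<^esub> (U f)"
    "\<And>h. h \<in> carrier G \<Longrightarrow> U f ** ic N s h = ic N' s' (h \<star> \<one>\<^bsub>G\<^esub>) ** w h"
    "(\<And>h. h \<in> carrier G \<Longrightarrow> iso_arr C (w h)) \<Longrightarrow> iso_arr CG f"
    unfolding f_def using one w compat by (blast intro: assemble)+
  have uf: "is_arr C (U f)" "src (U f) = fst N" "trg (U f) = fst N'" using as(1) CG_arrD(3) by auto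
  note iA = ic_arr(1,3)[OF A one] ic_arr(2)[OF A, of "\<one>\<^bsub>G\<^esub>"] and pA = pr_arr(1)[OF A one] pr_arr(2,3)[OF A, of "\<one>\<^bsub>G\<^esub>"]
  have e: "ee N t \<one>\<^bsub>G\<^esub> \<in> arrows C (fst N) (fst N)" using ee_arr[OF dA(1) one] .
  \<comment> \<open>On the component of degree one the assembled map is \<open>F\<^sub>1 u\<close>, up to the unit constraint.\<close>
  have fe: "U f ** (s ** r) = s' ** (u ** r)"
  proof -
    have "U f ** (s ** r) = U f ** (ic N s \<one>\<^bsub>G\<^esub> ** pr N r \<one>\<^bsub>G\<^esub>)" unfolding dA(11) ic_pr[OF A one] ..
    also have "\<dots> = (ic N' s' (\<one>\<^bsub>G\<^esub> \<star> \<one>\<^bsub>G\<^esub>) ** w \<one>\<^bsub>G\<^esub>) ** pr N r \<one>\<^bsub>G\<^esub>"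
      using uf iA pA by (intro cmp_assoc_subst[OF as(3)[OF one]]) auto
    also have "\<dots> = ainv C (st N' \<one>\<^bsub>G\<^esub>) ** (fmap (F \<one>\<^bsub>G\<^esub>) (s' ** (u ** r)) ** st N \<one>\<^bsub>G\<^esub>)"
      using dA(1-10,13-14) dB(1-10,13-14) u by (simp add: ic_def pr_def w_def F_cmp)
    also have "fmap (F \<one>\<^bsub>G\<^esub>) (s' ** (u ** r)) ** st N \<one>\<^bsub>G\<^esub> = st N' \<one>\<^bsub>G\<^esub> ** (s' ** (u ** r))"
      using dA dB u by (intro unit_natural[symmetric]) auto
    finally show ?thesis using ainv_cancel(1)[OF dB(13)[OF one], of "s' ** (u ** r)"] dA dB u by simp
  qed
  have fs: "U f ** s = s' ** u"
  proof -
    have "U f ** s = (U f ** (s ** r)) ** s" using uf dA(1-10,12) by simp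
    also have "\<dots> = s' ** u" unfolding fe using dA(1-10,12) dB(1-10) u by simp
    finally show ?thesis .
  qed
  have rf: "r' ** U f = u ** r"
  proof -
    have "(s' ** r') ** U f = U f ** (s ** r)"
      using homogeneous_ee[OF dA(1) dB(1) _ one one as(2)] uf by (simp add: dA(11) dB(11))
    then have "r' ** ((s' ** r') ** U f) = r' ** (s' ** (u ** r))" unfolding fe by simp
    moreover have "r' ** ((s' ** r') ** U f) = (r' ** s') ** (r' ** U f)"
      and "r' ** (s' ** (u ** r)) = (r' ** s') ** (u ** r)" using uf u dA(1-10) dB(1-10) by simp_all
    ultimately show ?thesis unfolding dB(12) using uf u dA(1-10) dB(1-10) by simp
  qed
  show ?thesis
    using that[of f] as(1,2) fs rf as(4) F_iso by (simp add: w_def)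
qed

end

text \<open>A graded object is determined by its component of degree one; in particular it is isomorphic to
  the object induced from it.\<close>

lemma graded_at_iso:
  assumes "graded_at N t X r s" "graded_at N' t' X' r' s'" "(X, X') \<in> iso_rel C"
  shows "(N, N') \<in> iso_rel CG"
proof -
  obtain u where u: "u \<in> arrows C X X'" "iso_arr C u" using assms(3) by (auto simp: iso_rel_iff)
  obtain f where "f \<in> arrows CG N N'" "iso_arr CG f"
    using extend_component[OF assms(1,2) u(1)] u(2) by metis
  then show ?thesis by (intro iso_relI[of CG f]) auto
qed

text \<open>Through the components, composition of homogeneous morphisms turns into the composition
  \<open>X \<rightarrow> F\<^sub>a X' \<rightarrow> F\<^sub>a F\<^sub>b X'' \<cong> F\<^sub>a\<^sub>b X''\<close>. This is where the coherence of descended functors comes from.\<close>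

lemma component_cmp:
  assumes A: "graded_at N t X r s" and B: "graded_at N' t' X' r' s'" and D: "graded_at N'' t'' X'' r'' s''"
    and f: "f \<in> arrows CG N N'" and f': "f' \<in> arrows CG N' N''"
    and a: "a \<in> carrier G" and b: "b \<in> carrier G" and deg: "homogeneous t t' a (U f)"
  shows "pr N'' r'' (a \<star> b) ** (U f' ** (U f ** s)) =
    E a b X'' ** (fmap (F a) (pr N'' r'' b ** (U f' ** s')) ** (pr N' r' a ** (U f ** s)))"
proof -
  note dA = graded_atD[OF A] and dB = graded_atD[OF B] and dD = graded_atD[OF D]
  have uf: "is_arr C (U f)" "src (U f) = fst N" "trg (U f) = fst N'"
    and uf': "is_arr C (U f')" "src (U f') = fst N'" "trg (U f') = fst N''" using f f' CG_arrD(3) by auto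
  have ar: "is_arr CG f'" "src f' = N'" "trg f' = N''" using f' by auto
  note pD = pr_arr(1)[OF D b] pr_arr(2,3)[OF D, of b]
  note pB = pr_arr(1)[OF B a] pr_arr(2,3)[OF B, of a] and iB = ic_arr(1,3)[OF B a] ic_arr(2)[OF B, of a]
  have fs: "U f ** s = ic N' s' a ** (pr N' r' a ** (U f ** s))"
    using homogeneous_s[OF A B uf deg a] .
  have st': "st N'' a ** (U f' ** (U f ** s)) = fmap (F a) (U f') ** (st N' a ** (U f ** s))"
    using cmp_assoc_subst[OF CG_arrD(4)[OF ar(1) a], of "U f ** s"] uf uf' dA dB dD a ar by simp
  have stB: "st N' a ** (U f ** s) = fmap (F a) s' ** (pr N' r' a ** (U f ** s))"
  proof -
    have "st N' a ** (ic N' s' a ** (pr N' r' a ** (U f ** s))) = fmap (F a) s' ** (pr N' r' a ** (U f ** s))"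
      using uf dA dB a pB iB by (intro cmp_assoc_subst[OF st_ic_self[OF B a]]) auto
    then show ?thesis using fs by simp
  qed
  have "pr N'' r'' (a \<star> b) ** (U f' ** (U f ** s)) =
      E a b X'' ** (fmap (F a) (pr N'' r'' b) ** (st N'' a ** (U f' ** (U f ** s))))"
    unfolding pr_cocycle[OF D a b] using uf uf' dA dB dD a b pD by simp
  also have "\<dots> = E a b X'' ** (fmap (F a) (pr N'' r'' b ** (U f' ** s')) ** (pr N' r' a ** (U f ** s)))"
    unfolding st' stB using uf uf' dA dB dD a b pD pB by (simp add: F_cmp)
  finally show ?thesis .
qed

lemma homogeneous_cmp:
  assumes A: "graded N t" and B: "graded N' t'" and D: "graded N'' t''"
    and f: "f \<in> arrows C (fst N) (fst N')" and f': "f' \<in> arrows C (fst N') (fst N'')"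
    and a: "a \<in> carrier G" and b: "b \<in> carrier G"
    and deg: "homogeneous t t' a f" "homogeneous t' t'' b f'"
  shows "homogeneous t t'' (a \<star> b) (f' ** f)"
  unfolding homogeneous_def
proof
  fix \<chi> assume \<chi>: "\<chi> \<in> carrier Gd"
  note tA = gradedD[OF A] and tB = gradedD[OF B] and tD = gradedD[OF D]
  have "t'' \<chi> ** (f' ** f) = scl C (\<chi> b) (f' ** t' \<chi>) ** f"
    using deg(2) \<chi> f f' tD unfolding homogeneous_def by (intro cmp_assoc_subst) auto
  also have "\<dots> = scl C (\<chi> b) (f' ** (t' \<chi> ** f))" using \<chi> f f' tB b by simp
  also have "t' \<chi> ** f = scl C (\<chi> a) (f ** t \<chi>)" using deg(1) \<chi> unfolding homogeneous_def by blast
  finally show "t'' \<chi> ** (f' ** f) = scl C (\<chi> (a \<star> b)) ((f' ** f) ** t \<chi>)"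
    using \<chi> f f' tA a b by (simp add: S.char_mult S.K.m_comm)
qed

text \<open>Conjugation by \<open>f\<close> carries the projection of degree one to that of degree \<open>a\<close>, so the restriction
  of the inverse of \<open>f\<close> inverts the component.\<close>

lemma component_iso:
  assumes A: "graded_at N t X r s" and B: "graded_at N' t' X' r' s'"
    and f: "f \<in> arrows C (fst N) (fst N')" "iso_arr C f" and a: "a \<in> carrier G" and deg: "homogeneous t t' a f"
  shows "iso_arr C (pr N' r' a ** (f ** s))"
proof -
  note dA = graded_atD[OF A] and dB = graded_atD[OF B] and tA = gradedD[OF graded_atD(1)[OF A]]
    and tB = gradedD[OF graded_atD(1)[OF B]]
  note pB = pr_arr(1)[OF B a] pr_arr(2,3)[OF B, of a] and iB = ic_arr(1,3)[OF B a] ic_arr(2)[OF B, of a]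
  let ?g = "r ** (ainv C f ** ic N' s' a)" and ?c = "pr N' r' a ** (f ** s)"
  have fs: "ic N' s' a ** ?c = f ** s" using homogeneous_s[OF A B _ _ _ deg a] f by simp
  have "?g ** ?c = r ** (ainv C f ** (ic N' s' a ** ?c))" using f dA dB pB iB by simp
  also have "\<dots> = r ** s" unfolding fs using ainv_cancel(1)[OF f(2), of s] f dA by simp
  finally have 1: "?g ** ?c = idn C X" using dA(12) by simp
  have ef: "ee N' t' a ** f = f ** ee N t \<one>\<^bsub>G\<^esub>"
    using homogeneous_ee[OF dA(1) dB(1) f(1) a G.one_closed deg] a by simp
  have "f ** (s ** (r ** ainv C f)) = (ee N' t' a ** f) ** ainv C f"
    unfolding ef dA(11)[symmetric] using f dA(1-10) by simp
  also have "\<dots> = ee N' t' a" using f ee_arr[OF dB(1) a] by simp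
  finally have fsr: "f ** (s ** (r ** ainv C f)) = ee N' t' a" .
  have "?c ** ?g = pr N' r' a ** ((f ** (s ** (r ** ainv C f))) ** ic N' s' a)"
    using f dA(1-10) dB pB iB by simp
  also have "\<dots> = idn C (ob (F a) X')" unfolding fsr ee_ic[OF B a] by (rule pr_ic_same[OF B a])
  finally have 2: "?c ** ?g = idn C (ob (F a) X')" .
  have "inverses C ?c ?g" using 1 2 f dA dB pB iB by (simp add: inverses_def)
  then show ?thesis by (auto simp: iso_arr_def)
qed

end

section \<open>Induction\<close>

lemma (in additive_karoubi_category) finite_biprod_exists:
  assumes "finite I" "\<And>i. i \<in> I \<Longrightarrow> Xs i \<in> Obj C"
  shows "\<exists>S j p. biprod C I Xs S j p"
proof -
  obtain f and n :: nat where f: "bij_betw f I {..<n}"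
    using ex_bij_betw_finite_nat[OF assms(1)] by (auto simp: atLeast0LessThan)
  define g where "g = inv_into I f"
  have g: "bij_betw g {..<n} I" using f unfolding g_def by (rule bij_betw_inv_into)
  have gf: "g (f i) = i" if "i \<in> I" for i using f that by (simp add: g_def bij_betw_def)
  have "Xs (g i) \<in> Obj C" if "i < n" for i using g assms(2) that by (auto simp: bij_betw_def)
  then obtain S where "is_direct_sum C {..<n} (\<lambda>i. Xs (g i)) S"
    using additive[unfolded additive_category_def, rule_format, of n "\<lambda>i. Xs (g i)"] by blast
  then obtain j p where "biprod C {..<n} (\<lambda>i. Xs (g i)) S j p" by (auto simp: is_direct_sum_iff)
  from biprod_reindex[OF this f] have "biprod C I (\<lambda>i. Xs (g (f i))) S (\<lambda>k. j (f k)) (\<lambda>k. p (f k))" .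
  then have "biprod C I Xs S (\<lambda>k. j (f k)) (\<lambda>k. p (f k))" by (rule biprod_mono_Xs) (rule arg_cong[OF gf])
  then show ?thesis by blast
qed

context dual_setting
begin

abbreviation "IndC \<equiv> ob (Ind C G F \<epsilon>)"

lemma F_ff: "g \<in> carrier G \<Longrightarrow> ff_functor K C C (F g)"
  using autoequivalence_faithful_full(1,2)[OF F_autoequivalence]
  by unfold_locales (auto simp: F_linear)

lemma unit_iso:
  assumes X: "X \<in> Obj C"
  shows "(X, ob (F \<one>\<^bsub>G\<^esub>) X) \<in> iso_rel C"
proof -
  have "(ob (F \<one>\<^bsub>G\<^esub>) (ob (F \<one>\<^bsub>G\<^esub>) X), ob (F \<one>\<^bsub>G\<^esub>) X) \<in> iso_rel C"
    using X E_iso[of "\<one>\<^bsub>G\<^esub>" "\<one>\<^bsub>G\<^esub>" X] by (intro iso_relI[of C "E \<one>\<^bsub>G\<^esub> \<one>\<^bsub>G\<^esub> X"]) auto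
  then show ?thesis
    using ff_functor.iso_rel_reflect[OF F_ff[OF G.one_closed], of "ob (F \<one>\<^bsub>G\<^esub>) X" X] X by (auto intro: iso_rel_sym)
qed

text \<open>The structure of \<open>Ind X\<close> identifies the summand \<open>F\<^sub>g\<^sub>k X\<close> with the summand \<open>F\<^sub>g F\<^sub>k X\<close> of \<open>F\<^sub>g\<close> of the
  sum. Stated on the summands, this equation replaces the formula for \<open>\<epsilon>(X)\<close> from here on.\<close>

lemma Ind_structure:
  assumes X: "X \<in> Obj C"
  obtains S j p a where "biprod C (carrier G) (\<lambda>h. ob (F h) X) S j p" "IndC X = mk_eq S a"
    "\<And>g. g \<in> carrier G \<Longrightarrow> a g \<in> arrows C S (ob (F g) S)"
    "\<And>g k. g \<in> carrier G \<Longrightarrow> k \<in> carrier G \<Longrightarrow> a g ** (j (g \<star> k) ** E g k X) = fmap (F g) (j k)"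
proof -
  have "\<exists>x. case x of (S, inc, prj) \<Rightarrow> is_biproduct C (carrier G) (\<lambda>h. ob (F h) X) S inc prj"
  proof -
    obtain S j p where "biprod C (carrier G) (\<lambda>h. ob (F h) X) S j p"
      using finite_biprod_exists[OF finite_G, of "\<lambda>h. ob (F h) X"] X by auto
    then have "is_direct_sum C (carrier G) (\<lambda>h. ob (F h) X) S" by (auto simp: is_direct_sum_iff)
    then show ?thesis by (auto simp: is_direct_sum_def)
  qed
  then have "case chosen_biproduct C (carrier G) (\<lambda>h. ob (F h) X) of (S, inc, prj) \<Rightarrow>
      is_biproduct C (carrier G) (\<lambda>h. ob (F h) X) S inc prj"
    unfolding chosen_biproduct_def by (rule someI_ex)
  then obtain S inc prj where ch: "chosen_biproduct C (carrier G) (\<lambda>h. ob (F h) X) = (S, inc, prj)"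
    and ib: "is_biproduct C (carrier G) (\<lambda>h. ob (F h) X) S inc prj"
    by (cases "chosen_biproduct C (carrier G) (\<lambda>h. ob (F h) X)") auto
  define j where "j h = Arr (ob (F h) X) (inc h) S" for h
  define p where "p h = Arr S (prj h) (ob (F h) X)" for h
  have jp: "biprod C (carrier G) (\<lambda>h. ob (F h) X) S j p"
    using ib by (simp add: is_biproduct_iff_biprod j_def[abs_def] p_def[abs_def])
  note b = biprodD[OF jp]
  define t where "t g h = (let h' = inv\<^bsub>G\<^esub> g \<star> h in (fmap (F g) (j h') ** ainv C (E g h' X)))" for g h
  define a where "a g = sm C S (ob (F g) S) (carrier G) (\<lambda>h. t g h ** p h)" for g
  have gh: "g \<star> (inv\<^bsub>G\<^esub> g \<star> h) = h" if "g \<in> carrier G" "h \<in> carrier G" for g h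
    using that by (simp add: G.m_assoc[symmetric])
  have t: "t g h \<in> arrows C (ob (F h) X) (ob (F g) S)" if "g \<in> carrier G" "h \<in> carrier G" for g h
    unfolding t_def Let_def using that b X gh[OF that] by simp
  have ind: "IndC X = mk_eq S a"
  proof -
    have "mph (a g) = (\<Oplus>\<^bsub>Hom C S (ob (F g) S)\<^esub>h\<in>carrier G.
        (let h' = inv\<^bsub>G\<^esub> g \<star> h in
          ar (F g) (ob (F h') X) S (inc h') \<cdot>
          (inv_mor C (ob (F g) (ob (F h') X)) (ob (F h) X) (\<epsilon> g h' X) \<cdot> prj h)))" if g: "g \<in> carrier G" for g
    proof -
      have Sg: "S \<in> Obj C" "ob (F g) S \<in> Obj C" using b g by simp_all
      interpret M: module K "Hom C S (ob (F g) S)" by (rule Hom_module[OF Sg])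
      have *: "mph (t g h ** p h) = (let h' = inv\<^bsub>G\<^esub> g \<star> h in
          ar (F g) (ob (F h') X) S (inc h') \<cdot>
          (inv_mor C (ob (F g) (ob (F h') X)) (ob (F h) X) (\<epsilon> g h' X) \<cdot> prj h))" if h: "h \<in> carrier G" for h
      proof -
        define h' where "h' = inv\<^bsub>G\<^esub> g \<star> h"
        have h': "h' \<in> carrier G" "g \<star> h' = h" using g h gh by (simp_all add: h'_def)
        have Eh: "E g h' X = Arr (ob (F g) (ob (F h') X)) (\<epsilon> g h' X) (ob (F h) X)" using h' by (simp add: E_def)
        have inv: "ainv C (E g h' X) =
            Arr (ob (F h) X) (inv_mor C (ob (F g) (ob (F h') X)) (ob (F h) X) (\<epsilon> g h' X)) (ob (F g) (ob (F h') X))"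
          using inv_mor_ainv[of "ob (F g) (ob (F h') X)" "ob (F h) X" "\<epsilon> g h' X"] E_iso[OF g h'(1) X] g h h' X
          unfolding Eh by simp
        have "t g h ** p h = fmap (F g) (j h') ** (ainv C (E g h' X) ** p h)"
          unfolding t_def Let_def h'_def[symmetric] using g h h' b X by simp
        then show ?thesis
          unfolding Let_def h'_def[symmetric] inv by (simp add: cmp_def fmap_def j_def p_def)
      qed
      have "mph (t g h ** p h) \<in> mor C S (ob (F g) S)" if "h \<in> carrier G" for h
      proof -
        have "is_arr C (t g h ** p h)" using t[OF g that] b that by simp
        then show ?thesis using t[OF g that] b that by (simp add: is_arr_def[of C "t g h ** p h"] del: is_arr_cmp)
      qed
      then show ?thesis unfolding a_def sm_def using * by (auto intro!: M.finsum_cong')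
    qed
    then show ?thesis
      by (auto simp: Ind_def Ind_ob_def ch mk_eq_def intro!: restrict_ext)
  qed
  have a: "a g \<in> arrows C S (ob (F g) S)" if "g \<in> carrier G" for g
    unfolding a_def using b t that by simp
  have aj: "a g ** (j (g \<star> k) ** E g k X) = fmap (F g) (j k)" if g: "g \<in> carrier G" and k: "k \<in> carrier G" for g k
  proof -
    have gk: "inv\<^bsub>G\<^esub> g \<star> (g \<star> k) = k" using g k by (simp add: G.m_assoc[symmetric])
    have "a g ** j (g \<star> k) = t g (g \<star> k)"
      unfolding a_def using b t g k by (intro biprod_sm_inc[OF jp]) auto
    then have "a g ** j (g \<star> k) = fmap (F g) (j k) ** ainv C (E g k X)" unfolding t_def gk by simp
    then have "a g ** (j (g \<star> k) ** E g k X) = (fmap (F g) (j k) ** ainv C (E g k X)) ** E g k X"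
      using a[OF g] b g k X by (intro cmp_assoc_subst) auto
    then show ?thesis using b g k X by simp
  qed
  show ?thesis by (rule that[OF jp ind a aj])
qed

text \<open>Let \<open>t\<^sub>\<chi>\<close> be the scalar \<open>\<chi>(h)\<close> on the summand \<open>F\<^sub>h X\<close>. The component of degree one is \<open>F\<^sub>1 X\<close>, which is
  isomorphic to \<open>X\<close>.\<close>

lemma Ind_graded:
  assumes X: "X \<in> Obj C"
  obtains t r s where "graded_at (IndC X) t X r s"
proof -
  obtain S j p a where jp: "biprod C (carrier G) (\<lambda>h. ob (F h) X) S j p" and ind: "IndC X = mk_eq S a"
    and a: "\<And>g. g \<in> carrier G \<Longrightarrow> a g \<in> arrows C S (ob (F g) S)"
    and aj: "\<And>g k. g \<in> carrier G \<Longrightarrow> k \<in> carrier G \<Longrightarrow> a g ** (j (g \<star> k) ** E g k X) = fmap (F g) (j k)"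
    by (rule Ind_structure[OF X]) (rule that; assumption)
  note b = biprodD[OF jp]
  let ?N = "mk_eq S a"
  have gk_ex: "\<exists>k\<in>carrier G. h = g \<star> k" if "g \<in> carrier G" "h \<in> carrier G" for g h
    using that by (intro bexI[of _ "inv\<^bsub>G\<^esub> g \<star> h"]) (simp_all add: G.m_assoc[symmetric])
  \<comment> \<open>Arrows out of \<open>S\<close> may be compared after composing with \<open>j (g k)\<close> and a structure isomorphism.\<close>
  have S_eqI: "u = v" if g: "g \<in> carrier G" and u: "u \<in> arrows C S Z" and v: "v \<in> arrows C S Z"
    and uv: "\<And>k. k \<in> carrier G \<Longrightarrow> u ** (j (g \<star> k) ** E g k X) = v ** (j (g \<star> k) ** E g k X)" for g u v Z
  proof (rule biprod_eqI_right[OF jp u v])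
    fix h assume h: "h \<in> carrier G"
    then obtain k where k: "k \<in> carrier G" "h = g \<star> k" using gk_ex[OF g] by blast
    have "(u ** j h) ** E g k X = (v ** j h) ** E g k X" using uv[OF k(1)] u v b h g k X by simp
    then show "u ** j h = v ** j h" using u v b h g k X by - (rule iso_cancel_right[OF E_iso[OF g k(1) X]], auto)
  qed
  have Fjp: "biprod C (carrier G) (\<lambda>h. ob (F g) (ob (F h) X)) (ob (F g) S) (\<lambda>h. fmap (F g) (j h)) (\<lambda>h. fmap (F g) (p h))"
    if "g \<in> carrier G" for g using lin_functor.biprod_fmap[OF F_functor[OF that] jp] .
  have iso: "iso_arr C (a g)" if g: "g \<in> carrier G" for g
  proof (rule biprod_iso_arr[OF jp Fjp[OF g]])
    show "bij_betw (\<lambda>h. inv\<^bsub>G\<^esub> g \<star> h) (carrier G) (carrier G)" by (rule S.translate_bij) (use g in simp)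
    fix h assume h: "h \<in> carrier G"
    define k where "k = inv\<^bsub>G\<^esub> g \<star> h"
    have k: "k \<in> carrier G" "h = g \<star> k" using g h by (simp_all add: k_def G.m_assoc[symmetric])
    show "ainv C (E g (inv\<^bsub>G\<^esub> g \<star> h) X) \<in> arrows C (ob (F h) X) (ob (F g) (ob (F (inv\<^bsub>G\<^esub> g \<star> h)) X))"
      "iso_arr C (ainv C (E g (inv\<^bsub>G\<^esub> g \<star> h) X))"
      unfolding k_def[symmetric] using g k X by simp_all
    have "a g ** j h = (a g ** (j (g \<star> k) ** E g k X)) ** ainv C (E g k X)"
      using a[OF g] b h g k X by simp
    then show "a g ** j h = fmap (F g) (j (inv\<^bsub>G\<^esub> g \<star> h)) ** ainv C (E g (inv\<^bsub>G\<^esub> g \<star> h) X)"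
      unfolding aj[OF g k(1)] unfolding k_def .
  qed (use a[OF g] in auto)
  have N: "?N \<in> Obj CG"
  proof (rule mk_eq_Obj)
    fix g h assume g: "g \<in> carrier G" and h: "h \<in> carrier G"
    have gh: "g \<star> h \<in> carrier G" using g h by simp
    let ?rhs = "E g h S ** (fmap (F g) (a h) ** a g)"
    have rhs: "?rhs \<in> arrows C S (ob (F (g \<star> h)) S)" using a[OF g] a[OF h] g h b by simp
    show "a (g \<star> h) = ?rhs"
    proof (rule S_eqI[OF gh a[OF gh] rhs])
      fix k assume k: "k \<in> carrier G"
      have hk: "h \<star> k \<in> carrier G" using h k by simp
      let ?j = "j (g \<star> (h \<star> k))"
      have jg: "?j \<in> arrows C (ob (F (g \<star> (h \<star> k))) X) S" using b g hk by simp
      have as: "g \<star> h \<star> k = g \<star> (h \<star> k)" using g h k by (simp add: G.m_assoc)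
      have ea: "E (g \<star> h) k X ** E g h (ob (F k) X) = E g (h \<star> k) X ** fmap (F g) (E h k X)"
        using E_assoc[OF g h k X] .
      have tE: "trg (E (g \<star> h) k X) = ob (F (g \<star> (h \<star> k))) X" by (simp add: as)
      have iE: "iso_arr C (E g h (ob (F k) X))" using g h k X by simp
      have "?rhs ** ((?j ** E (g \<star> h) k X) ** E g h (ob (F k) X)) =
          ?rhs ** (?j ** (E g (h \<star> k) X ** fmap (F g) (E h k X)))"
        using jg tE g h k gh X ea by simp
      also have "\<dots> = E g h S ** (fmap (F g) (a h) ** ((a g ** (?j ** E g (h \<star> k) X)) ** fmap (F g) (E h k X)))"
        using jg a[OF g] a[OF h] g h k hk X b(2) by simp
      also have "\<dots> = E g h S ** (fmap (F g) (a h) ** (fmap (F g) (j (h \<star> k)) ** fmap (F g) (E h k X)))"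
        unfolding aj[OF g hk] ..
      also have "\<dots> = E g h S ** fmap (F g) (a h ** (j (h \<star> k) ** E h k X))"
        using a[OF h] g h k hk X b by (simp add: F_cmp)
      also have "\<dots> = fmap (F (g \<star> h)) (j k) ** E g h (ob (F k) X)"
        unfolding aj[OF h k] using E_natural[OF g h, of "j k"] b k by simp
      also have "\<dots> = a (g \<star> h) ** ((?j ** E (g \<star> h) k X) ** E g h (ob (F k) X))"
        unfolding aj[OF gh k, symmetric] using a[OF gh] jg tE g h k gh X by (simp add: as)
      finally have "(a (g \<star> h) ** (?j ** E (g \<star> h) k X)) ** E g h (ob (F k) X) =
          (?rhs ** (?j ** E (g \<star> h) k X)) ** E g h (ob (F k) X)"
        using a[OF gh] rhs jg tE g h k gh X by simp
      then have "a (g \<star> h) ** (?j ** E (g \<star> h) k X) = ?rhs ** (?j ** E (g \<star> h) k X)"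
        using a[OF gh] rhs jg tE g h k gh X by - (rule iso_cancel_right[OF iE], auto)
      then show "a (g \<star> h) ** (j (g \<star> h \<star> k) ** E (g \<star> h) k X) =
        ?rhs ** (j (g \<star> h \<star> k) ** E (g \<star> h) k X)" unfolding as .
    qed
  qed (use a iso b in auto)
  have st: "st ?N g = a g" if "g \<in> carrier G" for g using that a[OF that] by simp
  define t where "t \<chi> = sm C S S (carrier G) (\<lambda>h. scl C (\<chi> h) (j h) ** p h)" for \<chi>
  have t: "t \<chi> \<in> arrows C S S" if "\<chi> \<in> carrier Gd" for \<chi> unfolding t_def using b that by simp
  have tj: "t \<chi> ** j h = scl C (\<chi> h) (j h)" if "\<chi> \<in> carrier Gd" "h \<in> carrier G" for \<chi> h
    unfolding t_def using that b by (intro biprod_sm_inc[OF jp]) auto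
  have gr: "graded ?N t"
    unfolding graded_def
  proof (intro conjI ballI N)
    show "t \<one>\<^bsub>Gd\<^esub> = idn C (fst ?N)"
    proof (rule biprod_eqI_right[OF jp])
      show "t \<one>\<^bsub>Gd\<^esub> ** j h = idn C (fst ?N) ** j h" if h: "h \<in> carrier G" for h
        using tj[OF S.Gd.one_closed h] b(3,4,5)[OF h] h by (simp add: S.char_one_apply)
    qed (use t[OF S.Gd.one_closed] b(2) in auto)
    fix \<chi> assume \<chi>: "\<chi> \<in> carrier Gd"
    show "t \<chi> \<in> arrows C (fst ?N) (fst ?N)" using t[OF \<chi>] by simp
    show "t \<chi> ** t \<psi> = t (\<chi> \<otimes>\<^bsub>Gd\<^esub> \<psi>)" if \<psi>: "\<psi> \<in> carrier Gd" for \<psi>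
    proof (rule biprod_eqI_right[OF jp])
      fix h assume h: "h \<in> carrier G"
      have "(t \<chi> ** t \<psi>) ** j h = t \<chi> ** (t \<psi> ** j h)" using t \<chi> \<psi> b h by simp
      then show "(t \<chi> ** t \<psi>) ** j h = t (\<chi> \<otimes>\<^bsub>Gd\<^esub> \<psi>) ** j h"
        using tj[OF \<chi> h] tj[OF \<psi> h] tj[of "\<chi> \<otimes>\<^bsub>Gd\<^esub> \<psi>" h] t \<chi> \<psi> b h
        by (simp add: S.char_mult_apply S.K.m_comm)
    qed (use t \<chi> \<psi> in auto)
    fix g assume g: "g \<in> carrier G"
    show "st ?N g ** t \<chi> = scl C (\<chi> g) (fmap (F g) (t \<chi>) ** st ?N g)"
      unfolding st[OF g]
    proof (rule S_eqI[OF g])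
      fix k assume k: "k \<in> carrier G"
      have gk: "g \<star> k \<in> carrier G" using g k by simp
      have "(a g ** t \<chi>) ** (j (g \<star> k) ** E g k X) = a g ** ((t \<chi> ** j (g \<star> k)) ** E g k X)"
        using a[OF g] t[OF \<chi>] b gk g k X by simp
      also have "\<dots> = scl C (\<chi> (g \<star> k)) (a g ** (j (g \<star> k) ** E g k X))"
        unfolding tj[OF \<chi> gk] using a[OF g] \<chi> b gk g k X by simp
      also have "\<dots> = scl C (\<chi> g) (fmap (F g) (t \<chi> ** j k))"
        unfolding aj[OF g k] tj[OF \<chi> k] using \<chi> b g k by (simp add: S.char_mult F_scl)
      also have "\<dots> = scl C (\<chi> g) (fmap (F g) (t \<chi>) ** (a g ** (j (g \<star> k) ** E g k X)))"
        unfolding aj[OF g k] using t[OF \<chi>] b g k by (simp add: F_cmp)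
      also have "\<dots> = scl C (\<chi> g) (fmap (F g) (t \<chi>) ** a g) ** (j (g \<star> k) ** E g k X)"
        using a[OF g] t[OF \<chi>] \<chi> b gk g k X by simp
      finally show "(a g ** t \<chi>) ** (j (g \<star> k) ** E g k X) =
        scl C (\<chi> g) (fmap (F g) (t \<chi>) ** a g) ** (j (g \<star> k) ** E g k X)" .
    qed (use a[OF g] t[OF \<chi>] \<chi> g in auto)
  qed
  obtain u where u: "u \<in> arrows C X (ob (F \<one>\<^bsub>G\<^esub>) X)" "iso_arr C u"
    using unit_iso[OF X] by (auto simp: iso_rel_iff)
  have one: "\<one>\<^bsub>G\<^esub> \<in> carrier G" by simp
  have e1: "ee ?N t \<one>\<^bsub>G\<^esub> = j \<one>\<^bsub>G\<^esub> ** p \<one>\<^bsub>G\<^esub>"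
  proof (rule biprod_eqI_right[OF jp])
    fix k assume k: "k \<in> carrier G"
    have "ee ?N t \<one>\<^bsub>G\<^esub> ** j k = (if \<one>\<^bsub>G\<^esub> = k then j k else zr C (ob (F k) X) S)"
      using ee_eigen[OF gr _ one k, of "j k"] tj[OF _ k] b(3-5)[OF k] by simp
    then show "ee ?N t \<one>\<^bsub>G\<^esub> ** j k = (j \<one>\<^bsub>G\<^esub> ** p \<one>\<^bsub>G\<^esub>) ** j k" using b k X by (cases "k = \<one>\<^bsub>G\<^esub>") auto
  qed (use ee_arr[OF gr one] b in auto)
  have "graded_at ?N t X (ainv C u ** p \<one>\<^bsub>G\<^esub>) (j \<one>\<^bsub>G\<^esub> ** u)"
    unfolding graded_at_def
  proof (intro conjI gr X)
    show "ainv C u ** p \<one>\<^bsub>G\<^esub> \<in> arrows C (fst ?N) X" "j \<one>\<^bsub>G\<^esub> ** u \<in> arrows C X (fst ?N)" using u b by simp_all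
    have "(j \<one>\<^bsub>G\<^esub> ** u) ** (ainv C u ** p \<one>\<^bsub>G\<^esub>) = j \<one>\<^bsub>G\<^esub> ** (u ** (ainv C u ** p \<one>\<^bsub>G\<^esub>))" using u b by simp
    then show "(j \<one>\<^bsub>G\<^esub> ** u) ** (ainv C u ** p \<one>\<^bsub>G\<^esub>) = ee ?N t \<one>\<^bsub>G\<^esub>"
      using e1 ainv_cancel(2)[OF u(2), of "p \<one>\<^bsub>G\<^esub>"] u b by simp
    have "(ainv C u ** p \<one>\<^bsub>G\<^esub>) ** (j \<one>\<^bsub>G\<^esub> ** u) = ainv C u ** ((p \<one>\<^bsub>G\<^esub> ** j \<one>\<^bsub>G\<^esub>) ** u)" using u b(1-9) by simp
    then show "(ainv C u ** p \<one>\<^bsub>G\<^esub>) ** (j \<one>\<^bsub>G\<^esub> ** u) = idn C X" using u b by simp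
  qed
  then show ?thesis using that ind by simp
qed

section \<open>Induction and additive closures\<close>

lemma graded_at_retract: "graded_at N t X r s \<Longrightarrow> X \<preceq> fst N"
  using graded_atD[of N t X r s] by (intro generated_retract[of s _ _ r]) auto

lemma graded_at_underlying:
  assumes "graded_at N t X r s" "M \<in> Obj C" "\<And>h. h \<in> carrier G \<Longrightarrow> ob (F h) X \<preceq> M"
  shows "fst N \<preceq> M"
  using biprod_generated[OF graded_biprod[OF assms(1)] assms(2,3)] .

text \<open>Arrows between the components of degree one extend to the graded objects. So a sum of composites
  through \<open>X'\<close> that equals the identity of \<open>X\<close> extends to a sum of composites through \<open>N'\<close>, and this
  is the identity of \<open>N\<close> because it restricts to the identity of \<open>X\<close>.\<close>

lemma graded_at_generated:
  assumes A: "graded_at N t X r s" and B: "graded_at N' t' X' r' s'" and g: "X \<preceq> X'"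
  shows "CG.generated N N'"
proof -
  note dA = graded_atD[OF A] and dB = graded_atD[OF B]
  have "\<exists>f\<in>CG.thru N' N N. U f ** s = s ** v" if "v \<in> thru X' X X" for v
    using that
  proof (induction rule: thru.induct)
    case thru_zr
    have "U (zr CG N N) ** s = s ** zr C X X" using dA by simp
    then show ?case using CG.thru_zr by blast
  next
    case (thru_pl v a b)
    then obtain f where f: "f \<in> CG.thru N' N N" "U f ** s = s ** v" by blast
    have v: "v \<in> arrows C X X" using thru_arrows[OF thru_pl(1)] dA by simp
    have fa: "f \<in> arrows CG N N" using CG.thru_arrows[OF f(1)] dA by simp
    obtain fa where fa: "fa \<in> arrows CG N N'" "U fa ** s = s' ** a"
      by (rule extend_component[OF A B thru_pl(2)]) blast
    obtain fb where fb: "fb \<in> arrows CG N' N" "U fb ** s' = s ** b"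
      by (rule extend_component[OF B A thru_pl(3)]) blast
    have ar: "is_arr C (U f)" "src (U f) = fst N" "trg (U f) = fst N" "is_arr C (U fa)" "src (U fa) = fst N"
      "trg (U fa) = fst N'" "is_arr C (U fb)" "src (U fb) = fst N'" "trg (U fb) = fst N"
      using CG.thru_arrows[OF f(1)] dA fa(1) fb(1) CG_arrD(3) by auto
    have "U fb ** (U fa ** s) = (U fb ** s') ** a" unfolding fa(2) using ar dB thru_pl(2) by simp
    also have "\<dots> = s ** (b ** a)" unfolding fb(2) using dA thru_pl(2,3) by simp
    finally have "U (pl CG f (fb **\<^bsub>CG\<^esub> fa)) ** s = s ** pl C v (b ** a)"
      using ar dA dB f(2) thru_pl(2,3) v by (simp add: pl_cmp cmp_pl)
    then show ?case using CG.thru_pl[OF f(1) fa(1) fb(1)] by blast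
  qed
  then obtain f where f: "f \<in> CG.thru N' N N" "U f ** s = s ** idn C X" using g by (auto simp: generated_def)
  have "f = idn CG N"
    using CG.thru_arrows[OF f(1)] f(2) dA by (intro equivariant_eqI[OF A A]) auto
  then show ?thesis using f(1) dA dB by (simp add: CG.generated_def)
qed

lemma graded_iso:
  assumes gr: "graded N t" and \<chi>: "\<chi> \<in> carrier Gd"
  shows "iso_arr CG (lift N (ob (Fd \<chi>) N) (t \<chi>))"
proof -
  note d = gradedD[OF gr]
  have "t \<chi> ** t (inv\<^bsub>Gd\<^esub> \<chi>) = idn C (fst N)" "t (inv\<^bsub>Gd\<^esub> \<chi>) ** t \<chi> = idn C (fst N)" using d(6,7) \<chi> by simp_all
  then have "inverses C (t \<chi>) (t (inv\<^bsub>Gd\<^esub> \<chi>))" using d \<chi> by (simp add: inverses_def)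
  then show ?thesis
    using graded_lift[OF gr \<chi>] d(4,5)[OF \<chi>] by (intro CG_iso) (auto simp: iso_arr_def)
qed

lemma graded_stable:
  assumes gr: "graded N t" and \<chi>: "\<chi> \<in> carrier Gd"
  shows "(ob (Fd \<chi>) N, N) \<in> iso_rel CG"
  by (rule CG.iso_rel_sym[OF iso_relI[OF graded_iso[OF assms]]]) simp_all

text \<open>The morphism into the induced object has the structure isomorphisms \<open>\<alpha>\<^sub>h\<close> as components. The
  sum of the \<open>\<alpha>\<^sub>h\<inverse>\<close>, divided by the order of the group, retracts it.\<close>

lemma retract_of_induced:
  assumes N: "N \<in> Obj CG" and P: "graded_at P t (fst N) r s"
  obtains A B where "A \<in> arrows CG N P" "B \<in> arrows CG P N" "B **\<^bsub>CG\<^esub> A = idn CG N"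
    "\<And>h. h \<in> carrier G \<Longrightarrow> pr P r h ** U A = st N h"
    "\<And>h. h \<in> carrier G \<Longrightarrow> U B ** ic P s h = scl C S.ordK_inv (ainv C (st N h))"
proof -
  let ?X = "fst N" and ?Y = "fst P"
  note n = CG_ObjD[OF N] and d = graded_atD[OF P] and i = ic_arr[OF P] and p = pr_arr[OF P]
  note bp = graded_biprod[OF P]
  define A where "A = sm C ?X ?Y (carrier G) (\<lambda>h. ic P s h ** st N h)"
  define B where "B = sm C ?Y ?X (carrier G) (\<lambda>h. scl C S.ordK_inv (ainv C (st N h)) ** pr P r h)"
  have A: "A \<in> arrows C ?X ?Y" unfolding A_def using n d i by simp
  have B: "B \<in> arrows C ?Y ?X" unfolding B_def using n d p by simp
  have pA: "pr P r h ** A = st N h" if "h \<in> carrier G" for h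
    unfolding A_def using that n d by (intro biprod_prj_sm[OF bp]) auto
  have Bi: "B ** ic P s h = scl C S.ordK_inv (ainv C (st N h))" if "h \<in> carrier G" for h
    unfolding B_def using that n d by (intro biprod_sm_inc[OF bp]) auto
  have "B ** A = sm C ?X ?X (carrier G) (\<lambda>h. B ** (ic P s h ** st N h))"
    unfolding A_def using B n d i finite_G by (subst cmp_sm) auto
  also have "\<dots> = sm C ?X ?X (carrier G) (\<lambda>h. scl C S.ordK_inv (idn C ?X))"
  proof (intro sm_cong)
    fix h assume h: "h \<in> carrier G"
    have "B ** (ic P s h ** st N h) = scl C S.ordK_inv (ainv C (st N h)) ** st N h"
      using B n h i(1,3)[OF h] i(2)[of h] by (intro cmp_assoc_subst[OF Bi[OF h]]) auto
    then show "B ** (ic P s h ** st N h) = scl C S.ordK_inv (idn C ?X)" using n h by simp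
  qed (use n in auto)
  also have "\<dots> = scl C S.ordK_inv (sm C ?X ?X (carrier G) (\<lambda>h. scl C \<one>\<^bsub>K\<^esub> (idn C ?X)))"
    using n finite_G by (simp add: scl_sm)
  also have "\<dots> = idn C ?X"
    using n finite_G sm_const_scl[of "carrier G" "idn C ?X" ?X ?X "\<lambda>_. \<one>\<^bsub>K\<^esub>"] by (simp flip: S.ordK_def)
  finally have BA: "B ** A = idn C ?X" .
  have A_eq: "is_arr CG (lift N P A)"
  proof (rule lift_arr[OF N d(2) A])
    fix g assume g: "g \<in> carrier G"
    have Fbp: "biprod C (carrier G) (\<lambda>h. ob (F g) (ob (F h) ?X)) (ob (F g) ?Y)
        (\<lambda>h. fmap (F g) (ic P s h)) (\<lambda>h. fmap (F g) (pr P r h))"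
      using lin_functor.biprod_fmap[OF F_functor[OF g] bp] .
    show "st P g ** A = fmap (F g) A ** st N g"
    proof (rule biprod_eqI_left[OF Fbp])
      fix k assume k: "k \<in> carrier G"
      have gk: "g \<star> k \<in> carrier G" using g k by simp
      have "E g k ?X ** (fmap (F g) (pr P r k) ** (st P g ** A)) = pr P r (g \<star> k) ** A"
        unfolding pr_cocycle[OF P g k] using g k d n A p(1)[OF k] p(2,3)[of k] by simp
      also have "\<dots> = E g k ?X ** (fmap (F g) (pr P r k ** A) ** st N g)"
        unfolding pA[OF gk] pA[OF k] by (rule n(4)[OF g k])
      finally have "E g k ?X ** (fmap (F g) (pr P r k) ** (st P g ** A)) =
          E g k ?X ** (fmap (F g) (pr P r k) ** (fmap (F g) A ** st N g))"
        using g k d n A p(1)[OF k] p(2,3)[of k] by (simp add: F_cmp)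
      then show "fmap (F g) (pr P r k) ** (st P g ** A) = fmap (F g) (pr P r k) ** (fmap (F g) A ** st N g)"
        using g k d n A p(1)[OF k] p(2,3)[of k] by - (rule iso_cancel_left[OF E_iso[OF g k n(1)]], auto)
    qed (use A g d n in auto)
  qed
  have B_eq: "is_arr CG (lift P N B)"
  proof (rule lift_arr[OF d(2) N B])
    fix g assume g: "g \<in> carrier G"
    show "st N g ** B = fmap (F g) B ** st P g"
    proof (rule biprod_eqI_right[OF bp])
      fix h assume h: "h \<in> carrier G"
      define k where "k = inv\<^bsub>G\<^esub> g \<star> h"
      have k: "k \<in> carrier G" and hk: "h = g \<star> k" using g h by (simp_all add: k_def G.m_assoc[symmetric])
      note ih = i(1,3)[OF h] i(2)[of h] and ik = i(1,3)[OF k] i(2)[of k]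
      have inv: "st N g ** (ainv C (st N h) ** E g k ?X) = fmap (F g) (ainv C (st N k))"
      proof -
        let ?u = "E g k ?X ** fmap (F g) (st N k)"
        have u: "iso_arr C ?u" using g k n by simp
        have e: "?u ** st N g = st N h" unfolding hk n(4)[OF g k] using g k n(1) n(3)[OF g] n(3)[OF k] by simp
        have Ek: "E g k ?X \<in> arrows C (ob (F g) (ob (F k) ?X)) (ob (F h) ?X)" using g k n(1) by (simp add: hk)
        have "?u ** (st N g ** (ainv C (st N h) ** E g k ?X)) = st N h ** (ainv C (st N h) ** E g k ?X)"
          using u iso_arr_arr[OF u] Ek g n(3)[OF g] n(2)[OF h] by (intro cmp_assoc_subst[OF e]) auto
        also have "\<dots> = E g k ?X" using Ek n(2)[OF h] by (intro ainv_cancel(2)) auto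
        also have "\<dots> = ?u ** fmap (F g) (ainv C (st N k))"
          using g k n(1) n(2,3)[OF k] by (simp flip: F_cmp)
        finally show ?thesis
          using g k h n(1) n(2,3)[OF g] n(2,3)[OF h] n(2,3)[OF k]
          by - (rule iso_cancel_left[OF u], auto simp: hk)
      qed
      have "((st N g ** B) ** ic P s h) ** E g k ?X = st N g ** ((B ** ic P s h) ** E g k ?X)"
        using B ih g k n by (simp add: hk)
      also have "\<dots> = scl C S.ordK_inv (st N g ** (ainv C (st N h) ** E g k ?X))"
        unfolding Bi[OF h] using n(1) n(2,3)[OF g] n(2,3)[OF h] g k by (simp add: hk)
      also have "\<dots> = fmap (F g) (B ** ic P s k)"
        unfolding inv Bi[OF k] using n(1) n(2,3)[OF k] g by (simp add: F_scl)
      also have "\<dots> = fmap (F g) B ** (st P g ** (ic P s h ** E g k ?X))"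
        using ic_cocycle[OF P g k] B ik g by (simp add: hk F_cmp)
      also have "\<dots> = ((fmap (F g) B ** st P g) ** ic P s h) ** E g k ?X"
        using B ih d(2,3) d(13,14)[OF g] g k n(1) by (simp add: hk)
      finally show "(st N g ** B) ** ic P s h = (fmap (F g) B ** st P g) ** ic P s h"
        using B ih d(2,3) d(13,14)[OF g] g k n(1) n(3)[OF g]
        by - (rule iso_cancel_right[OF E_iso[OF g k n(1)]], auto simp: hk)
    qed (use B g d n in auto)
  qed
  show ?thesis
  proof (rule that[of "lift N P A" "lift P N B"])
    show "lift P N B **\<^bsub>CG\<^esub> lift N P A = idn CG N" using A B BA by (intro U_eqI) simp_all
    show "pr P r h ** U (lift N P A) = st N h" if "h \<in> carrier G" for h using pA[OF that] A by simp
    show "U (lift P N B) ** ic P s h = scl C S.ordK_inv (ainv C (st N h))" if "h \<in> carrier G" for h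
      using Bi[OF that] B by simp
  qed (use A_eq B_eq in simp_all)
qed

text \<open>Conversely \<open>Ind X\<close> is the direct sum of the twists \<open>F\<^sub>\<chi> N\<close>, by the orthogonality of the
  characters. For a stable \<open>N\<close> these twists are isomorphic to \<open>N\<close>.\<close>

lemma induced_generated_by_stable:
  assumes N: "N \<in> Obj CG" and P: "graded_at P t (fst N) r s"
    and stable: "\<And>\<chi>. \<chi> \<in> carrier Gd \<Longrightarrow> (ob (Fd \<chi>) N, N) \<in> iso_rel CG"
  shows "CG.generated P N"
proof -
  let ?X = "fst N" and ?Y = "fst P"
  note n = CG_ObjD[OF N] and d = graded_atD[OF P] and i = ic_arr[OF P] and p = pr_arr[OF P]
  note gt = gradedD[OF d(1)] and bp = graded_biprod[OF P]
  obtain A B where A: "A \<in> arrows CG N P" and B: "B \<in> arrows CG P N"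
    and pA: "\<And>h. h \<in> carrier G \<Longrightarrow> pr P r h ** U A = st N h"
    and Bi: "\<And>h. h \<in> carrier G \<Longrightarrow> U B ** ic P s h = scl C S.ordK_inv (ainv C (st N h))"
    by (rule retract_of_induced[OF N P]) blast
  have ua: "is_arr C (U A)" "src (U A) = ?X" "trg (U A) = ?Y" "is_arr C (U B)" "src (U B) = ?Y" "trg (U B) = ?X"
    using A B CG_arrD(3) by auto
  \<comment> \<open>The conjugate by \<open>t\<^sub>\<chi>\<close> of the idempotent \<open>A B\<close>, which factors through \<open>F\<^sub>\<chi> N\<close>.\<close>
  define f where "f \<chi> = t (inv\<^bsub>Gd\<^esub> \<chi>) ** (U A ** (U B ** t \<chi>))" for \<chi>
  have f: "f \<chi> \<in> arrows C ?Y ?Y" if "\<chi> \<in> carrier Gd" for \<chi> using that ua gt by (simp add: f_def)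
  have f_thru: "lift P P (f \<chi>) \<in> CG.thru N P P" if \<chi>: "\<chi> \<in> carrier Gd" for \<chi>
  proof -
    let ?\<chi>' = "inv\<^bsub>Gd\<^esub> \<chi>" and ?N = "ob (Fd \<chi>) N" and ?P = "ob (Fd \<chi>) P"
    have \<chi>': "?\<chi>' \<in> carrier Gd" using \<chi> by simp
    define x where "x = fmap (Fd \<chi>) B **\<^bsub>CG\<^esub> lift P ?P (t \<chi>)"
    define y where "y = fmap (Fd \<chi>) (lift P (ob (Fd ?\<chi>') P) (t ?\<chi>')) **\<^bsub>CG\<^esub> fmap (Fd \<chi>) A"
    have x: "x \<in> arrows CG P ?N" unfolding x_def using graded_lift[OF d(1) \<chi>] B \<chi> by simp
    have "ob (Fd \<chi>) (ob (Fd ?\<chi>') P) = P" using dual_dual[OF \<chi> \<chi>' d(2)] dual_one[OF d(2)] \<chi> by simp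
    then have y: "y \<in> arrows CG ?N P" unfolding y_def using graded_lift[OF d(1) \<chi>'] A \<chi> by simp
    have "y **\<^bsub>CG\<^esub> x \<in> CG.thru ?N P P" by (rule CG.thru_cmp[OF x y])
    then have "y **\<^bsub>CG\<^esub> x \<in> CG.thru N P P"
      by (rule CG.thru_trans) (use CG.iso_generated[OF stable[OF \<chi>]] d(2) in auto)
    moreover have "y **\<^bsub>CG\<^esub> x = lift P P (f \<chi>)"
      using x y f[OF \<chi>] gt(3-5)[OF \<chi>] gt(3-5)[OF \<chi>'] ua
      by (intro U_eqI) (simp_all add: x_def y_def f_def)
    ultimately show ?thesis by simp
  qed
  have "sm C ?Y ?Y (carrier Gd) f = idn C ?Y"
  proof (rule biprod_eqI_right[OF bp])
    fix k assume k: "k \<in> carrier G"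
    note ik = i(1,3)[OF k] i(2)[of k]
    have Yk: "ob (F k) ?X \<in> Obj C" using k n by simp
    have fi: "f \<chi> ** ic P s k = scl C (\<chi> k \<otimes>\<^bsub>K\<^esub> S.ordK_inv) (t (inv\<^bsub>Gd\<^esub> \<chi>) ** (U A ** ainv C (st N k)))"
      if \<chi>: "\<chi> \<in> carrier Gd" for \<chi>
    proof -
      have "f \<chi> ** ic P s k = t (inv\<^bsub>Gd\<^esub> \<chi>) ** (U A ** (U B ** (t \<chi> ** ic P s k)))"
        using ua gt \<chi> ik by (simp add: f_def)
      then show ?thesis unfolding t_ic[OF P \<chi> k] using ua gt \<chi> ik k n(1) n(2,3)[OF k] Bi[OF k] by simp
    qed
    show "sm C ?Y ?Y (carrier Gd) f ** ic P s k = idn C ?Y ** ic P s k"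
    proof (rule biprod_eqI_left[OF bp])
      fix h assume h: "h \<in> carrier G"
      note ph = p(1)[OF h] p(2,3)[of h]
      have Yh: "ob (F h) ?X \<in> Obj C" using h n by simp
      have trm: "pr P r h ** (f \<chi> ** ic P s k) =
          scl C (\<chi> (inv\<^bsub>G\<^esub> h \<star> k)) (scl C S.ordK_inv (st N h ** ainv C (st N k)))"
        if \<chi>: "\<chi> \<in> carrier Gd" for \<chi>
      proof -
        have \<chi>': "inv\<^bsub>Gd\<^esub> \<chi> \<in> carrier Gd" using \<chi> by simp
        have ar: "U A ** ainv C (st N k) \<in> arrows C (ob (F k) ?X) ?Y" using ua n(2,3)[OF k] by simp
        have "pr P r h ** (t (inv\<^bsub>Gd\<^esub> \<chi>) ** (U A ** ainv C (st N k))) =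
          scl C ((inv\<^bsub>Gd\<^esub> \<chi>) h) (pr P r h) ** (U A ** ainv C (st N k))"
          using ph gt \<chi>' ar by (intro cmp_assoc_subst[OF pr_t[OF P \<chi>' h]]) auto
        also have "\<dots> = scl C (\<chi> (inv\<^bsub>G\<^esub> h)) (pr P r h ** (U A ** ainv C (st N k)))"
          using ph \<chi> \<chi>' h ar by (simp add: S.char_inv_apply)
        also have "pr P r h ** (U A ** ainv C (st N k)) = st N h ** ainv C (st N k)"
          using ph ua n(2,3)[OF k] by (intro cmp_assoc_subst[OF pA[OF h]]) auto
        finally have "pr P r h ** (t (inv\<^bsub>Gd\<^esub> \<chi>) ** (U A ** ainv C (st N k))) =
          scl C (\<chi> (inv\<^bsub>G\<^esub> h)) (st N h ** ainv C (st N k))" .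
        then show ?thesis unfolding fi[OF \<chi>]
          using ph gt(3-5)[OF \<chi>'] ar \<chi> h k n(2,3)[OF k] n(3)[OF h]
          by (simp add: S.char_mult S.K.m_ac)
      qed
      have "pr P r h ** (sm C ?Y ?Y (carrier Gd) f ** ic P s k) =
          sm C (ob (F k) ?X) (ob (F h) ?X) (carrier Gd) (\<lambda>\<chi>. pr P r h ** (f \<chi> ** ic P s k))"
      proof -
        have "sm C ?Y ?Y (carrier Gd) f ** ic P s k = sm C (ob (F k) ?X) ?Y (carrier Gd) (\<lambda>\<chi>. f \<chi> ** ic P s k)"
          using f ik d(3) S.finite_chars by (subst sm_cmp) auto
        then show ?thesis using f ik ph d(3) Yk S.finite_chars by (simp add: cmp_sm)
      qed
      also have "\<dots> = sm C (ob (F k) ?X) (ob (F h) ?X) (carrier Gd)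
          (\<lambda>\<chi>. scl C (\<chi> (inv\<^bsub>G\<^esub> h \<star> k)) (scl C S.ordK_inv (st N h ** ainv C (st N k))))"
        using Yk Yh h k n(2,3)[OF k] n(3)[OF h] trm by (intro sm_cong) auto
      also have "\<dots> = scl C (\<Oplus>\<^bsub>K\<^esub>\<chi>\<in>carrier Gd. \<chi> (inv\<^bsub>G\<^esub> h \<star> k)) (scl C S.ordK_inv (st N h ** ainv C (st N k)))"
        using h k n(2,3)[OF k] n(3)[OF h] S.finite_chars by (intro sm_const_scl) auto
      also have "(\<Oplus>\<^bsub>K\<^esub>\<chi>\<in>carrier Gd. \<chi> (inv\<^bsub>G\<^esub> h \<star> k)) = (if h = k then S.ordK else \<zero>\<^bsub>K\<^esub>)"
      proof -
        have "inv\<^bsub>G\<^esub> h \<star> k = \<one>\<^bsub>G\<^esub> \<longleftrightarrow> h = k"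
          using h k by (metis G.inv_closed G.inv_inv G.inv_equality G.l_inv)
        then show ?thesis using S.sum_char_eval[of "inv\<^bsub>G\<^esub> h \<star> k"] h k by simp
      qed
      also have "scl C (if h = k then S.ordK else \<zero>\<^bsub>K\<^esub>) (scl C S.ordK_inv (st N h ** ainv C (st N k))) =
          pr P r h ** (idn C ?Y ** ic P s k)"
        using h k n(1) n(2,3)[OF k] n(2,3)[OF h] ik pr_ic_same[OF P h] pr_ic_other[OF P k h] by auto
      finally show "pr P r h ** (sm C ?Y ?Y (carrier Gd) f ** ic P s k) = pr P r h ** (idn C ?Y ** ic P s k)" .
    qed (use f ik d(3) S.finite_chars in auto)
  qed (use f d(3) S.finite_chars in auto)
  then have sum: "sm CG P P (carrier Gd) (\<lambda>\<chi>. lift P P (f \<chi>)) = idn CG P"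
  proof -
    have ar: "lift P P (f \<chi>) \<in> arrows CG P P" if "\<chi> \<in> carrier Gd" for \<chi>
      using CG.thru_arrows[OF f_thru[OF that]] d(2) by simp
    have "U (sm CG P P (carrier Gd) (\<lambda>\<chi>. lift P P (f \<chi>))) = sm C ?Y ?Y (carrier Gd) (\<lambda>\<chi>. U (lift P P (f \<chi>)))"
      using ar d(2) S.finite_chars by (intro U_sm) auto
    also have "\<dots> = sm C ?Y ?Y (carrier Gd) f" using f d(3) by (intro sm_cong) auto
    finally show ?thesis using \<open>sm C ?Y ?Y (carrier Gd) f = idn C ?Y\<close> by (intro U_eqI) simp_all
  qed
  show ?thesis by (rule CG.generated_sm[OF S.finite_chars d(2) N f_thru sum])
qed

end

section \<open>Equivariant autoequivalences\<close>

lemma (in ff_functor) iso_reflect: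
  assumes f: "is_arr C f" and i: "iso_arr D (fmap F f)"
  shows "iso_arr C f"
proof -
  obtain g where g: "is_arr C g" "src g = trg f" "trg g = src f" "fmap F g = ainv D (fmap F f)"
    using fullE[OF full, of "trg f" "src f" "ainv D (fmap F f)"] f i by auto
  have "g **\<^bsub>C\<^esub> f = idn C (src f)" using f g i by - (rule faithfulD[OF faithful], auto simp: fmap_cmp)
  moreover have "f **\<^bsub>C\<^esub> g = idn C (trg f)" using f g i by - (rule faithfulD[OF faithful], auto simp: fmap_cmp)
  ultimately show ?thesis using f g by (auto simp: iso_arr_def inverses_def intro!: exI[of _ g])
qed

lemma equivariant_autoequivalences_iff:
  "(H, \<delta>) \<in> equivariant_autoequivalences K C G F \<epsilon> \<longleftrightarrow> autoequivalence K C H \<and>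
    (\<forall>g\<in>carrier G. natural_iso C C (H \<circ>\<^sub>F F g) (F g \<circ>\<^sub>F H) (\<delta> g)) \<and>
    (\<forall>g\<in>carrier G. \<forall>h\<in>carrier G. \<forall>X\<in>Obj C.
      Arr (ob H (ob (F (g \<otimes>\<^bsub>G\<^esub> h)) X)) (\<delta> (g \<otimes>\<^bsub>G\<^esub> h) X) (ob (F (g \<otimes>\<^bsub>G\<^esub> h)) (ob H X)) **\<^bsub>C\<^esub>
        fmap H (Arr (ob (F g) (ob (F h) X)) (\<epsilon> g h X) (ob (F (g \<otimes>\<^bsub>G\<^esub> h)) X)) =
      Arr (ob (F g) (ob (F h) (ob H X))) (\<epsilon> g h (ob H X)) (ob (F (g \<otimes>\<^bsub>G\<^esub> h)) (ob H X)) **\<^bsub>C\<^esub>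
        (fmap (F g) (Arr (ob H (ob (F h) X)) (\<delta> h X) (ob (F h) (ob H X))) **\<^bsub>C\<^esub>
          Arr (ob H (ob (F g) (ob (F h) X))) (\<delta> g (ob (F h) X)) (ob (F g) (ob H (ob (F h) X)))))"
  by (simp add: equivariant_autoequivalences_def cmp_def fmap_def)

text \<open>An equivariant autoequivalence \<open>(H, \<delta>)\<close> of \<open>C\<close> acts on equivariant objects by
  \<open>(X, \<alpha>) \<mapsto> (H X, \<delta> \<circ> H \<alpha>)\<close>. This commutes with the dual action on the nose.\<close>

context dual_setting
begin

lemma autoequivalence_ff: "autoequivalence K C H \<Longrightarrow> ff_functor K C C H"
  using autoequivalence_faithful_full(1,2) by unfold_locales (auto simp: autoequivalence_def)

lemma CG_autoequivalence_ff: "autoequivalence K CG H \<Longrightarrow> ff_functor K CG CG H"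
  using CG.autoequivalence_faithful_full(1,2) by unfold_locales (auto simp: autoequivalence_def)

lemma equivariantization_of_autoequivalence:
  assumes ea: "(H, \<delta>) \<in> equivariant_autoequivalences K C G F \<epsilon>"
  shows "\<exists>HG \<delta>G. (HG, \<delta>G) \<in> equivariant_autoequivalences K CG Gd Fd (dual_eps C) \<and>
    (\<forall>X\<in>Obj C. (ob HG (IndC X), IndC (ob H X)) \<in> iso_rel CG)"
proof -
  note e = ea[unfolded equivariant_autoequivalences_iff]
  interpret H: ff_functor K C C H using e autoequivalence_ff by blast
  have es: "\<exists>X\<in>Obj C. (ob H X, Y) \<in> iso_rel C" if "Y \<in> Obj C" for Y
    using autoequivalence_faithful_full(3) e that by blast
  define D where "D g X = Arr (ob H (ob (F g) X)) (\<delta> g X) (ob (F g) (ob H X))" for g X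
  have nat: "natural_iso C C (H \<circ>\<^sub>F F g) (F g \<circ>\<^sub>F H) (\<delta> g)" if "g \<in> carrier G" for g using e that by blast
  have HF: "linear_functor K C C (H \<circ>\<^sub>F F g)" "linear_functor K C C (F g \<circ>\<^sub>F H)" if "g \<in> carrier G" for g
    using linear_functor_comp[OF F_linear[OF that] H.F] linear_functor_comp[OF H.F F_linear[OF that]] .
  have D_src [simp]: "src (D g X) = ob H (ob (F g) X)" "trg (D g X) = ob (F g) (ob H X)" for g X
    by (simp_all add: D_def)
  have D_iso [simp]: "iso_arr C (D g X)" if "g \<in> carrier G" "X \<in> Obj C" for g X
    using nat[OF that(1)] that(2) by (simp add: natural_iso_iff[OF HF[OF that(1)]] D_def)
  have D_arr [simp]: "is_arr C (D g X)" if "g \<in> carrier G" "X \<in> Obj C" for g X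
    by (rule iso_arr_arr) (simp add: that)
  have D_nat: "D g (trg f) ** fmap H (fmap (F g) f) = fmap (F g) (fmap H f) ** D g (src f)"
    if "g \<in> carrier G" "is_arr C f" for g f
    using nat[OF that(1)] that(2) by (simp add: natural_iso_iff[OF HF[OF that(1)]] D_def)
  have D_coh: "D (g \<star> h) X ** fmap H (E g h X) = E g h (ob H X) ** (fmap (F g) (D h X) ** D g (ob (F h) X))"
    if "g \<in> carrier G" "h \<in> carrier G" "X \<in> Obj C" for g h X
    using e that by (simp add: D_def E_def)
  define b where "b N g = D g (fst N) ** fmap H (st N g)" for N g
  define HGo where "HGo N = mk_eq (ob H (fst N)) (b N)" for N
  define HGa where "HGa t = lift (HGo (src t)) (HGo (trg t)) (fmap H (U t))" for t
  have fst_HGo [simp]: "fst (HGo N) = ob H (fst N)" for N by (simp add: HGo_def)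
  have st_HGo: "st (HGo N) g = D g (fst N) ** fmap H (st N g)" if "g \<in> carrier G" for N g
    unfolding HGo_def using that by (subst st_mk_eq) (simp_all add: b_def)
  have HGo: "HGo N \<in> Obj CG" if N: "N \<in> Obj CG" for N
    unfolding HGo_def
  proof (rule mk_eq_Obj)
    note n = CG_ObjD[OF N]
    show "ob H (fst N) \<in> Obj C" using n by simp
    show "iso_arr C (b N g)" if "g \<in> carrier G" for g using n(1) n(2,3)[OF that] that H.fmap_iso_arr by (simp add: b_def)
    show "src (b N g) = ob H (fst N)" "trg (b N g) = ob (F g) (ob H (fst N))" for g by (simp_all add: b_def)
    fix g h assume g: "g \<in> carrier G" and h: "h \<in> carrier G"
    let ?X = "fst N"
    note sg = n(2,3)[OF g] and sh = n(2,3)[OF h]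
    have "b N (g \<star> h) = (D (g \<star> h) ?X ** fmap H (E g h ?X)) ** (fmap H (fmap (F g) (st N h)) ** fmap H (st N g))"
      unfolding b_def n(4)[OF g h] using n(1) sg sh g h by (simp add: H.fmap_cmp)
    also have "\<dots> = E g h (ob H ?X) ** (fmap (F g) (D h ?X) **
        ((D g (ob (F h) ?X) ** fmap H (fmap (F g) (st N h))) ** fmap H (st N g)))"
      unfolding D_coh[OF g h n(1)] using n(1) sg sh g h by simp
    also have "D g (ob (F h) ?X) ** fmap H (fmap (F g) (st N h)) = fmap (F g) (fmap H (st N h)) ** D g ?X"
      using D_nat[OF g sh(2)] by simp
    finally show "b N (g \<star> h) = E g h (ob H ?X) ** (fmap (F g) (b N h) ** b N g)"
      using n(1) sg sh g h by (simp add: b_def F_cmp)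
  qed
  have HGa: "is_arr CG (HGa t)" if t: "is_arr CG t" for t
    unfolding HGa_def
  proof (rule lift_arr)
    note d = CG_arrD[OF t]
    show "HGo (src t) \<in> Obj CG" "HGo (trg t) \<in> Obj CG" using HGo d by blast+
    show "fmap H (U t) \<in> arrows C (fst (HGo (src t))) (fst (HGo (trg t)))" using d by simp
    fix g assume g: "g \<in> carrier G"
    note m = CG_ObjD(1)[OF d(1)] CG_ObjD(2,3)[OF d(1) g] and n = CG_ObjD(1)[OF d(2)] CG_ObjD(2,3)[OF d(2) g]
    have "st (HGo (trg t)) g ** fmap H (U t) = D g (fst (trg t)) ** fmap H (st (trg t) g ** U t)"
      unfolding st_HGo[OF g] using d(3) n g by (simp add: H.fmap_cmp)
    also have "\<dots> = (D g (fst (trg t)) ** fmap H (fmap (F g) (U t))) ** fmap H (st (src t) g)"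
      unfolding d(4)[OF g] using d(3) m n g by (simp add: H.fmap_cmp)
    also have "D g (fst (trg t)) ** fmap H (fmap (F g) (U t)) = fmap (F g) (fmap H (U t)) ** D g (fst (src t))"
      using D_nat[OF g d(3)] by simp
    finally show "st (HGo (trg t)) g ** fmap H (U t) = fmap (F g) (fmap H (U t)) ** st (HGo (src t)) g"
      unfolding st_HGo[OF g] using d(3) m n g by simp
  qed
  have U_HGa [simp]: "U (HGa t) = fmap H (U t)" for t by (simp add: HGa_def)
  have st_HGa [simp]: "src (HGa t) = HGo (src t)" "trg (HGa t) = HGo (trg t)" for t by (simp_all add: HGa_def)
  let ?HG = "mk_functor HGo HGa"
  have mk: "linear_functor K CG CG ?HG \<and> (\<forall>f. is_arr CG f \<longrightarrow> fmap ?HG f = HGa f)"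
  proof (rule linear_functor_mk_functor)
    show "HGa (idn CG N) = idn CG (HGo N)" if "N \<in> Obj CG" for N
      using CG_ObjD(1)[OF that] by (intro U_eqI) simp_all
    show "HGa (g **\<^bsub>CG\<^esub> f) = HGa g **\<^bsub>CG\<^esub> HGa f" if "is_arr CG f" "is_arr CG g" "trg f = src g" for f g
      using CG_arrD(3)[OF that(1)] CG_arrD(3)[OF that(2)] that(3) by (intro U_eqI) (simp_all add: H.fmap_cmp)
    show "HGa (pl CG f g) = pl CG (HGa f) (HGa g)"
      if "is_arr CG f" "is_arr CG g" "src f = src g" "trg f = trg g" for f g
      using CG_arrD(3)[OF that(1)] CG_arrD(3)[OF that(2)] that(3,4) by (intro U_eqI) (simp_all add: H.fmap_pl)
    show "HGa (scl CG c f) = scl CG c (HGa f)" if "is_arr CG f" "c \<in> carrier K" for f c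
      using CG_arrD(3)[OF that(1)] that(2) by (intro U_eqI) (simp_all add: H.fmap_scl)
  qed (use HGo HGa in auto)
  then have lin: "linear_functor K CG CG ?HG" and fmap_HG: "\<And>f. is_arr CG f \<Longrightarrow> fmap ?HG f = HGa f" by blast+
  have aut: "autoequivalence K CG ?HG"
  proof (rule CG.autoequivalenceI[OF lin])
    show "faithful_functor CG ?HG"
      unfolding faithful_functor_def
    proof (intro allI impI)
      fix f g assume fg: "is_arr CG f" "is_arr CG g" "src f = src g" "trg f = trg g" "fmap ?HG f = fmap ?HG g"
      have "HGa f = HGa g" using fmap_HG[OF fg(1)] fmap_HG[OF fg(2)] fg(5) by simp
      then have "fmap H (U f) = fmap H (U g)" using U_HGa by metis
      then have "U f = U g" using CG_arrD(3)[OF fg(1)] CG_arrD(3)[OF fg(2)] fg(3,4)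
        by - (rule faithfulD[OF H.faithful], auto)
      then show "f = g" using fg by (intro U_eqI) auto
    qed
    show "full_functor CG CG ?HG"
      unfolding full_functor_def
    proof (intro ballI)
      fix M N t assume M: "M \<in> Obj CG" and N: "N \<in> Obj CG" and t: "t \<in> arrows CG (ob ?HG M) (ob ?HG N)"
      have t: "is_arr CG t" "src t = HGo M" "trg t = HGo N" using t by auto
      note d = CG_arrD[OF t(1)] and m = CG_ObjD[OF M] and n = CG_ObjD[OF N]
      obtain f where f: "is_arr C f" "src f = fst M" "trg f = fst N" "fmap H f = U t"
        using fullE[OF H.full m(1) n(1) d(3)] t by auto
      have lf: "is_arr CG (lift M N f)"
      proof (rule lift_arr[OF M N])
        fix g assume g: "g \<in> carrier G"
        note mg = m(2,3)[OF g] and ng = n(2,3)[OF g]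
        have "D g (fst N) ** fmap H (st N g ** f) = st (HGo N) g ** U t"
          unfolding st_HGo[OF g] f(4)[symmetric] using f(1-3) ng n(1) g by (simp add: H.fmap_cmp)
        also have "\<dots> = fmap (F g) (fmap H f) ** st (HGo M) g" using d(4)[OF g] t f(4) by simp
        also have "\<dots> = (fmap (F g) (fmap H f) ** D g (fst M)) ** fmap H (st M g)"
          unfolding st_HGo[OF g] using f(1-3) mg m(1) g by simp
        also have "fmap (F g) (fmap H f) ** D g (fst M) = D g (fst N) ** fmap H (fmap (F g) f)"
          using D_nat[OF g f(1)] f by simp
        finally have "D g (fst N) ** fmap H (st N g ** f) = D g (fst N) ** fmap H (fmap (F g) f ** st M g)"
          using f(1-3) mg m(1) n(1) g by (simp add: H.fmap_cmp)
        then have "fmap H (st N g ** f) = fmap H (fmap (F g) f ** st M g)"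
          using f(1-3) mg ng m(1) n(1) g by - (rule iso_cancel_left[OF D_iso[OF g n(1)]], auto)
        then show "st N g ** f = fmap (F g) f ** st M g"
          using f(1-3) mg ng m(1) n(1) g by - (rule faithfulD[OF H.faithful], auto)
      qed (use f in simp)
      have "HGa (lift M N f) = t" using f t by (intro U_eqI) simp_all
      then show "\<exists>f\<in>arrows CG M N. fmap ?HG f = t" using lf fmap_HG[OF lf] by (intro bexI[of _ "lift M N f"]) auto
    qed
    show "\<exists>X\<in>Obj CG. (ob ?HG X, Y) \<in> iso_rel CG" if Y: "Y \<in> Obj CG" for Y
    proof -
      note y = CG_ObjD[OF Y]
      obtain X where X: "X \<in> Obj C" "(ob H X, fst Y) \<in> iso_rel C" using es y(1) by blast
      then obtain u where u: "is_arr C u" "src u = ob H X" "trg u = fst Y" "iso_arr C u" by (auto simp: iso_rel_iff)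
      define v where "v g = fmap (F g) (ainv C u) ** (st Y g ** u)" for g
      have v: "v g \<in> arrows C (ob H X) (ob (F g) (ob H X))" "iso_arr C (v g)" if "g \<in> carrier G" for g
        using u y that by (simp_all add: v_def)
      have "\<exists>f. f \<in> arrows C X (ob (F g) X) \<and> fmap H f = ainv C (D g X) ** v g" if g: "g \<in> carrier G" for g
        using fullE[OF H.full X(1), of "ob (F g) X" "ainv C (D g X) ** v g"] X(1) v[OF g] g by auto
      then obtain a where a: "\<And>g. g \<in> carrier G \<Longrightarrow> a g \<in> arrows C X (ob (F g) X) \<and> fmap H (a g) = ainv C (D g X) ** v g"
        by metis
      have Da: "D g X ** fmap H (a g) = v g" if g: "g \<in> carrier G" for g
        using a[OF g] ainv_cancel(2)[OF D_iso[OF g X(1)], of "v g"] v[OF g] by simp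
      have aO: "mk_eq X a \<in> Obj CG"
      proof (rule mk_eq_Obj[OF X(1)])
        show "iso_arr C (a g)" if g: "g \<in> carrier G" for g
        proof (rule H.iso_reflect)
          show "is_arr C (a g)" using a[OF g] by simp
          show "iso_arr C (fmap H (a g))" using a[OF g] v[OF g] D_iso[OF g X(1)] by simp
        qed
        show "src (a g) = X" "trg (a g) = ob (F g) X" if "g \<in> carrier G" for g using a[OF that] by simp_all
        fix g h assume g: "g \<in> carrier G" and h: "h \<in> carrier G"
        have gh: "g \<star> h \<in> carrier G" using g h by simp
        have ag: "is_arr C (a g)" "src (a g) = X" "trg (a g) = ob (F g) X" using a[OF g] by simp_all
        have ah: "is_arr C (a h)" "src (a h) = X" "trg (a h) = ob (F h) X" using a[OF h] by simp_all
        have agh: "is_arr C (a (g \<star> h))" "src (a (g \<star> h)) = X" "trg (a (g \<star> h)) = ob (F (g \<star> h)) X"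
          using a[OF gh] by simp_all
        note yg = y(2,3)[OF g] and yh = y(2,3)[OF h]
        let ?rhs = "E g h X ** (fmap (F g) (a h) ** a g)"
        have "D (g \<star> h) X ** fmap H ?rhs =
            (D (g \<star> h) X ** fmap H (E g h X)) ** (fmap H (fmap (F g) (a h)) ** fmap H (a g))"
          using ag ah g h X(1) by (simp add: H.fmap_cmp)
        also have "\<dots> = E g h (ob H X) ** (fmap (F g) (D h X) **
            ((D g (ob (F h) X) ** fmap H (fmap (F g) (a h))) ** fmap H (a g)))"
          unfolding D_coh[OF g h X(1)] using ag ah g h X(1) by simp
        also have "D g (ob (F h) X) ** fmap H (fmap (F g) (a h)) = fmap (F g) (fmap H (a h)) ** D g X"
          using D_nat[OF g ah(1)] ah by simp
        also have "E g h (ob H X) ** (fmap (F g) (D h X) ** ((fmap (F g) (fmap H (a h)) ** D g X) ** fmap H (a g))) =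
            E g h (ob H X) ** (fmap (F g) (D h X ** fmap H (a h)) ** (D g X ** fmap H (a g)))"
          using ag ah g h X(1) by (simp add: F_cmp)
        also have "\<dots> = E g h (ob H X) ** (fmap (F g) (v h) ** v g)" unfolding Da[OF g] Da[OF h] ..
        also have "fmap (F g) (v h) ** v g = fmap (F g) (fmap (F h) (ainv C u)) ** (fmap (F g) (st Y h) **
            (fmap (F g) (u ** ainv C u) ** (st Y g ** u)))"
          using u(1-3) ainv_simps(1-3)[OF u(4)] yg yh y(1) g h by (simp add: v_def F_cmp del: ainv_simps)
        also have "\<dots> = fmap (F g) (fmap (F h) (ainv C u)) ** (fmap (F g) (st Y h) ** (st Y g ** u))"
          using u yg y(1) g by simp
        also have "E g h (ob H X) ** \<dots> = (fmap (F (g \<star> h)) (ainv C u) ** E g h (fst Y)) **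
            (fmap (F g) (st Y h) ** (st Y g ** u))"
          using E_natural[OF g h, of "ainv C u"] u yg yh y(1) X(1) g h by (intro cmp_assoc_subst) auto
        also have "\<dots> = v (g \<star> h)" unfolding v_def y(4)[OF g h] using u yg yh y(1) g h by simp
        also have "\<dots> = D (g \<star> h) X ** fmap H (a (g \<star> h))" using Da[OF gh] by simp
        finally have "fmap H ?rhs = fmap H (a (g \<star> h))"
          using ag ah agh g h gh X(1) by - (rule iso_cancel_left[OF D_iso[OF gh X(1)]], auto)
        then show "a (g \<star> h) = ?rhs"
          using ag ah agh g h gh X(1) by - (rule faithfulD[OF H.faithful], auto)
      qed
      have st_a: "st (mk_eq X a) g = a g" if "g \<in> carrier G" for g using that a[OF that] by simp
      have "is_arr CG (lift (HGo (mk_eq X a)) Y u)"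
      proof (rule lift_arr[OF HGo[OF aO] Y])
        fix g assume g: "g \<in> carrier G"
        have "fmap (F g) u ** st (HGo (mk_eq X a)) g = fmap (F g) u ** v g"
          unfolding st_HGo[OF g] st_a[OF g] using Da[OF g] by simp
        also have "\<dots> = fmap (F g) (u ** ainv C u) ** (st Y g ** u)"
          using u(1-3) ainv_simps(1-3)[OF u(4)] y(2,3)[OF g] g by (simp add: v_def F_cmp del: ainv_simps)
        finally show "st Y g ** u = fmap (F g) u ** st (HGo (mk_eq X a)) g" using u y(1) y(2,3)[OF g] g by simp
      qed (use u in simp)
      then have "iso_arr CG (lift (HGo (mk_eq X a)) Y u)" using u by (intro CG_iso) simp_all
      then have "(HGo (mk_eq X a), Y) \<in> iso_rel CG" by (rule iso_relI) simp_all
      then show ?thesis using aO by auto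
    qed
  qed
  have comm: "HGo (ob (Fd \<chi>) N) = ob (Fd \<chi>) (HGo N)" if \<chi>: "\<chi> \<in> carrier Gd" and N: "N \<in> Obj CG" for \<chi> N
  proof (rule CG_Obj_eqI)
    show "HGo (ob (Fd \<chi>) N) \<in> Obj CG" "ob (Fd \<chi>) (HGo N) \<in> Obj CG" using HGo \<chi> N by simp_all
    fix g assume g: "g \<in> carrier G"
    then show "st (HGo (ob (Fd \<chi>) N)) g = st (ob (Fd \<chi>) (HGo N)) g"
      using \<chi> CG_ObjD(1)[OF N] CG_ObjD(3)[OF N g] by (simp add: st_HGo H.fmap_scl)
  qed simp
  define \<delta>G where "\<delta>G \<chi> N = Ident CG (ob (Fd \<chi>) (HGo N))" for \<chi> N
  have tag: "Arr (HGo (ob (Fd \<chi>) N)) (\<delta>G \<chi> N) (ob (Fd \<chi>) (HGo N)) = idn CG (ob (Fd \<chi>) (HGo N))"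
    if "\<chi> \<in> carrier Gd" "N \<in> Obj CG" for \<chi> N
    using comm[OF that] by (simp add: \<delta>G_def idn_def)
  have "(?HG, \<delta>G) \<in> equivariant_autoequivalences K CG Gd Fd (dual_eps C)"
    unfolding equivariant_autoequivalences_iff
  proof (intro conjI ballI aut)
    fix \<chi> assume \<chi>: "\<chi> \<in> carrier Gd"
    have lins: "linear_functor K CG CG (?HG \<circ>\<^sub>F Fd \<chi>)" "linear_functor K CG CG (Fd \<chi> \<circ>\<^sub>F ?HG)"
      using linear_functor_comp lin lin_functor.F[OF dual_lin_functor[OF \<chi>]] by blast+
    show "natural_iso CG CG (?HG \<circ>\<^sub>F Fd \<chi>) (Fd \<chi> \<circ>\<^sub>F ?HG) (\<delta>G \<chi>)"
      unfolding natural_iso_iff[OF lins]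
    proof (intro conjI ballI allI impI)
      show "iso_arr CG (Arr (ob (?HG \<circ>\<^sub>F Fd \<chi>) N) (\<delta>G \<chi> N) (ob (Fd \<chi> \<circ>\<^sub>F ?HG) N))" if "N \<in> Obj CG" for N
        using tag[OF \<chi> that] HGo[OF that] \<chi> by simp
      fix f assume f: "is_arr CG f"
      have O: "src f \<in> Obj CG" "trg f \<in> Obj CG" using CG_arrD[OF f] by blast+
      have c: "fmap ?HG (fmap (Fd \<chi>) f) = fmap (Fd \<chi>) (fmap ?HG f)"
        using fmap_HG[OF f] fmap_HG[of "fmap (Fd \<chi>) f"] f \<chi> comm[OF \<chi> O(1)] comm[OF \<chi> O(2)]
        by (intro U_eqI) simp_all
      have ar: "is_arr CG (fmap (Fd \<chi>) (fmap ?HG f))" using f fmap_HG[OF f] HGa[OF f] \<chi> by simp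
      show "Arr (ob (?HG \<circ>\<^sub>F Fd \<chi>) (trg f)) (\<delta>G \<chi> (trg f)) (ob (Fd \<chi> \<circ>\<^sub>F ?HG) (trg f)) **\<^bsub>CG\<^esub> fmap (?HG \<circ>\<^sub>F Fd \<chi>) f =
        fmap (Fd \<chi> \<circ>\<^sub>F ?HG) f **\<^bsub>CG\<^esub> Arr (ob (?HG \<circ>\<^sub>F Fd \<chi>) (src f)) (\<delta>G \<chi> (src f)) (ob (Fd \<chi> \<circ>\<^sub>F ?HG) (src f))"
        using tag[OF \<chi> O(1)] tag[OF \<chi> O(2)] c ar by simp
    qed
    fix \<psi> N assume \<psi>: "\<psi> \<in> carrier Gd" and N: "N \<in> Obj CG"
    have \<chi>\<psi>: "\<chi> \<otimes>\<^bsub>Gd\<^esub> \<psi> \<in> carrier Gd" using \<chi> \<psi> by simp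
    have eps: "Arr (ob (Fd \<chi>) (ob (Fd \<psi>) M)) (dual_eps C \<chi> \<psi> M) (ob (Fd (\<chi> \<otimes>\<^bsub>Gd\<^esub> \<psi>)) M) = idn CG (ob (Fd (\<chi> \<otimes>\<^bsub>Gd\<^esub> \<psi>)) M)"
      if "M \<in> Obj CG" for M
      using dual_dual[OF \<chi> \<psi> that]
      by (simp add: idn_def dual_eps_def equivariantization_def split_beta)
    have "fmap ?HG (idn CG (ob (Fd (\<chi> \<otimes>\<^bsub>Gd\<^esub> \<psi>)) N)) = idn CG (ob (Fd (\<chi> \<otimes>\<^bsub>Gd\<^esub> \<psi>)) (HGo N))"
      using lin_functor.fmap_idn[of K CG CG ?HG] lin N \<chi>\<psi> comm[OF \<chi>\<psi> N]
      by (simp add: lin_functor_def lin_functor_axioms_def CG_linear)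
    then show "Arr (ob ?HG (ob (Fd (\<chi> \<otimes>\<^bsub>Gd\<^esub> \<psi>)) N)) (\<delta>G (\<chi> \<otimes>\<^bsub>Gd\<^esub> \<psi>) N) (ob (Fd (\<chi> \<otimes>\<^bsub>Gd\<^esub> \<psi>)) (ob ?HG N)) **\<^bsub>CG\<^esub>
        fmap ?HG (Arr (ob (Fd \<chi>) (ob (Fd \<psi>) N)) (dual_eps C \<chi> \<psi> N) (ob (Fd (\<chi> \<otimes>\<^bsub>Gd\<^esub> \<psi>)) N)) =
      Arr (ob (Fd \<chi>) (ob (Fd \<psi>) (ob ?HG N))) (dual_eps C \<chi> \<psi> (ob ?HG N)) (ob (Fd (\<chi> \<otimes>\<^bsub>Gd\<^esub> \<psi>)) (ob ?HG N)) **\<^bsub>CG\<^esub>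
        (fmap (Fd \<chi>) (Arr (ob ?HG (ob (Fd \<psi>) N)) (\<delta>G \<psi> N) (ob (Fd \<psi>) (ob ?HG N))) **\<^bsub>CG\<^esub>
          Arr (ob ?HG (ob (Fd \<chi>) (ob (Fd \<psi>) N))) (\<delta>G \<chi> (ob (Fd \<psi>) N)) (ob (Fd \<chi>) (ob ?HG (ob (Fd \<psi>) N))))"
      using eps[OF N] eps[OF HGo[OF N]] tag[OF \<chi>\<psi> N] tag[OF \<psi> N] tag[OF \<chi>, of "ob (Fd \<psi>) N"]
        N HGo[OF N] \<chi> \<psi> \<chi>\<psi> comm[OF \<psi> N] dual_dual[OF \<chi> \<psi> HGo[OF N]]
        lin_functor.fmap_idn[OF dual_lin_functor[OF \<chi>], of "ob (Fd \<psi>) (HGo N)"]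
      by simp
  qed
  moreover have "(ob ?HG (IndC X), IndC (ob H X)) \<in> iso_rel CG" if X: "X \<in> Obj C" for X
  proof -
    obtain t r s where A: "graded_at (IndC X) t X r s" using Ind_graded[OF X] .
    let ?N = "IndC X"
    note d = graded_atD[OF A] and gt = gradedD[OF graded_atD(1)[OF A]]
    have gr: "graded (HGo ?N) (\<lambda>\<chi>. fmap H (t \<chi>))"
      unfolding graded_def
    proof (intro conjI ballI)
      show "HGo ?N \<in> Obj CG" using HGo d(2) .
      show "fmap H (t \<one>\<^bsub>Gd\<^esub>) = idn C (fst (HGo ?N))" using gt(6) d(3) by simp
      fix \<chi> assume \<chi>: "\<chi> \<in> carrier Gd"
      show "fmap H (t \<chi>) \<in> arrows C (fst (HGo ?N)) (fst (HGo ?N))" using gt \<chi> by simp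
      show "fmap H (t \<chi>) ** fmap H (t \<psi>) = fmap H (t (\<chi> \<otimes>\<^bsub>Gd\<^esub> \<psi>))" if "\<psi> \<in> carrier Gd" for \<psi>
        using gt \<chi> that by (simp flip: H.fmap_cmp)
      fix g assume g: "g \<in> carrier G"
      have "st (HGo ?N) g ** fmap H (t \<chi>) = D g (fst ?N) ** fmap H (st ?N g ** t \<chi>)"
        unfolding st_HGo[OF g] using gt(1-5) gt(9,10)[OF g] \<chi> g d(3) by (simp add: H.fmap_cmp)
      also have "\<dots> = scl C (\<chi> g) ((D g (fst ?N) ** fmap H (fmap (F g) (t \<chi>))) ** fmap H (st ?N g))"
        unfolding gt(8)[OF \<chi> g] using gt(1-5) gt(9,10)[OF g] \<chi> g d(3) by (simp add: H.fmap_cmp H.fmap_scl)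
      also have "D g (fst ?N) ** fmap H (fmap (F g) (t \<chi>)) = fmap (F g) (fmap H (t \<chi>)) ** D g (fst ?N)"
        using D_nat[OF g gt(3)[OF \<chi>]] gt(4,5)[OF \<chi>] by simp
      finally show "st (HGo ?N) g ** fmap H (t \<chi>) = scl C (\<chi> g) (fmap (F g) (fmap H (t \<chi>)) ** st (HGo ?N) g)"
        unfolding st_HGo[OF g] using gt(1-5) gt(9,10)[OF g] \<chi> g d(3) by simp
    qed
    have ee: "fmap H (ee ?N t \<one>\<^bsub>G\<^esub>) = ee (HGo ?N) (\<lambda>\<chi>. fmap H (t \<chi>)) \<one>\<^bsub>G\<^esub>"
    proof -
      have "fmap H (sm C (fst ?N) (fst ?N) (carrier Gd) (\<lambda>\<chi>. scl C (\<chi> (inv\<^bsub>G\<^esub> \<one>\<^bsub>G\<^esub>)) (t \<chi>))) =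
          sm C (ob H (fst ?N)) (ob H (fst ?N)) (carrier Gd) (\<lambda>\<chi>. fmap H (scl C (\<chi> (inv\<^bsub>G\<^esub> \<one>\<^bsub>G\<^esub>)) (t \<chi>)))"
        using gt S.finite_chars by (intro H.fmap_sm) auto
      also have "\<dots> = sm C (ob H (fst ?N)) (ob H (fst ?N)) (carrier Gd) (\<lambda>\<chi>. scl C (\<chi> (inv\<^bsub>G\<^esub> \<one>\<^bsub>G\<^esub>)) (fmap H (t \<chi>)))"
        using gt by (intro sm_cong) (auto simp: H.fmap_scl)
      finally show ?thesis unfolding ee_def using gt by (simp add: H.fmap_scl)
    qed
    have "graded_at (HGo ?N) (\<lambda>\<chi>. fmap H (t \<chi>)) (ob H X) (fmap H r) (fmap H s)"
      unfolding graded_at_def using gr ee d(1-10) d(11)[symmetric] d(12)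
      by (simp flip: H.fmap_cmp)
    moreover obtain t' r' s' where "graded_at (IndC (ob H X)) t' (ob H X) r' s'"
      using Ind_graded[of "ob H X"] X by auto
    ultimately show ?thesis using graded_at_iso iso_rel_refl X by simp
  qed
  ultimately show ?thesis by blast
qed

end

section \<open>Descent of equivariant autoequivalences to C\<close>

text \<open>An equivariant autoequivalence \<open>H'\<close> of the category of equivariant objects carries graded
  objects to graded objects and homogeneous morphisms to homogeneous morphisms. Since \<open>C\<close> is
  recovered as the category of graded objects and morphisms of degree one, \<open>H'\<close> induces an
  autoequivalence of \<open>C\<close>; the morphisms of degree \<open>g\<close> provide its equivariance.\<close>

locale dual_autoequivalence = dual_setting K C G F \<epsilon>
  for K :: "'k ring" and C :: "('o, 'm, 'k) category" (structure) and G :: "'g monoid"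
    and F :: "'g \<Rightarrow> ('o, 'm, 'o, 'm) functr" and \<epsilon> :: "'g \<Rightarrow> 'g \<Rightarrow> 'o \<Rightarrow> 'm" +
  fixes H' :: "('o \<times> ('g \<Rightarrow> 'm), 'm, 'o \<times> ('g \<Rightarrow> 'm), 'm) functr"
    and \<delta>' :: "('g \<Rightarrow> 'k) \<Rightarrow> 'o \<times> ('g \<Rightarrow> 'm) \<Rightarrow> 'm"
  assumes ea: "(H', \<delta>') \<in> equivariant_autoequivalences K CG Gd Fd (dual_eps C)"
begin

lemmas ea' = ea[unfolded equivariant_autoequivalences_iff]

sublocale H': ff_functor K CG CG H'
  using ea' CG_autoequivalence_ff by blast

lemma H'_es: "N \<in> Obj CG \<Longrightarrow> \<exists>M\<in>Obj CG. (ob H' M, N) \<in> iso_rel CG"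
  using CG.autoequivalence_faithful_full(3) ea' by blast

definition D :: "('g \<Rightarrow> 'k) \<Rightarrow> 'o \<times> ('g \<Rightarrow> 'm) \<Rightarrow> ('o \<times> ('g \<Rightarrow> 'm), 'm) arr"
  where "D \<chi> N = Arr (ob H' (ob (Fd \<chi>) N)) (\<delta>' \<chi> N) (ob (Fd \<chi>) (ob H' N))"

lemma D_src [simp]: "src (D \<chi> N) = ob H' (ob (Fd \<chi>) N)" "trg (D \<chi> N) = ob (Fd \<chi>) (ob H' N)"
  by (simp_all add: D_def)

lemma D_linear:
  assumes "\<chi> \<in> carrier Gd"
  shows "linear_functor K CG CG (H' \<circ>\<^sub>F Fd \<chi>)" "linear_functor K CG CG (Fd \<chi> \<circ>\<^sub>F H')"
  using linear_functor_comp[OF lin_functor.F[OF dual_lin_functor[OF assms]] H'.F]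
    linear_functor_comp[OF H'.F lin_functor.F[OF dual_lin_functor[OF assms]]] .

lemma D_natural_iso: "\<chi> \<in> carrier Gd \<Longrightarrow> natural_iso CG CG (H' \<circ>\<^sub>F Fd \<chi>) (Fd \<chi> \<circ>\<^sub>F H') (\<delta>' \<chi>)"
  using ea' by blast

lemma D_iso [simp]: "\<chi> \<in> carrier Gd \<Longrightarrow> N \<in> Obj CG \<Longrightarrow> iso_arr CG (D \<chi> N)"
  using D_natural_iso[of \<chi>] by (simp add: natural_iso_iff[OF D_linear] D_def)

lemma D_arr [simp]: "\<chi> \<in> carrier Gd \<Longrightarrow> N \<in> Obj CG \<Longrightarrow> is_arr CG (D \<chi> N)"
  by (rule iso_arr_arr) simp

lemma D_natural:
  "\<chi> \<in> carrier Gd \<Longrightarrow> is_arr CG f \<Longrightarrow>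
    D \<chi> (trg f) **\<^bsub>CG\<^esub> fmap H' (fmap (Fd \<chi>) f) = fmap (Fd \<chi>) (fmap H' f) **\<^bsub>CG\<^esub> D \<chi> (src f)"
  using D_natural_iso[of \<chi>] by (simp add: natural_iso_iff[OF D_linear] D_def)

lemma D_coherent:
  assumes \<chi>: "\<chi> \<in> carrier Gd" and \<psi>: "\<psi> \<in> carrier Gd" and N: "N \<in> Obj CG"
  shows "D (\<chi> \<otimes>\<^bsub>Gd\<^esub> \<psi>) N = fmap (Fd \<chi>) (D \<psi> N) **\<^bsub>CG\<^esub> D \<chi> (ob (Fd \<psi>) N)"
proof -
  have \<chi>\<psi>: "\<chi> \<otimes>\<^bsub>Gd\<^esub> \<psi> \<in> carrier Gd" using \<chi> \<psi> by simp
  have H'N: "ob H' N \<in> Obj CG" using N by simp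
  have eps: "Arr (ob (Fd \<chi>) (ob (Fd \<psi>) M)) (dual_eps C \<chi> \<psi> M) (ob (Fd (\<chi> \<otimes>\<^bsub>Gd\<^esub> \<psi>)) M) = idn CG (ob (Fd (\<chi> \<otimes>\<^bsub>Gd\<^esub> \<psi>)) M)"
    if "M \<in> Obj CG" for M
    using dual_dual[OF \<chi> \<psi> that]
    by (simp add: idn_def dual_eps_def equivariantization_def split_beta)
  have "D (\<chi> \<otimes>\<^bsub>Gd\<^esub> \<psi>) N **\<^bsub>CG\<^esub> fmap H' (idn CG (ob (Fd (\<chi> \<otimes>\<^bsub>Gd\<^esub> \<psi>)) N)) =
      idn CG (ob (Fd (\<chi> \<otimes>\<^bsub>Gd\<^esub> \<psi>)) (ob H' N)) **\<^bsub>CG\<^esub> (fmap (Fd \<chi>) (D \<psi> N) **\<^bsub>CG\<^esub> D \<chi> (ob (Fd \<psi>) N))"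
    using ea' \<chi> \<psi> N unfolding D_def eps[OF N, symmetric] eps[OF H'N, symmetric] by blast
  then show ?thesis using \<chi> \<psi> \<chi>\<psi> N H'N dual_dual[OF \<chi> \<psi> H'N] by simp
qed

text \<open>Composing with \<open>\<delta>'\<close> makes an arrow \<open>H' N \<rightarrow> F\<^sub>\<chi> (H' N)\<close> out of \<open>H' l\<close>. The coherence of \<open>\<delta>'\<close> ensures
  that this respects the products of a grading.\<close>

lemma transport_mult:
  assumes \<chi>: "\<chi> \<in> carrier Gd" and \<psi>: "\<psi> \<in> carrier Gd" and N: "N \<in> Obj CG"
    and l: "l \<in> arrows CG N (ob (Fd \<chi>) N)" and m: "m \<in> arrows CG N (ob (Fd \<psi>) N)"
  shows "U (D (\<chi> \<otimes>\<^bsub>Gd\<^esub> \<psi>) N **\<^bsub>CG\<^esub> fmap H' (fmap (Fd \<chi>) m **\<^bsub>CG\<^esub> l)) =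
    U (D \<psi> N **\<^bsub>CG\<^esub> fmap H' m) ** U (D \<chi> N **\<^bsub>CG\<^esub> fmap H' l)"
proof -
  have l': "is_arr CG l" "src l = N" "trg l = ob (Fd \<chi>) N" and m': "is_arr CG m" "src m = N" "trg m = ob (Fd \<psi>) N"
    using l m by auto
  let ?\<psi>N = "ob (Fd \<psi>) N"
  have O: "?\<psi>N \<in> Obj CG" "ob H' N \<in> Obj CG" using N \<psi> by simp_all
  have a1: "is_arr CG (D \<chi> ?\<psi>N)" "is_arr CG (fmap (Fd \<chi>) (D \<psi> N))" "is_arr CG (D \<chi> N)"
    "is_arr CG (fmap H' l)" "is_arr CG (fmap (Fd \<chi>) (fmap H' m))" "is_arr CG (fmap H' (fmap (Fd \<chi>) m))"
    using \<chi> \<psi> N O l' m' by simp_all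
  have "D (\<chi> \<otimes>\<^bsub>Gd\<^esub> \<psi>) N **\<^bsub>CG\<^esub> fmap H' (fmap (Fd \<chi>) m **\<^bsub>CG\<^esub> l) =
      fmap (Fd \<chi>) (D \<psi> N) **\<^bsub>CG\<^esub> ((D \<chi> ?\<psi>N **\<^bsub>CG\<^esub> fmap H' (fmap (Fd \<chi>) m)) **\<^bsub>CG\<^esub> fmap H' l)"
    unfolding D_coherent[OF \<chi> \<psi> N] using a1 l' m' \<chi> by (simp add: H'.fmap_cmp)
  also have "D \<chi> ?\<psi>N **\<^bsub>CG\<^esub> fmap H' (fmap (Fd \<chi>) m) = fmap (Fd \<chi>) (fmap H' m) **\<^bsub>CG\<^esub> D \<chi> N"
    using D_natural[OF \<chi> m'(1)] m' by simp
  finally have eq: "U (D (\<chi> \<otimes>\<^bsub>Gd\<^esub> \<psi>) N **\<^bsub>CG\<^esub> fmap H' (fmap (Fd \<chi>) m **\<^bsub>CG\<^esub> l)) =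
      U (D \<psi> N) ** ((U (fmap H' m) ** U (D \<chi> N)) ** U (fmap H' l))" by simp
  have "is_arr C (U (D \<psi> N))" "is_arr C (U (fmap H' m))" "is_arr C (U (D \<chi> N))" "is_arr C (U (fmap H' l))"
    using CG_arrD(3) \<chi> \<psi> N l' m' by simp_all
  then show ?thesis unfolding eq using l' m' by simp
qed

text \<open>The condition at the trivial character is automatic: an invertible idempotent is an identity.\<close>

lemma gradedI:
  assumes N: "N \<in> Obj CG" and ar: "\<And>\<chi>. \<chi> \<in> carrier Gd \<Longrightarrow> l \<chi> \<in> arrows CG N (ob (Fd \<chi>) N)"
    and mult: "\<And>\<chi> \<psi>. \<chi> \<in> carrier Gd \<Longrightarrow> \<psi> \<in> carrier Gd \<Longrightarrow> U (l \<psi>) ** U (l \<chi>) = U (l (\<chi> \<otimes>\<^bsub>Gd\<^esub> \<psi>))"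
    and iso: "iso_arr C (U (l \<one>\<^bsub>Gd\<^esub>))"
  shows "graded N (\<lambda>\<chi>. U (l \<chi>))"
proof -
  have u: "is_arr C (U (l \<chi>))" "src (U (l \<chi>)) = fst N" "trg (U (l \<chi>)) = fst N" if "\<chi> \<in> carrier Gd" for \<chi>
    using ar[OF that] CG_arrD(3) by auto
  have "U (l \<one>\<^bsub>Gd\<^esub>) ** U (l \<one>\<^bsub>Gd\<^esub>) = U (l \<one>\<^bsub>Gd\<^esub>) ** idn C (fst N)"
    using mult[of "\<one>\<^bsub>Gd\<^esub>" "\<one>\<^bsub>Gd\<^esub>"] u[of "\<one>\<^bsub>Gd\<^esub>"] by simp
  then have one: "U (l \<one>\<^bsub>Gd\<^esub>) = idn C (fst N)"
    using u[of "\<one>\<^bsub>Gd\<^esub>"] CG_ObjD(1)[OF N] by - (rule iso_cancel_left[OF iso], auto)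
  show ?thesis
    unfolding graded_def
  proof (intro conjI ballI N one)
    fix \<chi> assume \<chi>: "\<chi> \<in> carrier Gd"
    show "U (l \<chi>) \<in> arrows C (fst N) (fst N)" using u[OF \<chi>] by simp
    show "U (l \<chi>) ** U (l \<psi>) = U (l (\<chi> \<otimes>\<^bsub>Gd\<^esub> \<psi>))" if "\<psi> \<in> carrier Gd" for \<psi>
      using mult[OF that \<chi>] S.Gd.m_comm[OF \<chi> that] by simp
    have lift: "lift N (ob (Fd \<chi>) N) (U (l \<chi>)) = l \<chi>" using ar[OF \<chi>] lift_U[of "l \<chi>"] by simp
    show "st N g ** U (l \<chi>) = scl C (\<chi> g) (fmap (F g) (U (l \<chi>)) ** st N g)" if "g \<in> carrier G" for g
      using graded_lift_iff[OF N \<chi> _ N, of "U (l \<chi>)"] u[OF \<chi>] ar[OF \<chi>] that unfolding lift by simp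
  qed
qed

definition tr :: "'o \<times> ('g \<Rightarrow> 'm) \<Rightarrow> (('g \<Rightarrow> 'k) \<Rightarrow> ('o, 'm) arr) \<Rightarrow> ('g \<Rightarrow> 'k) \<Rightarrow> ('o, 'm) arr"
  where "tr N t \<chi> = U (D \<chi> N **\<^bsub>CG\<^esub> fmap H' (lift N (ob (Fd \<chi>) N) (t \<chi>)))"

lemma graded_transport:
  assumes gr: "graded N t"
  shows "graded (ob H' N) (tr N t)"
proof -
  note d = gradedD[OF gr]
  define l where "l \<chi> = lift N (ob (Fd \<chi>) N) (t \<chi>)" for \<chi>
  have l: "l \<chi> \<in> arrows CG N (ob (Fd \<chi>) N)" if "\<chi> \<in> carrier Gd" for \<chi>
    using graded_lift[OF gr that] by (simp add: l_def)
  have ll: "fmap (Fd \<chi>) (l \<psi>) **\<^bsub>CG\<^esub> l \<chi> = l (\<chi> \<otimes>\<^bsub>Gd\<^esub> \<psi>)" if \<chi>: "\<chi> \<in> carrier Gd" and \<psi>: "\<psi> \<in> carrier Gd" for \<chi> \<psi>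
    using d(3-5) d(7)[OF \<psi> \<chi>] S.Gd.m_comm[OF \<chi> \<psi>] dual_dual[OF \<chi> \<psi> d(1)] \<chi> \<psi>
    by (intro U_eqI) (simp_all add: l_def)
  have "graded (ob H' N) (\<lambda>\<chi>. U (D \<chi> N **\<^bsub>CG\<^esub> fmap H' (l \<chi>)))"
  proof (rule gradedI)
    show "ob H' N \<in> Obj CG" using d by simp
    show "D \<chi> N **\<^bsub>CG\<^esub> fmap H' (l \<chi>) \<in> arrows CG (ob H' N) (ob (Fd \<chi>) (ob H' N))" if "\<chi> \<in> carrier Gd" for \<chi>
      using l[OF that] that d(1) by simp
    show "U (D \<psi> N **\<^bsub>CG\<^esub> fmap H' (l \<psi>)) ** U (D \<chi> N **\<^bsub>CG\<^esub> fmap H' (l \<chi>)) =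
        U (D (\<chi> \<otimes>\<^bsub>Gd\<^esub> \<psi>) N **\<^bsub>CG\<^esub> fmap H' (l (\<chi> \<otimes>\<^bsub>Gd\<^esub> \<psi>)))"
      if \<chi>: "\<chi> \<in> carrier Gd" and \<psi>: "\<psi> \<in> carrier Gd" for \<chi> \<psi>
      using transport_mult[OF \<chi> \<psi> d(1) l[OF \<chi>] l[OF \<psi>]] ll[OF \<chi> \<psi>] by simp
    have "iso_arr CG (D \<one>\<^bsub>Gd\<^esub> N **\<^bsub>CG\<^esub> fmap H' (l \<one>\<^bsub>Gd\<^esub>))"
      using graded_iso[OF gr S.Gd.one_closed] d(1) by (intro CG.iso_arr_cmp H'.fmap_iso_arr D_iso) (simp_all add: l_def)
    then show "iso_arr C (U (D \<one>\<^bsub>Gd\<^esub> N **\<^bsub>CG\<^esub> fmap H' (l \<one>\<^bsub>Gd\<^esub>)))" using forget.fmap_iso_arr by fastforce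
  qed
  then show ?thesis by (simp add: tr_def[abs_def] l_def)
qed

text \<open>Homogeneity is an equation between morphisms \<open>N \<rightarrow> F\<^sub>\<chi> N'\<close> of equivariant objects, which the
  faithful functor \<open>H'\<close> respects and reflects.\<close>

lemma homogeneous_transport:
  assumes A: "graded N t" and B: "graded N' t'" and f: "f \<in> arrows CG N N'" and a: "a \<in> carrier G"
  shows "homogeneous (tr N t) (tr N' t') a (U (fmap H' f)) \<longleftrightarrow> homogeneous t t' a (U f)"
  unfolding homogeneous_def
proof (intro ball_cong refl)
  note dA = gradedD[OF A] and dB = gradedD[OF B]
  have f': "is_arr CG f" "src f = N" "trg f = N'" using f by auto
  fix \<chi> assume \<chi>: "\<chi> \<in> carrier Gd"
  let ?l = "lift N (ob (Fd \<chi>) N) (t \<chi>)" and ?l' = "lift N' (ob (Fd \<chi>) N') (t' \<chi>)"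
  have l: "is_arr CG ?l" and l': "is_arr CG ?l'" using graded_lift[OF A \<chi>] graded_lift[OF B \<chi>] .
  have \<chi>a: "\<chi> a \<in> carrier K" using \<chi> a by simp
  define x where "x = ?l' **\<^bsub>CG\<^esub> f"
  define y where "y = scl CG (\<chi> a) (fmap (Fd \<chi>) f **\<^bsub>CG\<^esub> ?l)"
  have xy: "x \<in> arrows CG N (ob (Fd \<chi>) N')" "y \<in> arrows CG N (ob (Fd \<chi>) N')"
    unfolding x_def y_def using l l' f' \<chi> \<chi>a by simp_all
  have ar: "is_arr CG (D \<chi> N')" "is_arr CG (D \<chi> N)" "is_arr CG (fmap H' f)" "is_arr CG (fmap H' ?l)" "is_arr CG (fmap H' ?l')"
    "is_arr CG (fmap H' (fmap (Fd \<chi>) f))" "is_arr CG (fmap (Fd \<chi>) (fmap H' f))"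
    using \<chi> dA(1) dB(1) f' l l' by simp_all
  have U_x: "U (D \<chi> N' **\<^bsub>CG\<^esub> fmap H' x) = tr N' t' \<chi> ** U (fmap H' f)"
  proof -
    have "D \<chi> N' **\<^bsub>CG\<^esub> fmap H' x = (D \<chi> N' **\<^bsub>CG\<^esub> fmap H' ?l') **\<^bsub>CG\<^esub> fmap H' f"
      unfolding x_def using ar l' f' by (simp add: H'.fmap_cmp)
    then show ?thesis by (simp only: U_cmp tr_def)
  qed
  have U_y: "U (D \<chi> N' **\<^bsub>CG\<^esub> fmap H' y) = scl C (\<chi> a) (U (fmap H' f) ** tr N t \<chi>)"
  proof -
    have "D \<chi> N' **\<^bsub>CG\<^esub> fmap H' y = scl CG (\<chi> a) ((D \<chi> N' **\<^bsub>CG\<^esub> fmap H' (fmap (Fd \<chi>) f)) **\<^bsub>CG\<^esub> fmap H' ?l)"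
      unfolding y_def using ar l f' \<chi> \<chi>a by (simp add: H'.fmap_cmp H'.fmap_scl)
    also have "D \<chi> N' **\<^bsub>CG\<^esub> fmap H' (fmap (Fd \<chi>) f) = fmap (Fd \<chi>) (fmap H' f) **\<^bsub>CG\<^esub> D \<chi> N"
      using D_natural[OF \<chi> f'(1)] f' by simp
    also have "(fmap (Fd \<chi>) (fmap H' f) **\<^bsub>CG\<^esub> D \<chi> N) **\<^bsub>CG\<^esub> fmap H' ?l =
        fmap (Fd \<chi>) (fmap H' f) **\<^bsub>CG\<^esub> (D \<chi> N **\<^bsub>CG\<^esub> fmap H' ?l)"
      using ar f' by simp
    finally show ?thesis by (simp only: U_scl U_cmp U_fmap_dual tr_def)
  qed
  have "x = y \<longleftrightarrow> D \<chi> N' **\<^bsub>CG\<^esub> fmap H' x = D \<chi> N' **\<^bsub>CG\<^esub> fmap H' y"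
  proof
    assume "D \<chi> N' **\<^bsub>CG\<^esub> fmap H' x = D \<chi> N' **\<^bsub>CG\<^esub> fmap H' y"
    then have "fmap H' x = fmap H' y"
      using xy \<chi> dB(1) by - (rule CG.iso_cancel_left[OF D_iso[OF \<chi> dB(1)]], auto)
    then show "x = y" using xy by - (rule faithfulD[OF H'.faithful], auto)
  qed simp
  also have "\<dots> \<longleftrightarrow> U (D \<chi> N' **\<^bsub>CG\<^esub> fmap H' x) = U (D \<chi> N' **\<^bsub>CG\<^esub> fmap H' y)"
    by (rule U_eq_iff) (use xy in auto)
  finally have 1: "x = y \<longleftrightarrow> tr N' t' \<chi> ** U (fmap H' f) = scl C (\<chi> a) (U (fmap H' f) ** tr N t \<chi>)"
    unfolding U_x U_y .
  have "x = y \<longleftrightarrow> U x = U y" by (rule U_eq_iff) (use xy in auto)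
  also have "\<dots> \<longleftrightarrow> t' \<chi> ** U f = scl C (\<chi> a) (U f ** t \<chi>)"
    unfolding x_def y_def using dA(3-5)[OF \<chi>] dB(3-5)[OF \<chi>] by simp
  finally show "tr N' t' \<chi> ** U (fmap H' f) = scl C (\<chi> a) (U (fmap H' f) ** tr N t \<chi>) \<longleftrightarrow>
      t' \<chi> ** U f = scl C (\<chi> a) (U f ** t \<chi>)"
    using 1 by simp
qed

text \<open>The objects in play: \<open>P X\<close> is the induced object with its grading, \<open>Q X\<close> its image under
  \<open>H'\<close>, and \<open>Ho X\<close> a splitting of the component of degree one of \<open>Q X\<close>.\<close>

abbreviation "P X \<equiv> IndC X"
abbreviation "Q X \<equiv> ob H' (P X)"

definition "dat X = (SOME (t, r, s). graded_at (P X) t X r s)"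
definition "tP X = fst (dat X)"
definition "rP X = fst (snd (dat X))"
definition "sP X = snd (snd (dat X))"

lemma A: "X \<in> Obj C \<Longrightarrow> graded_at (P X) (tP X) X (rP X) (sP X)"
proof -
  assume X: "X \<in> Obj C"
  obtain t r s where "graded_at (P X) t X r s" using Ind_graded[OF X] .
  then have "case dat X of (t, r, s) \<Rightarrow> graded_at (P X) t X r s"
    unfolding dat_def by - (rule someI[of _ "(t, r, s)"], simp)
  then show ?thesis by (simp add: split_beta tP_def rP_def sP_def)
qed

definition "dat' X = (SOME (Y, r, s). graded_at (Q X) (tr (P X) (tP X)) Y r s)"
definition "Ho X = fst (dat' X)"
definition "rQ X = fst (snd (dat' X))"
definition "sQ X = snd (snd (dat' X))"

lemma B: "X \<in> Obj C \<Longrightarrow> graded_at (Q X) (tr (P X) (tP X)) (Ho X) (rQ X) (sQ X)"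
proof -
  assume X: "X \<in> Obj C"
  obtain Y r s where "graded_at (Q X) (tr (P X) (tP X)) Y r s"
    using graded_split[OF graded_transport[OF graded_atD(1)[OF A[OF X]]]] by blast
  then have "case dat' X of (Y, r, s) \<Rightarrow> graded_at (Q X) (tr (P X) (tP X)) Y r s"
    unfolding dat'_def by - (rule someI[of _ "(Y, r, s)"], simp)
  then show ?thesis by (simp add: split_beta Ho_def rQ_def sQ_def)
qed

lemmas dA = graded_atD[OF A] and dB = graded_atD[OF B]

text \<open>The extension of an arrow of \<open>C\<close> to the induced objects; degree one and the restriction to \<open>X\<close>
  characterize it, which makes it functorial.\<close>

definition Pm :: "('o, 'm) arr \<Rightarrow> ('o \<times> ('g \<Rightarrow> 'm), 'm) arr"
  where "Pm u = (SOME f. f \<in> arrows CG (P (src u)) (P (trg u)) \<and>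
    homogeneous (tP (src u)) (tP (trg u)) \<one>\<^bsub>G\<^esub> (U f) \<and> U f ** sP (src u) = sP (trg u) ** u)"

lemma Pm:
  assumes u: "is_arr C u"
  shows "is_arr CG (Pm u)" "src (Pm u) = P (src u)" "trg (Pm u) = P (trg u)"
    "homogeneous (tP (src u)) (tP (trg u)) \<one>\<^bsub>G\<^esub> (U (Pm u))" "U (Pm u) ** sP (src u) = sP (trg u) ** u"
proof -
  have "\<exists>f. f \<in> arrows CG (P (src u)) (P (trg u)) \<and>
    homogeneous (tP (src u)) (tP (trg u)) \<one>\<^bsub>G\<^esub> (U f) \<and> U f ** sP (src u) = sP (trg u) ** u"
    by (rule extend_component[OF A A, of "src u" "trg u" u]) (use u in auto)
  then have "Pm u \<in> arrows CG (P (src u)) (P (trg u)) \<and>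
    homogeneous (tP (src u)) (tP (trg u)) \<one>\<^bsub>G\<^esub> (U (Pm u)) \<and> U (Pm u) ** sP (src u) = sP (trg u) ** u"
    unfolding Pm_def by (rule someI_ex)
  then show "is_arr CG (Pm u)" "src (Pm u) = P (src u)" "trg (Pm u) = P (trg u)"
    "homogeneous (tP (src u)) (tP (trg u)) \<one>\<^bsub>G\<^esub> (U (Pm u))" "U (Pm u) ** sP (src u) = sP (trg u) ** u" by auto
qed

lemma U_Pm:
  assumes u: "is_arr C u"
  shows "is_arr C (U (Pm u))" "src (U (Pm u)) = fst (P (src u))" "trg (U (Pm u)) = fst (P (trg u))"
  using Pm[OF u] CG_arrD(3) by simp_all

lemma Pm_eqI:
  assumes u: "is_arr C u" and f: "f \<in> arrows CG (P (src u)) (P (trg u))" and eq: "U f ** sP (src u) = sP (trg u) ** u"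
  shows "Pm u = f"
  using Pm[OF u] f eq u by (intro equivariant_eqI[OF A A, of "src u" "trg u"]) auto

lemma Pm_idn: "X \<in> Obj C \<Longrightarrow> Pm (idn C X) = idn CG (P X)"
  using dA[of X] by (intro Pm_eqI) auto

lemma Pm_cmp:
  assumes u: "is_arr C u" and v: "is_arr C v" and "trg u = src v"
  shows "Pm (v ** u) = Pm v **\<^bsub>CG\<^esub> Pm u"
proof (rule Pm_eqI)
  note O = is_arr_Obj[OF u] is_arr_Obj[OF v]
  note s = dA(8-10)[OF O(1)] dA(8-10)[OF O(2)] dA(8-10)[OF O(4)]
  have "U (Pm v) ** (U (Pm u) ** sP (src u)) = (U (Pm v) ** sP (src v)) ** u"
    unfolding Pm(5)[OF u] using U_Pm[OF v] s assms by simp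
  then show "U (Pm v **\<^bsub>CG\<^esub> Pm u) ** sP (src (v ** u)) = sP (trg (v ** u)) ** (v ** u)"
    unfolding Pm(5)[OF v] using U_Pm[OF u] U_Pm[OF v] s assms by simp
qed (use assms Pm(1-3)[OF u] Pm(1-3)[OF v] in auto)

lemma Pm_pl:
  assumes u: "is_arr C u" and v: "is_arr C v" and uv: "src u = src v" "trg u = trg v"
  shows "Pm (pl C u v) = pl CG (Pm u) (Pm v)"
proof (rule Pm_eqI)
  note O = is_arr_Obj[OF v]
  note s = dA(8-10)[OF O(1)] dA(8-10)[OF O(2)]
  show "U (pl CG (Pm u) (Pm v)) ** sP (src (pl C u v)) = sP (trg (pl C u v)) ** pl C u v"
    using Pm(5)[OF u] Pm(5)[OF v] U_Pm[OF u] U_Pm[OF v] s assms by (simp add: pl_cmp cmp_pl)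
qed (use assms Pm(1-3)[OF u] Pm(1-3)[OF v] in auto)

lemma Pm_scl:
  assumes u: "is_arr C u" and a: "a \<in> carrier K"
  shows "Pm (scl C a u) = scl CG a (Pm u)"
proof (rule Pm_eqI)
  note O = is_arr_Obj[OF u]
  note s = dA(8-10)[OF O(1)] dA(8-10)[OF O(2)]
  show "U (scl CG a (Pm u)) ** sP (src (scl C a u)) = sP (trg (scl C a u)) ** scl C a u"
    using Pm(5)[OF u] U_Pm[OF u] s assms by simp
qed (use assms Pm(1-3)[OF u] in auto)

definition Ha :: "('o, 'm) arr \<Rightarrow> ('o, 'm) arr"
  where "Ha u = rQ (trg u) ** (U (fmap H' (Pm u)) ** sQ (src u))"

lemma UH:
  assumes u: "is_arr C u"
  shows "is_arr CG (fmap H' (Pm u))" "src (fmap H' (Pm u)) = Q (src u)" "trg (fmap H' (Pm u)) = Q (trg u)"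
    "is_arr C (U (fmap H' (Pm u)))" "src (U (fmap H' (Pm u))) = fst (Q (src u))" "trg (U (fmap H' (Pm u))) = fst (Q (trg u))"
    "homogeneous (tr (P (src u)) (tP (src u))) (tr (P (trg u)) (tP (trg u))) \<one>\<^bsub>G\<^esub> (U (fmap H' (Pm u)))"
proof -
  note O = is_arr_Obj[OF u]
  note p = Pm[OF u]
  show h: "is_arr CG (fmap H' (Pm u))" "src (fmap H' (Pm u)) = Q (src u)" "trg (fmap H' (Pm u)) = Q (trg u)"
    using p by simp_all
  show "is_arr C (U (fmap H' (Pm u)))" "src (U (fmap H' (Pm u))) = fst (Q (src u))"
    "trg (U (fmap H' (Pm u))) = fst (Q (trg u))"
    using CG_arrD(3)[OF h(1)] p by simp_all
  show "homogeneous (tr (P (src u)) (tP (src u))) (tr (P (trg u)) (tP (trg u))) \<one>\<^bsub>G\<^esub> (U (fmap H' (Pm u)))"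
    using homogeneous_transport[OF dA(1)[OF O(1)] dA(1)[OF O(2)], of "Pm u" "\<one>\<^bsub>G\<^esub>"] p by simp
qed

lemma Ha_arr:
  assumes u: "is_arr C u"
  shows "is_arr C (Ha u)" "src (Ha u) = Ho (src u)" "trg (Ha u) = Ho (trg u)"
  using UH[OF u] dB[OF is_arr_Obj(1)[OF u]] dB[OF is_arr_Obj(2)[OF u]] by (simp_all add: Ha_def)

lemma Ha_s:
  assumes u: "is_arr C u"
  shows "U (fmap H' (Pm u)) ** sQ (src u) = sQ (trg u) ** Ha u"
  unfolding Ha_def
  using homogeneous_one_s[OF B[OF is_arr_Obj(1)[OF u]] B[OF is_arr_Obj(2)[OF u]] UH(4-7)[OF u]] .

lemma Ha_eqI:
  assumes u: "is_arr C u" and v: "v \<in> arrows C (Ho (src u)) (Ho (trg u))"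
    and eq: "U (fmap H' (Pm u)) ** sQ (src u) = sQ (trg u) ** v"
  shows "Ha u = v"
proof -
  note d = dB[OF is_arr_Obj(2)[OF u]]
  have "rQ (trg u) ** (sQ (trg u) ** v) = idn C (Ho (trg u)) ** v"
    using d v by (intro cmp_assoc_subst) auto
  then show ?thesis unfolding Ha_def eq using v by simp
qed

text \<open>The arrow \<open>H' (P u)\<close> extends its component \<open>Ha u\<close>, and the extension also commutes with the
  projections to the components of degree one.\<close>

lemma r_Ha:
  assumes u: "is_arr C u"
  shows "rQ (trg u) ** U (fmap H' (Pm u)) = Ha u ** rQ (src u)"
proof -
  note O = is_arr_Obj[OF u]
  obtain f where f: "f \<in> arrows CG (Q (src u)) (Q (trg u))" "U f ** sQ (src u) = sQ (trg u) ** Ha u"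
    "rQ (trg u) ** U f = Ha u ** rQ (src u)"
    by (rule extend_component[OF B[OF O(1)] B[OF O(2)], of "Ha u"]) (use Ha_arr[OF u] in auto)
  have "fmap H' (Pm u) = f"
    using UH[OF u] f Ha_s[OF u] by (intro equivariant_eqI[OF B[OF O(1)] B[OF O(2)]]) auto
  then show ?thesis using f(3) by simp
qed

abbreviation "H \<equiv> mk_functor Ho Ha"

lemma H_linear: "linear_functor K C C H" and fmap_H: "is_arr C u \<Longrightarrow> fmap H u = Ha u"
proof -
  have "linear_functor K C C H \<and> (\<forall>f. is_arr C f \<longrightarrow> fmap H f = Ha f)"
  proof (rule linear_functor_mk_functor)
    show "Ho X \<in> Obj C" if "X \<in> Obj C" for X using dB(4)[OF that] .
    show "Ha f \<in> arrows C (Ho (src f)) (Ho (trg f))" if "is_arr C f" for f using Ha_arr[OF that] by simp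
    show "Ha (idn C X) = idn C (Ho X)" if X: "X \<in> Obj C" for X
      using dB[OF X] dA(2)[OF X] X by (intro Ha_eqI) (simp_all add: Pm_idn)
    show "Ha (g ** f) = Ha g ** Ha f" if f: "is_arr C f" and g: "is_arr C g" and fg: "trg f = src g" for f g
    proof (rule Ha_eqI)
      note O = is_arr_Obj[OF f] is_arr_Obj[OF g]
      note s = dB(8-10)[OF O(1)] dB(8-10)[OF O(2)] dB(8-10)[OF O(4)]
      have "U (fmap H' (Pm g)) ** (U (fmap H' (Pm f)) ** sQ (src f)) = (U (fmap H' (Pm g)) ** sQ (src g)) ** Ha f"
        unfolding Ha_s[OF f] using UH(4-6)[OF g] s Ha_arr[OF f] fg by simp
      also have "\<dots> = sQ (trg g) ** (Ha g ** Ha f)"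
        unfolding Ha_s[OF g] using s Ha_arr[OF f] Ha_arr[OF g] fg by simp
      finally show "U (fmap H' (Pm (g ** f))) ** sQ (src (g ** f)) = sQ (trg (g ** f)) ** (Ha g ** Ha f)"
        using UH(4-6)[OF f] UH(4-6)[OF g] s fg Pm(1-3)[OF f] Pm(1-3)[OF g]
        by (simp add: Pm_cmp[OF f g fg] H'.fmap_cmp)
    qed (use f g fg Ha_arr[OF f] Ha_arr[OF g] in auto)
    show "Ha (pl C f g) = pl C (Ha f) (Ha g)"
      if f: "is_arr C f" and g: "is_arr C g" and fg: "src f = src g" "trg f = trg g" for f g
    proof (rule Ha_eqI)
      note O = is_arr_Obj[OF g]
      note s = dB(8-10)[OF O(1)] dB(8-10)[OF O(2)]
      show "U (fmap H' (Pm (pl C f g))) ** sQ (src (pl C f g)) = sQ (trg (pl C f g)) ** pl C (Ha f) (Ha g)"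
        using UH(4-6)[OF f] UH(4-6)[OF g] s fg Pm(1-3)[OF f] Pm(1-3)[OF g] Ha_s[OF f] Ha_s[OF g] Ha_arr[OF f] Ha_arr[OF g]
        by (simp add: Pm_pl[OF f g fg] H'.fmap_pl pl_cmp cmp_pl)
    qed (use f g fg Ha_arr[OF f] Ha_arr[OF g] in auto)
    show "Ha (scl C a f) = scl C a (Ha f)" if f: "is_arr C f" and a: "a \<in> carrier K" for f a
    proof (rule Ha_eqI)
      note O = is_arr_Obj[OF f]
      note s = dB(8-10)[OF O(1)] dB(8-10)[OF O(2)]
      show "U (fmap H' (Pm (scl C a f))) ** sQ (src (scl C a f)) = sQ (trg (scl C a f)) ** scl C a (Ha f)"
        using UH(4-6)[OF f] s a Pm(1-3)[OF f] Ha_s[OF f] Ha_arr[OF f]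
        by (simp add: Pm_scl[OF f a] H'.fmap_scl)
    qed (use f a Ha_arr[OF f] in auto)
  qed
  then show "linear_functor K C C H" "is_arr C u \<Longrightarrow> fmap H u = Ha u" by blast+
qed

lemma H_faithful: "faithful_functor C H"
  unfolding faithful_functor_def
proof (intro allI impI)
  fix f g assume f: "is_arr C f" and g: "is_arr C g" and fg: "src f = src g" "trg f = trg g" "fmap H f = fmap H g"
  note O = is_arr_Obj[OF g]
  have "Ha f = Ha g" using fg fmap_H[OF f] fmap_H[OF g] by simp
  then have "fmap H' (Pm f) = fmap H' (Pm g)"
    using UH(1-3)[OF f] UH(1-3)[OF g] Ha_s[OF f] Ha_s[OF g] fg
    by (intro equivariant_eqI[OF B[OF O(1)] B[OF O(2)]]) auto
  then have "Pm f = Pm g" using Pm(1-3)[OF f] Pm(1-3)[OF g] fg by - (rule faithfulD[OF H'.faithful], auto)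
  then have "sP (trg g) ** f = sP (trg g) ** g" using Pm(5)[OF f] Pm(5)[OF g] fg by simp
  then have "rP (trg g) ** (sP (trg g) ** f) = rP (trg g) ** (sP (trg g) ** g)" by simp
  moreover have "rP (trg g) ** (sP (trg g) ** w) = idn C (trg g) ** w" if "is_arr C w" "trg w = trg g" for w
    using dA[OF O(2)] that by (intro cmp_assoc_subst) auto
  ultimately show "f = g" using f g fg by simp
qed

text \<open>An arrow between the components of degree one extends to an equivariant morphism of degree one; its
  preimage under \<open>H'\<close> has degree one as well and restricts to the arrow sought.\<close>

lemma H_full: "full_functor C C H"
  unfolding full_functor_def
proof (intro ballI)
  fix X Y v assume X: "X \<in> Obj C" and Y: "Y \<in> Obj C" and v: "v \<in> arrows C (ob H X) (ob H Y)"
  have v: "v \<in> arrows C (Ho X) (Ho Y)" using v by simp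
  obtain g where g: "g \<in> arrows CG (Q X) (Q Y)"
    "homogeneous (tr (P X) (tP X)) (tr (P Y) (tP Y)) \<one>\<^bsub>G\<^esub> (U g)" "U g ** sQ X = sQ Y ** v"
    by (rule extend_component[OF B[OF X] B[OF Y] v]) blast
  obtain f where f: "is_arr CG f" "src f = P X" "trg f = P Y" "fmap H' f = g"
    using fullE[OF H'.full dA(2)[OF X] dA(2)[OF Y], of g] g(1) by auto
  have Uf: "is_arr C (U f)" "src (U f) = fst (P X)" "trg (U f) = fst (P Y)" using CG_arrD(3)[OF f(1)] f by simp_all
  have hom: "homogeneous (tP X) (tP Y) \<one>\<^bsub>G\<^esub> (U f)"
    using homogeneous_transport[OF dA(1)[OF X] dA(1)[OF Y], of f "\<one>\<^bsub>G\<^esub>"] f g(2) by simp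
  define u where "u = rP Y ** (U f ** sP X)"
  have u: "is_arr C u" "src u = X" "trg u = Y" unfolding u_def using Uf dA[OF X] dA[OF Y] by simp_all
  have "U f ** sP X = sP Y ** u" unfolding u_def using homogeneous_one_s[OF A[OF X] A[OF Y] Uf hom] .
  then have "Pm u = f" using f u by (intro Pm_eqI) auto
  then have "Ha u = v" using g f u v by (intro Ha_eqI) auto
  then show "\<exists>f\<in>arrows C X Y. fmap H f = v" using u fmap_H[OF u(1)] by (intro bexI[of _ u]) auto
qed

text \<open>Essential surjectivity: choose \<open>N\<close> with \<open>H' N \<cong> P Z\<close>, transport the grading of \<open>P Z\<close> to
  \<open>N\<close>, and split its component of degree one.\<close>

lemma H_es:
  assumes Z: "Z \<in> Obj C"
  shows "\<exists>X\<in>Obj C. (ob H X, Z) \<in> iso_rel C"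
proof -
  obtain N where N: "N \<in> Obj CG" "(ob H' N, P Z) \<in> iso_rel CG" using H'_es[OF dA(2)[OF Z]] by blast
  then obtain u where u: "is_arr CG u" "src u = ob H' N" "trg u = P Z" "iso_arr CG u" by (auto simp: iso_rel_iff)
  have Uu: "iso_arr C (U u)" using forget.fmap_iso_arr[OF u(4)] by simp
  have Uu': "is_arr C (U u)" "src (U u) = fst (ob H' N)" "trg (U u) = fst (P Z)" using iso_arr_arr[OF Uu] u by simp_all
  have U_inv: "U (ainv CG u) = ainv C (U u)" using forget.fmap_ainv[OF u(4)] by simp
  note gZ = gradedD[OF dA(1)[OF Z]] and glZ = graded_lift[OF dA(1)[OF Z]] and PZ = dA(2)[OF Z]
  \<comment> \<open>The grading of \<open>P Z\<close>, carried over to \<open>H' N\<close> along \<open>u\<close>.\<close>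
  define c where "c \<chi> = fmap (Fd \<chi>) (ainv CG u) **\<^bsub>CG\<^esub> (lift (P Z) (ob (Fd \<chi>) (P Z)) (tP Z \<chi>) **\<^bsub>CG\<^esub> u)" for \<chi>
  have c: "c \<chi> \<in> arrows CG (ob H' N) (ob (Fd \<chi>) (ob H' N))" if "\<chi> \<in> carrier Gd" for \<chi>
    using that u glZ[OF that] by (simp add: c_def)
  have Uc: "U (c \<chi>) = ainv C (U u) ** (tP Z \<chi> ** U u)" if "\<chi> \<in> carrier Gd" for \<chi>
    using that gZ(3-5)[OF that] by (simp add: c_def U_inv)
  have D_inv: "is_arr CG (ainv CG (D \<chi> N))" "src (ainv CG (D \<chi> N)) = ob (Fd \<chi>) (ob H' N)"
    "trg (ainv CG (D \<chi> N)) = ob H' (ob (Fd \<chi>) N)" if "\<chi> \<in> carrier Gd" for \<chi>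
    using D_iso[OF that N(1)] by simp_all
  \<comment> \<open>The grading of \<open>N\<close> whose transport by \<open>H'\<close> is \<open>c\<close>.\<close>
  have "\<exists>l. l \<in> arrows CG N (ob (Fd \<chi>) N) \<and> fmap H' l = ainv CG (D \<chi> N) **\<^bsub>CG\<^esub> c \<chi>" if \<chi>: "\<chi> \<in> carrier Gd" for \<chi>
  proof -
    have ar: "is_arr CG (ainv CG (D \<chi> N) **\<^bsub>CG\<^esub> c \<chi>)" using D_inv[OF \<chi>] c[OF \<chi>] by simp
    show ?thesis by (rule fullE[OF H'.full N(1) _ ar, of "ob (Fd \<chi>) N"]) (use N(1) \<chi> D_inv[OF \<chi>] c[OF \<chi>] in auto)
  qed
  then obtain l where l: "\<And>\<chi>. \<chi> \<in> carrier Gd \<Longrightarrow> l \<chi> \<in> arrows CG N (ob (Fd \<chi>) N) \<and> fmap H' (l \<chi>) = ainv CG (D \<chi> N) **\<^bsub>CG\<^esub> c \<chi>"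
    by metis
  have l': "l \<chi> \<in> arrows CG N (ob (Fd \<chi>) N)" if "\<chi> \<in> carrier Gd" for \<chi> using l[OF that] by blast
  have Dl: "D \<chi> N **\<^bsub>CG\<^esub> fmap H' (l \<chi>) = c \<chi>" if \<chi>: "\<chi> \<in> carrier Gd" for \<chi>
    using l[OF \<chi>] CG.ainv_cancel(2)[OF D_iso[OF \<chi> N(1)], of "c \<chi>"] c[OF \<chi>] by simp
  have grN: "graded N (\<lambda>\<chi>. U (l \<chi>))"
  proof (rule gradedI[OF N(1) l'])
    fix \<chi> \<psi> assume \<chi>: "\<chi> \<in> carrier Gd" and \<psi>: "\<psi> \<in> carrier Gd"
    have \<chi>\<psi>: "\<chi> \<otimes>\<^bsub>Gd\<^esub> \<psi> \<in> carrier Gd" using \<chi> \<psi> by simp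
    note lx = l'[OF \<chi>] and ly = l'[OF \<psi>] and lxy = l'[OF \<chi>\<psi>]
    let ?m = "fmap (Fd \<chi>) (l \<psi>) **\<^bsub>CG\<^esub> l \<chi>"
    have m: "?m \<in> arrows CG N (ob (Fd (\<chi> \<otimes>\<^bsub>Gd\<^esub> \<psi>)) N)" using lx ly \<chi> dual_dual[OF \<chi> \<psi> N(1)] by simp
    have "U (D (\<chi> \<otimes>\<^bsub>Gd\<^esub> \<psi>) N **\<^bsub>CG\<^esub> fmap H' ?m) = U (c \<psi>) ** U (c \<chi>)"
      using transport_mult[OF \<chi> \<psi> N(1) lx ly] Dl[OF \<chi>] Dl[OF \<psi>] by simp
    also have "\<dots> = ainv C (U u) ** (tP Z \<psi> ** (U u ** (ainv C (U u) ** (tP Z \<chi> ** U u))))"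
      unfolding Uc[OF \<chi>] Uc[OF \<psi>] using Uu' Uu gZ(3-5)[OF \<chi>] gZ(3-5)[OF \<psi>] by simp
    also have "U u ** (ainv C (U u) ** (tP Z \<chi> ** U u)) = tP Z \<chi> ** U u"
      using Uu' gZ(3-5)[OF \<chi>] by (intro ainv_cancel(2)[OF Uu]) auto
    also have "tP Z \<psi> ** (tP Z \<chi> ** U u) = tP Z (\<chi> \<otimes>\<^bsub>Gd\<^esub> \<psi>) ** U u"
      using Uu' gZ(3-5)[OF \<chi>] gZ(3-5)[OF \<psi>] gZ(7)[OF \<psi> \<chi>] S.Gd.m_comm[OF \<chi> \<psi>]
      by (intro cmp_assoc_subst) auto
    also have "ainv C (U u) ** \<dots> = U (D (\<chi> \<otimes>\<^bsub>Gd\<^esub> \<psi>) N **\<^bsub>CG\<^esub> fmap H' (l (\<chi> \<otimes>\<^bsub>Gd\<^esub> \<psi>)))"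
      using Uc[OF \<chi>\<psi>] Dl[OF \<chi>\<psi>] by simp
    finally have "D (\<chi> \<otimes>\<^bsub>Gd\<^esub> \<psi>) N **\<^bsub>CG\<^esub> fmap H' ?m = D (\<chi> \<otimes>\<^bsub>Gd\<^esub> \<psi>) N **\<^bsub>CG\<^esub> fmap H' (l (\<chi> \<otimes>\<^bsub>Gd\<^esub> \<psi>))"
      using m lxy by (intro U_eqI) auto
    then have "fmap H' ?m = fmap H' (l (\<chi> \<otimes>\<^bsub>Gd\<^esub> \<psi>))"
      using m lxy N(1) \<chi>\<psi> H'.is_arr_fmap by - (rule CG.iso_cancel_left[OF D_iso[OF \<chi>\<psi> N(1)]], auto)
    then have "?m = l (\<chi> \<otimes>\<^bsub>Gd\<^esub> \<psi>)" using m lxy by - (rule faithfulD[OF H'.faithful], auto)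
    then have "U ?m = U (l (\<chi> \<otimes>\<^bsub>Gd\<^esub> \<psi>))" by simp
    then show "U (l \<psi>) ** U (l \<chi>) = U (l (\<chi> \<otimes>\<^bsub>Gd\<^esub> \<psi>))" by simp
  next
    let ?e = "\<one>\<^bsub>Gd\<^esub>"
    have "iso_arr CG (lift (P Z) (ob (Fd ?e) (P Z)) (tP Z ?e) **\<^bsub>CG\<^esub> u)"
      using graded_iso[OF dA(1)[OF Z] S.Gd.one_closed] u by (intro CG.iso_arr_cmp) auto
    moreover have "iso_arr CG (fmap (Fd ?e) (ainv CG u))"
      using lin_functor.fmap_iso_arr[OF dual_lin_functor[OF S.Gd.one_closed] iso_arr_ainv[OF u(4)]] .
    moreover have "is_arr CG (c ?e)" using c[OF S.Gd.one_closed] by simp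
    ultimately have "iso_arr CG (c ?e)" unfolding c_def
      using u glZ[OF S.Gd.one_closed] by - (rule CG.iso_arr_cmp, auto)
    then have "iso_arr CG (fmap H' (l ?e))"
      using l[OF S.Gd.one_closed] D_iso[OF S.Gd.one_closed N(1)] c[OF S.Gd.one_closed] by simp
    then have "iso_arr CG (l ?e)" using l'[OF S.Gd.one_closed] by - (rule H'.iso_reflect, auto)
    then show "iso_arr C (U (l ?e))" using forget.fmap_iso_arr by fastforce
  qed
  define tN where "tN \<chi> = U (l \<chi>)" for \<chi>
  have grN: "graded N tN" using grN by (simp add: tN_def[abs_def])
  have trN: "tr N tN \<chi> = ainv C (U u) ** (tP Z \<chi> ** U u)" if \<chi>: "\<chi> \<in> carrier Gd" for \<chi>
  proof -
    have "lift N (ob (Fd \<chi>) N) (tN \<chi>) = l \<chi>" using l'[OF \<chi>] lift_U[of "l \<chi>"] by (simp add: tN_def)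
    then show ?thesis unfolding tr_def using Dl[OF \<chi>] Uc[OF \<chi>] by simp
  qed
  have u_hom: "homogeneous (tr N tN) (tP Z) \<one>\<^bsub>G\<^esub> (U u)"
    unfolding homogeneous_def
  proof
    fix \<chi> assume \<chi>: "\<chi> \<in> carrier Gd"
    have "U u ** tr N tN \<chi> = tP Z \<chi> ** U u"
      unfolding trN[OF \<chi>] using Uu' gZ(3-5)[OF \<chi>] by (intro ainv_cancel(2)[OF Uu]) auto
    then show "tP Z \<chi> ** U u = scl C (\<chi> \<one>\<^bsub>G\<^esub>) (U u ** tr N tN \<chi>)" using \<chi> Uu' gZ(3-5)[OF \<chi>] by simp
  qed
  obtain X r s where X: "graded_at N tN X r s" using graded_split[OF grN] by blast
  note dX = graded_atD[OF X]
  obtain f where f: "f \<in> arrows CG (P X) N" "homogeneous (tP X) tN \<one>\<^bsub>G\<^esub> (U f)" "iso_arr CG f"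
    by (rule extend_component[OF A[OF dX(4)] X, of "idn C X"]) (use dX(4) in auto)
  have ff: "is_arr CG (fmap H' f)" "src (fmap H' f) = Q X" "trg (fmap H' f) = ob H' N" "iso_arr CG (fmap H' f)"
    using f(1) H'.fmap_iso_arr[OF f(3)] by auto
  have Uff: "is_arr C (U (fmap H' f))" "src (U (fmap H' f)) = fst (Q X)" "trg (U (fmap H' f)) = fst (ob H' N)"
    using CG_arrD(3)[OF ff(1)] ff by simp_all
  have iff: "iso_arr C (U (fmap H' f))" using forget.fmap_iso_arr[OF ff(4)] by simp
  have f_hom: "homogeneous (tr (P X) (tP X)) (tr N tN) \<one>\<^bsub>G\<^esub> (U (fmap H' f))"
    using homogeneous_transport[OF dA(1)[OF dX(4)] grN f(1) G.one_closed] f(2) by simp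
  have "homogeneous (tr (P X) (tP X)) (tP Z) (\<one>\<^bsub>G\<^esub> \<star> \<one>\<^bsub>G\<^esub>) (U u ** U (fmap H' f))"
    by (rule homogeneous_cmp[OF dB(1)[OF dX(4)] graded_transport[OF grN] dA(1)[OF Z] _ _ _ _ f_hom u_hom])
      (use Uff Uu' in auto)
  then have hom: "homogeneous (tr (P X) (tP X)) (tP Z) \<one>\<^bsub>G\<^esub> (U u ** U (fmap H' f))" by simp
  have cmp_iso: "iso_arr C (pr (P Z) (rP Z) \<one>\<^bsub>G\<^esub> ** ((U u ** U (fmap H' f)) ** sQ X))"
    by (rule component_iso[OF B[OF dX(4)] A[OF Z] _ _ _ hom]) (use Uff Uu' iff Uu in auto)
  have "(Ho X, ob (F \<one>\<^bsub>G\<^esub>) Z) \<in> iso_rel C"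
    by (rule iso_relI[OF cmp_iso]) (use dB[OF dX(4)] pr_arr[OF A[OF Z], of "\<one>\<^bsub>G\<^esub>"] Uff Uu' in auto)
  then have "(Ho X, Z) \<in> iso_rel C" using iso_rel_sym[OF unit_iso[OF Z]] iso_rel_trans by blast
  then show ?thesis using dX(4) by auto
qed

lemma H_autoequivalence: "autoequivalence K C H"
  by (rule autoequivalenceI[OF H_linear H_faithful H_full H_es])

text \<open>The morphism \<open>P (F\<^sub>g X) \<rightarrow> P X\<close> of degree \<open>g\<close> that identifies \<open>F\<^sub>h F\<^sub>g X\<close> with
  \<open>F\<^sub>h\<^sub>g X\<close>.\<close>

definition Dm :: "'g \<Rightarrow> 'o \<Rightarrow> ('o \<times> ('g \<Rightarrow> 'm), 'm) arr"
  where "Dm g X = assemble (P (ob (F g) X)) (rP (ob (F g) X)) (P X) (sP X) g (\<lambda>h. E h g X)"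

lemma Dm:
  assumes g: "g \<in> carrier G" and X: "X \<in> Obj C"
  shows "is_arr CG (Dm g X)" "src (Dm g X) = P (ob (F g) X)" "trg (Dm g X) = P X"
    "homogeneous (tP (ob (F g) X)) (tP X) g (U (Dm g X))" "iso_arr CG (Dm g X)"
    "\<And>h. h \<in> carrier G \<Longrightarrow> U (Dm g X) ** ic (P (ob (F g) X)) (sP (ob (F g) X)) h =
      ic (P X) (sP X) (h \<star> g) ** E h g X"
proof -
  have FX: "ob (F g) X \<in> Obj C" using g X by simp
  have w: "E h g X \<in> arrows C (ob (F h) (ob (F g) X)) (ob (F (h \<star> g)) X)" if "h \<in> carrier G" for h
    using that g X by simp
  have compat: "E h (k \<star> g) X ** fmap (F h) (E k g X) = E (h \<star> k) g X ** E h k (ob (F g) X)"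
    if "h \<in> carrier G" "k \<in> carrier G" for h k
    using E_assoc[OF that g X] by simp
  note as = assemble[where w = "\<lambda>h. E h g X", OF A[OF FX] A[OF X] g, folded Dm_def]
  have "Dm g X \<in> arrows CG (P (ob (F g) X)) (P X)" by (rule as(1)) (use w compat in auto)
  then show "is_arr CG (Dm g X)" "src (Dm g X) = P (ob (F g) X)" "trg (Dm g X) = P X" by simp_all
  show "homogeneous (tP (ob (F g) X)) (tP X) g (U (Dm g X))" by (rule as(2)) (use w compat in auto)
  show "iso_arr CG (Dm g X)" by (rule as(4)) (use w compat g X in auto)
  show "U (Dm g X) ** ic (P (ob (F g) X)) (sP (ob (F g) X)) h = ic (P X) (sP X) (h \<star> g) ** E h g X"
    if "h \<in> carrier G" for h by (rule as(3)) (use w compat that in auto)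
qed

lemma U_Dm:
  assumes g: "g \<in> carrier G" and X: "X \<in> Obj C"
  shows "is_arr C (U (Dm g X))" "src (U (Dm g X)) = fst (P (ob (F g) X))" "trg (U (Dm g X)) = fst (P X)"
  using Dm(1-3)[OF assms] CG_arrD(3) by simp_all

lemma Pm_ic:
  assumes u: "is_arr C u" and h: "h \<in> carrier G"
  shows "U (Pm u) ** ic (P (src u)) (sP (src u)) h = ic (P (trg u)) (sP (trg u)) h ** fmap (F h) u"
proof -
  note O = is_arr_Obj[OF u]
  note d = dA[OF O(2)]
  have "U (Pm u) ** ic (P (src u)) (sP (src u)) h = ainv C (st (P (trg u)) h) ** fmap (F h) (sP (trg u) ** u)"
    using equivariant_ic[OF A[OF O(1)] A[OF O(2)] _ h, of "Pm u"] Pm[OF u] by simp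
  then show ?thesis unfolding ic_def using d(1-10) d(13)[OF h] u h by (simp add: F_cmp)
qed

lemma P_eqI:
  assumes X: "X \<in> Obj C" and f: "f \<in> arrows CG (P X) M" and f': "f' \<in> arrows CG (P X) M"
    and eq: "\<And>h. h \<in> carrier G \<Longrightarrow> U f ** ic (P X) (sP X) h = U f' ** ic (P X) (sP X) h"
  shows "f = f'"
proof -
  have ff: "is_arr CG f" "is_arr CG f'" "src f = P X" "src f' = P X" "trg f = M" "trg f' = M" using f f' by auto
  have "U f = U f'"
    by (rule biprod_eqI_right[OF graded_biprod[OF A[OF X]]])
      (use ff CG_arrD(3)[OF ff(1)] CG_arrD(3)[OF ff(2)] eq in simp_all)
  then show ?thesis using f f' by (intro U_eqI) auto
qed

text \<open>Both sides agree on all components, where the equation is the naturality of \<open>\<epsilon>\<^sub>h\<^sub>,\<^sub>g\<close>.\<close>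

lemma Dm_natural:
  assumes g: "g \<in> carrier G" and u: "is_arr C u"
  shows "Dm g (trg u) **\<^bsub>CG\<^esub> Pm (fmap (F g) u) = Pm u **\<^bsub>CG\<^esub> Dm g (src u)"
proof (rule P_eqI)
  note O = is_arr_Obj[OF u]
  let ?X = "src u" and ?Y = "trg u"
  have gu: "is_arr C (fmap (F g) u)" using g u by simp
  have FX: "ob (F g) ?X \<in> Obj C" "ob (F g) ?Y \<in> Obj C" using g O by simp_all
  show "ob (F g) ?X \<in> Obj C" by (rule FX)
  show "Dm g ?Y **\<^bsub>CG\<^esub> Pm (fmap (F g) u) \<in> arrows CG (P (ob (F g) ?X)) (P ?Y)"
    "Pm u **\<^bsub>CG\<^esub> Dm g ?X \<in> arrows CG (P (ob (F g) ?X)) (P ?Y)"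
    using Dm(1-3)[OF g O(1)] Dm(1-3)[OF g O(2)] Pm(1-3)[OF gu] Pm(1-3)[OF u] by simp_all
  fix h assume h: "h \<in> carrier G"
  have hg: "h \<star> g \<in> carrier G" using g h by simp
  let ?i = "\<lambda>X. ic (P X) (sP X)"
  have i: "is_arr C (?i X k)" "src (?i X k) = ob (F k) X" "trg (?i X k) = fst (P X)"
    if "X \<in> Obj C" "k \<in> carrier G" for X k
    using ic_arr[OF A[OF that(1)], of k] that(2) by simp_all
  note ar = U_Dm[OF g O(1)] U_Dm[OF g O(2)] U_Pm[OF gu] U_Pm[OF u] i[OF FX(1) h] i[OF FX(2) h] i[OF O(1) hg] i[OF O(2) hg]
  have "U (Dm g ?Y **\<^bsub>CG\<^esub> Pm (fmap (F g) u)) ** ?i (ob (F g) ?X) h =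
      U (Dm g ?Y) ** (U (Pm (fmap (F g) u)) ** ?i (ob (F g) ?X) h)"
    using ar by simp
  also have "\<dots> = (U (Dm g ?Y) ** ?i (ob (F g) ?Y) h) ** fmap (F h) (fmap (F g) u)"
    using Pm_ic[OF gu h] ar g h u by simp
  also have "\<dots> = ?i ?Y (h \<star> g) ** (E h g ?Y ** fmap (F h) (fmap (F g) u))"
    unfolding Dm(6)[OF g O(2) h] using ar g h u O by simp
  also have "\<dots> = (?i ?Y (h \<star> g) ** fmap (F (h \<star> g)) u) ** E h g ?X"
    unfolding E_natural[OF h g u] using ar g h hg u O by simp
  also have "\<dots> = U (Pm u) ** (?i ?X (h \<star> g) ** E h g ?X)"
    unfolding Pm_ic[OF u hg, symmetric] using ar g h hg u O by simp
  also have "\<dots> = U (Pm u **\<^bsub>CG\<^esub> Dm g ?X) ** ?i (ob (F g) ?X) h"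
    unfolding Dm(6)[OF g O(1) h, symmetric] using ar by simp
  finally show "U (Dm g ?Y **\<^bsub>CG\<^esub> Pm (fmap (F g) u)) ** ?i (ob (F g) ?X) h =
      U (Pm u **\<^bsub>CG\<^esub> Dm g ?X) ** ?i (ob (F g) ?X) h" .
qed

text \<open>On the components this is the associativity condition for \<open>\<epsilon>\<close>.\<close>

lemma Dm_coherent:
  assumes g: "g \<in> carrier G" and h: "h \<in> carrier G" and X: "X \<in> Obj C"
  shows "Dm (g \<star> h) X **\<^bsub>CG\<^esub> Pm (E g h X) = Dm h X **\<^bsub>CG\<^esub> Dm g (ob (F h) X)"
proof (rule P_eqI)
  have gh: "g \<star> h \<in> carrier G" using g h by simp
  let ?hX = "ob (F h) X" and ?ghX = "ob (F (g \<star> h)) X" and ?g_hX = "ob (F g) (ob (F h) X)"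
  have O: "?hX \<in> Obj C" "?ghX \<in> Obj C" "?g_hX \<in> Obj C" using g h gh X by simp_all
  have Ea: "is_arr C (E g h X)" using g h X by simp
  show "?g_hX \<in> Obj C" by (rule O)
  show "Dm (g \<star> h) X **\<^bsub>CG\<^esub> Pm (E g h X) \<in> arrows CG (P ?g_hX) (P X)"
    "Dm h X **\<^bsub>CG\<^esub> Dm g ?hX \<in> arrows CG (P ?g_hX) (P X)"
    using Dm(1-3)[OF gh X] Dm(1-3)[OF h X] Dm(1-3)[OF g O(1)] Pm(1-3)[OF Ea] by simp_all
  fix k assume k: "k \<in> carrier G"
  have kg: "k \<star> g \<in> carrier G" "k \<star> g \<star> h \<in> carrier G" "k \<star> (g \<star> h) = k \<star> g \<star> h"
    using g h k by (simp_all add: G.m_assoc)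
  let ?i = "\<lambda>X. ic (P X) (sP X)"
  have i: "is_arr C (?i Y l)" "src (?i Y l) = ob (F l) Y" "trg (?i Y l) = fst (P Y)"
    if "Y \<in> Obj C" "l \<in> carrier G" for Y l
    using ic_arr[OF A[OF that(1)], of l] that(2) by simp_all
  note ar = U_Dm[OF gh X] U_Dm[OF h X] U_Dm[OF g O(1)] U_Pm[OF Ea]
    i[OF O(3) k] i[OF O(2) k] i[OF O(1) kg(1)] i[OF X kg(2)]
  have kE: "is_arr C (E k (g \<star> h) X)" "trg (E k (g \<star> h) X) = ob (F (k \<star> g \<star> h)) X"
    using k gh X kg(3) by simp_all
  have "U (Dm (g \<star> h) X **\<^bsub>CG\<^esub> Pm (E g h X)) ** ?i ?g_hX k =
      U (Dm (g \<star> h) X) ** (U (Pm (E g h X)) ** ?i ?g_hX k)"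
    using ar by simp
  also have "\<dots> = (U (Dm (g \<star> h) X) ** ?i ?ghX k) ** fmap (F k) (E g h X)"
    using Pm_ic[OF Ea k] ar k Ea by simp
  also have "\<dots> = ?i X (k \<star> g \<star> h) ** (E k (g \<star> h) X ** fmap (F k) (E g h X))"
    unfolding Dm(6)[OF gh X k] kg(3) using ar k Ea kE by simp
  also have "E k (g \<star> h) X ** fmap (F k) (E g h X) = E (k \<star> g) h X ** E k g ?hX"
    using E_assoc[OF k g h X] by simp
  also have "?i X (k \<star> g \<star> h) ** (E (k \<star> g) h X ** E k g ?hX) =
      (U (Dm h X) ** ?i ?hX (k \<star> g)) ** E k g ?hX"
    unfolding Dm(6)[OF h X kg(1)] using ar k g h kg X by simp
  also have "\<dots> = U (Dm h X) ** (U (Dm g ?hX) ** ?i ?g_hX k)"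
    unfolding Dm(6)[OF g O(1) k] using ar k g h X by simp
  also have "\<dots> = U (Dm h X **\<^bsub>CG\<^esub> Dm g ?hX) ** ?i ?g_hX k" using ar by simp
  finally show "U (Dm (g \<star> h) X **\<^bsub>CG\<^esub> Pm (E g h X)) ** ?i ?g_hX k =
      U (Dm h X **\<^bsub>CG\<^esub> Dm g ?hX) ** ?i ?g_hX k" .
qed

text \<open>The equivariance of the descended functor is the component of degree \<open>g\<close> of \<open>H' (P (F\<^sub>g X)) \<rightarrow> H' (P X)\<close>.\<close>

definition dl :: "'g \<Rightarrow> 'o \<Rightarrow> ('o, 'm) arr"
  where "dl g X = pr (Q X) (rQ X) g ** (U (fmap H' (Dm g X)) ** sQ (ob (F g) X))"

lemma UHD:
  assumes g: "g \<in> carrier G" and X: "X \<in> Obj C"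
  shows "fmap H' (Dm g X) \<in> arrows CG (Q (ob (F g) X)) (Q X)"
    "is_arr C (U (fmap H' (Dm g X)))" "src (U (fmap H' (Dm g X))) = fst (Q (ob (F g) X))"
    "trg (U (fmap H' (Dm g X))) = fst (Q X)" "iso_arr C (U (fmap H' (Dm g X)))"
    "homogeneous (tr (P (ob (F g) X)) (tP (ob (F g) X))) (tr (P X) (tP X)) g (U (fmap H' (Dm g X)))"
proof -
  have FX: "ob (F g) X \<in> Obj C" using g X by simp
  note d = Dm[OF g X]
  show h: "fmap H' (Dm g X) \<in> arrows CG (Q (ob (F g) X)) (Q X)" using d by simp
  then show "is_arr C (U (fmap H' (Dm g X)))" "src (U (fmap H' (Dm g X))) = fst (Q (ob (F g) X))"
    "trg (U (fmap H' (Dm g X))) = fst (Q X)" using CG_arrD(3)[of "fmap H' (Dm g X)"] by simp_all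
  show "iso_arr C (U (fmap H' (Dm g X)))" using forget.fmap_iso_arr[OF H'.fmap_iso_arr[OF d(5)]] by simp
  show "homogeneous (tr (P (ob (F g) X)) (tP (ob (F g) X))) (tr (P X) (tP X)) g (U (fmap H' (Dm g X)))"
    using homogeneous_transport[OF dA(1)[OF FX] dA(1)[OF X], of "Dm g X" g] d g by simp
qed

lemma dl_arr:
  assumes g: "g \<in> carrier G" and X: "X \<in> Obj C"
  shows "iso_arr C (dl g X)" "src (dl g X) = Ho (ob (F g) X)" "trg (dl g X) = ob (F g) (Ho X)"
proof -
  have FX: "ob (F g) X \<in> Obj C" using g X by simp
  show "src (dl g X) = Ho (ob (F g) X)" "trg (dl g X) = ob (F g) (Ho X)"
    using dB(9)[OF FX] pr_arr(3)[OF B[OF X]] by (simp_all add: dl_def)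
  show "iso_arr C (dl g X)"
    unfolding dl_def using UHD[OF g X] g
    by (intro component_iso[OF B[OF FX] B[OF X] _ _ g UHD(6)[OF g X]]) auto
qed

lemma dl_natural:
  assumes g: "g \<in> carrier G" and u: "is_arr C u"
  shows "dl g (trg u) ** Ha (fmap (F g) u) = fmap (F g) (Ha u) ** dl g (src u)"
proof -
  note O = is_arr_Obj[OF u]
  let ?X = "src u" and ?Y = "trg u"
  have gu: "is_arr C (fmap (F g) u)" using g u by simp
  have FX: "ob (F g) ?X \<in> Obj C" "ob (F g) ?Y \<in> Obj C" using g O by simp_all
  note pY = pr_arr(1)[OF B[OF O(2)] g] pr_arr(2,3)[OF B[OF O(2)], of g]
    and pX = pr_arr(1)[OF B[OF O(1)] g] pr_arr(2,3)[OF B[OF O(1)], of g]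
  note ar = UHD(2-4)[OF g O(1)] UHD(2-4)[OF g O(2)] UH(4-6)[OF u] UH(4-6)[OF gu] dB(8-10)[OF FX(1)] dB(8-10)[OF FX(2)]
    Ha_arr[OF u] Ha_arr[OF gu] pX pY
  have nat: "U (fmap H' (Dm g ?Y)) ** U (fmap H' (Pm (fmap (F g) u))) = U (fmap H' (Pm u)) ** U (fmap H' (Dm g ?X))"
  proof -
    have "fmap H' (Dm g ?Y **\<^bsub>CG\<^esub> Pm (fmap (F g) u)) = fmap H' (Pm u **\<^bsub>CG\<^esub> Dm g ?X)"
      unfolding Dm_natural[OF g u] ..
    then have "fmap H' (Dm g ?Y) **\<^bsub>CG\<^esub> fmap H' (Pm (fmap (F g) u)) = fmap H' (Pm u) **\<^bsub>CG\<^esub> fmap H' (Dm g ?X)"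
      using Dm(1-3)[OF g O(1)] Dm(1-3)[OF g O(2)] Pm(1-3)[OF u] Pm(1-3)[OF gu] by (simp add: H'.fmap_cmp)
    then show ?thesis by (metis U_cmp)
  qed
  have pu: "pr (Q ?Y) (rQ ?Y) g ** U (fmap H' (Pm u)) = fmap (F g) (Ha u) ** pr (Q ?X) (rQ ?X) g"
  proof -
    note eq = CG_arrD(4)[OF UH(1)[OF u] g]
    have "pr (Q ?Y) (rQ ?Y) g ** U (fmap H' (Pm u)) = fmap (F g) (rQ ?Y) ** (st (Q ?Y) g ** U (fmap H' (Pm u)))"
      unfolding pr_def using UH(4-6)[OF u] dB(1-10)[OF O(2)] dB(14)[OF O(2) g] g by simp
    also have "st (Q ?Y) g ** U (fmap H' (Pm u)) = fmap (F g) (U (fmap H' (Pm u))) ** st (Q ?X) g"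
      using eq UH(2,3)[OF u] by simp
    also have "fmap (F g) (rQ ?Y) ** (fmap (F g) (U (fmap H' (Pm u))) ** st (Q ?X) g) =
        fmap (F g) (rQ ?Y ** U (fmap H' (Pm u))) ** st (Q ?X) g"
      using UH(4-6)[OF u] dB(1-10)[OF O(1)] dB(14)[OF O(1) g] dB(1-10)[OF O(2)] g by (simp add: F_cmp)
    also have "\<dots> = fmap (F g) (Ha u) ** pr (Q ?X) (rQ ?X) g"
      unfolding r_Ha[OF u] pr_def using Ha_arr[OF u] dB(1-10)[OF O(1)] dB(14)[OF O(1) g] g by (simp add: F_cmp)
    finally show ?thesis .
  qed
  have "dl g ?Y ** Ha (fmap (F g) u) =
      pr (Q ?Y) (rQ ?Y) g ** (U (fmap H' (Dm g ?Y)) ** (sQ (ob (F g) ?Y) ** Ha (fmap (F g) u)))"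
    unfolding dl_def using ar by simp
  also have "sQ (ob (F g) ?Y) ** Ha (fmap (F g) u) = U (fmap H' (Pm (fmap (F g) u))) ** sQ (ob (F g) ?X)"
    using Ha_s[OF gu] by simp
  also have "U (fmap H' (Dm g ?Y)) ** (U (fmap H' (Pm (fmap (F g) u))) ** sQ (ob (F g) ?X)) =
      (U (fmap H' (Pm u)) ** U (fmap H' (Dm g ?X))) ** sQ (ob (F g) ?X)"
    using ar by (intro cmp_assoc_subst[OF nat]) auto
  also have "pr (Q ?Y) (rQ ?Y) g ** \<dots> = (pr (Q ?Y) (rQ ?Y) g ** U (fmap H' (Pm u))) ** (U (fmap H' (Dm g ?X)) ** sQ (ob (F g) ?X))"
    using ar by simp
  also have "\<dots> = fmap (F g) (Ha u) ** dl g ?X"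
    unfolding pu dl_def using ar g by simp
  finally show ?thesis .
qed

lemma dl_coherent:
  assumes g: "g \<in> carrier G" and h: "h \<in> carrier G" and X: "X \<in> Obj C"
  shows "dl (g \<star> h) X ** Ha (E g h X) = E g h (Ho X) ** (fmap (F g) (dl h X) ** dl g (ob (F h) X))"
proof -
  have gh: "g \<star> h \<in> carrier G" using g h by simp
  let ?hX = "ob (F h) X" and ?ghX = "ob (F (g \<star> h)) X" and ?g_hX = "ob (F g) (ob (F h) X)"
  have O: "?hX \<in> Obj C" "?ghX \<in> Obj C" "?g_hX \<in> Obj C" using g h gh X by simp_all
  have Ea: "is_arr C (E g h X)" using g h X by simp
  note ar = UHD(2-4)[OF gh X] UHD(2-4)[OF h X] UHD(2-4)[OF g O(1)] UH(4-6)[OF Ea] dB(8-10)[OF O(2)] dB(8-10)[OF O(3)]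
    Ha_arr[OF Ea] pr_arr(1)[OF B[OF X] gh] pr_arr(2,3)[OF B[OF X], of "g \<star> h"]
  have coh: "U (fmap H' (Dm (g \<star> h) X)) ** U (fmap H' (Pm (E g h X))) =
      U (fmap H' (Dm h X)) ** U (fmap H' (Dm g ?hX))"
  proof -
    have "fmap H' (Dm (g \<star> h) X **\<^bsub>CG\<^esub> Pm (E g h X)) = fmap H' (Dm h X **\<^bsub>CG\<^esub> Dm g ?hX)"
      unfolding Dm_coherent[OF g h X] ..
    then have "fmap H' (Dm (g \<star> h) X) **\<^bsub>CG\<^esub> fmap H' (Pm (E g h X)) = fmap H' (Dm h X) **\<^bsub>CG\<^esub> fmap H' (Dm g ?hX)"
      using Dm(1-3)[OF gh X] Dm(1-3)[OF h X] Dm(1-3)[OF g O(1)] Pm(1-3)[OF Ea] by (simp add: H'.fmap_cmp)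
    then show ?thesis by (metis U_cmp)
  qed
  have "dl (g \<star> h) X ** Ha (E g h X) =
      pr (Q X) (rQ X) (g \<star> h) ** (U (fmap H' (Dm (g \<star> h) X)) ** (sQ ?ghX ** Ha (E g h X)))"
    unfolding dl_def using ar by simp
  also have "sQ ?ghX ** Ha (E g h X) = U (fmap H' (Pm (E g h X))) ** sQ ?g_hX" using Ha_s[OF Ea] by simp
  also have "U (fmap H' (Dm (g \<star> h) X)) ** (U (fmap H' (Pm (E g h X))) ** sQ ?g_hX) =
      (U (fmap H' (Dm h X)) ** U (fmap H' (Dm g ?hX))) ** sQ ?g_hX"
    using ar by (intro cmp_assoc_subst[OF coh]) auto
  also have "\<dots> = U (fmap H' (Dm h X)) ** (U (fmap H' (Dm g ?hX)) ** sQ ?g_hX)" using ar by simp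
  also have "pr (Q X) (rQ X) (g \<star> h) ** \<dots> = E g h (Ho X) ** (fmap (F g) (dl h X) ** dl g ?hX)"
    unfolding dl_def
    by (rule component_cmp[OF B[OF O(3)] B[OF O(1)] B[OF X] UHD(1)[OF g O(1)] UHD(1)[OF h X] g h UHD(6)[OF g O(1)]])
  finally show ?thesis .
qed

lemma descent_equivariant:
  "(H, \<lambda>g X. mph (dl g X)) \<in> equivariant_autoequivalences K C G F \<epsilon>"
  unfolding equivariant_autoequivalences_iff
proof (intro conjI ballI H_autoequivalence)
  have tag: "Arr (Ho (ob (F g) X)) (mph (dl g X)) (ob (F g) (Ho X)) = dl g X" if "g \<in> carrier G" "X \<in> Obj C" for g X
    using dl_arr(2,3)[OF that] by (intro arr_eqI) simp_all
  fix g assume g: "g \<in> carrier G"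
  have lins: "linear_functor K C C (H \<circ>\<^sub>F F g)" "linear_functor K C C (F g \<circ>\<^sub>F H)"
    using linear_functor_comp[OF F_linear[OF g] H_linear] linear_functor_comp[OF H_linear F_linear[OF g]] .
  show "natural_iso C C (H \<circ>\<^sub>F F g) (F g \<circ>\<^sub>F H) (\<lambda>X. mph (dl g X))"
    unfolding natural_iso_iff[OF lins]
    using tag[OF g] dl_arr(1)[OF g] dl_natural[OF g] fmap_H g by simp
  fix h X assume h: "h \<in> carrier G" and X: "X \<in> Obj C"
  have gh: "g \<star> h \<in> carrier G" and FX: "ob (F h) X \<in> Obj C" using g h X by simp_all
  have E1: "Arr (ob (F g) (ob (F h) Y)) (\<epsilon> g h Y) (ob (F (g \<star> h)) Y) = E g h Y" for Y by (simp add: E_def)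
  show "Arr (ob H (ob (F (g \<star> h)) X)) (mph (dl (g \<star> h) X)) (ob (F (g \<star> h)) (ob H X)) **
        fmap H (Arr (ob (F g) (ob (F h) X)) (\<epsilon> g h X) (ob (F (g \<star> h)) X)) =
      Arr (ob (F g) (ob (F h) (ob H X))) (\<epsilon> g h (ob H X)) (ob (F (g \<star> h)) (ob H X)) **
        (fmap (F g) (Arr (ob H (ob (F h) X)) (mph (dl h X)) (ob (F h) (ob H X))) **
          Arr (ob H (ob (F g) (ob (F h) X))) (mph (dl g (ob (F h) X))) (ob (F g) (ob H (ob (F h) X))))"
    unfolding ob_mk_functor E1 tag[OF gh X] tag[OF h X] tag[OF g FX]
    using dl_coherent[OF g h X] fmap_H[of "E g h X"] g h X by simp
qed

lemma descent_Ind: "X \<in> Obj C \<Longrightarrow> (ob H' (IndC X), IndC (ob H X)) \<in> iso_rel CG"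
proof -
  assume X: "X \<in> Obj C"
  have HX: "Ho X \<in> Obj C" using dB(4)[OF X] .
  show ?thesis using graded_at_iso[OF B[OF X] A[OF HX] iso_rel_refl[OF HX]] by simp
qed

end

section \<open>Orbits of equivariant autoequivalences\<close>

lemma linear_functor_Obj: "linear_functor K C D F \<Longrightarrow> X \<in> Obj C \<Longrightarrow> ob F X \<in> Obj D"
  by (simp add: linear_functor_def)

context linear_category
begin

lemma equivariant_autoequivalence_iso:
  assumes ea: "(H, \<delta>) \<in> equivariant_autoequivalences K C G F \<epsilon>" and g: "g \<in> carrier G"
    and F: "linear_functor K C C (F g)" and X: "X \<in> Obj C"
  shows "(ob H (ob (F g) X), ob (F g) (ob H X)) \<in> iso_rel C"
proof -
  have "natural_iso C C (H \<circ>\<^sub>F F g) (F g \<circ>\<^sub>F H) (\<delta> g)" and H: "linear_functor K C C H"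
    using ea g by (auto simp: equivariant_autoequivalences_def autoequivalence_def)
  then have "\<delta> g X \<in> isos C (ob H (ob (F g) X)) (ob (F g) (ob H X))"
    using X by (simp add: natural_iso_def comp_functor_def)
  moreover have "ob H (ob (F g) X) \<in> Obj C" "ob (F g) (ob H X) \<in> Obj C"
    using linear_functor_Obj F H X by metis+
  ultimately show ?thesis by (auto simp: iso_rel_def)
qed

text \<open>Reflexivity is what places a pair in its own class in the automorphism group; the identities are
  the natural isomorphism.\<close>

lemma equivariant_iso_rel_refl:
  assumes ea: "(H, \<delta>) \<in> equivariant_autoequivalences K C G F \<epsilon>"
    and F: "\<And>g. g \<in> carrier G \<Longrightarrow> linear_functor K C C (F g)"
  shows "((H, \<delta>), (H, \<delta>)) \<in> equivariant_iso_rel K C G F \<epsilon>"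
proof -
  have H: "linear_functor K C C H" using ea by (auto simp: equivariant_autoequivalences_def autoequivalence_def)
  note HX = linear_functor_Obj[OF H]
  have Hf: "ar H X Y f \<in> mor C (ob H X) (ob H Y)" if "X \<in> Obj C" "Y \<in> Obj C" "f \<in> mor C X Y" for X Y f
    using H that unfolding linear_functor_def by blast
  have "inverse_morphisms C X X (Ident C X) (Ident C X)" if "X \<in> Obj C" for X
    using that by (simp add: inverse_morphisms_def Ident_closed Comp_Ident_left)
  then have nat: "natural_iso C C H H (\<lambda>X. Ident C (ob H X))"
    unfolding natural_iso_def isos_def
    using HX Comp_Ident_left[OF HX HX Hf] Comp_Ident_right[OF HX HX Hf] by auto
  have "ar (F g) (ob H X) (ob H X) (Ident C (ob H X)) \<cdot> \<delta> g X = \<delta> g X \<cdot> Ident C (ob H (ob (F g) X))"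
    if g: "g \<in> carrier G" and X: "X \<in> Obj C" for g X
  proof -
    have "natural_iso C C (H \<circ>\<^sub>F F g) (F g \<circ>\<^sub>F H) (\<delta> g)"
      using ea g by (auto simp: equivariant_autoequivalences_def)
    then have d: "\<delta> g X \<in> mor C (ob H (ob (F g) X)) (ob (F g) (ob H X))"
      using X by (auto simp: natural_iso_def comp_functor_def isos_def inverse_morphisms_def)
    have "ar (F g) (ob H X) (ob H X) (Ident C (ob H X)) = Ident C (ob (F g) (ob H X))"
      and "ob (F g) X \<in> Obj C" "ob (F g) (ob H X) \<in> Obj C"
      using F[OF g] HX[OF X] X unfolding linear_functor_def by blast+
    then show ?thesis using d HX by (simp add: Comp_Ident_left[OF _ _ d] Comp_Ident_right[OF _ _ d])
  qed
  then show ?thesis using ea nat by (auto simp: equivariant_iso_rel_def)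
qed

text \<open>The members of a class are naturally isomorphic functors, so they agree on isomorphism classes.\<close>

lemma Aut_act_class:
  assumes ea: "(H, \<delta>) \<in> equivariant_autoequivalences K C G F \<epsilon>"
    and F: "\<And>g. g \<in> carrier G \<Longrightarrow> linear_functor K C C (F g)" and M: "M \<in> Obj C"
  shows "Aut_act C (equivariant_iso_rel K C G F \<epsilon> `` {(H, \<delta>)}) (iso_rel C `` {M}) = iso_rel C `` {ob H M}"
proof (intro equalityI subsetI)
  interpret H: lin_functor K C C H
    using ea by unfold_locales (auto simp: equivariant_autoequivalences_def autoequivalence_def)
  fix N assume "N \<in> Aut_act C (equivariant_iso_rel K C G F \<epsilon> `` {(H, \<delta>)}) (iso_rel C `` {M})"
  then obtain H' \<delta>' M' where H': "((H, \<delta>), (H', \<delta>')) \<in> equivariant_iso_rel K C G F \<epsilon>"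
    and M': "(M, M') \<in> iso_rel C" and N: "(ob H' M', N) \<in> iso_rel C"
    by (auto simp: Aut_act_def)
  have M'_Obj: "M' \<in> Obj C" using M' by (simp add: iso_rel_def)
  obtain \<phi> where "natural_iso C C H H' \<phi>" using H' by (auto simp: equivariant_iso_rel_def)
  then have "\<phi> M' \<in> isos C (ob H M') (ob H' M')" using M'_Obj by (simp add: natural_iso_def)
  then have "(ob H M', ob H' M') \<in> iso_rel C" using H.ob_Obj[OF M'_Obj] N by (auto simp: iso_rel_def)
  then show "N \<in> iso_rel C `` {ob H M}"
    using H.ob_iso_rel[OF M'] N iso_rel_trans by blast
next
  fix N assume "N \<in> iso_rel C `` {ob H M}"
  then show "N \<in> Aut_act C (equivariant_iso_rel K C G F \<epsilon> `` {(H, \<delta>)}) (iso_rel C `` {M})"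
    using equivariant_iso_rel_refl[OF ea F] iso_rel_refl[OF M] unfolding Aut_act_def by blast
qed

lemma orbit_class:
  assumes F: "\<And>g. g \<in> carrier G \<Longrightarrow> linear_functor K C C (F g)" and M: "M \<in> Obj C"
  shows "orbit (equivariant_Aut K C G F \<epsilon>) (Aut_act C) (iso_rel C `` {M}) =
    (\<lambda>(H, \<delta>). iso_rel C `` {ob H M}) ` equivariant_autoequivalences K C G F \<epsilon>"
proof -
  have "orbit (equivariant_Aut K C G F \<epsilon>) (Aut_act C) (iso_rel C `` {M}) =
      (\<lambda>A. Aut_act C A (iso_rel C `` {M})) ` ((\<lambda>a. equivariant_iso_rel K C G F \<epsilon> `` {a}) ` equivariant_autoequivalences K C G F \<epsilon>)"
    by (auto simp: orbit_def equivariant_Aut_def quotient_def)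
  also have "\<dots> = (\<lambda>(H, \<delta>). iso_rel C `` {ob H M}) ` equivariant_autoequivalences K C G F \<epsilon>"
    unfolding image_image
  proof (intro image_cong refl)
    fix a assume "a \<in> equivariant_autoequivalences K C G F \<epsilon>"
    then show "Aut_act C (equivariant_iso_rel K C G F \<epsilon> `` {a}) (iso_rel C `` {M}) =
        (case a of (H, \<delta>) \<Rightarrow> iso_rel C `` {ob H M})"
      using Aut_act_class[where F = F, OF _ F M] by (cases a) simp
  qed
  finally show ?thesis .
qed

end

section \<open>The bijection on stable basic objects and on orbits\<close>

context dual_setting
begin

lemma Ind_Obj: "X \<in> Obj C \<Longrightarrow> IndC X \<in> Obj CG"
  using Ind_graded graded_atD(2) by metis

lemma Ind_generated: "X \<preceq> Y \<Longrightarrow> CG.generated (IndC X) (IndC Y)"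
  by (rule Ind_graded[OF generated_Obj(1)], assumption, rule Ind_graded[OF generated_Obj(2)], assumption)
    (rule graded_at_generated)

lemma Ind_stable: "X \<in> Obj C \<Longrightarrow> \<chi> \<in> carrier Gd \<Longrightarrow> (ob (Fd \<chi>) (IndC X), IndC X) \<in> iso_rel CG"
  using Ind_graded graded_stable graded_atD(1) by metis

text \<open>\<open>M \<preceq> U (Ind M) \<preceq> U (Ind M') \<preceq> M'\<close>, where the last step uses that all \<open>F\<^sub>h M'\<close> are isomorphic to
  \<open>M'\<close>.\<close>

lemma Ind_reflects_generated:
  assumes M: "M \<in> Obj C" and M': "stable_object C G F M'" and le: "CG.generated (IndC M) (IndC M')"
  shows "M \<preceq> M'"
proof -
  have M'_Obj: "M' \<in> Obj C" using M' by (simp add: stable_object_def)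
  obtain t r s where A: "graded_at (IndC M) t M r s" using Ind_graded[OF M] .
  obtain t' r' s' where B: "graded_at (IndC M') t' M' r' s'" using Ind_graded[OF M'_Obj] .
  have "fst (IndC M') \<preceq> M'"
    using graded_at_underlying[OF B M'_Obj] M' iso_generated by (auto simp: stable_object_def)
  moreover have "fst (IndC M) \<preceq> fst (IndC M')" using forget.generated_ob[OF le] by simp
  ultimately show ?thesis using graded_at_retract[OF A] generated_trans by blast
qed

definition basic_of_Ind :: "'o \<Rightarrow> ('o \<times> ('g \<Rightarrow> 'm)) set"
  where "basic_of_Ind M =
    {N \<in> Obj CG. basic_object CG N \<and> add_closure CG N = add_closure CG (IndC M)}"

lemma basic_of_Ind_eq_class:
  assumes M: "M \<in> Obj C" and N: "basic_object CG N" "CG.generated N (IndC M)" "CG.generated (IndC M) N"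
  shows "basic_of_Ind M = iso_rel CG `` {N}"
proof (intro equalityI subsetI)
  note P = Ind_Obj[OF M]
  fix L assume "L \<in> basic_of_Ind M"
  then have L: "L \<in> Obj CG" "basic_object CG L" "CG.generated L (IndC M)" "CG.generated (IndC M) L"
    using CG.add_closure_eq_iff[OF _ P] unfolding basic_of_Ind_def by blast+
  have "(N, L) \<in> iso_rel CG"
    using CG.basic_iso_of_generated[OF N(1) L(2)] N L CG.generated_trans by blast
  then show "L \<in> iso_rel CG `` {N}" by simp
next
  note P = Ind_Obj[OF M]
  fix L assume "L \<in> iso_rel CG `` {N}"
  then have NL: "(N, L) \<in> iso_rel CG" by simp
  have L: "L \<in> Obj CG" using NL by (simp add: iso_rel_def)
  have "CG.generated L (IndC M)" "CG.generated (IndC M) L"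
    using CG.iso_generated[OF NL] CG.iso_generated[OF CG.iso_rel_sym[OF NL]] N CG.generated_trans by blast+
  then show "L \<in> basic_of_Ind M"
    using L CG.basic_object_iso[OF N(1) NL] CG.add_closure_eq_iff[OF L P] by (simp add: basic_of_Ind_def)
qed

text \<open>The twist \<open>F\<^sub>\<chi> N\<close> is basic again, and it generates the same additive closure as \<open>N\<close> since
  \<open>F\<^sub>\<chi> (Ind M) \<cong> Ind M\<close>.\<close>

lemma stable_of_generated:
  assumes M: "M \<in> Obj C" and N: "basic_object CG N" "CG.generated N (IndC M)" "CG.generated (IndC M) N"
  shows "stable_object CG Gd Fd N"
  unfolding stable_object_def
proof (intro conjI ballI)
  show "N \<in> Obj CG" using CG.generated_Obj(1)[OF N(2)] .
  fix \<chi> assume \<chi>: "\<chi> \<in> carrier Gd"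
  note L = lin_functor.generated_ob[OF dual_lin_functor[OF \<chi>]]
  have "basic_object CG (ob (Fd \<chi>) N)" using ff_functor.basic_object_ob[OF dual_ff_functor[OF \<chi>] N(1)] .
  moreover have "CG.generated (ob (Fd \<chi>) N) N"
    using L[OF N(2)] CG.iso_generated[OF Ind_stable[OF M \<chi>]] N(3) CG.generated_trans by blast
  moreover have "CG.generated N (ob (Fd \<chi>) N)"
    using L[OF N(3)] CG.iso_generated[OF CG.iso_rel_sym[OF Ind_stable[OF M \<chi>]]] N(2) CG.generated_trans by blast
  ultimately show "(ob (Fd \<chi>) N, N) \<in> iso_rel CG" using CG.basic_iso_of_generated N(1) by blast
qed

text \<open>The union is over a constant family, so no representative has to be chosen.\<close>

definition \<iota> :: "'o set \<Rightarrow> ('o \<times> ('g \<Rightarrow> 'm)) set"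
  where "\<iota> m = (\<Union>M\<in>m. basic_of_Ind M)"

lemma \<iota>_class:
  assumes M: "M \<in> Obj C"
  shows "\<iota> (iso_rel C `` {M}) = basic_of_Ind M"
proof -
  have eq: "basic_of_Ind M' = basic_of_Ind M" if iso: "(M, M') \<in> iso_rel C" for M'
  proof -
    have "M' \<in> Obj C" using iso by (simp add: iso_rel_def)
    then have "add_closure CG (IndC M') = add_closure CG (IndC M)"
      using CG.add_closure_eq_iff[OF Ind_Obj Ind_Obj] Ind_generated iso_generated[OF iso]
        iso_generated[OF iso_rel_sym[OF iso]] M by blast
    then show ?thesis by (simp add: basic_of_Ind_def)
  qed
  have "\<iota> (iso_rel C `` {M}) = (\<Union>M'\<in>iso_rel C `` {M}. basic_of_Ind M)"
    unfolding \<iota>_def by (intro SUP_cong refl eq) simp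
  also have "\<dots> = basic_of_Ind M" using iso_rel_refl[OF M] by blast
  finally show ?thesis .
qed

lemma basic_of_Ind_exists:
  assumes M: "M \<in> Obj C"
  obtains N where "N \<in> Obj CG" "basic_object CG N" "CG.generated N (IndC M)" "CG.generated (IndC M) N"
    "stable_object CG Gd Fd N" "\<iota> (iso_rel C `` {M}) = iso_rel CG `` {N}"
proof -
  obtain N where N: "basic_object CG N" "N \<in> Obj CG" "CG.generated (IndC M) N" "CG.generated N (IndC M)"
    using CG.basic_generator_exists[OF Ind_Obj[OF M]] .
  show ?thesis
    using that[OF N(2,1,4,3) stable_of_generated[OF M N(1,4,3)]] basic_of_Ind_eq_class[OF M N(1,4,3)] \<iota>_class[OF M]
    by simp
qed

lemma Stab_cases:
  assumes "m \<in> Stab C G F"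
  obtains M where "M \<in> Obj C" "basic_object C M" "stable_object C G F M" "m = iso_rel C `` {M}"
  using assms unfolding Stab_def quotient_def by blast

lemma StabI: "basic_object C M \<Longrightarrow> stable_object C G F M \<Longrightarrow> iso_rel C `` {M} \<in> Stab C G F"
  unfolding Stab_def quotient_def by (auto simp: stable_object_def)

lemma Stab_dual_cases:
  assumes "n \<in> Stab CG Gd Fd"
  obtains N where "N \<in> Obj CG" "basic_object CG N" "stable_object CG Gd Fd N" "n = iso_rel CG `` {N}"
  using assms unfolding Stab_def quotient_def by blast

lemma Stab_dualI: "basic_object CG N \<Longrightarrow> stable_object CG Gd Fd N \<Longrightarrow> iso_rel CG `` {N} \<in> Stab CG Gd Fd"
  unfolding Stab_def by (rule quotientI) (simp add: stable_object_def)

lemma \<iota>_inj: "inj_on \<iota> (Stab C G F)"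
proof (rule inj_onI)
  fix m m' assume m: "m \<in> Stab C G F" and m': "m' \<in> Stab C G F" and eq: "\<iota> m = \<iota> m'"
  obtain M where M: "M \<in> Obj C" "basic_object C M" "stable_object C G F M" "m = iso_rel C `` {M}"
    using Stab_cases[OF m] .
  obtain M' where M': "M' \<in> Obj C" "basic_object C M'" "stable_object C G F M'" "m' = iso_rel C `` {M'}"
    using Stab_cases[OF m'] .
  obtain N where N: "N \<in> Obj CG" "CG.generated N (IndC M)" "CG.generated (IndC M) N" "\<iota> m = iso_rel CG `` {N}"
    using basic_of_Ind_exists[OF M(1)] M(4) by metis
  obtain N' where N': "CG.generated N' (IndC M')" "CG.generated (IndC M') N'" "\<iota> m' = iso_rel CG `` {N'}"
    using basic_of_Ind_exists[OF M'(1)] M'(4) by metis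
  have "N \<in> iso_rel CG `` {N'}" using CG.iso_rel_refl[OF N(1)] N(4) N'(3) eq by auto
  then have NN': "(N', N) \<in> iso_rel CG" by simp
  have "CG.generated (IndC M) (IndC M')" "CG.generated (IndC M') (IndC M)"
    using CG.iso_generated[OF NN'] CG.iso_generated[OF CG.iso_rel_sym[OF NN']] N N' CG.generated_trans by blast+
  then have "(M, M') \<in> iso_rel C"
    using basic_iso_of_generated[OF M(2) M'(2)] Ind_reflects_generated M(1,3) M'(1,3) by blast
  then show "m = m'" unfolding M(4) M'(4) using iso_rel_trans iso_rel_sym by blast
qed

text \<open>The preimage is the basic object of the additive closure of \<open>U N\<close>.\<close>

lemma \<iota>_surj:
  assumes n: "n \<in> Stab CG Gd Fd"
  obtains m where "m \<in> Stab C G F" "\<iota> m = n"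
proof -
  obtain N where N: "N \<in> Obj CG" "basic_object CG N" "stable_object CG Gd Fd N" "n = iso_rel CG `` {N}"
    using Stab_dual_cases[OF n] .
  have X: "fst N \<in> Obj C" using CG_ObjD(1)[OF N(1)] .
  obtain M where M: "basic_object C M" "M \<in> Obj C" "fst N \<preceq> M" "M \<preceq> fst N" using basic_generator_exists[OF X] .
  have stable: "stable_object C G F M"
    unfolding stable_object_def
  proof (intro conjI ballI M(2))
    fix g assume g: "g \<in> carrier G"
    note L = lin_functor.generated_ob[OF F_functor[OF g]]
    have iso: "(fst N, ob (F g) (fst N)) \<in> iso_rel C"
      using CG_ObjD(2,3)[OF N(1) g] by (intro iso_relI[of C "st N g"]) auto
    have "ob (F g) M \<preceq> M"
      using L[OF M(4)] iso_generated[OF iso_rel_sym[OF iso]] M(3) generated_trans by blast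
    moreover have "M \<preceq> ob (F g) M"
      using L[OF M(3)] iso_generated[OF iso] M(4) generated_trans by blast
    ultimately show "(ob (F g) M, M) \<in> iso_rel C"
      using basic_iso_of_generated[OF ff_functor.basic_object_ob[OF F_ff[OF g] M(1)] M(1)] by blast
  qed
  obtain t r s where P: "graded_at (IndC (fst N)) t (fst N) r s" using Ind_graded[OF X] .
  obtain A B where "A \<in> arrows CG N (IndC (fst N))" "B \<in> arrows CG (IndC (fst N)) N" "B **\<^bsub>CG\<^esub> A = idn CG N"
    by (rule retract_of_induced[OF N(1) P]) blast
  then have "CG.generated N (IndC (fst N))" by (rule CG.generated_retract)
  moreover have "CG.generated (IndC (fst N)) N"
    using induced_generated_by_stable[OF N(1) P] N(3) by (simp add: stable_object_def)
  ultimately have "basic_of_Ind M = iso_rel CG `` {N}"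
    using basic_of_Ind_eq_class[OF M(2) N(2)] Ind_generated[OF M(3)] Ind_generated[OF M(4)] CG.generated_trans by blast
  then show ?thesis
    using that[OF StabI[OF M(1) stable]] \<iota>_class[OF M(2)] N(4) by simp
qed

lemma \<iota>_bij: "bij_betw \<iota> (Stab C G F) (Stab CG Gd Fd)"
  unfolding bij_betw_def
proof (intro conjI \<iota>_inj equalityI subsetI)
  show "n \<in> \<iota> ` Stab C G F" if "n \<in> Stab CG Gd Fd" for n using \<iota>_surj[OF that] by blast
  fix n assume "n \<in> \<iota> ` Stab C G F"
  then obtain m where m: "m \<in> Stab C G F" "n = \<iota> m" by blast
  obtain M where M: "M \<in> Obj C" "m = iso_rel C `` {M}" using Stab_cases[OF m(1)] by metis
  obtain N where "basic_object CG N" "stable_object CG Gd Fd N" "n = iso_rel CG `` {N}"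
    using basic_of_Ind_exists[OF M(1)] M(2) m(2) by metis
  then show "n \<in> Stab CG Gd Fd" using Stab_dualI by simp
qed

abbreviation "AutC \<equiv> equivariant_Aut K C G F \<epsilon>"
abbreviation "AutCG \<equiv> equivariant_Aut K CG Gd Fd (dual_eps C)"

lemma orbit_subset_Stab:
  assumes m: "m \<in> Stab C G F"
  shows "orbit AutC (Aut_act C) m \<subseteq> Stab C G F"
proof -
  obtain M where M: "M \<in> Obj C" "basic_object C M" "stable_object C G F M" "m = iso_rel C `` {M}"
    using Stab_cases[OF m] .
  have "iso_rel C `` {ob H M} \<in> Stab C G F" if ea: "(H, \<delta>) \<in> equivariant_autoequivalences K C G F \<epsilon>" for H \<delta>
  proof -
    interpret H: ff_functor K C C H
      using ea autoequivalence_ff by (auto simp: equivariant_autoequivalences_def)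
    have "(ob (F g) (ob H M), ob H M) \<in> iso_rel C" if g: "g \<in> carrier G" for g
    proof -
      have "(ob (F g) M, M) \<in> iso_rel C" using M(3) g by (simp add: stable_object_def)
      then show ?thesis
        using iso_rel_sym[OF equivariant_autoequivalence_iso[OF ea g F_linear[OF g] M(1)]] H.ob_iso_rel iso_rel_trans
        by blast
    qed
    then have "stable_object C G F (ob H M)" using M(1) by (simp add: stable_object_def)
    then show ?thesis using StabI[OF H.basic_object_ob[OF M(2)]] by simp
  qed
  moreover have "orbit AutC (Aut_act C) m = (\<lambda>(H, \<delta>). iso_rel C `` {ob H M}) ` equivariant_autoequivalences K C G F \<epsilon>"
    unfolding M(4) by (rule orbit_class[where F = F, OF F_linear M(1)])
  ultimately show ?thesis by auto
qed

text \<open>Let \<open>N\<close> be the basic object of \<open>add (Ind M)\<close>. If \<open>H'\<close> and \<open>H\<close> correspond to each other in the sense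
  that \<open>H' (Ind M) \<cong> Ind (H M)\<close>, then \<open>H' N\<close> is the basic object of \<open>add (Ind (H M))\<close>. Each functor on
  either side has a counterpart on the other.\<close>

lemma orbit_\<iota>:
  assumes m: "m \<in> Stab C G F"
  shows "orbit AutCG (Aut_act CG) (\<iota> m) = \<iota> ` orbit AutC (Aut_act C) m"
proof -
  obtain M where M: "M \<in> Obj C" "m = iso_rel C `` {M}" using Stab_cases[OF m] by metis
  obtain N where N: "N \<in> Obj CG" "basic_object CG N" "CG.generated N (IndC M)" "CG.generated (IndC M) N"
    "\<iota> m = iso_rel CG `` {N}"
    using basic_of_Ind_exists[OF M(1)] M(2) by metis
  have match: "\<iota> (iso_rel C `` {X}) = iso_rel CG `` {ob H' N}"
    if H': "autoequivalence K CG H'" and iso: "(ob H' (IndC M), IndC X) \<in> iso_rel CG" and X: "X \<in> Obj C" for H' X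
  proof -
    interpret H': ff_functor K CG CG H' by (rule CG_autoequivalence_ff[OF H'])
    show ?thesis
      unfolding \<iota>_class[OF X]
    proof (rule basic_of_Ind_eq_class[OF X H'.basic_object_ob[OF N(2)]])
      show "CG.generated (ob H' N) (IndC X)"
        using H'.generated_ob[OF N(3)] CG.iso_generated[OF iso] CG.generated_trans by blast
      show "CG.generated (IndC X) (ob H' N)"
        using H'.generated_ob[OF N(4)] CG.iso_generated[OF CG.iso_rel_sym[OF iso]] CG.generated_trans by blast
    qed
  qed
  have orbC: "orbit AutC (Aut_act C) m = (\<lambda>(H, \<delta>). iso_rel C `` {ob H M}) ` equivariant_autoequivalences K C G F \<epsilon>"
    unfolding M(2) by (rule orbit_class[where F = F, OF F_linear M(1)])
  have orbCG: "orbit AutCG (Aut_act CG) (\<iota> m) =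
      (\<lambda>(H, \<delta>). iso_rel CG `` {ob H N}) ` equivariant_autoequivalences K CG Gd Fd (dual_eps C)"
    unfolding N(5) by (rule CG.orbit_class[OF lin_functor.F[OF dual_lin_functor] N(1)])
  show ?thesis
  proof (intro equalityI subsetI)
    fix n assume "n \<in> orbit AutCG (Aut_act CG) (\<iota> m)"
    then obtain H' \<delta>' where ea: "(H', \<delta>') \<in> equivariant_autoequivalences K CG Gd Fd (dual_eps C)"
      and n: "n = iso_rel CG `` {ob H' N}" unfolding orbCG by auto
    interpret desc: dual_autoequivalence K C G F \<epsilon> H' \<delta>' using ea by unfold_locales
    have H'_auto: "autoequivalence K CG H'" using ea by (auto simp: equivariant_autoequivalences_def)
    have HM: "ob desc.H M \<in> Obj C" using desc.H_linear M(1) unfolding linear_functor_def by blast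
    have "n = \<iota> (iso_rel C `` {ob desc.H M})"
      unfolding n by (rule match[OF H'_auto desc.descent_Ind[OF M(1)] HM, symmetric])
    moreover have "iso_rel C `` {ob desc.H M} \<in> orbit AutC (Aut_act C) m"
      unfolding orbC by (rule image_eqI[OF _ desc.descent_equivariant]) simp
    ultimately show "n \<in> \<iota> ` orbit AutC (Aut_act C) m" by blast
  next
    fix n assume "n \<in> \<iota> ` orbit AutC (Aut_act C) m"
    then obtain H \<delta> where ea: "(H, \<delta>) \<in> equivariant_autoequivalences K C G F \<epsilon>"
      and n: "n = \<iota> (iso_rel C `` {ob H M})" unfolding orbC by auto
    obtain HG \<delta>G where eaG: "(HG, \<delta>G) \<in> equivariant_autoequivalences K CG Gd Fd (dual_eps C)"
      and iso: "(ob HG (IndC M), IndC (ob H M)) \<in> iso_rel CG"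
      using equivariantization_of_autoequivalence[OF ea] M(1) by blast
    have HG_auto: "autoequivalence K CG HG" using eaG by (auto simp: equivariant_autoequivalences_def)
    have "ob H M \<in> Obj C"
      using ea M(1) by (auto simp: equivariant_autoequivalences_def autoequivalence_def linear_functor_def)
    then have "n = iso_rel CG `` {ob HG N}" unfolding n by (rule match[OF HG_auto iso])
    then show "n \<in> orbit AutCG (Aut_act CG) (\<iota> m)" unfolding orbCG using eaG by force
  qed
qed

lemma \<iota>_orbits_bij:
  "bij_betw (image \<iota>) (orbits AutC (Stab C G F) (Aut_act C)) (orbits AutCG (Stab CG Gd Fd) (Aut_act CG))"
  unfolding bij_betw_def
proof
  have "orbits AutC (Stab C G F) (Aut_act C) \<subseteq> Pow (Stab C G F)"
    unfolding orbits_def using orbit_subset_Stab by blast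
  then show "inj_on (image \<iota>) (orbits AutC (Stab C G F) (Aut_act C))"
    using inj_on_subset[OF inj_on_image_Pow[OF \<iota>_inj]] by blast
  have "image \<iota> ` orbits AutC (Stab C G F) (Aut_act C) = (\<lambda>m. orbit AutCG (Aut_act CG) (\<iota> m)) ` Stab C G F"
    unfolding orbits_def using orbit_\<iota> by (auto simp: image_iff)
  also have "\<dots> = orbits AutCG (\<iota> ` Stab C G F) (Aut_act CG)" unfolding orbits_def by blast
  finally show "image \<iota> ` orbits AutC (Stab C G F) (Aut_act C) = orbits AutCG (Stab CG Gd Fd) (Aut_act CG)"
    using \<iota>_bij by (simp add: bij_betw_def)
qed

end

theorem proposition5p7:
  fixes K :: "'k ring" and G :: "'g monoid" and C :: "('o, 'm, 'k) category"
    and F :: "'g \<Rightarrow> ('o, 'm, 'o, 'm) functr" and \<epsilon> :: "'g \<Rightarrow> 'g \<Rightarrow> 'o \<Rightarrow> 'm"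
  assumes "field K"
    and "comm_group G" and "finite (carrier G)" and "splits_over G K"
    and "linear_category K C" and "additive_category C"
    and "idempotent_complete C" and "hom_finite K C"
    and "category_action K C G F \<epsilon>"
  defines "CG \<equiv> equivariantization C G F \<epsilon>"
    and "Gd \<equiv> character_group K G"
    and "Fd \<equiv> dual_functor C G F"
    and "\<epsilon>d \<equiv> dual_eps C"
  shows "\<exists>\<iota>. bij_betw \<iota> (Stab C G F) (Stab CG Gd Fd) \<and>
    (\<forall>M\<in>Obj C. basic_object C M \<and> stable_object C G F M \<longrightarrow>
      \<iota> (iso_rel C `` {M}) =
        {N \<in> Obj CG. basic_object CG N \<and>
          add_closure CG N = add_closure CG (ob (Ind C G F \<epsilon>) M)}) \<and>
    (\<exists>\<kappa>. bij_betw \<kappa>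
        (orbits (equivariant_Aut K C G F \<epsilon>) (Stab C G F) (Aut_act C))
        (orbits (equivariant_Aut K CG Gd Fd \<epsilon>d) (Stab CG Gd Fd) (Aut_act CG)) \<and>
      (\<forall>m\<in>Stab C G F.
        \<kappa> (orbit (equivariant_Aut K C G F \<epsilon>) (Aut_act C) m) =
        orbit (equivariant_Aut K CG Gd Fd \<epsilon>d) (Aut_act CG) (\<iota> m)))"
proof -
  interpret K: field K by fact
  interpret G: comm_group G by fact
  interpret C: linear_category K C by fact
  interpret dual: dual_setting K C G F \<epsilon>
    using assms(3,4,6,7,9) C.hom_finite_end_dim[OF assms(8)] by unfold_locales
  show ?thesis
    unfolding CG_def Gd_def Fd_def \<epsilon>d_def
  proof (intro exI conjI ballI impI)
    show "bij_betw dual.\<iota> (Stab C G F)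
        (Stab (equivariantization C G F \<epsilon>) (character_group K G) (dual_functor C G F))"
      by (rule dual.\<iota>_bij)
    show "dual.\<iota> (iso_rel C `` {M}) = {N \<in> Obj (equivariantization C G F \<epsilon>).
        basic_object (equivariantization C G F \<epsilon>) N \<and> add_closure (equivariantization C G F \<epsilon>) N =
          add_closure (equivariantization C G F \<epsilon>) (ob (Ind C G F \<epsilon>) M)}"
      if "M \<in> Obj C" for M
      using dual.\<iota>_class[OF that] by (simp only: dual.basic_of_Ind_def)
    show "bij_betw (image dual.\<iota>)
        (orbits (equivariant_Aut K C G F \<epsilon>) (Stab C G F) (Aut_act C))
        (orbits (equivariant_Aut K (equivariantization C G F \<epsilon>) (character_group K G) (dual_functor C G F) (dual_eps C))
          (Stab (equivariantization C G F \<epsilon>) (character_group K G) (dual_functor C G F))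
          (Aut_act (equivariantization C G F \<epsilon>)))"
      by (rule dual.\<iota>_orbits_bij)
    show "dual.\<iota> ` orbit (equivariant_Aut K C G F \<epsilon>) (Aut_act C) m =
        orbit (equivariant_Aut K (equivariantization C G F \<epsilon>) (character_group K G) (dual_functor C G F) (dual_eps C))
          (Aut_act (equivariantization C G F \<epsilon>)) (dual.\<iota> m)"
      if "m \<in> Stab C G F" for m
      by (rule dual.orbit_\<iota>[OF that, symmetric])
  qed
qed

end
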